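(* Let $\mathbb{X}$ be a rank one non-compact symmetric space with origin $o$. Let $e^{-t\sqrt{-\Delta}}$, $t>0$, be the Poisson semigroup and $p_t=p_t(\cdot,o)$ the Poisson kernel based at $o$. For $f\in L^1(\mathbb{X})$ let $M=\int_{\mathbb{X}}f\,d\mu$ denote its mass. Then the convergence $$\big\|e^{-t\sqrt{-\Delta}}f-M\,p_t\big\|_{L^1(\mathbb{X})}\longrightarrow 0\quad\text{as } t\to+\infty \qquad ( * )$$ fails in general, that is, there exists $f\in L^1(\mathbb{X})$ for which $( * )$ does not hold. However, $( * )$ holds for every radial $f\in L^1(\mathbb{X})$.
   Context: A rank one non-compact symmetric space is $\mathbb{X}=\mathbb{G}/K$, where $\mathbb{G}$ is a connected non-compact semisimple Lie group with finite center and of real rank one, and $K$ is a maximal compact subgroup; these are the real, complex and quaternionic hyperbolic spaces and the octonionic hyperbolic plane. The origin is $o=\{K\}$. $\mathbb{X}$ carries its $\mathbb{G}$-invariant Riemannian metric, induced by the Killing form normalized so that $|H_0|=1$, where $H_0$ is the element of the one-dimensional maximal abelian subspace $\mathfrak a\subset\mathfrak p$ (with $\mathfrak g=\mathfrak k\oplus\mathfrak p$ the Cartan decomposition) with $\alpha(H_0)=1$, $\alpha$ being the positive indivisible restricted root. $\mu$ is the Riemannian measure, $d$ the geodesic distance, and $\Delta$ the Laplace-Beltrami operator (with $-\Delta\ge0$). A function $f$ on $\mathbb{X}$ is radial if $f(x)$ depends only on $d(x,o)$. The Poisson kernel is $p_t(x,y)=\frac{t}{2\sqrt{\pi}}\int_0^\infty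 h_u(x,y)e^{-t^2/(4u)}u^{-3/2}\,du$, where $h_u$ is the heat kernel of $\mathbb{X}$; it depends only on $d(x,y)$, and $e^{-t\sqrt{-\Delta}}f(x)=\int_{\mathbb{X}}p_t(x,y)f(y)\,d\mu(y)$. *)

theory Defs
  imports "HOL-Analysis.Analysis"
begin

section \<open>Semisimple Lie algebras of real rank one\<close>

text \<open>
  The Lie algebra lives on a finite-dimensional real vector space \<open>'g\<close>. The inner product that the
  class \<open>euclidean_space\<close> provides is used only to compute traces and dimensions, which do not
  depend on it; all geometry comes from the Killing form.
\<close>

definition lie_algebra :: "('g::euclidean_space \<Rightarrow> 'g \<Rightarrow> 'g) \<Rightarrow> bool" where
  "lie_algebra br \<longleftrightarrow> bilinear br \<and> (\<forall>X. br X X = 0) \<and>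
     (\<forall>X Y Z. br X (br Y Z) + br Y (br Z X) + br Z (br X Y) = 0)"

text \<open>The trace of \<open>ad X \<circ> ad Y\<close>.\<close>
definition killing :: "('g::euclidean_space \<Rightarrow> 'g \<Rightarrow> 'g) \<Rightarrow> 'g \<Rightarrow> 'g \<Rightarrow> real" where
  "killing br X Y = (\<Sum>b\<in>Basis. br X (br Y b) \<bullet> b)"

definition semisimple :: "('g::euclidean_space \<Rightarrow> 'g \<Rightarrow> 'g) \<Rightarrow> bool" where
  "semisimple br \<longleftrightarrow> lie_algebra br \<and> (\<forall>X. (\<forall>Y. killing br X Y = 0) \<longrightarrow> X = 0)"

text \<open>A Cartan decomposition \<open>g = k + p\<close> is given by its Cartan involution \<open>th\<close>,
  which is \<open>1\<close> on \<open>k\<close> and \<open>-1\<close> on \<open>p\<close>.\<close>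
definition cartan_involution ::
    "('g::euclidean_space \<Rightarrow> 'g \<Rightarrow> 'g) \<Rightarrow> ('g \<Rightarrow> 'g) \<Rightarrow> bool" where
  "cartan_involution br th \<longleftrightarrow> linear th \<and> (\<forall>X. th (th X) = X) \<and>
     (\<forall>X Y. th (br X Y) = br (th X) (th Y)) \<and>
     (\<forall>X. X \<noteq> 0 \<longrightarrow> killing br X (th X) < 0)"

definition p_space :: "('g::euclidean_space \<Rightarrow> 'g) \<Rightarrow> 'g set" where
  "p_space th = {X. th X = - X}"

definition abelian_subspace_of ::
    "('g::euclidean_space \<Rightarrow> 'g \<Rightarrow> 'g) \<Rightarrow> 'g set \<Rightarrow> 'g set \<Rightarrow> bool" where
  "abelian_subspace_of br P A \<longleftrightarrow> subspace A \<and> A \<subseteq> P \<and> (\<forall>X\<in>A. \<forall>Y\<in>A. br X Y = 0)"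

definition maximal_abelian_subspace_of ::
    "('g::euclidean_space \<Rightarrow> 'g \<Rightarrow> 'g) \<Rightarrow> 'g set \<Rightarrow> 'g set \<Rightarrow> bool" where
  "maximal_abelian_subspace_of br P A \<longleftrightarrow> abelian_subspace_of br P A \<and>
     (\<forall>A'. abelian_subspace_of br P A' \<and> A \<subseteq> A' \<longrightarrow> A' = A)"

text \<open>Only the values of the functional \<open>lam\<close> on \<open>A\<close> matter.\<close>
definition restricted_root ::
    "('g::euclidean_space \<Rightarrow> 'g \<Rightarrow> 'g) \<Rightarrow> 'g set \<Rightarrow> ('g \<Rightarrow> real) \<Rightarrow> bool" where
  "restricted_root br A lam \<longleftrightarrow> linear lam \<and> (\<exists>H\<in>A. lam H \<noteq> 0) \<and>
     (\<exists>X. X \<noteq> 0 \<and> (\<forall>H\<in>A. br H X = lam H *\<^sub>R X))"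

definition indivisible_root ::
    "('g::euclidean_space \<Rightarrow> 'g \<Rightarrow> 'g) \<Rightarrow> 'g set \<Rightarrow> ('g \<Rightarrow> real) \<Rightarrow> bool" where
  "indivisible_root br A lam \<longleftrightarrow>
     restricted_root br A lam \<and> \<not> restricted_root br A (\<lambda>H. lam H / 2)"

text \<open>
  Calling \<open>alpha\<close> positive is a choice between the two indivisible roots, which are opposite to
  each other. The rank one condition implies that \<open>p\<close> is not zero, so the group is not compact.
\<close>
definition rank_one_data ::
    "('g::euclidean_space \<Rightarrow> 'g \<Rightarrow> 'g) \<Rightarrow> ('g \<Rightarrow> 'g) \<Rightarrow> 'g set \<Rightarrow> ('g \<Rightarrow> real) \<Rightarrow> 'g \<Rightarrow> bool" where
  "rank_one_data br th A alpha H0 \<longleftrightarrow>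
     semisimple br \<and> cartan_involution br th \<and>
     maximal_abelian_subspace_of br (p_space th) A \<and> dim A = 1 \<and>
     indivisible_root br A alpha \<and> H0 \<in> A \<and> alpha H0 = 1"


section \<open>The symmetric space \<open>G/K\<close>\<close>

definition exp_ad :: "('g::euclidean_space \<Rightarrow> 'g \<Rightarrow> 'g) \<Rightarrow> 'g \<Rightarrow> 'g \<Rightarrow> 'g" where
  "exp_ad br X = (\<lambda>Y. \<Sum>n. (1 / fact n) *\<^sub>R ((br X ^^ n) Y))"

text \<open>
  The adjoint group, generated by the automorphisms \<open>exp (ad X)\<close>. It represents every connected
  Lie group with finite centre and Lie algebra \<open>g\<close>: the centre of such a group is contained in each
  maximal compact subgroup, so the quotient by a maximal compact subgroup does not change
  when the group is replaced by its image under \<open>Ad\<close>, and this image is the group below.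
  Elements are linear maps. The topology is that of pointwise convergence, which on linear
  maps of a finite-dimensional space is the norm topology.
\<close>
inductive_set adjoint_group :: "('g::euclidean_space \<Rightarrow> 'g \<Rightarrow> 'g) \<Rightarrow> ('g \<Rightarrow> 'g) set"
  for br where
  one: "id \<in> adjoint_group br"
| step: "g \<in> adjoint_group br \<Longrightarrow> g \<circ> exp_ad br X \<in> adjoint_group br"

text \<open>
  The fixed points of the global Cartan involution: the maximal compact subgroup whose Lie algebra
  is \<open>k\<close>. Every maximal compact subgroup arises from exactly one Cartan involution in this way.
\<close>
definition max_compact ::
    "('g::euclidean_space \<Rightarrow> 'g \<Rightarrow> 'g) \<Rightarrow> ('g \<Rightarrow> 'g) \<Rightarrow> ('g \<Rightarrow> 'g) set" where
  "max_compact br th = {k \<in> adjoint_group br. k \<circ> th = th \<circ> k}"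

definition coset ::
    "('g::euclidean_space \<Rightarrow> 'g \<Rightarrow> 'g) \<Rightarrow> ('g \<Rightarrow> 'g) \<Rightarrow> ('g \<Rightarrow> 'g) \<Rightarrow> ('g \<Rightarrow> 'g) set" where
  "coset br th g = (\<lambda>k. g \<circ> k) ` max_compact br th"

definition sym_space ::
    "('g::euclidean_space \<Rightarrow> 'g \<Rightarrow> 'g) \<Rightarrow> ('g \<Rightarrow> 'g) \<Rightarrow> ('g \<Rightarrow> 'g) set set" where
  "sym_space br th = coset br th ` adjoint_group br"

definition origin ::
    "('g::euclidean_space \<Rightarrow> 'g \<Rightarrow> 'g) \<Rightarrow> ('g \<Rightarrow> 'g) \<Rightarrow> ('g \<Rightarrow> 'g) set" where
  "origin br th = coset br th id"

definition translate :: "('g \<Rightarrow> 'g) \<Rightarrow> ('g \<Rightarrow> 'g) set \<Rightarrow> ('g \<Rightarrow> 'g) set" where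
  "translate g x = (\<lambda>g'. g \<circ> g') ` x"


section \<open>Riemannian metric, distance and measure\<close>

text \<open>The Killing form, rescaled so that \<open>H0\<close> has norm one. On \<open>p\<close>, which is the tangent space
  at the origin, this is the Riemannian metric.\<close>
definition p_inner ::
    "('g::euclidean_space \<Rightarrow> 'g \<Rightarrow> 'g) \<Rightarrow> 'g \<Rightarrow> 'g \<Rightarrow> 'g \<Rightarrow> real" where
  "p_inner br H0 X Y = killing br X Y / killing br H0 H0"

definition p_part :: "('g::euclidean_space \<Rightarrow> 'g) \<Rightarrow> 'g \<Rightarrow> 'g" where
  "p_part th X = (1 / 2) *\<^sub>R (X - th X)"

text \<open>
  \<open>c\<close> is a continuously differentiable curve in \<open>G\<close> on the unit interval with logarithmic derivative
  \<open>c\<^sup>-\<^sup>1 c' = ad W\<close>. Each \<open>C\<^sup>1\<close> curve in \<open>G/K\<close> is the projection \<open>t \<mapsto> c(t)K\<close> of such a curve. By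
  invariance of the metric, the speed of the projection is the norm of the \<open>p\<close>-part of \<open>W\<close>.
\<close>
definition C1_curve ::
    "('g::euclidean_space \<Rightarrow> 'g \<Rightarrow> 'g) \<Rightarrow> (real \<Rightarrow> 'g \<Rightarrow> 'g) \<Rightarrow> (real \<Rightarrow> 'g) \<Rightarrow> bool" where
  "C1_curve br c W \<longleftrightarrow> continuous_on {0..1} W \<and>
     (\<forall>t\<in>{0..1}. c t \<in> adjoint_group br \<and>
        (\<forall>Z. ((\<lambda>s. c s Z) has_vector_derivative c t (br (W t) Z)) (at t within {0..1})))"

definition curve_length ::
    "('g::euclidean_space \<Rightarrow> 'g \<Rightarrow> 'g) \<Rightarrow> ('g \<Rightarrow> 'g) \<Rightarrow> 'g \<Rightarrow> (real \<Rightarrow> 'g) \<Rightarrow> real" where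
  "curve_length br th H0 W =
     integral {0..1} (\<lambda>t. sqrt (p_inner br H0 (p_part th (W t)) (p_part th (W t))))"

definition geo_dist ::
    "('g::euclidean_space \<Rightarrow> 'g \<Rightarrow> 'g) \<Rightarrow> ('g \<Rightarrow> 'g) \<Rightarrow> 'g \<Rightarrow>
     ('g \<Rightarrow> 'g) set \<Rightarrow> ('g \<Rightarrow> 'g) set \<Rightarrow> real" where
  "geo_dist br th H0 x y =
     Inf {curve_length br th H0 W | c W.
            C1_curve br c W \<and> coset br th (c 0) = x \<and> coset br th (c 1) = y}"

text \<open>Borel sets of the quotient topology on \<open>G/K\<close>.\<close>
definition borel_sym ::
    "('g::euclidean_space \<Rightarrow> 'g \<Rightarrow> 'g) \<Rightarrow> ('g \<Rightarrow> 'g) \<Rightarrow> ('g \<Rightarrow> 'g) set measure" where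
  "borel_sym br th = sigma (sym_space br th)
     {U. U \<subseteq> sym_space br th \<and>
         openin (top_of_set (adjoint_group br)) {g \<in> adjoint_group br. coset br th g \<in> U}}"

text \<open>
  The Riemannian measure of an invariant metric is an invariant Borel measure, finite on small
  balls, and such a measure is unique up to a factor. The factor is fixed by the volume of small
  balls being asymptotic to that of Euclidean balls of the same dimension.
\<close>
definition riemannian_measure ::
    "('g::euclidean_space \<Rightarrow> 'g \<Rightarrow> 'g) \<Rightarrow> ('g \<Rightarrow> 'g) \<Rightarrow> 'g \<Rightarrow> ('g \<Rightarrow> 'g) set measure \<Rightarrow> bool" where
  "riemannian_measure br th H0 M \<longleftrightarrow>
     space M = sym_space br th \<and> sets M = sets (borel_sym br th) \<and>
     (\<forall>g\<in>adjoint_group br. \<forall>S\<in>sets M. emeasure M (translate g ` S) = emeasure M S) \<and>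
     ((\<lambda>r. measure M {x \<in> sym_space br th. geo_dist br th H0 x (origin br th) < r} /
            (unit_ball_vol (real (dim (p_space th))) * r ^ dim (p_space th))) \<longlongrightarrow> 1) (at_right 0)"


section \<open>Laplacian and heat kernel\<close>

text \<open>Functions on \<open>G/K\<close> are differentiated as right \<open>K\<close>-invariant functions on \<open>G\<close>, along
  left-invariant vector fields.\<close>
definition left_inv_deriv ::
    "('g::euclidean_space \<Rightarrow> 'g \<Rightarrow> 'g) \<Rightarrow> 'g \<Rightarrow> (('g \<Rightarrow> 'g) \<Rightarrow> real) \<Rightarrow> ('g \<Rightarrow> 'g) \<Rightarrow> real" where
  "left_inv_deriv br Y F g = deriv (\<lambda>s. F (g \<circ> exp_ad br (s *\<^sub>R Y))) 0"

text \<open>\<open>C\<^sup>k\<close> functions on \<open>{0<..} \<times> G\<close>.\<close>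
primrec Ck_time_group ::
    "('g::euclidean_space \<Rightarrow> 'g \<Rightarrow> 'g) \<Rightarrow> nat \<Rightarrow> (real \<Rightarrow> ('g \<Rightarrow> 'g) \<Rightarrow> real) \<Rightarrow> bool" where
  "Ck_time_group br 0 u \<longleftrightarrow>
     continuous_on ({0<..} \<times> adjoint_group br) (\<lambda>(t, g). u t g)"
| "Ck_time_group br (Suc k) u \<longleftrightarrow>
     continuous_on ({0<..} \<times> adjoint_group br) (\<lambda>(t, g). u t g) \<and>
     (\<forall>t>0. \<forall>g\<in>adjoint_group br. (\<lambda>s. u s g) differentiable (at t)) \<and>
     Ck_time_group br k (\<lambda>t g. deriv (\<lambda>s. u s g) t) \<and>
     (\<forall>Y. (\<forall>t>0. \<forall>g\<in>adjoint_group br.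
              (\<lambda>s. u t (g \<circ> exp_ad br (s *\<^sub>R Y))) differentiable (at 0)) \<and>
          Ck_time_group br k (\<lambda>t. left_inv_deriv br Y (u t)))"

definition orthonormal_basis_p ::
    "('g::euclidean_space \<Rightarrow> 'g \<Rightarrow> 'g) \<Rightarrow> ('g \<Rightarrow> 'g) \<Rightarrow> 'g \<Rightarrow> 'g set \<Rightarrow> bool" where
  "orthonormal_basis_p br th H0 E \<longleftrightarrow> finite E \<and> E \<subseteq> p_space th \<and> span E = p_space th \<and>
     (\<forall>X\<in>E. \<forall>Y\<in>E. p_inner br H0 X Y = (if X = Y then 1 else 0))"

text \<open>
  The Laplace-Beltrami operator, evaluated at the point \<open>gK\<close>. The curves \<open>s \<mapsto> g exp(sY)K\<close>, for
  \<open>Y\<close> in an orthonormal basis of \<open>p\<close>, are geodesics through \<open>gK\<close> with orthonormal directions, and the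
  Laplacian is the sum of the second derivatives along them, whichever basis is chosen.
\<close>
definition laplacian_at ::
    "('g::euclidean_space \<Rightarrow> 'g \<Rightarrow> 'g) \<Rightarrow> ('g \<Rightarrow> 'g) \<Rightarrow> 'g \<Rightarrow>
     (('g \<Rightarrow> 'g) set \<Rightarrow> real) \<Rightarrow> ('g \<Rightarrow> 'g) \<Rightarrow> real" where
  "laplacian_at br th H0 f g =
     (\<Sum>Y\<in>(SOME E. orthonormal_basis_p br th H0 E).
        left_inv_deriv br Y (left_inv_deriv br Y (\<lambda>g'. f (coset br th g'))) g)"

text \<open>\<open>G/K\<close> is complete, so bounded support means compact support.\<close>
definition continuous_compact_support ::
    "('g::euclidean_space \<Rightarrow> 'g \<Rightarrow> 'g) \<Rightarrow> ('g \<Rightarrow> 'g) \<Rightarrow> 'g \<Rightarrow>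
     (('g \<Rightarrow> 'g) set \<Rightarrow> real) \<Rightarrow> bool" where
  "continuous_compact_support br th H0 f \<longleftrightarrow>
     continuous_on (adjoint_group br) (\<lambda>g. f (coset br th g)) \<and>
     (\<exists>R. \<forall>x\<in>sym_space br th. geo_dist br th H0 x (origin br th) > R \<longrightarrow> f x = 0)"

text \<open>
  \<open>h u x y\<close> is the heat kernel: the smooth integral kernel of the symmetric sub-Markovian
  semigroup on \<open>G/K\<close> generated by the Laplacian. Since \<open>G/K\<close> is complete, the Laplacian is
  essentially self-adjoint on smooth functions of compact support, and the values of \<open>h\<close>
  for positive time and points of \<open>G/K\<close> are determined uniquely.
\<close>
definition heat_kernel ::
    "('g::euclidean_space \<Rightarrow> 'g \<Rightarrow> 'g) \<Rightarrow> ('g \<Rightarrow> 'g) \<Rightarrow> 'g \<Rightarrow> ('g \<Rightarrow> 'g) set measure \<Rightarrow>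
     (real \<Rightarrow> ('g \<Rightarrow> 'g) set \<Rightarrow> ('g \<Rightarrow> 'g) set \<Rightarrow> real) \<Rightarrow> bool" where
  "heat_kernel br th H0 M h \<longleftrightarrow>
     (\<forall>y\<in>sym_space br th. \<forall>k. Ck_time_group br k (\<lambda>u g. h u (coset br th g) y)) \<and>
     (\<forall>u>0. \<forall>y\<in>sym_space br th. \<forall>g\<in>adjoint_group br.
        deriv (\<lambda>s. h s (coset br th g) y) u = laplacian_at br th H0 (\<lambda>x. h u x y) g) \<and>
     (\<forall>x\<in>sym_space br th. \<forall>f. continuous_compact_support br th H0 f \<longrightarrow>
        ((\<lambda>u. LINT y|M. h u x y * f y) \<longlongrightarrow> f x) (at_right 0)) \<and>
     (\<forall>u>0. \<forall>x\<in>sym_space br th. \<forall>y\<in>sym_space br th. 0 \<le> h u x y \<and> h u x y = h u y x) \<and>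
     (\<forall>u>0. \<forall>x\<in>sym_space br th. (\<integral>\<^sup>+ y. ennreal (h u x y) \<partial>M) \<le> 1) \<and>
     (\<forall>u>0. \<forall>v>0. \<forall>x\<in>sym_space br th. \<forall>y\<in>sym_space br th.
        h (u + v) x y = (LINT z|M. h u x z * h v z y))"


section \<open>Poisson semigroup\<close>

definition poisson_kernel ::
    "(real \<Rightarrow> 'x \<Rightarrow> 'x \<Rightarrow> real) \<Rightarrow> real \<Rightarrow> 'x \<Rightarrow> 'x \<Rightarrow> real" where
  "poisson_kernel h t x y = t / (2 * sqrt pi) *
     (LINT u:{0<..}|lborel. h u x y * exp (- t\<^sup>2 / (4 * u)) * u powr (- 3 / 2))"

definition poisson_semigroup ::
    "'x measure \<Rightarrow> (real \<Rightarrow> 'x \<Rightarrow> 'x \<Rightarrow> real) \<Rightarrow> real \<Rightarrow> ('x \<Rightarrow> complex) \<Rightarrow> 'x \<Rightarrow> complex" where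
  "poisson_semigroup M h t f x = (LINT y|M. complex_of_real (poisson_kernel h t x y) * f y)"

text \<open>The \<open>L\<^sup>1\<close> norm is taken in the extended nonnegative reals, because the Bochner integral of
  a function that is not integrable is zero by convention.\<close>
definition L1_norm :: "'x measure \<Rightarrow> ('x \<Rightarrow> complex) \<Rightarrow> ennreal" where
  "L1_norm M f = (\<integral>\<^sup>+ x. ennreal (norm (f x)) \<partial>M)"

definition poisson_asymptotics ::
    "'x measure \<Rightarrow> (real \<Rightarrow> 'x \<Rightarrow> 'x \<Rightarrow> real) \<Rightarrow> 'x \<Rightarrow> ('x \<Rightarrow> complex) \<Rightarrow> bool" where
  "poisson_asymptotics M h x0 f \<longleftrightarrow>
     ((\<lambda>t. L1_norm M (\<lambda>x. poisson_semigroup M h t f x -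
              (LINT y|M. f y) * complex_of_real (poisson_kernel h t x x0))) \<longlongrightarrow> 0) at_top"

definition radial ::
    "('g::euclidean_space \<Rightarrow> 'g \<Rightarrow> 'g) \<Rightarrow> ('g \<Rightarrow> 'g) \<Rightarrow> 'g \<Rightarrow>
     (('g \<Rightarrow> 'g) set \<Rightarrow> complex) \<Rightarrow> bool" where
  "radial br th H0 f \<longleftrightarrow>
     (\<forall>x\<in>sym_space br th. \<forall>y\<in>sym_space br th.
        geo_dist br th H0 x (origin br th) = geo_dist br th H0 y (origin br th) \<longrightarrow> f x = f y)"

end

theory Submission imports Defs begin

text \<open>
  Let \<open>N (gK)\<close> be the logarithm of the sum of \<open>Q (g Y) (g Y)\<close> over an orthonormal basis of \<open>p\<close>, where
  \<open>Q\<close> is the inner product on \<open>g\<close> defined by the Killing form and the Cartan involution. This is a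
  smooth, proper, radial function with bounded first derivatives along left translations and with
  \<open>0 < c \<le> \<Delta> N \<le> C\<close>. It replaces explicit formulas for the volume growth and for the kernels.

  Cutoffs built from \<open>N\<close> give conservation of the total mass of the heat kernel \<open>h\<close>. A parabolic
  maximum principle then gives invariance of \<open>h\<close> under \<open>G\<close>, since no invariance is assumed.

  Failure: let \<open>f\<close> be the indicator of a ball. If the asymptotics held for \<open>f\<close> and its translates, then
  \<open>q = P\<^sub>t f\<close> would satisfy \<open>\<parallel>q - q \<circ> a\<^sup>-\<^sup>1\<parallel>\<^sub>1 \<rightarrow> 0\<close> for each \<open>a\<close> in \<open>G\<close>, while the mass of \<open>q\<close> is constant. The
  derivatives \<open>\<psi>\<close> of \<open>N\<close> along left translations by \<open>exp (s V)\<close>, \<open>V\<close> in the basis of \<open>p\<close>, are bounded,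
  and \<open>\<psi> (exp V x) - \<psi> x\<close>, summed over \<open>V\<close>, is at least some \<open>\<kappa> > 0\<close>; pairing with \<open>q\<close> is a contradiction.

  Radial functions: let \<open>\<phi>\<close> be the sign of \<open>P\<^sub>t f - M p\<^sub>t\<close> and \<open>w = P\<^sub>t \<phi>\<close>. By duality, the norm in question is
  the integral of \<open>f (w - w o)\<close>. The subordination density varies by \<open>O(r / t\<^sup>2)\<close> in \<open>L\<^sup>1\<close> under a shift
  by \<open>r\<close>, so \<open>\<bar>H\<^sub>r w - w\<bar> \<le> C r / t\<^sup>2\<close> for the heat semigroup \<open>H\<^sub>r\<close>. As \<open>w\<close> is radial, comparison with \<open>N\<close> in a
  ball gives \<open>\<bar>w x - w o\<bar> \<le> C (N x - N o) / t\<^sup>2\<close>, and dominated convergence concludes.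
\<close>

text \<open>The hypotheses supply a bracket, an involution, an invariant measure and a list of
  properties of \<open>h\<close>; root multiplicities and the volume density in polar coordinates
  never appear. Two facts about \<open>N\<close> carry the quantitative part. Its Laplacian is a sum
  of variances, which could vanish only at a common eigenvector of all \<open>ad Y\<close> with
  \<open>Y\<close> in \<open>p\<close>; such a vector centralizes \<open>p\<close>, and the vectors
  \<open>g e\<close> with \<open>e\<close> in \<open>p\<close> are orthogonal to this centralizer.
  Real rank one makes the closure of \<open>K\<close> transitive on the spheres of \<open>p\<close>,
  so continuous radial functions are constant on the level sets of \<open>N\<close>. The Laplacian
  is defined by right translations, whereas the measure is preserved by left ones; the Casimir
  element gives the same operator from either side and so leads to Green's formula. For
  \<open>Hs u f\<close> no regularity in space beyond continuity is established; hence the maximum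
  principles test it with smooth functions touching from above. The factor
  \<open>1 / t\<^sup>2\<close> comes from subordination: \<open>P\<^sub>t\<close> averages the heat
  semigroup over times of order \<open>t\<^sup>2\<close>, with a density that is smooth at that
  scale.\<close>

section \<open>The Banach algebra of operators\<close>

text \<open>A copy of the bounded linear maps with composition as multiplication: this makes \<open>exp\<close> applicable.\<close>
typedef (overloaded) 'a endo = "UNIV :: ('a::euclidean_space \<Rightarrow>\<^sub>L 'a) set" ..

setup_lifting type_definition_endo

instantiation endo :: (euclidean_space) real_normed_algebra_1
begin
lift_definition zero_endo :: "'a endo" is 0 .
lift_definition one_endo :: "'a endo" is id_blinfun .
lift_definition plus_endo :: "'a endo \<Rightarrow> 'a endo \<Rightarrow> 'a endo" is "(+)" .
lift_definition minus_endo :: "'a endo \<Rightarrow> 'a endo \<Rightarrow> 'a endo" is "(-)" .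
lift_definition uminus_endo :: "'a endo \<Rightarrow> 'a endo" is uminus .
lift_definition times_endo :: "'a endo \<Rightarrow> 'a endo \<Rightarrow> 'a endo" is blinfun_compose .
lift_definition scaleR_endo :: "real \<Rightarrow> 'a endo \<Rightarrow> 'a endo" is scaleR .
lift_definition norm_endo :: "'a endo \<Rightarrow> real" is norm .
lift_definition sgn_endo :: "'a endo \<Rightarrow> 'a endo" is sgn .
lift_definition dist_endo :: "'a endo \<Rightarrow> 'a endo \<Rightarrow> real" is dist .
definition uniformity_endo :: "('a endo \<times> 'a endo) filter" where
  "uniformity_endo = (INF e\<in>{0<..}. principal {(x, y). dist x y < e})"
definition open_endo :: "'a endo set \<Rightarrow> bool" where
  "open_endo U \<longleftrightarrow> (\<forall>x\<in>U. \<forall>\<^sub>F (x', y) in uniformity. x' = x \<longrightarrow> y \<in> U)"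
instance
proof
  have ne: "\<exists>x::'a. x \<noteq> 0" using nonempty_Basis nonzero_Basis by blast
  show "norm (1::'a endo) = 1"
    by transfer (use ne in \<open>simp add: norm_blinfun_id\<close>)
  show "(0::'a endo) \<noteq> 1"
    by transfer (metis ne blinfun_apply_id_blinfun id_apply zero_blinfun.rep_eq)
  show "norm (x * y) \<le> norm x * norm y" for x y :: "'a endo"
    by transfer (rule norm_blinfun_compose)
qed (transfer, auto simp: dist_norm uniformity_endo_def open_endo_def sgn_div_norm norm_triangle_ineq
      algebra_simps intro!: blinfun_eqI simp: blinfun.bilinear_simps)+
end


instance endo :: (euclidean_space) banach
proof
  fix X :: "nat \<Rightarrow> 'a endo"
  assume "Cauchy X"
  then have "Cauchy (\<lambda>n. Rep_endo (X n))"
    by (simp add: Cauchy_def dist_endo.rep_eq)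
  then obtain L where L: "(\<lambda>n. Rep_endo (X n)) \<longlonglongrightarrow> L"
    using Cauchy_convergent convergent_def by blast
  have "X \<longlonglongrightarrow> Abs_endo L"
    using L by (simp add: tendsto_iff dist_endo.rep_eq Abs_endo_inverse)
  then show "convergent X" by (rule convergentI)
qed

lift_definition app :: "'a::euclidean_space endo \<Rightarrow> 'a \<Rightarrow> 'a" is blinfun_apply .

definition endo_of :: "('a::euclidean_space \<Rightarrow> 'a) \<Rightarrow> 'a endo" where
  "endo_of f = Abs_endo (Blinfun f)"

lemma app_endo_of [simp]: "linear f \<Longrightarrow> app (endo_of f) = f"
  by (simp add: endo_of_def app.rep_eq Abs_endo_inverse bounded_linear_Blinfun_apply
      linear_conv_bounded_linear)

lemma endo_eqI: "(\<And>x. app S x = app T x) \<Longrightarrow> S = T"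
  by transfer (rule blinfun_eqI)

lemma bounded_bilinear_app: "bounded_bilinear app"
proof
  show "app (a + a') b = app a b + app a' b" for a a' :: "'a endo" and b
    by transfer (simp add: blinfun.bilinear_simps)
  show "app a (b + b') = app a b + app a b'" for a :: "'a endo" and b b'
    by transfer (simp add: blinfun.bilinear_simps)
  show "app (r *\<^sub>R a) b = r *\<^sub>R app a b" for a :: "'a endo" and b r
    by transfer (simp add: blinfun.bilinear_simps)
  show "app a (r *\<^sub>R b) = r *\<^sub>R app a b" for a :: "'a endo" and b r
    by transfer (simp add: blinfun.bilinear_simps)
  show "\<exists>K. \<forall>a b. norm (app a b :: 'a) \<le> norm a * norm b * K"
    by (rule exI[of _ 1], transfer) (simp add: norm_blinfun)
qed

interpretation app: bounded_bilinear app by (rule bounded_bilinear_app)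

lemma norm_app: "norm (app T x) \<le> norm T * norm x"
  by transfer (rule norm_blinfun)

lemma norm_endo_bound: "0 \<le> b \<Longrightarrow> (\<And>x. norm (app T x) \<le> b * norm x) \<Longrightarrow> norm T \<le> b"
  by transfer (rule norm_blinfun_bound)

lemma app_one [simp]: "app 1 x = x" and app_mult [simp]: "app (S * T) x = app S (app T x)"
  by (transfer, simp)+

lemma app_one' [simp]: "app 1 = id" and app_mult': "app (S * T) = app S \<circ> app T"
  by auto

lemma linear_app [simp]: "linear (app T)"
  using app.bounded_linear_right bounded_linear.linear by blast

lemma endo_of_app [simp]: "endo_of (app T) = T"
  by (rule endo_eqI) simp

lemma app_eq_iff: "app S = app T \<longleftrightarrow> S = T"
  by (metis endo_of_app)

lemma app_power: "app (T ^ n) x = (app T ^^ n) x"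
  by (induction n arbitrary: x) (auto simp: funpow_swap1)

lemma linear_endo_of_bilinear:
  assumes "bilinear f"
  shows "linear (\<lambda>X. endo_of (f X))"
proof -
  have l: "linear (f X)" for X using assms by (auto simp: bilinear_def)
  show ?thesis
    by (rule linearI; rule endo_eqI)
      (simp_all add: l app.add_left app.scaleR_left bilinear_ladd[OF assms] bilinear_lmul[OF assms])
qed

section \<open>The exponential map\<close>

lemma app_exp: "app (exp T) x = (\<Sum>n. (1 / fact n) *\<^sub>R ((app T ^^ n) x))"
proof -
  have "(\<lambda>n. app (T ^ n /\<^sub>R fact n) x) sums app (exp T) x"
    using bounded_linear.sums[OF app.bounded_linear_left exp_converges] .
  then show ?thesis
    by (simp add: sums_unique app.scaleR_left app_power inverse_eq_divide)
qed

lemma continuous_exp_algebra: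
  "continuous_on S (exp :: 'a::{real_normed_algebra_1,banach} \<Rightarrow> 'a)"
proof -
  have "continuous_on (ball 0 R) (exp :: 'a \<Rightarrow> 'a)" for R
  proof -
    have "uniform_limit (ball 0 R) (\<lambda>n x. \<Sum>i<n. x ^ i /\<^sub>R fact i) (\<lambda>x::'a. \<Sum>i. x ^ i /\<^sub>R fact i) sequentially"
    proof (rule Weierstrass_m_test)
      show "norm (x ^ n /\<^sub>R fact n) \<le> \<bar>R\<bar> ^ n /\<^sub>R fact n" if "x \<in> ball 0 R" for n and x :: 'a
      proof -
        have "norm (x ^ n) \<le> norm x ^ n" by (rule norm_power_ineq)
        also have "\<dots> \<le> \<bar>R\<bar> ^ n" using that by (intro power_mono) auto
        finally show ?thesis by (simp add: divide_inverse mult_left_mono)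
      qed
      show "summable (\<lambda>n. \<bar>R\<bar> ^ n /\<^sub>R fact n)" by (rule summable_exp_generic)
    qed
    then have "continuous_on (ball 0 R) (\<lambda>x::'a. \<Sum>i. x ^ i /\<^sub>R fact i)"
      by (rule uniform_limit_theorem[rotated])
        (auto intro!: always_eventually continuous_intros)
    then show ?thesis by (simp add: exp_def[abs_def])
  qed
  moreover have "(UNIV :: 'a set) = (\<Union>R. ball 0 R)"
    by (auto intro: gt_ex)
  ultimately have "continuous_on (UNIV :: 'a set) exp"
    by (metis (no_types, lifting) continuous_on_open_UN open_ball)
  then show ?thesis using continuous_on_subset by blast
qed

lemma has_vector_derivative_exp_app:
  "((\<lambda>s. app (exp (s *\<^sub>R T)) x) has_vector_derivative app (exp (s *\<^sub>R T)) (app T x)) (at s within A)"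
proof -
  have "((\<lambda>s. exp (s *\<^sub>R T)) has_vector_derivative exp (s *\<^sub>R T) * T) (at s within A)"
    by (rule exp_scaleR_has_vector_derivative_right)
  from bounded_linear.has_vector_derivative[OF app.bounded_linear_left this, of x]
  show ?thesis by simp
qed

lemma exp_scaleR_add: "exp ((s + t) *\<^sub>R (T::'a::{real_normed_algebra_1,banach})) = exp (s *\<^sub>R T) * exp (t *\<^sub>R T)"
  by (simp add: scaleR_add_left exp_add_commuting)

lemma exp_minus_cancel [simp]:
  "exp (- T) * exp (T::'a::{real_normed_algebra_1,banach}) = 1" "exp T * exp (- T) = 1"
  using exp_minus_inverse[of T] exp_minus_inverse[of "- T"] by auto

lemma app_exp_eigen:
  assumes "app T v = a *\<^sub>R v"
  shows "app (exp T) v = exp a *\<^sub>R v"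
proof -
  have p: "(app T ^^ n) v = a ^ n *\<^sub>R v" for n
    by (induction n) (auto simp: assms app.scaleR_right)
  have "app (exp T) v = (\<Sum>n. (a ^ n /\<^sub>R fact n) *\<^sub>R v)"
    by (simp add: app_exp p divide_inverse mult.commute)
  also have "\<dots> = exp a *\<^sub>R v"
    using bounded_linear.suminf[OF bounded_linear_scaleR_left[of v] summable_exp_generic[of a]]
    by (simp add: exp_def)
  finally show ?thesis .
qed

section \<open>The Killing form\<close>

definition tr :: "'a::euclidean_space endo \<Rightarrow> real" where
  "tr T = (\<Sum>b\<in>Basis. app T b \<bullet> b)"

lemma tr_mult_commute: "tr (S * T) = tr (T * S)"
proof -
  have e: "tr (S * T) = (\<Sum>b\<in>Basis. \<Sum>c\<in>Basis. (app T b \<bullet> c) * (app S c \<bullet> b))" for S T :: "'a endo"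
  proof -
    have "app (S * T) b \<bullet> b = (\<Sum>c\<in>Basis. (app T b \<bullet> c) * (app S c \<bullet> b))" for b
    proof -
      have "app S (app T b) = app S (\<Sum>c\<in>Basis. (app T b \<bullet> c) *\<^sub>R c)"
        by (simp add: euclidean_representation)
      then show ?thesis
        by (simp add: app.sum_right app.scaleR_right inner_sum_left)
    qed
    then show ?thesis by (simp add: tr_def)
  qed
  show ?thesis
    unfolding e by (subst sum.swap) (simp add: mult.commute)
qed

lemma tr_add: "tr (S + T) = tr S + tr T" and tr_diff: "tr (S - T) = tr S - tr T"
  and tr_scaleR: "tr (c *\<^sub>R S) = c * tr S"
  by (simp_all add: tr_def app.add_left app.diff_left app.scaleR_left inner_add_left inner_diff_left
      sum.distrib sum_subtractf sum_distrib_left)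

text \<open>Applied with \<open>L\<close> an automorphism, \<open>S = ad Y\<close> and
  \<open>T = ad (L Y)\<close>, this turns the covariance of \<open>ad\<close> into the conjugation
  rule \<open>ex_conj\<close>.\<close>

lemma exp_intertwine:
  fixes S T L :: "'a::{real_normed_algebra_1,banach}"
  assumes "L * S = T * L"
  shows "L * exp S = exp T * L"
proof -
  have p: "L * S ^ n = T ^ n * L" for n
    by (induction n) (simp_all add: assms, metis assms mult.assoc power_Suc power_commutes)
  have "L * exp S = (\<Sum>n. L * (S ^ n /\<^sub>R fact n))"
    using bounded_linear.suminf[OF bounded_linear_mult_right summable_exp_generic] by (simp add: exp_def)
  also have "\<dots> = (\<Sum>n. (T ^ n /\<^sub>R fact n) * L)" by (simp add: p)
  also have "\<dots> = exp T * L"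
    using bounded_linear.suminf[OF bounded_linear_mult_left[of L] summable_exp_generic[of T]] by (simp add: exp_def)
  finally show ?thesis .
qed

locale rank_one =
  fixes br :: "'g::euclidean_space \<Rightarrow> 'g \<Rightarrow> 'g" and th A alpha H0
  assumes data: "rank_one_data br th A alpha H0"
begin

lemma bil: "bilinear br" and br_self [simp]: "br X X = 0"
  and jacobi: "br X (br Y Z) + br Y (br Z X) + br Z (br X Y) = 0"
  and nondeg: "(\<And>Y. killing br X Y = 0) \<Longrightarrow> X = 0"
  using data by (auto simp: rank_one_data_def semisimple_def lie_algebra_def)

sublocale br: bounded_bilinear br
  using bil by (simp add: bilinear_conv_bounded_bilinear)

lemma br_anti: "br X Y = - br Y X"
proof -
  have "br (X + Y) (X + Y) = br X Y + br Y X"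
    unfolding br.add_left br.add_right by simp
  then show ?thesis by (simp add: eq_neg_iff_add_eq_0)
qed

lemma br_deriv: "br X (br Y Z) = br (br X Y) Z + br Y (br X Z)"
proof -
  have "br Y (br Z X) = - br Y (br X Z)" by (subst br_anti[of Z X]) (simp add: br.minus_right)
  then show ?thesis
    using jacobi[of X Y Z] br_anti[of Z "br X Y"] by (simp add: algebra_simps)
qed

lemma linear_th: "linear th" and th_th [simp]: "th (th X) = X"
  and th_br: "th (br X Y) = br (th X) (th Y)"
  and th_pos: "X \<noteq> 0 \<Longrightarrow> killing br X (th X) < 0"
  using data by (auto simp: rank_one_data_def cartan_involution_def)

lemma th_simps [simp]: "th (X + Y) = th X + th Y" "th (X - Y) = th X - th Y" "th (- X) = - th X"
  "th (c *\<^sub>R X) = c *\<^sub>R th X" "th 0 = 0"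
  using linear_th by (simp_all add: linear_add linear_diff linear_neg linear_scale linear_0)

definition ad :: "'g \<Rightarrow> 'g endo" where "ad X = endo_of (br X)"

lemma linear_br [simp]: "linear (br X)"
  using br.bounded_linear_right bounded_linear.linear by blast

lemma app_ad [simp]: "app (ad X) Y = br X Y"
  by (simp add: ad_def)

lemma linear_ad: "linear ad"
  unfolding ad_def[abs_def] by (rule linear_endo_of_bilinear[OF bil])

lemma ad_simps: "ad (X + Y) = ad X + ad Y" "ad (X - Y) = ad X - ad Y" "ad (- X) = - ad X"
  "ad (c *\<^sub>R X) = c *\<^sub>R ad X"
  using linear_ad by (simp_all add: linear_add linear_diff linear_neg linear_scale)

lemma bounded_linear_ad: "bounded_linear ad"
  using linear_ad by (simp add: linear_conv_bounded_linear)

lemma continuous_ad [continuous_intros]: "continuous_on S f \<Longrightarrow> continuous_on S (\<lambda>x. ad (f x))"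
  by (rule bounded_linear.continuous_on[OF bounded_linear_ad])

lemma ad_br: "ad (br X Y) = ad X * ad Y - ad Y * ad X"
  by (rule endo_eqI) (simp add: app.diff_left br_deriv[of X Y])

lemma killing_tr: "killing br X Y = tr (ad X * ad Y)"
  by (simp add: killing_def tr_def)

lemma killing_sym: "killing br X Y = killing br Y X"
  unfolding killing_tr by (rule tr_mult_commute)

lemma killing_invariant: "killing br (br X Y) Z = - killing br Y (br X Z)"
proof -
  have "tr (ad X * (ad Y * ad Z)) = tr (ad Y * ad Z * ad X)" by (rule tr_mult_commute)
  then show ?thesis
    by (simp add: killing_tr ad_br tr_diff algebra_simps)
qed

text \<open>The operator of \<open>a Z\<close> is the conjugate of that of \<open>Z\<close> by
  \<open>a\<close>, and the trace is cyclic. The inverse is passed as \<open>b\<close> so that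
  \<open>th\<close>, its own inverse, and the elements of \<open>G\<close> are covered
  alike.\<close>

lemma killing_automorphism:
  assumes "linear a" "linear b" and ab: "\<And>X. a (b X) = X" "\<And>X. b (a X) = X"
    and aut: "\<And>X Y. a (br X Y) = br (a X) (a Y)"
  shows "killing br (a X) (a Y) = killing br X Y"
proof -
  have "ad (a Z) = endo_of a * ad Z * endo_of b" for Z
    by (rule endo_eqI) (simp add: assms)
  then have "ad (a X) * ad (a Y) = endo_of a * (ad X * (endo_of b * endo_of a) * ad Y * endo_of b)"
    by (simp add: mult.assoc)
  moreover have "endo_of b * endo_of a = 1" by (rule endo_eqI) (simp add: assms)
  ultimately have "tr (ad (a X) * ad (a Y)) = tr ((ad X * ad Y * endo_of b) * endo_of a)"
    by (simp add: tr_mult_commute[of "endo_of a"])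
  also have "\<dots> = tr (ad X * ad Y)"
    using \<open>endo_of b * endo_of a = 1\<close> by (simp add: mult.assoc)
  finally show ?thesis by (simp add: killing_tr)
qed

lemma killing_th: "killing br (th X) (th Y) = killing br X Y"
  by (rule killing_automorphism[of th th]) (auto simp: linear_th th_br)

lemma H0_A: "H0 \<in> A" and alpha_H0: "alpha H0 = 1"
  and A_max: "maximal_abelian_subspace_of br (p_space th) A" and dim_A: "dim A = 1"
  using data by (auto simp: rank_one_data_def)

lemma th_H0 [simp]: "th H0 = - H0"
  using A_max H0_A by (auto simp: maximal_abelian_subspace_of_def abelian_subspace_of_def p_space_def)

lemma linear_alpha: "linear alpha"
  using data by (auto simp: rank_one_data_def indivisible_root_def restricted_root_def)

lemma H0_nz: "H0 \<noteq> 0"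
  using alpha_H0 linear_0[OF linear_alpha] by auto

definition B :: "'g \<Rightarrow> 'g \<Rightarrow> real" where "B = p_inner br H0"
text \<open>The positive definite inner product attached to the Cartan involution: \<open>B\<close>
  on \<open>p\<close>, \<open>- B\<close> on the fixed points of \<open>th\<close>, with the two
  spaces orthogonal. By \<open>Q_br\<close> the operator \<open>br Y\<close> is symmetric for
  \<open>Y\<close> in \<open>p\<close> and skew for \<open>th Y = Y\<close>.\<close>

definition Q :: "'g \<Rightarrow> 'g \<Rightarrow> real" where "Q X Y = - B X (th Y)"

lemma killing_H0: "killing br H0 H0 > 0"
  using th_pos[OF H0_nz] by (simp add: killing_tr ad_simps tr_def app.minus_left sum_negf app.minus_right)

lemma B_bilinear: "bilinear B"
  unfolding bilinear_def B_def p_inner_def[abs_def]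
  by (auto intro!: linearI simp: killing_tr ad_simps distrib_left distrib_right tr_add tr_scaleR
      add_divide_distrib)

sublocale B: bounded_bilinear B
  using B_bilinear by (simp add: bilinear_conv_bounded_bilinear)

lemma Q_bilinear: "bilinear Q"
  unfolding bilinear_def Q_def
  by (auto intro!: linearI simp: B.add_left B.add_right B.scaleR_left B.scaleR_right)

sublocale Q: bounded_bilinear Q
  using Q_bilinear by (simp add: bilinear_conv_bounded_bilinear)

lemma B_sym: "B X Y = B Y X" and B_th: "B (th X) (th Y) = B X Y"
  and B_inv: "B (br X Y) Z = - B Y (br X Z)"
  by (simp_all add: B_def p_inner_def killing_sym[of X Y] killing_th killing_invariant)

lemma B_H0: "B H0 H0 = 1"
  using killing_H0 by (simp add: B_def p_inner_def)

lemma Q_H0: "Q H0 H0 = 1"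
  by (simp add: Q_def B_H0 B.minus_right)

lemma Q_sym: "Q X Y = Q Y X"
  using B_th[of "th Y" X] B_sym[of X "th Y"] by (simp add: Q_def)

lemma Q_pos: "X \<noteq> 0 \<Longrightarrow> 0 < Q X X"
  using th_pos[of X] killing_H0 by (simp add: Q_def B_def p_inner_def divide_neg_pos)

lemma Q_nonneg [simp]: "0 \<le> Q X X"
  using Q_pos[of X] by (cases "X = 0") (auto simp: Q.zero_left)

lemma Q_eq_0 [simp]: "Q X X = 0 \<longleftrightarrow> X = 0"
proof
  show "Q X X = 0 \<Longrightarrow> X = 0" using Q_pos[of X] by (cases "X = 0") auto
qed (simp add: Q.zero_left)

lemma Q_th: "Q (th X) (th Y) = Q X Y"
  unfolding Q_def using B_th[of X "th Y"] by simp

lemma Q_br: "Q (br X Y) Z = - Q Y (br (th X) Z)"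
proof -
  have "Q (br X Y) Z = B Y (br X (th Z))" by (simp add: Q_def B_inv)
  also have "br X (th Z) = th (br (th X) Z)" by (simp add: th_br)
  finally show ?thesis by (simp add: Q_def)
qed

lemma Q_le: obtains K where "0 < K" "\<And>v. Q v v \<le> K * (norm v)\<^sup>2"
proof -
  obtain K where K: "0 < K" "\<And>x y. norm (Q x y) \<le> norm x * norm y * K"
    using Q.pos_bounded by blast
  have "Q v v \<le> K * (norm v)\<^sup>2" for v
  proof -
    have "Q v v \<le> norm (Q v v)" by simp
    also have "\<dots> \<le> norm v * norm v * K" by (rule K)
    finally show ?thesis by (simp only: power2_eq_square ac_simps)
  qed
  then show thesis by (rule that[OF K(1)])
qed

lemma Q_ge: obtains m where "0 < m" "\<And>v. m * (norm v)\<^sup>2 \<le> Q v v"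
proof -
  have "continuous_on (sphere (0::'g) 1) (\<lambda>v. Q v v)"
    by (intro Q.continuous_on continuous_on_id)
  then obtain u where u: "u \<in> sphere 0 1" "\<And>v. v \<in> sphere 0 1 \<Longrightarrow> Q u u \<le> Q v v"
    using continuous_attains_inf[of "sphere 0 1" "\<lambda>v. Q v v"] by (auto simp del: mem_sphere)
  have "Q u u > 0" using u(1) by (intro Q_pos) auto
  moreover have "Q u u * (norm v)\<^sup>2 \<le> Q v v" for v
  proof (cases "v = 0")
    case False
    have "Q u u \<le> Q (v /\<^sub>R norm v) (v /\<^sub>R norm v)" using False by (intro u(2)) simp
    also have "\<dots> = Q v v / (norm v)\<^sup>2"
      by (simp only: Q.scaleR_left Q.scaleR_right real_scaleR_def power2_eq_square divide_inverse
          inverse_mult_distrib ac_simps)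
    finally show ?thesis
      using False by (simp add: pos_le_divide_eq)
  qed (simp add: Q.zero_left)
  ultimately show thesis by (rule that)
qed

lemma Q_cauchy: "(Q x y)\<^sup>2 \<le> Q x x * Q y y"
proof (cases "y = 0")
  case False
  have "0 \<le> Q (Q y y *\<^sub>R x - Q x y *\<^sub>R y) (Q y y *\<^sub>R x - Q x y *\<^sub>R y)" by simp
  also have "\<dots> = Q y y * (Q x x * Q y y - (Q x y)\<^sup>2)"
    by (simp add: Q.diff_left Q.diff_right Q.scaleR_left Q.scaleR_right Q_sym[of y x]
        algebra_simps power2_eq_square)
  finally show ?thesis using Q_pos[OF False] by (simp add: zero_le_mult_iff)
qed (simp add: Q.zero_right)

section \<open>Rank one structure\<close>

lemma A_eq: "A = range (\<lambda>c. c *\<^sub>R H0)"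
proof -
  have "subspace A" using A_max by (simp add: maximal_abelian_subspace_of_def abelian_subspace_of_def)
  then have "span {H0} = A"
    using H0_A H0_nz dim_A by (intro subspace_dim_equal) (auto simp: span_minimal)
  then show ?thesis by (simp add: span_singleton)
qed

text \<open>\<open>H0\<close> and \<open>w\<close> span an abelian subspace of \<open>p\<close> that
  contains \<open>A\<close>; by maximality it equals \<open>A\<close>, which is a line because the
  real rank is one.\<close>

lemma centralizer_H0:
  assumes "th w = - w" "br H0 w = 0"
  obtains c where "w = c *\<^sub>R H0"
proof -
  let ?A' = "span {H0, w}"
  have z: "br x y = 0" if "x \<in> {H0, w}" "y \<in> {H0, w}" for x y
    using that assms br_anti[of w H0] by auto
  have z1: "br x y = 0" if "x \<in> ?A'" "y \<in> {H0, w}" for x y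
    using that(1) by (induction rule: span_induct_alt)
      (use z that(2) in \<open>auto simp: br.add_left br.scaleR_left br.zero_left\<close>)
  have z2: "br x y = 0" if "x \<in> ?A'" "y \<in> ?A'" for x y
    using that(2) by (induction rule: span_induct_alt)
      (use z1 that(1) in \<open>auto simp: br.add_right br.scaleR_right br.zero_right\<close>)
  have "subspace (p_space th)" unfolding p_space_def by (auto simp: subspace_def)
  moreover have "{H0, w} \<subseteq> p_space th" using assms by (auto simp: p_space_def)
  ultimately have "?A' \<subseteq> p_space th" by (simp add: span_minimal)
  then have "abelian_subspace_of br (p_space th) ?A'"
    using z2 by (auto simp: abelian_subspace_of_def)
  moreover have "A \<subseteq> ?A'" unfolding A_eq by (auto intro: span_scale span_base)
  ultimately have "?A' = A" using A_max by (simp add: maximal_abelian_subspace_of_def)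
  then have "w \<in> A" using span_base[of w "{H0,w}"] by auto
  then show thesis using that unfolding A_eq by auto
qed

text \<open>\<open>ad H0\<close> exchanges the two eigenspaces of \<open>th\<close>, because
  \<open>th H0 = - H0\<close>. So the two components of a root vector for \<open>alpha\<close> are
  carried into each other, with factor \<open>alpha H0 = 1\<close>.\<close>

lemma root_vector:
  obtains Xp Xk where "th Xp = - Xp" "th Xk = Xk" "br H0 Xp = Xk" "br H0 Xk = Xp" "Xp \<noteq> 0"
proof -
  obtain X where X: "X \<noteq> 0" "br H0 X = X"
    using data H0_A alpha_H0 by (auto simp: rank_one_data_def indivisible_root_def restricted_root_def)
  define Xp where "Xp = (1/2) *\<^sub>R (X - th X)"
  define Xk where "Xk = (1/2) *\<^sub>R (X + th X)"
  have "br H0 (th X) = - th X"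
    using arg_cong[OF X(2), of th] by (simp add: th_br br.minus_left) (metis minus_minus)
  then have 1: "br H0 Xp = Xk" "br H0 Xk = Xp"
    by (simp_all add: Xp_def Xk_def br.scaleR_right br.diff_right br.add_right X)
  have "Xp \<noteq> 0"
  proof
    assume "Xp = 0"
    then have "Xk = 0" using 1 by (simp add: br.zero_right)
    have "X = Xp + Xk" by (simp add: Xp_def Xk_def flip: scaleR_add_left scaleR_add_right)
    with \<open>Xp = 0\<close> \<open>Xk = 0\<close> X(1) show False by simp
  qed
  with 1 show thesis
    by (intro that[of Xp Xk]) (simp_all add: Xp_def Xk_def algebra_simps)
qed

text \<open>The centralizer of \<open>p\<close>. \<open>zp_th\<close> places it in the fixed space
  of \<open>th\<close>, and it is an ideal: the compact part that a semisimple algebra of real rank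
  one may contain. On \<open>zp\<close> the sum in \<open>variance_bound\<close> vanishes for
  \<open>mu = 0\<close>, so that bound can only hold on the orthogonal complement.\<close>

definition zp :: "'g set" where "zp = {v. \<forall>Y. th Y = - Y \<longrightarrow> br Y v = 0}"

text \<open>Twice the \<open>p\<close>-component of \<open>v\<close>, called \<open>w\<close>, also
  centralizes \<open>p\<close>, since \<open>th\<close> preserves the condition. So \<open>w\<close>
  is a multiple of \<open>H0\<close>, and \<open>H0\<close> does not commute with
  \<open>Xp\<close>.\<close>

lemma zp_th: assumes "v \<in> zp" shows "th v = v"
proof -
  have tv: "br Y (th v) = 0" if "th Y = - Y" for Y
  proof -
    have "br Y v = 0" using assms that by (simp add: zp_def)
    then have "th (br Y v) = 0" by simp
    then show ?thesis using that by (simp add: th_br br.minus_left)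
  qed
  define w where "w = v - th v"
  have w: "br Y w = 0" if "th Y = - Y" for Y
    using tv[OF that] assms that by (simp add: w_def zp_def br.diff_right)
  have "th w = - w" by (simp add: w_def)
  with w[of H0] obtain c where c: "w = c *\<^sub>R H0" using centralizer_H0 by auto
  obtain Xp Xk where X: "th Xp = - Xp" "th Xk = Xk" "br H0 Xp = Xk" "br H0 Xk = Xp" "Xp \<noteq> 0"
    by (rule root_vector)
  have "c *\<^sub>R Xk = 0"
    using w[OF X(1)] X(3) br_anti[of Xp H0] unfolding c br.scaleR_right by simp
  moreover have "Xk \<noteq> 0" using X by (auto simp: br.zero_right)
  ultimately have "w = 0" using c by auto
  then show ?thesis by (simp add: w_def)
qed

text \<open>The eigenvalue of \<open>br Y\<close> on \<open>v\<close>, times \<open>Q v v\<close>,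
  is \<open>- B Y W\<close> with \<open>W = br v (th v)\<close> in \<open>p\<close>. Brackets of two
  elements of \<open>p\<close> kill \<open>v\<close>, because both act on \<open>v\<close> by
  scalars, and so do triple brackets. Thus the functional vanishes at \<open>br (br W Y) Y\<close>,
  which forces \<open>br W Y = 0\<close>. So \<open>W\<close> lies in \<open>zp\<close> and in
  \<open>p\<close>, hence is 0, and all eigenvalues vanish.\<close>

lemma common_eigenvector:
  assumes "\<And>Y. th Y = - Y \<Longrightarrow> \<exists>m. br Y v = m *\<^sub>R v"
  shows "v \<in> zp"
proof -
  define W where "W = br v (th v)"
  have thW: "th W = - W" by (simp add: W_def th_br) (rule br_anti)
  have mu: "Q (br Y v) v = - B Y W" for Y
    unfolding Q_def W_def using B_inv[of v Y "th v"] by (simp add: br_anti[of Y v] B.minus_left)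
  have c2: "br (br Y Y') v = 0" if Y: "th Y = - Y" "th Y' = - Y'" for Y Y'
  proof -
    obtain m m' where "br Y v = m *\<^sub>R v" "br Y' v = m' *\<^sub>R v" using assms Y by meson
    then show ?thesis using br_deriv[of Y Y' v] by (simp add: br.scaleR_right mult.commute)
  qed
  have c3: "br (br (br Y Y') Y'') v = 0" if Y: "th Y = - Y" "th Y' = - Y'" "th Y'' = - Y''"
    for Y Y' Y''
  proof -
    obtain m where "br Y'' v = m *\<^sub>R v" using assms Y by meson
    then show ?thesis using br_deriv[of "br Y Y'" Y'' v] c2[of Y Y'] Y
      by (simp add: br.scaleR_right br.zero_right)
  qed
  have "br Y W = 0" if Y: "th Y = - Y" for Y
  proof -
    have "B (br (br W Y) Y) W = 0"
      using mu[of "br (br W Y) Y"] c3[OF thW Y Y] by (simp add: Q.zero_left)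
    moreover have "B (br W Y) (br W Y) = B (br (br W Y) Y) W"
    proof -
      have "B (br W Y) (br W Y) = - B Y (br W (br W Y))" by (rule B_inv)
      also have "\<dots> = B Y (br (br W Y) W)" by (subst br_anti[of W]) (simp add: B.minus_right)
      also have "\<dots> = - B (br (br W Y) Y) W" by (simp add: B_inv)
      finally have "B (br W Y) (br W Y) = - B (br (br W Y) Y) W" .
      then show ?thesis using \<open>B (br (br W Y) Y) W = 0\<close> by simp
    qed
    ultimately have "Q (br W Y) (br W Y) = 0"
      by (simp add: Q_def th_br thW Y br.minus_left br.minus_right B.minus_right)
    then show ?thesis using br_anti[of Y W] by simp
  qed
  then have "W \<in> zp" unfolding zp_def by blast
  then have "W = 0" using zp_th[of W] thW by (metis eq_neg_iff_add_eq_0 scaleR_2 scaleR_eq_0_iff zero_neq_numeral)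
  then have z: "Q (br Y v) v = 0" for Y using mu by (simp add: B.zero_right)
  have "br Y v = 0" if "th Y = - Y" for Y
  proof -
    obtain m where m: "br Y v = m *\<^sub>R v" using assms \<open>th Y = - Y\<close> by meson
    then show ?thesis using z[of Y] by (auto simp: Q.scaleR_left)
  qed
  then show ?thesis by (auto simp: zp_def)
qed

text \<open>Compactness: on the unit sphere of the complement of \<open>zp\<close> the sum is
  continuous and cannot vanish, by \<open>common_eigenvector\<close>. For a unit vector the best
  choice of \<open>mu Y\<close> is \<open>Q (br Y v) v\<close>, so a bound for this choice covers
  all \<open>mu\<close>; general \<open>v\<close> follow by scaling.\<close>

lemma variance_bound:
  assumes P0: "finite P0" "span P0 = p_space th"
  obtains c where "0 < c"
    "\<And>v mu. (\<And>z. z \<in> zp \<Longrightarrow> Q v z = 0) \<Longrightarrow>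
       c * Q v v \<le> (\<Sum>Y\<in>P0. Q (br Y v - mu Y *\<^sub>R v) (br Y v - mu Y *\<^sub>R v))"
proof -
  define V where "V = {v. \<forall>z\<in>zp. Q v z = 0}"
  define u where "u Y v = br Y v - Q (br Y v) v *\<^sub>R v" for Y v
  define F where "F v = (\<Sum>Y\<in>P0. Q (u Y v) (u Y v))" for v
  let ?S = "V \<inter> {v. Q v v = 1}"
  have cont: "continuous_on UNIV (\<lambda>v. Q v z)" "continuous_on UNIV (\<lambda>v. Q v v)" for z
    by (intro Q.continuous_on continuous_intros)+
  have "V = (\<Inter>z\<in>zp. {v. Q v z = 0})" by (auto simp: V_def)
  then have "closed V"
    using cont by (auto intro!: closed_INT closed_Collect_eq continuous_intros)
  moreover have "compact {v. Q v v = 1}"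
  proof -
    obtain m where m: "0 < m" "\<And>v. m * (norm v)\<^sup>2 \<le> Q v v" using Q_ge by blast
    have "bounded {v. Q v v = 1}"
    proof (rule boundedI)
      fix v assume "v \<in> {v. Q v v = 1}"
      then have "(norm v)\<^sup>2 \<le> 1 / m" using m(2)[of v] m(1) by (simp add: field_simps)
      then show "norm v \<le> sqrt (1 / m)" by (rule real_le_rsqrt)
    qed
    moreover have "closed {v. Q v v = 1}" using cont by (auto intro!: closed_Collect_eq continuous_intros)
    ultimately show ?thesis by (simp add: compact_eq_bounded_closed)
  qed
  ultimately have comp: "compact ?S" by (rule closed_Int_compact)
  have Fpos: "F v > 0" if v: "v \<in> ?S" for v
  proof (rule ccontr)
    assume "\<not> F v > 0"
    moreover have "F v \<ge> 0" unfolding F_def by (simp add: sum_nonneg)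
    ultimately have "F v = 0" by simp
    then have u0: "u Y v = 0" if "Y \<in> P0" for Y
      using that P0(1) by (simp add: F_def sum_nonneg_eq_0_iff)
    \<comment> \<open>The candidate eigenvalue \<open>Q (br Y v) v\<close> is linear in
      \<open>Y\<close>, so the relation passes from \<open>P0\<close> to its span.\<close>
    have eig: "br Y v = Q (br Y v) v *\<^sub>R v" if "Y \<in> span P0" for Y
      using that
    proof (induction rule: span_induct_alt)
      case base then show ?case by (simp add: br.zero_left Q.zero_left)
    next
      case (step c x y)
      have "br x v = Q (br x v) v *\<^sub>R v" using u0[OF step(1)] by (simp add: u_def)
      then have "br (c *\<^sub>R x + y) v = c *\<^sub>R (Q (br x v) v *\<^sub>R v) + Q (br y v) v *\<^sub>R v"
        using step(2) by (simp only: br.add_left br.scaleR_left)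
      moreover have "Q (br (c *\<^sub>R x + y) v) v = c * Q (br x v) v + Q (br y v) v"
        by (simp add: br.add_left br.scaleR_left Q.add_left Q.scaleR_left)
      ultimately show ?case
        by (simp only: scaleR_add_left scaleR_scaleR)
    qed
    have "v \<in> zp"
    proof (rule common_eigenvector)
      fix Y assume "th Y = - Y"
      then have "Y \<in> span P0" using P0(2) by (simp add: p_space_def)
      then show "\<exists>m. br Y v = m *\<^sub>R v" by (intro exI) (rule eig)
    qed
    then have "Q v v = 0" "Q v v = 1" using v unfolding V_def by blast+
    then show False by linarith
  qed
  have "\<exists>c>0. \<forall>v\<in>?S. c \<le> F v"
  proof (cases "?S = {}")
    case True then show ?thesis by (intro exI[of _ 1]) auto
  next
    case False
    have "continuous_on ?S F"
      unfolding F_def u_def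
      by (intro continuous_on_sum Q.continuous_on continuous_intros br.continuous_on)
    then obtain v0 where "v0 \<in> ?S" "\<forall>v\<in>?S. F v0 \<le> F v"
      using continuous_attains_inf[OF comp False] by blast
    then show ?thesis using Fpos by blast
  qed
  then obtain c where c: "0 < c" "\<And>v. v \<in> ?S \<Longrightarrow> c \<le> F v" by auto
  have main: "c * Q v v \<le> (\<Sum>Y\<in>P0. Q (br Y v - mu Y *\<^sub>R v) (br Y v - mu Y *\<^sub>R v))"
    if v: "\<And>z. z \<in> zp \<Longrightarrow> Q v z = 0" for v mu
  proof (cases "v = 0")
    case True then show ?thesis by (simp add: Q.zero_left sum_nonneg)
  next
    case False
    define s where "s = sqrt (Q v v)"
    have s: "s > 0" "s * s = Q v v" using Q_pos[OF False] by (simp_all add: s_def)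
    define w where "w = v /\<^sub>R s"
    have vw: "v = s *\<^sub>R w" using s(1) by (simp add: w_def)
    have "Q w w = inverse s * (inverse s * (s * s))"
      by (simp add: w_def Q.scaleR_left Q.scaleR_right s(2))
    then have w1: "Q w w = 1" using s(1) by (simp add: field_simps)
    have "Q w z = 0" if "z \<in> zp" for z
      by (simp add: w_def Q.scaleR_left v[OF that])
    then have "w \<in> ?S" using w1 unfolding V_def by blast
    then have "c \<le> F w" by (rule c)
    also have "F w \<le> (\<Sum>Y\<in>P0. Q (br Y w - mu Y *\<^sub>R w) (br Y w - mu Y *\<^sub>R w))"
      unfolding F_def
    proof (rule sum_mono)
      fix Y assume "Y \<in> P0"
      have "Q (br Y w - mu Y *\<^sub>R w) (br Y w - mu Y *\<^sub>R w) = Q (u Y w) (u Y w) + (mu Y - Q (br Y w) w)\<^sup>2"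
        by (simp add: u_def Q.diff_left Q.diff_right Q.scaleR_left Q.scaleR_right w1
            Q_sym[of w "br Y w"] power2_eq_square algebra_simps)
      then show "Q (u Y w) (u Y w) \<le> Q (br Y w - mu Y *\<^sub>R w) (br Y w - mu Y *\<^sub>R w)" by simp
    qed
    finally have "s * s * c \<le> s * s * (\<Sum>Y\<in>P0. Q (br Y w - mu Y *\<^sub>R w) (br Y w - mu Y *\<^sub>R w))"
      by (rule mult_left_mono) (simp add: s)
    also have "\<dots> = (\<Sum>Y\<in>P0. Q (br Y v - mu Y *\<^sub>R v) (br Y v - mu Y *\<^sub>R v))"
      unfolding sum_distrib_left
    proof (intro sum.cong refl)
      fix Y
      have "br Y v - mu Y *\<^sub>R v = s *\<^sub>R (br Y w - mu Y *\<^sub>R w)"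
        unfolding vw br.scaleR_right scaleR_diff_right by (simp add: mult.commute)
      then show "s * s * Q (br Y w - mu Y *\<^sub>R w) (br Y w - mu Y *\<^sub>R w) =
          Q (br Y v - mu Y *\<^sub>R v) (br Y v - mu Y *\<^sub>R v)"
        by (simp add: Q.scaleR_left Q.scaleR_right)
    qed
    finally show ?thesis by (simp only: s(2) mult.commute)
  qed
  show thesis by (rule that[OF c(1)]) (rule main)
qed

end

context rank_one
begin

section \<open>The adjoint group\<close>

abbreviation "G \<equiv> adjoint_group br"
abbreviation "K \<equiv> max_compact br th"
abbreviation "cs \<equiv> coset br th"
abbreviation "X \<equiv> sym_space br th"
abbreviation "ex \<equiv> exp_ad br"
abbreviation "p \<equiv> p_space th"

lemma p_iff: "Y \<in> p \<longleftrightarrow> th Y = - Y"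
  by (simp add: p_space_def)

lemma subspace_p: "subspace p"
  by (auto simp: subspace_def p_iff)

lemma ex_app: "ex Y = app (exp (ad Y))"
  by (rule ext) (simp add: exp_ad_def app_exp ad_def)

text \<open>Transporting \<open>br (app (E s) x) (app (E s) y)\<close> back by \<open>F s\<close>,
  the inverse of \<open>E s\<close>, gives a curve with zero derivative; compare
  \<open>s = 1\<close> with \<open>s = 0\<close>.\<close>

lemma app_exp_derivation:
  assumes D: "\<And>x y. app D (br x y) = br (app D x) y + br x (app D y)"
  shows "app (exp D) (br x y) = br (app (exp D) x) (app (exp D) y)"
proof -
  define E where "E s = exp (s *\<^sub>R D)" for s
  define F where "F s = exp (s *\<^sub>R (- D))" for s
  define f where "f s = app (F s) (br (app (E s) x) (app (E s) y))" for s
  have E: "((\<lambda>s. app (E s) z) has_vector_derivative app D (app (E s) z)) (at s)" for s z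
    using bounded_linear.has_vector_derivative[OF app.bounded_linear_left exp_scaleR_has_vector_derivative_left]
    by (simp add: E_def)
  have F: "(F has_vector_derivative F s * (- D)) (at s)" for s
    unfolding F_def by (rule exp_scaleR_has_vector_derivative_right)
  have d: "(f has_vector_derivative
      app (F s) (br (app (E s) x) (app D (app (E s) y)) + br (app D (app (E s) x)) (app (E s) y))
      + app (F s * (- D)) (br (app (E s) x) (app (E s) y))) (at s)" for s
    unfolding f_def by (intro app.has_vector_derivative br.has_vector_derivative E F)
  have z: "app (F s) (br a (app D b) + br (app D a) b) + app (F s * (- D)) (br a b) = 0" for s a b
    by (simp add: D app.minus_left app.minus_right app.add_right)
  have f0: "(f has_vector_derivative 0) (at s)" for s
    by (rule has_vector_derivative_eq_rhs[OF d z])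
  obtain c where "\<And>s. s \<in> UNIV \<Longrightarrow> f s = c"
    by (rule has_vector_derivative_zero_constant[of UNIV f]) (use f0 in auto)
  then have "f 1 = f 0" by simp
  then have "app (exp D) (f 1) = app (exp D) (br x y)" by (simp add: f_def E_def F_def)
  then show ?thesis
    by (simp add: f_def E_def F_def flip: app_mult)
qed

lemma ex_br: "ex Y (br x y) = br (ex Y x) (ex Y y)"
  unfolding ex_app by (rule app_exp_derivation, simp only: app_ad, rule br_deriv)

lemma ex_add: "ex ((s + t) *\<^sub>R Y) = ex (s *\<^sub>R Y) \<circ> ex (t *\<^sub>R Y)"
  by (simp add: ex_app ad_simps exp_scaleR_add app_mult')

lemma ex_minus [simp]: "ex (- Y) (ex Y x) = x" "ex Y (ex (- Y) x) = x"
  by (simp_all add: ex_app ad_simps flip: app_mult)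

lemma ex_minus' [simp]: "ex (- Y) \<circ> ex Y = id" "ex Y \<circ> ex (- Y) = id"
  by (auto simp: fun_eq_iff)

lemma ex_0 [simp]: "ex 0 = id"
  by (simp add: ex_app ad_simps linear_0[OF linear_ad])

lemma ex_conj:
  assumes "linear L" "\<And>x y. L (br x y) = br (L x) (L y)"
  shows "L (ex Y x) = ex (L Y) (L x)"
proof -
  have "endo_of L * ad Y = ad (L Y) * endo_of L"
    by (rule endo_eqI) (simp add: assms)
  then have "app (endo_of L * exp (ad Y)) x = app (exp (ad (L Y)) * endo_of L) x"
    by (simp only: exp_intertwine)
  then show ?thesis by (simp add: ex_app assms)
qed

lemma th_ex: "th (ex Y x) = ex (th Y) (th x)"
  by (rule ex_conj) (auto simp: linear_th th_br)

lemma G_id [simp]: "id \<in> G" by (rule adjoint_group.one)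

lemma G_comp_ex: "g \<in> G \<Longrightarrow> g \<circ> ex Y \<in> G" by (rule adjoint_group.step)

lemma G_ex [simp]: "ex Y \<in> G" using G_comp_ex[OF G_id] by simp

lemma G_linear: "g \<in> G \<Longrightarrow> linear g"
proof (induction rule: adjoint_group.induct)
  case one
  show ?case unfolding id_def by (rule linear_ident)
next
  case (step g Y)
  show ?case unfolding ex_app by (rule linear_compose[OF linear_app step(2)])
qed

lemma G_br: "g \<in> G \<Longrightarrow> g (br x y) = br (g x) (g y)"
  by (induction arbitrary: x y rule: adjoint_group.induct) (auto simp: ex_br)

lemma G_comp: "h \<in> G \<Longrightarrow> g \<in> G \<Longrightarrow> g \<circ> h \<in> G"
proof (induction arbitrary: g rule: adjoint_group.induct)
  case (step h Y)
  then have "(g \<circ> h) \<circ> ex Y \<in> G" by (intro G_comp_ex)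
  then show ?case by (simp only: comp_assoc)
qed simp

lemma G_inverse: "g \<in> G \<Longrightarrow> \<exists>g'\<in>G. g \<circ> g' = id \<and> g' \<circ> g = id"
proof (induction rule: adjoint_group.induct)
  case one
  then show ?case by (intro bexI[of _ id]) auto
next
  case (step g Y)
  then obtain g' where g': "g' \<in> G" "g \<circ> g' = id" "g' \<circ> g = id" by blast
  have "\<And>x. g (g' x) = x" "\<And>x. g' (g x) = x"
    using fun_cong[OF g'(2)] fun_cong[OF g'(3)] by simp_all
  then show ?case using G_comp[OF g'(1) G_ex[of "- Y"]]
    by (intro bexI[of _ "ex (- Y) \<circ> g'"]) (auto simp: fun_eq_iff)
qed

lemma G_bij: "g \<in> G \<Longrightarrow> bij g"
  using G_inverse[of g] o_bij[of _ g] by blast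

lemma G_inv: "g \<in> G \<Longrightarrow> inv g \<in> G"
  using G_inverse[of g] inv_unique_comp[of g] by auto

lemma G_inv_simps: "g \<in> G \<Longrightarrow> g (inv g x) = x" "g \<in> G \<Longrightarrow> inv g (g x) = x"
  using G_bij by (auto simp: bij_is_surj surj_f_inv_f bij_is_inj inv_f_f)

lemma G_inv_comp: "g \<in> G \<Longrightarrow> g \<circ> inv g = id" "g \<in> G \<Longrightarrow> inv g \<circ> g = id"
  by (auto simp: fun_eq_iff G_inv_simps)

lemma inv_ex: "inv (ex Y) = ex (- Y)"
  by (rule inv_unique_comp) auto

lemma G_B: "g \<in> G \<Longrightarrow> B (g x) (g y) = B x y"
  unfolding B_def p_inner_def
  by (subst killing_automorphism[of g "inv g"]) (auto simp: G_linear G_inv G_br G_inv_simps)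

text \<open>The adjoint of \<open>g\<close> for \<open>Q\<close> is
  \<open>th \<circ> inv g \<circ> th\<close>, since \<open>g\<close> preserves
  \<open>B\<close>.\<close>

lemma G_Q: "g \<in> G \<Longrightarrow> Q (g x) y = Q x (th (inv g (th y)))"
  unfolding Q_def using G_B[of "inv g" "g x" "th y"] by (simp add: G_inv G_inv_simps)

lemma G_conj_ex: "g \<in> G \<Longrightarrow> g \<circ> ex Y = ex (g Y) \<circ> g"
  using ex_conj[of g Y] by (auto simp: G_linear G_br)

lemma G_conj_th: "g \<in> G \<Longrightarrow> th \<circ> g \<circ> th \<in> G"
proof (induction rule: adjoint_group.induct)
  case one
  have "th \<circ> id \<circ> th = id" by auto
  then show ?case by (simp only: G_id)
next
  case (step g Y)
  have "th \<circ> (g \<circ> ex Y) \<circ> th = (th \<circ> g \<circ> th) \<circ> ex (th Y)"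
    by (rule ext) (simp add: th_ex)
  then show ?case by (simp only: G_comp_ex[OF step(2)])
qed

lemma K_G: "k \<in> K \<Longrightarrow> k \<in> G" and K_th: "k \<in> K \<Longrightarrow> k (th x) = th (k x)"
  by (auto simp: max_compact_def fun_eq_iff)

lemma K_I: "k \<in> G \<Longrightarrow> (\<And>x. k (th x) = th (k x)) \<Longrightarrow> k \<in> K"
  by (auto simp: max_compact_def fun_eq_iff)

lemma K_id [simp]: "id \<in> K" by (rule K_I) auto

lemma K_comp: "k \<in> K \<Longrightarrow> l \<in> K \<Longrightarrow> k \<circ> l \<in> K"
  by (rule K_I) (auto simp: K_G G_comp K_th)

lemma K_inv: "k \<in> K \<Longrightarrow> inv k \<in> K"
proof (rule K_I)
  fix x assume k: "k \<in> K"
  have "inv k (th (k (inv k x))) = inv k (k (th (inv k x)))" by (simp add: K_th k)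
  then show "inv k (th x) = th (inv k x)" by (simp add: G_inv_simps K_G k)
qed (simp add: K_G G_inv)

lemma K_Q: "k \<in> K \<Longrightarrow> Q (k x) (k y) = Q x y"
  by (simp add: G_Q K_G flip: K_th) (simp add: K_G G_inv_simps)

lemma K_ex: "th Z = Z \<Longrightarrow> ex Z \<in> K"
  by (rule K_I) (auto simp: th_ex)

lemma K_p: "k \<in> K \<Longrightarrow> Y \<in> p \<Longrightarrow> k Y \<in> p"
  using K_th[of k Y] by (simp add: p_iff linear_neg[OF G_linear[OF K_G]])

lemma cs_eqI: "k \<in> K \<Longrightarrow> cs (g \<circ> k) = cs g"
proof -
  assume k: "k \<in> K"
  have "(\<lambda>l. k \<circ> l) ` K = K"
  proof
    show "K \<subseteq> (\<lambda>l. k \<circ> l) ` K"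
    proof
      fix l assume "l \<in> K"
      then have "l = k \<circ> (inv k \<circ> l)" "inv k \<circ> l \<in> K"
        using k by (auto simp: K_inv K_comp K_G G_inv_comp simp flip: comp_assoc)
      then show "l \<in> (\<lambda>l. k \<circ> l) ` K" by blast
    qed
  qed (auto simp: k K_comp)
  then have "(\<lambda>h. g \<circ> h) ` K = (\<lambda>h. g \<circ> h) ` (\<lambda>l. k \<circ> l) ` K" by simp
  then show ?thesis by (simp add: coset_def image_image comp_assoc)
qed

lemma cs_eqD: assumes "cs g = cs g'" obtains k where "k \<in> K" "g = g' \<circ> k"
proof -
  have "g \<in> cs g" unfolding coset_def by (rule image_eqI[of _ _ id]) auto
  then show thesis using assms that by (auto simp: coset_def)
qed

lemma translate_cs [simp]: "translate a (cs g) = cs (a \<circ> g)"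
  by (auto simp: translate_def coset_def image_image comp_assoc)

lemma X_iff: "x \<in> X \<longleftrightarrow> (\<exists>g\<in>G. x = cs g)"
  by (auto simp: sym_space_def)

lemma cs_X [simp]: "g \<in> G \<Longrightarrow> cs g \<in> X" by (auto simp: X_iff)

lemma translate_X: "a \<in> G \<Longrightarrow> x \<in> X \<Longrightarrow> translate a x \<in> X"
  by (auto simp: X_iff intro: G_comp)

lemma translate_translate: "translate a (translate b x) = translate (a \<circ> b) x"
  by (auto simp: translate_def image_image comp_assoc)

lemma translate_id [simp]: "translate id x = x"
  by (simp add: translate_def)

lemma translate_inv:
  "a \<in> G \<Longrightarrow> translate (inv a) (translate a x) = x"
  "a \<in> G \<Longrightarrow> translate a (translate (inv a) x) = x"
  by (simp_all add: translate_translate G_inv_comp)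

section \<open>Diagonalization\<close>

text \<open>The choice \<open>t = b / d\<close>, with \<open>d\<close> positive and larger than
  \<open>c\<close>, contradicts the inequality unless \<open>b = 0\<close>. This is the first-order
  condition at a maximum, used in \<open>symmetric_eigenvector\<close>.\<close>

lemma linear_coefficient_zero:
  fixes b c :: real
  assumes "\<And>t. 2 * t * b \<le> t\<^sup>2 * c"
  shows "b = 0"
proof (rule ccontr)
  assume "b \<noteq> 0"
  define d where "d = \<bar>c\<bar> + 1"
  have d: "d > 0" "c < d" by (auto simp: d_def)
  have "2 * (b / d) * b \<le> (b / d)\<^sup>2 * c" by (rule assms)
  then have "2 * b\<^sup>2 * d \<le> b\<^sup>2 * c" using d(1) by (simp add: field_simps power2_eq_square)
  moreover have "b\<^sup>2 * c < b\<^sup>2 * d" "b\<^sup>2 * d > 0" using d \<open>b \<noteq> 0\<close> by auto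
  ultimately show False by linarith
qed

definition onb :: "'g set \<Rightarrow> bool" where
  "onb E \<longleftrightarrow> finite E \<and> (\<forall>e\<in>E. \<forall>f\<in>E. Q e f = (if e = f then 1 else 0))"

lemma onb_expand:
  assumes E: "onb E" and v: "v \<in> span E"
  shows "v = (\<Sum>e\<in>E. Q v e *\<^sub>R e)"
  using v
proof (induction rule: span_induct_alt)
  case base then show ?case by (simp add: Q.zero_left)
next
  case (step c x y)
  have "x = (\<Sum>e\<in>E. Q x e *\<^sub>R e)"
  proof -
    have "(\<Sum>e\<in>E. Q x e *\<^sub>R e) = (\<Sum>e\<in>E. if x = e then e else 0)"
      using E step(1) by (intro sum.cong) (auto simp: onb_def)
    then show ?thesis using E step(1) by (simp add: onb_def)
  qed
  then have "c *\<^sub>R x + y = c *\<^sub>R (\<Sum>e\<in>E. Q x e *\<^sub>R e) + (\<Sum>e\<in>E. Q y e *\<^sub>R e)"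
    using step(2) by (rule_tac arg_cong2[where f="\<lambda>a b. c *\<^sub>R a + b"])
  also have "\<dots> = (\<Sum>e\<in>E. Q (c *\<^sub>R x + y) e *\<^sub>R e)"
    by (simp add: Q.add_left Q.scaleR_left scaleR_add_left sum.distrib scaleR_right.sum)
  finally show ?case .
qed

lemma compact_Q_sphere: "compact {v. Q v v = 1}"
proof -
  obtain m where m: "0 < m" "\<And>v. m * (norm v)\<^sup>2 \<le> Q v v" using Q_ge by blast
  have "bounded {v. Q v v = 1}"
  proof (rule boundedI)
    fix v assume "v \<in> {v. Q v v = 1}"
    then have "(norm v)\<^sup>2 \<le> 1 / m" using m(2)[of v] m(1) by (simp add: field_simps)
    then show "norm v \<le> sqrt (1 / m)" by (rule real_le_rsqrt)
  qed
  moreover have "closed {v. Q v v = 1}"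
    by (intro closed_Collect_eq Q.continuous_on continuous_intros)
  ultimately show ?thesis by (simp add: compact_eq_bounded_closed)
qed

text \<open>Take a maximizer \<open>e\<close> of the Rayleigh quotient on the unit sphere of
  \<open>W\<close>. The first variation gives \<open>Q (S e) u = 0\<close> for every
  \<open>u\<close> in \<open>W\<close> orthogonal to \<open>e\<close>; apply this to the component
  of \<open>S e\<close> orthogonal to \<open>e\<close>.\<close>

lemma symmetric_eigenvector:
  assumes S: "linear S" "\<And>x y. Q (S x) y = Q x (S y)"
    and W: "subspace W" "S ` W \<subseteq> W" "W \<noteq> {0}"
  obtains e mu where "e \<in> W" "Q e e = 1" "S e = mu *\<^sub>R e"
proof -
  let ?C = "{v. Q v v = 1} \<inter> W"
  obtain w where w: "w \<in> W" "w \<noteq> 0" using W subspace_0 by blast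
  define s where "s = sqrt (Q w w)"
  have s: "s > 0" "Q w w = s * s" using Q_pos[OF w(2)] by (simp_all add: s_def)
  have "Q (w /\<^sub>R s) (w /\<^sub>R s) = 1" using s(1) by (simp add: Q.scaleR_left Q.scaleR_right s(2) field_simps)
  then have "w /\<^sub>R s \<in> ?C" using w(1) W(1) by (auto simp: subspace_scale)
  then have ne: "?C \<noteq> {}" by blast
  have lin: "bounded_linear S" using S(1) by (simp add: linear_conv_bounded_linear)
  have "compact ?C" using compact_Q_sphere closed_subspace[OF W(1)] by (rule compact_Int_closed)
  moreover have "continuous_on ?C (\<lambda>v. Q (S v) v)"
    by (intro Q.continuous_on bounded_linear.continuous_on[OF lin] continuous_on_id)
  ultimately obtain e where e: "e \<in> ?C" and max: "\<And>v. v \<in> ?C \<Longrightarrow> Q (S v) v \<le> Q (S e) e"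
    using continuous_attains_sup[OF _ ne, of "\<lambda>v. Q (S v) v"] by blast
  define mu where "mu = Q (S e) e"
  have e1: "Q e e = 1" "e \<in> W" using e by auto
  have scaled: "Q (S v) v \<le> mu * Q v v" if "v \<in> W" for v
  proof (cases "v = 0")
    case True then show ?thesis by (simp add: Q.zero_right)
  next
    case False
    define r where "r = sqrt (Q v v)"
    have r: "r > 0" "Q v v = r * r" using Q_pos[OF False] by (simp_all add: r_def)
    have "Q (v /\<^sub>R r) (v /\<^sub>R r) = 1" using r(1) by (simp add: Q.scaleR_left Q.scaleR_right r(2) field_simps)
    then have "v /\<^sub>R r \<in> ?C" using that W(1) by (auto simp: subspace_scale)
    then have "Q (S (v /\<^sub>R r)) (v /\<^sub>R r) \<le> mu" using max by (simp add: mu_def)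
    then have "Q (S v) v / (r * r) \<le> mu"
      by (simp add: linear_scale[OF S(1)] Q.scaleR_left Q.scaleR_right divide_inverse mult_ac)
    then show ?thesis using r by (simp add: pos_divide_le_eq)
  qed
  have orth: "Q (S e) u = 0" if u: "u \<in> W" "Q e u = 0" for u
  proof (rule linear_coefficient_zero)
    fix t
    have "e + t *\<^sub>R u \<in> W" using e1 u W(1) by (simp add: subspace_add subspace_scale)
    from scaled[OF this]
    have "mu + 2 * t * Q (S e) u + t\<^sup>2 * Q (S u) u \<le> mu * (1 + t\<^sup>2 * Q u u)"
      using u S(2)[of u e]
      by (simp add: linear_add[OF S(1)] linear_scale[OF S(1)] Q.add_left Q.add_right Q.scaleR_left
          Q.scaleR_right e1 Q_sym[of u e] Q_sym[of u "S e"] power2_eq_square algebra_simps flip: mu_def)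
    then show "2 * t * Q (S e) u \<le> t\<^sup>2 * (mu * Q u u - Q (S u) u)"
      by (simp add: algebra_simps)
  qed
  define u where "u = S e - mu *\<^sub>R e"
  have "u \<in> W" using e1 W by (auto simp: u_def subspace_diff subspace_scale)
  moreover have "Q e u = 0"
    by (simp add: u_def Q.diff_right Q.scaleR_right e1 mu_def Q_sym[of e "S e"])
  moreover have "Q u u = Q (S e) u - mu * Q e u"
    using Q.diff_left[of "S e" "mu *\<^sub>R e" u] unfolding u_def[symmetric] by (simp add: Q.scaleR_left)
  ultimately have "Q u u = 0" using orth[of u] by simp
  then have "u = 0" by simp
  then have "S e = mu *\<^sub>R e" by (simp add: u_def)
  then show thesis by (rule that[OF e1(2,1)])
qed

text \<open>Split off one eigenvector and recurse on its orthogonal complement, which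
  \<open>S\<close> preserves by symmetry. With \<open>S = id\<close> the same statement supplies
  orthonormal bases of arbitrary subspaces.\<close>

lemma symmetric_diagonalizable:
  assumes S: "linear S" "\<And>x y. Q (S x) y = Q x (S y)"
  shows "subspace W \<Longrightarrow> S ` W \<subseteq> W \<Longrightarrow>
    \<exists>E. onb E \<and> span E = W \<and> (\<forall>e\<in>E. \<exists>mu. S e = mu *\<^sub>R e)"
proof (induction "dim W" arbitrary: W rule: less_induct)
  case less
  show ?case
  proof (cases "W = {0}")
    case True
    then show ?thesis by (intro exI[of _ "{}"]) (auto simp: onb_def)
  next
    case False
    obtain e mu where e: "e \<in> W" "Q e e = 1" "S e = mu *\<^sub>R e"
      using symmetric_eigenvector[OF S less(2,3) False] by blast
    define W' where "W' = {w \<in> W. Q e w = 0}"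
    have sub: "subspace W'" using less(2)
      by (auto simp: W'_def subspace_def Q.add_right Q.scaleR_right Q.zero_right)
    have inv: "S ` W' \<subseteq> W'"
    proof safe
      fix w assume w: "w \<in> W'"
      have "Q e (S w) = Q (S e) w" by (simp add: S)
      then show "S w \<in> W'" using w less(3) by (auto simp: W'_def e(3) Q.scaleR_left)
    qed
    have "e \<notin> W'" using e(2) by (simp add: W'_def)
    moreover have "W' \<subseteq> W" by (auto simp: W'_def)
    ultimately have "W' \<subset> W" using e(1) by blast
    moreover have "span W = W" "span W' = W'" using less(2) sub by (simp_all add: span_eq_iff[THEN iffD2])
    ultimately have "dim W' < dim W" using dim_psubset[of W' W] by (simp only: simp_thms)
    from less(1)[OF this sub inv] obtain E where
      E: "onb E" "span E = W'" "\<forall>e\<in>E. \<exists>mu. S e = mu *\<^sub>R e" by blast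
    have EW: "E \<subseteq> W'" using E(2) span_superset by blast
    have "onb (insert e E)"
    proof -
      have "Q e f = 0 \<and> Q f e = 0 \<and> e \<noteq> f" if "f \<in> E" for f
        using EW that e(2) Q_sym[of f e] by (auto simp: W'_def)
      then show ?thesis using E(1) e(2) unfolding onb_def by auto
    qed
    moreover have "span (insert e E) = W"
    proof
      show "span (insert e E) \<subseteq> W" using e EW less(2) by (intro span_minimal) (auto simp: W'_def)
      show "W \<subseteq> span (insert e E)"
      proof
        fix w assume w: "w \<in> W"
        have "w - Q e w *\<^sub>R e \<in> W'"
          using w e less(2) by (auto simp: W'_def subspace_diff subspace_scale Q.diff_right Q.scaleR_right)
        then have "w - Q e w *\<^sub>R e \<in> span (insert e E)"
          using E(2) span_mono[of E "insert e E"] by blast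
        moreover have "Q e w *\<^sub>R e \<in> span (insert e E)" by (simp add: span_scale span_base)
        ultimately show "w \<in> span (insert e E)" using span_add by force
      qed
    qed
    ultimately show ?thesis using E(3) e(3) by (intro exI[of _ "insert e E"]) blast
  qed
qed

end

instance endo :: (euclidean_space) heine_borel
proof
  fix f :: "nat \<Rightarrow> 'a endo"
  assume f: "bounded (range f)"
  then obtain b where "\<And>n. norm (f n) \<le> b" by (auto simp: bounded_iff)
  then have "bounded (range (\<lambda>n. Rep_endo (f n)))"
    by (auto simp: bounded_iff norm_endo.rep_eq)
  then obtain l r where lr: "strict_mono r" "((\<lambda>n. Rep_endo (f n)) \<circ> r) \<longlonglongrightarrow> l"
    using bounded_imp_convergent_subsequence by blast
  then have "(f \<circ> r) \<longlonglongrightarrow> Abs_endo l"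
    by (simp add: tendsto_iff dist_endo.rep_eq Abs_endo_inverse)
  with lr show "\<exists>l r. strict_mono r \<and> (f \<circ> r) \<longlonglongrightarrow> l" by blast
qed

context rank_one
begin

section \<open>The Cartan decomposition\<close>

lemma onb_UNIV: obtains E where "onb E" "span E = UNIV"
  using symmetric_diagonalizable[of id UNIV] by (auto simp: linear_id)

lemma eigen_orthogonal:
  assumes "\<And>x y. Q (S x) y = Q x (S y)" "S e = a *\<^sub>R e" "S f = b *\<^sub>R f" "a \<noteq> b"
  shows "Q e f = 0"
  using assms(1)[of e f] assms(4) by (simp add: assms(2,3) Q.scaleR_left Q.scaleR_right)

text \<open>The functional sending \<open>x\<close> to \<open>tr (T * ad x)\<close> is represented
  by some \<open>ad Y\<close> through the Killing form. The difference \<open>F = T - ad Y\<close>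
  is again a derivation, so \<open>ad (app F x)\<close> is the commutator of \<open>F\<close> and
  \<open>ad x\<close>, and the Killing form of \<open>app F x\<close> and \<open>z\<close> becomes
  \<open>tr (F * ad (br x z)) = 0\<close>. Nondegeneracy gives \<open>F = 0\<close>.\<close>

lemma derivation_inner:
  assumes D: "linear D" "\<And>x y. D (br x y) = br (D x) y + br x (D y)"
  obtains Y where "D = br Y"
proof -
  define T where "T = endo_of D"
  have T: "app T = D" by (simp add: T_def D)
  obtain E where E: "onb E" "span E = UNIV" by (rule onb_UNIV)
  define \<phi> where "\<phi> x = tr (T * ad x)" for x
  define Y0 where "Y0 = (\<Sum>e\<in>E. \<phi> e *\<^sub>R e)"
  have Y0: "Q Y0 x = \<phi> x" for x
  proof -
    have "\<phi> x = \<phi> (\<Sum>e\<in>E. Q x e *\<^sub>R e)" using onb_expand[OF E(1), of x] E(2) by simp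
    also have "\<dots> = (\<Sum>e\<in>E. Q x e * \<phi> e)"
    proof -
      have "linear \<phi>"
        by (rule linearI) (simp_all add: \<phi>_def ad_simps distrib_left tr_add tr_scaleR)
      then show ?thesis by (simp add: linear_sum linear_scale)
    qed
    also have "\<dots> = Q Y0 x"
      unfolding Y0_def Q.sum_left by (intro sum.cong refl) (simp add: Q.scaleR_left Q_sym[of x] mult.commute)
    finally show ?thesis by simp
  qed
  \<comment> \<open>\<open>Y0\<close> represents the functional for \<open>Q\<close>; applying
    \<open>th\<close> with a sign passes from \<open>Q\<close> to \<open>B\<close>, and the factor
    undoes the normalization of \<open>B\<close>.\<close>
  define Y where "Y = - (1 / killing br H0 H0) *\<^sub>R th Y0"
  have Y: "tr (ad Y * ad x) = \<phi> x" for x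
  proof -
    have "tr (ad Y * ad x) = killing br H0 H0 * B Y x"
      using killing_H0 by (simp add: B_def p_inner_def killing_tr)
    also have "\<dots> = - B (th Y0) x"
      using killing_H0 by (simp add: Y_def B.scaleR_left B.minus_left)
    also have "\<dots> = Q Y0 x" using B_th[of Y0 "th x"] by (simp add: Q_def)
    finally show ?thesis by (simp add: Y0)
  qed
  define F where "F = T - ad Y"
  have F0: "tr (F * ad x) = 0" for x
    using Y[of x] by (simp add: F_def left_diff_distrib tr_diff \<phi>_def)
  have Fbr: "app F (br x y) = br (app F x) y + br x (app F y)" for x y
    unfolding F_def app.diff_left T app_ad D(2) br_deriv[of Y x y]
    by (simp add: br.diff_left br.diff_right)
  have "app F x = 0" for x
  proof (rule nondeg)
    fix z
    have "ad (app F x) = F * ad x - ad x * F"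
      by (rule endo_eqI) (simp add: app.diff_left Fbr)
    then have "killing br (app F x) z = tr (F * ad x * ad z) - tr (ad x * F * ad z)"
      by (simp add: killing_tr left_diff_distrib tr_diff)
    also have "tr (ad x * F * ad z) = tr (F * ad z * ad x)"
      using tr_mult_commute[of "ad x" "F * ad z"] by (simp add: mult.assoc)
    also have "tr (F * ad x * ad z) - tr (F * ad z * ad x) = tr (F * ad (br x z))"
      by (simp add: ad_br right_diff_distrib tr_diff mult.assoc)
    finally show "killing br (app F x) z = 0" by (simp add: F0)
  qed
  then have "D x = br Y x" for x by (simp add: F_def app.diff_left T)
  then show thesis by (intro that[of Y]) auto
qed

lemma ad_inject: assumes "\<And>z. br Y z = br Y' z" shows "Y = Y'"
proof -
  have "ad (Y - Y') = 0"
    by (rule endo_eqI) (simp add: ad_simps app.diff_left assms app.zero_left)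
  then have "Y - Y' = 0" by (intro nondeg) (simp add: killing_tr tr_def app.zero_left)
  then show ?thesis by simp
qed

text \<open>The logarithm \<open>D\<close> of \<open>s\<close> is defined on eigenvectors. Since
  \<open>s\<close> is an automorphism, eigenvalues multiply under brackets of eigenvectors, and
  \<open>ln\<close> turns products into sums; so \<open>D\<close> is a derivation, hence some
  \<open>br Y\<close>. Symmetry of \<open>D\<close> puts \<open>Y\<close> in
  \<open>p\<close>.\<close>

lemma positive_automorphism_log:
  assumes s: "linear s" "\<And>x y. s (br x y) = br (s x) (s y)"
    and sym: "\<And>x y. Q (s x) y = Q x (s y)" and pos: "\<And>x. x \<noteq> 0 \<Longrightarrow> 0 < Q (s x) x"
  obtains Y where "Y \<in> p" "ex Y = s"
proof -
  obtain E where E: "onb E" "span E = UNIV" "\<forall>e\<in>E. \<exists>mu. s e = mu *\<^sub>R e"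
    using symmetric_diagonalizable[OF s(1) sym, of UNIV] by auto
  then obtain mu where mu: "\<And>e. e \<in> E \<Longrightarrow> s e = mu e *\<^sub>R e" by metis
  have QE: "Q e f = (if e = f then 1 else 0)" if "e \<in> E" "f \<in> E" for e f
    using E(1) that by (simp add: onb_def)
  have mu_pos: "mu e > 0" if "e \<in> E" for e
  proof -
    have "Q e e = 1" using QE that by simp
    then have "e \<noteq> 0" by (auto simp: Q.zero_left)
    from pos[OF this] show ?thesis by (simp add: mu[OF that] Q.scaleR_left \<open>Q e e = 1\<close>)
  qed
  define D where "D v = (\<Sum>e\<in>E. (ln (mu e) * Q v e) *\<^sub>R e)" for v
  have lin: "linear D"
    by (rule linearI)
      (simp_all add: D_def Q.add_left Q.scaleR_left distrib_left scaleR_add_left sum.distrib scaleR_right.sum mult_ac)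
  have expand: "v = (\<Sum>e\<in>E. Q v e *\<^sub>R e)" for v
    using onb_expand[OF E(1), of v] E(2) by simp
  have Deig: "D w = ln m *\<^sub>R w" if w: "s w = m *\<^sub>R w" for w m
  proof -
    have "D w = (\<Sum>e\<in>E. ln m *\<^sub>R (Q w e *\<^sub>R e))"
      unfolding D_def
    proof (intro sum.cong refl)
      fix e assume e: "e \<in> E"
      show "(ln (mu e) * Q w e) *\<^sub>R e = ln m *\<^sub>R (Q w e *\<^sub>R e)"
      proof (cases "mu e = m")
        case False
        then have "Q w e = 0" using eigen_orthogonal[of s w m e "mu e"] sym w mu[OF e] by auto
        then show ?thesis by simp
      qed simp
    qed
    also have "\<dots> = ln m *\<^sub>R (\<Sum>e\<in>E. Q w e *\<^sub>R e)" by (rule scaleR_right.sum[symmetric])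
    finally show ?thesis by (simp flip: expand)
  qed
  have DE: "D e = ln (mu e) *\<^sub>R e" if "e \<in> E" for e by (rule Deig) (rule mu[OF that])
  have Dbr0: "D (br e f) = br (D e) f + br e (D f)" if e: "e \<in> E" and f: "f \<in> E" for e f
  proof -
    have "s (br e f) = (mu e * mu f) *\<^sub>R br e f"
      by (simp add: s(2) mu e f br.scaleR_left br.scaleR_right mult.commute)
    then have "D (br e f) = ln (mu e * mu f) *\<^sub>R br e f" by (rule Deig)
    also have "ln (mu e * mu f) = ln (mu e) + ln (mu f)"
      using mu_pos[OF e] mu_pos[OF f] by (simp add: ln_mult)
    finally show ?thesis
      by (simp add: DE e f br.scaleR_left br.scaleR_right scaleR_add_left)
  qed
  have Dbr: "D (br x y) = br (D x) y + br x (D y)" for x y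
  proof -
    have 1: "D (br x f) = br (D x) f + br x (D f)" if "f \<in> E" for x f
    proof -
      have "x \<in> span E" using E(2) by simp
      then show ?thesis
      proof (induction rule: span_induct_alt)
        case base then show ?case by (simp add: br.zero_left linear_0[OF lin])
      next
        case (step c e z)
        then show ?case using Dbr0[OF step(1) that]
          by (simp add: br.add_left br.scaleR_left linear_add[OF lin] linear_scale[OF lin] algebra_simps)
      qed
    qed
    have "y \<in> span E" using E(2) by simp
    then show ?thesis
    proof (induction rule: span_induct_alt)
      case base then show ?case by (simp add: br.zero_right linear_0[OF lin])
    next
      case (step c e z)
      then show ?case using 1[OF step(1), of x]
        by (simp add: br.add_right br.scaleR_right linear_add[OF lin] linear_scale[OF lin] algebra_simps)
    qed
  qed
  obtain Y where Y: "D = br Y" using derivation_inner[OF lin Dbr] by blast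
  have "Q (D x) y = Q x (D y)" for x y
    by (simp add: D_def Q.sum_left Q.sum_right Q.scaleR_left Q.scaleR_right Q_sym[of _ y] mult_ac)
  then have q0: "Q x (br (Y + th Y) y) = 0" for x y
    using Q_br[of Y x y] by (simp add: Y br.add_left Q.add_right)
  have "br (Y + th Y) y = br 0 y" for y
    using q0[of "br (Y + th Y) y" y] unfolding Q_eq_0 by (simp add: br.zero_left)
  then have "Y + th Y = 0" by (rule ad_inject)
  then have Yp: "Y \<in> p" by (simp add: p_iff eq_neg_iff_add_eq_0 add.commute)
  have "ex Y v = s v" for v
  proof -
    have exE: "ex Y e = s e" if "e \<in> E" for e
    proof -
      have "app (ad Y) e = ln (mu e) *\<^sub>R e" using DE[OF that] by (simp add: Y)
      then have "ex Y e = exp (ln (mu e)) *\<^sub>R e" unfolding ex_app by (rule app_exp_eigen)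
      then show ?thesis using mu_pos that by (simp add: mu)
    qed
    have "v \<in> span E" using E(2) by simp
    then show ?thesis
      by (rule linear_eq_on_span[OF G_linear[OF G_ex] s(1) exE, rotated])
  qed
  then have "ex Y = s" by (rule ext)
  with Yp show thesis by (rule that)
qed

lemma ad_p_symmetric: "Y \<in> p \<Longrightarrow> Q (br Y x) y = Q x (br Y y)"
  using Q_br[of Y x y] by (simp add: p_iff br.minus_left Q.minus_right)

lemma ex_p_symmetric: "Y \<in> p \<Longrightarrow> Q (ex Y x) y = Q x (ex Y y)"
  by (simp add: G_Q inv_ex th_ex p_iff)

text \<open>Both operators are diagonalizable with real eigenvalues. An eigenvector of
  \<open>br Y\<close> for \<open>a\<close> has a component along an eigenvector of
  \<open>br Y'\<close> for \<open>b\<close> only if \<open>exp a = exp b\<close>, that is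
  \<open>a = b\<close>.\<close>

lemma ex_inject:
  assumes "Y \<in> p" "Y' \<in> p" "ex Y = ex Y'"
  shows "Y = Y'"
proof (rule ad_inject)
  fix z
  obtain E where E: "onb E" "span E = UNIV" "\<forall>e\<in>E. \<exists>mu. br Y e = mu *\<^sub>R e"
    using symmetric_diagonalizable[of "br Y" UNIV] ad_p_symmetric[OF assms(1)] by auto
  obtain E' where E': "onb E'" "span E' = UNIV" "\<forall>e\<in>E'. \<exists>mu. br Y' e = mu *\<^sub>R e"
    using symmetric_diagonalizable[of "br Y'" UNIV] ad_p_symmetric[OF assms(2)] by auto
  have eqE: "br Y e = br Y' e" if e: "e \<in> E" for e
  proof -
    obtain a where a: "br Y e = a *\<^sub>R e" using E(3) e by blast
    have "ex Y e = exp a *\<^sub>R e"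
      using app_exp_eigen[of "ad Y" e a] a by (simp add: ex_app)
    then have exa: "ex Y' e = exp a *\<^sub>R e" by (simp only: assms(3))
    have ee: "e = (\<Sum>f\<in>E'. Q e f *\<^sub>R f)" using onb_expand[OF E'(1), of e] E'(2) by simp
    have "br Y' e = br Y' (\<Sum>f\<in>E'. Q e f *\<^sub>R f)" by (rule arg_cong[OF ee])
    also have "\<dots> = (\<Sum>f\<in>E'. Q e f *\<^sub>R br Y' f)" by (simp add: br.sum_right br.scaleR_right)
    also have "\<dots> = (\<Sum>f\<in>E'. a *\<^sub>R (Q e f *\<^sub>R f))"
    proof (intro sum.cong refl)
      fix f assume "f \<in> E'"
      then obtain b where b: "br Y' f = b *\<^sub>R f" using E'(3) by blast
      have exb: "ex Y' f = exp b *\<^sub>R f"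
        using app_exp_eigen[of "ad Y'" f b] b by (simp add: ex_app)
      show "Q e f *\<^sub>R br Y' f = a *\<^sub>R (Q e f *\<^sub>R f)"
      proof (cases "a = b")
        case False
        then have "Q e f = 0"
          using eigen_orthogonal[of "ex Y'" e "exp a" f "exp b"] exa exb ex_p_symmetric[OF assms(2)] by auto
        then show ?thesis by simp
      qed (simp add: b)
    qed
    also have "\<dots> = a *\<^sub>R (\<Sum>f\<in>E'. Q e f *\<^sub>R f)" by (rule scaleR_right.sum[symmetric])
    also have "\<dots> = a *\<^sub>R e" by (simp flip: ee)
    finally show ?thesis using a by simp
  qed
  have "z \<in> span E" using E(2) by simp
  then show "br Y z = br Y' z" by (rule linear_eq_on_span[OF linear_br linear_br eqE, rotated])
qed

text \<open>The Cartan embedding: \<open>g\<close> times the inverse of its image under the global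
  Cartan involution. It depends only on the coset of \<open>g\<close> and takes the value
  \<open>ex (2 *\<^sub>R Y)\<close> at the coset of \<open>ex Y\<close> for \<open>Y\<close> in
  \<open>p\<close>.\<close>

definition sy :: "('g \<Rightarrow> 'g) \<Rightarrow> 'g \<Rightarrow> 'g" where
  "sy g = g \<circ> th \<circ> inv g \<circ> th"

lemma inv_comp_G: "g \<in> G \<Longrightarrow> h \<in> G \<Longrightarrow> inv (g \<circ> h) = inv h \<circ> inv g"
  by (simp add: o_inv_distrib G_bij)

lemma sy_K: "g \<in> G \<Longrightarrow> k \<in> K \<Longrightarrow> sy (g \<circ> k) = sy g"
  by (rule ext) (simp add: sy_def inv_comp_G K_G K_th[OF K_inv, symmetric] G_inv_simps flip: K_th)

lemma sy_ex: assumes "Y \<in> p" shows "sy (ex Y) = ex (2 *\<^sub>R Y)"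
proof -
  have "ex (2 *\<^sub>R Y) = ex ((1 + 1) *\<^sub>R Y)" by simp
  also have "\<dots> = ex Y \<circ> ex Y" unfolding ex_add by simp
  finally show ?thesis
    using assms by (auto simp: sy_def fun_eq_iff inv_ex th_ex p_iff)
qed

text \<open>\<open>sy g\<close> is \<open>g\<close> times its \<open>Q\<close>-adjoint, hence a
  positive automorphism with a logarithm \<open>Z\<close> in \<open>p\<close>. With \<open>Y\<close>
  half of \<open>Z\<close>, the element \<open>k = ex (- Y) \<circ> g\<close> commutes with
  \<open>th\<close>.\<close>

theorem cartan_decomposition:
  assumes g: "g \<in> G"
  obtains Y k where "Y \<in> p" "k \<in> K" "g = ex Y \<circ> k"
proof -
  have gi: "inv g \<in> G" using g by (rule G_inv)
  define gt where "gt x = th (inv g (th x))" for x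
  have sy_eq: "sy g x = g (gt x)" for x by (simp add: sy_def gt_def)
  have Qgt: "Q (g x) y = Q x (gt y)" for x y using G_Q[OF g] by (simp add: gt_def)
  have gt_nz: "gt x \<noteq> 0" if "x \<noteq> 0" for x
  proof
    assume "gt x = 0"
    then have "th (gt x) = 0" by simp
    then have "g (inv g (th x)) = 0" by (simp add: gt_def linear_0[OF G_linear[OF g]])
    then have "th (th x) = 0" using g by (simp add: G_inv_simps)
    then show False using that by simp
  qed
  have sy_G: "sy g = g \<circ> (th \<circ> inv g \<circ> th)" by (auto simp: sy_def)
  have "sy g \<in> G" unfolding sy_G by (intro G_comp G_conj_th gi g)
  then obtain Z where Z: "Z \<in> p" "ex Z = sy g"
  proof (rule_tac positive_automorphism_log[of "sy g"])
    show "Q (sy g x) y = Q x (sy g y)" for x y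
      unfolding sy_eq by (metis Q_sym Qgt)
    show "0 < Q (sy g x) x" if "x \<noteq> 0" for x
      unfolding sy_eq Qgt using gt_nz[OF that] by (rule Q_pos)
  qed (auto simp: G_linear G_br)
  define Y where "Y = (1/2) *\<^sub>R Z"
  have Y: "Y \<in> p" using Z(1) by (simp add: Y_def p_iff)
  have thY: "th Y = - Y" using Y by (simp add: p_iff)
  have "ex Y \<circ> ex Y = sy g" using sy_ex[OF Y] Z(2) sy_ex[OF Y]
    using ex_add[of 1 1 Y] by (simp add: Y_def)
  then have YY: "ex Y (ex Y x) = g (th (inv g (th x)))" for x by (auto simp: sy_def fun_eq_iff)
  define k where "k = ex (- Y) \<circ> g"
  have kG: "k \<in> G" unfolding k_def by (intro G_comp g G_ex)
  have "k \<in> K"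
  proof (rule K_I[OF kG])
    fix x
    have "ex Y (ex Y (th (g x))) = g (th x)" unfolding YY using g by (simp add: G_inv_simps)
    then have "ex (- Y) (g (th x)) = ex Y (th (g x))" by (metis ex_minus(1))
    also have "\<dots> = th (ex (- Y) (g x))" by (simp add: th_ex thY)
    finally show "k (th x) = th (k x)" by (simp add: k_def)
  qed
  moreover have "g = ex Y \<circ> k" by (auto simp: k_def fun_eq_iff)
  ultimately show thesis using Y that by blast
qed

text \<open>The exponential map at the origin, bijective from \<open>p\<close> by \<open>X_E\<close>
  and \<open>E_inject\<close>. It is defined on all of the Lie algebra, so that points may be moved
  off \<open>p\<close>, as the rounding in \<open>measurable_Caratheodory\<close> does.\<close>

definition E :: "'g \<Rightarrow> ('g \<Rightarrow> 'g) set" where "E Y = cs (ex Y)"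

lemma E_X [simp]: "E Y \<in> X" by (simp add: E_def)

lemma X_E: assumes "x \<in> X" obtains Y where "Y \<in> p" "x = E Y"
proof -
  obtain g where g: "g \<in> G" "x = cs g" using assms by (auto simp: X_iff)
  obtain Y k where "Y \<in> p" "k \<in> K" "g = ex Y \<circ> k" using cartan_decomposition[OF g(1)] by blast
  then show thesis using that[of Y] g(2) by (simp add: E_def cs_eqI)
qed

lemma E_inject: assumes "Y \<in> p" "Y' \<in> p" "E Y = E Y'" shows "Y = Y'"
proof -
  obtain k where k: "k \<in> K" "ex Y = ex Y' \<circ> k" using cs_eqD[of "ex Y" "ex Y'"] assms(3) E_def by auto
  have "ex (2 *\<^sub>R Y) = ex (2 *\<^sub>R Y')"
    using sy_ex[OF assms(1)] sy_ex[OF assms(2)] sy_K[OF G_ex k(1), of Y'] by (simp add: k(2))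
  then have "2 *\<^sub>R Y = 2 *\<^sub>R Y'"
    using assms(1,2) by (intro ex_inject) (simp_all add: p_iff)
  then show ?thesis by simp
qed

definition org where "org = origin br th"

lemma org_cs: "org = cs id" by (simp add: org_def origin_def)

lemma org_X [simp]: "org \<in> X" by (simp add: org_cs)

lemma translate_K_E: assumes "k \<in> K" shows "translate k (E Y) = E (k Y)"
proof -
  have "k \<circ> ex Y = ex (k Y) \<circ> k" using assms by (intro G_conj_ex K_G)
  then show ?thesis by (simp add: E_def cs_eqI assms)
qed

lemma translate_K_org: "k \<in> K \<Longrightarrow> translate k org = org"
  using cs_eqI[of k id] by (simp add: org_cs)

section \<open>Transitivity on spheres\<close>

text \<open>Taking the closure avoids proving that \<open>K\<close> is closed; by continuity, \<open>K\<close>-invariant functions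
  are invariant under the closure as well.\<close>
definition Kbar :: "'g endo set" where "Kbar = closure (endo_of ` K)"

lemma endo_of_G: "g \<in> G \<Longrightarrow> app (endo_of g) = g" by (simp add: G_linear)

lemma compact_Kbar: "compact Kbar"
proof -
  obtain m where m: "0 < m" "\<And>v. m * (norm v)\<^sup>2 \<le> Q v v" using Q_ge by blast
  obtain M where M: "0 < M" "\<And>v. Q v v \<le> M * (norm v)\<^sup>2" using Q_le by blast
  have "norm T \<le> sqrt (M / m)" if TK: "T \<in> endo_of ` K" for T
  proof (rule norm_endo_bound)
    fix x
    obtain k where k: "k \<in> K" "T = endo_of k" using TK by auto
    have "m * (norm (k x))\<^sup>2 \<le> M * (norm x)\<^sup>2"
      using m(2)[of "k x"] M(2)[of x] K_Q[OF k(1), of x x] by linarith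
    then have "(norm (k x))\<^sup>2 \<le> M / m * (norm x)\<^sup>2" using m(1) by (simp add: field_simps)
    then have "norm (k x) \<le> sqrt (M / m * (norm x)\<^sup>2)" by (rule real_le_rsqrt)
    also have "\<dots> = sqrt (M / m) * norm x"
      by (simp only: real_sqrt_mult real_sqrt_abs abs_norm_cancel)
    finally show "norm (app T x) \<le> sqrt (M / m) * norm x"
      using k by (simp add: endo_of_G K_G)
  qed (use m M in auto)
  then have "bounded (endo_of ` K)" by (auto intro: boundedI)
  then show ?thesis unfolding Kbar_def by simp
qed

lemma Kbar_induct:
  assumes "T \<in> Kbar" "closed {T. P T}" "\<And>k. k \<in> K \<Longrightarrow> P (endo_of k)"
  shows "P T"
proof -
  have "Kbar \<subseteq> {T. P T}" unfolding Kbar_def using assms(2,3) by (intro closure_minimal) auto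
  then show ?thesis using assms(1) by auto
qed

lemma continuous_app_arg: "continuous_on S (\<lambda>T. app T x)"
  by (rule bounded_linear.continuous_on[OF app.bounded_linear_left continuous_on_id])

lemma continuous_th: "continuous_on S f \<Longrightarrow> continuous_on S (\<lambda>x. th (f x))"
  using linear_th by (rule bounded_linear.continuous_on[OF linear_conv_bounded_linear[THEN iffD1]])

lemma Kbar_p: assumes "T \<in> Kbar" "Y \<in> p" shows "app T Y \<in> p"
  unfolding p_iff using assms(1)
proof (rule Kbar_induct)
  show "closed {T. th (app T Y) = - app T Y}"
    by (intro closed_Collect_eq continuous_th continuous_on_minus continuous_app_arg)
  show "th (app (endo_of k) Y) = - app (endo_of k) Y" if "k \<in> K" for k
    using K_p[OF that assms(2)] by (simp add: p_iff endo_of_G K_G that)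
qed

lemma Kbar_Q: assumes "T \<in> Kbar" shows "Q (app T x) (app T x) = Q x x"
  using assms
proof (rule Kbar_induct)
  show "closed {T. Q (app T x) (app T x) = Q x x}"
    by (intro closed_Collect_eq Q.continuous_on continuous_on_const continuous_app_arg)
qed (simp add: endo_of_G K_G K_Q)

lemma Kbar_mult: assumes "k \<in> K" "T \<in> Kbar" shows "endo_of k * T \<in> Kbar"
proof -
  have "(\<lambda>T. endo_of k * T) ` Kbar \<subseteq> Kbar"
    unfolding Kbar_def
  proof (rule image_closure_subset)
    show "(\<lambda>T. endo_of k * T) ` endo_of ` K \<subseteq> closure (endo_of ` K)"
    proof safe
      fix l assume l: "l \<in> K"
      have "endo_of k * endo_of l = endo_of (k \<circ> l)"
        using assms(1) l K_comp[OF assms(1) l] by (intro endo_eqI) (simp add: endo_of_G K_G)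
      then show "endo_of k * endo_of l \<in> closure (endo_of ` K)"
        using K_comp[OF assms(1) l] closure_subset[of "endo_of ` K"] by auto
    qed
  qed (auto intro!: continuous_intros)
  then show ?thesis using assms(2) by blast
qed

lemma Kbar_1: "1 \<in> Kbar"
proof -
  have "endo_of id = 1" by (rule endo_eqI) (simp add: linear_id)
  then have "1 \<in> endo_of ` K" by (intro image_eqI[OF _ K_id]) simp
  then show ?thesis unfolding Kbar_def by (rule subsetD[OF closure_subset])
qed

lemma has_derivative_ex:
  "((\<lambda>s. ex (s *\<^sub>R Z) v) has_vector_derivative ex (s *\<^sub>R Z) (br Z v)) (at s within S)"
  using has_vector_derivative_exp_app[of "ad Z" v s S] by (simp add: ex_app ad_simps)

text \<open>At a maximum of \<open>Q (app T Y) H0\<close> over the compact set \<open>Kbar\<close>,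
  the derivative along \<open>ex (s *\<^sub>R Z)\<close> with \<open>Z = br u H0\<close> vanishes,
  which says \<open>Q Z Z = 0\<close>. So \<open>u\<close> commutes with \<open>H0\<close> and is a
  multiple of it.\<close>

theorem Kbar_transitive:
  assumes Y: "Y \<in> p"
  obtains T where "T \<in> Kbar" "app T Y = sqrt (Q Y Y) *\<^sub>R H0"
proof -
  define f where "f T = Q (app T Y) H0" for T
  have "continuous_on Kbar f"
    unfolding f_def by (intro Q.continuous_on continuous_on_const continuous_app_arg)
  then obtain T0 where T0: "T0 \<in> Kbar" and max: "\<And>T. T \<in> Kbar \<Longrightarrow> f T \<le> f T0"
    using continuous_attains_sup[OF compact_Kbar, of f] Kbar_1 by blast
  define u where "u = app T0 Y"
  have up: "u \<in> p" unfolding u_def using T0 Y by (rule Kbar_p)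
  define Z where "Z = br u H0"
  have Zk: "th Z = Z" using up by (simp add: Z_def th_br p_iff br.minus_left br.minus_right)
  have "((\<lambda>s. Q (ex (s *\<^sub>R Z) u) H0) has_vector_derivative Q (ex (0 *\<^sub>R Z) (br Z u)) H0) (at 0)"
    by (rule bounded_linear.has_vector_derivative[OF Q.bounded_linear_left has_derivative_ex])
  then have "((\<lambda>s. Q (ex (s *\<^sub>R Z) u) H0) has_real_derivative Q (br Z u) H0) (at 0)"
    by (simp add: has_real_derivative_iff_has_vector_derivative)
  moreover have "\<forall>s. \<bar>0 - s\<bar> < 1 \<longrightarrow> Q (ex (s *\<^sub>R Z) u) H0 \<le> Q (ex (0 *\<^sub>R Z) u) H0"
  proof (intro allI impI)
    fix s
    have "ex (s *\<^sub>R Z) \<in> K" by (rule K_ex) (simp add: Zk)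
    then have "f (endo_of (ex (s *\<^sub>R Z)) * T0) \<le> f T0" by (intro max Kbar_mult T0)
    then show "Q (ex (s *\<^sub>R Z) u) H0 \<le> Q (ex (0 *\<^sub>R Z) u) H0"
      by (simp add: f_def u_def endo_of_G)
  qed
  ultimately have "Q (br Z u) H0 = 0" by (intro DERIV_local_max[of _ _ 0 1]) auto
  then have "Q (br u Z) H0 = 0" using br_anti[of u Z] by (simp add: Q.minus_left)
  then have "Q Z Z = 0" using ad_p_symmetric[OF up, of Z H0] by (simp add: Z_def)
  then have "br H0 u = 0" using br_anti[of H0 u] by (simp add: Z_def)
  then obtain c where c: "u = c *\<^sub>R H0" using centralizer_H0[of u] up by (auto simp: p_iff)
  have cc: "c * c = Q Y Y"
    using Kbar_Q[OF T0, of Y] unfolding u_def[symmetric] c by (simp add: Q.scaleR_left Q.scaleR_right Q_H0)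
  have fT0: "f T0 = c" unfolding f_def u_def[symmetric] c by (simp add: Q.scaleR_left Q_H0)
  \<comment> \<open>A negative maximum \<open>c\<close> would, since \<open>c * c = Q Y Y\<close>,
    force \<open>app T Y = c *\<^sub>R H0\<close> for all \<open>T\<close> in \<open>Kbar\<close>;
    but \<open>ex (s *\<^sub>R Xk)\<close> lies in \<open>K\<close> and moves
    \<open>H0\<close>.\<close>
  have "c \<ge> 0"
  proof (rule ccontr)
    assume "\<not> c \<ge> 0"
    then have neg: "c < 0" by simp
    have all: "app T Y = c *\<^sub>R H0" if T: "T \<in> Kbar" for T
    proof -
      have "f T \<le> c" using max[OF T] fT0 by simp
      then have "c * c \<le> c * f T" using neg by simp
      moreover have "Q (app T Y - c *\<^sub>R H0) (app T Y - c *\<^sub>R H0) = c * c - 2 * (c * f T) + c * c"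
        using Q_sym[of H0 "app T Y"]
        by (simp add: Q.diff_left Q.diff_right Q.scaleR_left Q.scaleR_right Kbar_Q[OF T] cc
            f_def Q_H0 right_diff_distrib)
      ultimately have "Q (app T Y - c *\<^sub>R H0) (app T Y - c *\<^sub>R H0) \<le> 0" by linarith
      then have "Q (app T Y - c *\<^sub>R H0) (app T Y - c *\<^sub>R H0) = 0" using Q_nonneg by (intro antisym)
      then show ?thesis by simp
    qed
    have Yc: "Y = c *\<^sub>R H0" using all[OF Kbar_1] by simp
    obtain Xp Xk where X: "th Xp = - Xp" "th Xk = Xk" "br H0 Xp = Xk" "br H0 Xk = Xp" "Xp \<noteq> 0"
      by (rule root_vector)
    have const: "ex (s *\<^sub>R Xk) Y = Y" for s
    proof -
      have k: "ex (s *\<^sub>R Xk) \<in> K" by (rule K_ex) (simp add: X)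
      have "endo_of (ex (s *\<^sub>R Xk)) * 1 \<in> Kbar" using k Kbar_1 by (rule Kbar_mult)
      then show ?thesis using all[of "endo_of (ex (s *\<^sub>R Xk))"] Yc by (simp add: endo_of_G)
    qed
    have "((\<lambda>s. ex (s *\<^sub>R Xk) Y) has_vector_derivative ex (0 *\<^sub>R Xk) (br Xk Y)) (at 0)"
      by (rule has_derivative_ex)
    then have "((\<lambda>s::real. Y) has_vector_derivative br Xk Y) (at 0)" by (simp add: const)
    then have "br Xk Y = 0"
      by (rule vector_derivative_unique_at) (rule has_vector_derivative_const)
    then have "c *\<^sub>R br Xk H0 = 0" by (simp add: Yc br.scaleR_right)
    then show False using neg X br_anti[of Xk H0] by simp
  qed
  then have "c = sqrt (Q Y Y)" using cc by (simp flip: cc)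
  then show thesis using that[OF T0] c by (simp add: u_def)
qed

lemma K_invariant_radial:
  fixes u :: "('g \<Rightarrow> 'g) set \<Rightarrow> real"
  assumes inv: "\<And>k x. k \<in> K \<Longrightarrow> x \<in> X \<Longrightarrow> u (translate k x) = u x"
    and cont: "continuous_on UNIV (\<lambda>Y. u (E Y))" and Y: "Y \<in> p"
  shows "u (E Y) = u (E (sqrt (Q Y Y) *\<^sub>R H0))"
proof -
  obtain T where T: "T \<in> Kbar" "app T Y = sqrt (Q Y Y) *\<^sub>R H0" by (rule Kbar_transitive[OF Y])
  have "u (E (app T Y)) = u (E Y)"
    using T(1)
  proof (rule Kbar_induct)
    show "closed {T. u (E (app T Y)) = u (E Y)}"
      by (intro closed_Collect_eq continuous_on_const continuous_on_compose2[OF cont continuous_app_arg]) auto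
    show "u (E (app (endo_of k) Y)) = u (E Y)" if "k \<in> K" for k
      using inv[OF that E_X] by (simp add: endo_of_G K_G that flip: translate_K_E)
  qed
  then show ?thesis by (simp add: T(2))
qed

end

section \<open>The Trotter formula\<close>

lemma norm_exp_minus_1_le:
  fixes x :: "'a::{real_normed_algebra_1,banach}"
  shows "norm (exp x - 1) \<le> exp (norm x) - 1"
proof -
  have "(\<lambda>n. x ^ Suc n /\<^sub>R fact (Suc n)) sums (exp x - x ^ 0 /\<^sub>R fact 0)"
    using exp_converges[of x] by (subst sums_Suc_iff) simp
  then have s: "(\<lambda>n. x ^ Suc n /\<^sub>R fact (Suc n)) sums (exp x - 1)" by simp
  have "(\<lambda>n. norm x ^ Suc n /\<^sub>R fact (Suc n)) sums (exp (norm x) - norm x ^ 0 /\<^sub>R fact 0)"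
    using exp_converges[of "norm x"] by (subst sums_Suc_iff) simp
  then have t: "(\<lambda>n. norm x ^ Suc n /\<^sub>R fact (Suc n)) sums (exp (norm x) - 1)" by simp
  have le: "norm (x ^ Suc n /\<^sub>R fact (Suc n)) \<le> norm x ^ Suc n /\<^sub>R fact (Suc n)" for n
    using norm_power_ineq[of x "Suc n"]
    by (simp add: divide_inverse mult_left_mono del: power_Suc fact_Suc)
  have "norm (suminf (\<lambda>n. x ^ Suc n /\<^sub>R fact (Suc n))) \<le> suminf (\<lambda>n. norm x ^ Suc n /\<^sub>R fact (Suc n))"
    by (rule norm_suminf_le[OF le sums_summable[OF t]])
  then show ?thesis
    using sums_unique[OF s] sums_unique[OF t] by simp
qed

text \<open>Bounds of the form \<open>exp a - 1\<close> are chosen because they compose: exponents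
  add under products, so the distance from 1 of a long product is controlled by a sum.\<close>

lemma norm_mult_minus_1_le:
  fixes x y :: "'a::{real_normed_algebra_1,banach}"
  assumes "norm (x - 1) \<le> exp a - 1" "norm (y - 1) \<le> exp b - 1"
  shows "norm (x * y - 1) \<le> exp (a + b) - 1"
proof -
  have e: "x * y - 1 = (x - 1) * (y - 1) + (x - 1) + (y - 1)" by (simp add: algebra_simps)
  have "norm (x * y - 1) \<le> norm ((x - 1) * (y - 1)) + norm (x - 1) + norm (y - 1)"
    using norm_triangle_ineq[of "(x - 1) * (y - 1) + (x - 1)" "y - 1"]
      norm_triangle_ineq[of "(x - 1) * (y - 1)" "x - 1"] unfolding e by linarith
  also have "\<dots> \<le> (exp a - 1) * (exp b - 1) + (exp a - 1) + (exp b - 1)"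
  proof (intro add_mono assms order_trans[OF norm_mult_ineq])
    have "0 \<le> exp a - 1" using assms(1) norm_ge_zero[of "x - 1"] by linarith
    then show "norm (x - 1) * norm (y - 1) \<le> (exp a - 1) * (exp b - 1)"
      by (intro mult_mono assms) auto
  qed
  also have "\<dots> = exp (a + b) - 1" by (simp add: exp_add algebra_simps)
  finally show ?thesis .
qed

lemma norm_power_diff_le:
  fixes x y :: "'a::real_normed_algebra_1"
  assumes "norm x \<le> r" "norm y \<le> r" "1 \<le> r"
  shows "norm (x ^ n - y ^ n) \<le> n * norm (x - y) * r ^ n"
proof (induction n)
  case (Suc n)
  have "x ^ Suc n - y ^ Suc n = x * (x ^ n - y ^ n) + (x - y) * y ^ n" by (simp add: algebra_simps)
  then have "norm (x ^ Suc n - y ^ Suc n) \<le> norm (x * (x ^ n - y ^ n)) + norm ((x - y) * y ^ n)"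
    by (simp only: norm_triangle_ineq)
  also have "\<dots> \<le> r * (n * norm (x - y) * r ^ n) + norm (x - y) * r ^ n"
  proof (intro add_mono order_trans[OF norm_mult_ineq])
    show "norm x * norm (x ^ n - y ^ n) \<le> r * (n * norm (x - y) * r ^ n)"
      by (rule mult_mono[OF assms(1) Suc]) (use assms in auto)
    have "norm (y ^ n) \<le> r ^ n"
      using norm_power_ineq[of y n] power_mono[OF assms(2) norm_ge_zero, of n] by linarith
    then show "norm (x - y) * norm (y ^ n) \<le> norm (x - y) * r ^ n"
      by (rule mult_left_mono) simp
  qed
  also have "\<dots> \<le> r * (n * norm (x - y) * r ^ n) + norm (x - y) * (r * r ^ n)"
  proof (intro add_left_mono mult_left_mono)
    show "r ^ n \<le> r * r ^ n" using mult_right_mono[OF assms(3), of "r ^ n"] assms(3) by simp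
  qed simp
  also have "\<dots> = real (Suc n) * norm (x - y) * r ^ Suc n" by (simp add: algebra_simps)
  finally show ?case .
qed simp

lemma exp_nat_scaleR:
  "exp (real n *\<^sub>R (z::'a::{real_normed_algebra_1,banach})) = exp z ^ n"
proof (induction n)
  case (Suc n)
  have "exp (real (Suc n) *\<^sub>R z) = exp ((1 + real n) *\<^sub>R z)" by simp
  also have "\<dots> = exp z * exp z ^ n" unfolding exp_scaleR_add Suc by simp
  finally show ?case by simp
qed simp

text \<open>The product of the two short exponentials and the short exponential of the sum differ by
  \<open>o(1/n)\<close>, because \<open>f\<close> has derivative 0 at 0; taking the
  \<open>n\<close>-th power multiplies the error by \<open>n\<close> and a bounded factor.\<close>

lemma trotter:
  fixes x y :: "'a::{real_normed_algebra_1,banach}"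
  shows "(\<lambda>n. (exp ((1 / real (Suc n)) *\<^sub>R x) * exp ((1 / real (Suc n)) *\<^sub>R y)) ^ Suc n) \<longlonglongrightarrow> exp (x + y)"
proof -
  define a where "a n = 1 / real (Suc n)" for n
  define f where "f t = exp (t *\<^sub>R x) * exp (t *\<^sub>R y) - exp (t *\<^sub>R (x + y))" for t
  have "(f has_vector_derivative (exp (0 *\<^sub>R x) * (exp (0 *\<^sub>R y) * y) + exp (0 *\<^sub>R x) * x * exp (0 *\<^sub>R y))
      - exp (0 *\<^sub>R (x + y)) * (x + y)) (at 0)"
    unfolding f_def
    by (intro has_vector_derivative_diff has_vector_derivative_mult exp_scaleR_has_vector_derivative_right)
  then have "(f has_vector_derivative 0) (at 0)" by (simp add: add.commute)
  then have lim: "((\<lambda>h. norm (f h) / norm h) \<longlongrightarrow> 0) (at 0)"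
    by (simp add: has_vector_derivative_def has_derivative_at f_def)
  have "filterlim a (at 0) sequentially"
    unfolding filterlim_at a_def using LIMSEQ_inverse_real_of_nat
    by (auto simp: inverse_eq_divide eventually_sequentially)
  from filterlim_compose[OF lim this] have na: "(\<lambda>n. norm (f (a n)) / norm (a n)) \<longlonglongrightarrow> 0" .
  define R where "R = exp (norm x + norm y)"
  have bound: "norm ((exp (a n *\<^sub>R x) * exp (a n *\<^sub>R y)) ^ Suc n - exp (x + y)) \<le> norm (f (a n)) / norm (a n) * R" for n
  proof -
    have an: "a n > 0" by (simp add: a_def)
    define r where "r = exp (a n * (norm x + norm y))"
    have "norm (exp (a n *\<^sub>R x) * exp (a n *\<^sub>R y)) \<le> exp (norm (a n *\<^sub>R x)) * exp (norm (a n *\<^sub>R y))"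
      by (intro order_trans[OF norm_mult_ineq] mult_mono norm_exp) auto
    also have "\<dots> = r" using an by (simp add: r_def exp_add distrib_left)
    finally have 1: "norm (exp (a n *\<^sub>R x) * exp (a n *\<^sub>R y)) \<le> r" .
    have "norm (exp (a n *\<^sub>R (x + y))) \<le> exp (norm (a n *\<^sub>R (x + y)))" by (rule norm_exp)
    also have "\<dots> \<le> r" using an norm_triangle_ineq[of x y] by (simp add: r_def)
    finally have 2: "norm (exp (a n *\<^sub>R (x + y))) \<le> r" .
    have 3: "1 \<le> r" using an by (simp add: r_def)
    have "exp (a n *\<^sub>R (x + y)) ^ Suc n = exp (real (Suc n) *\<^sub>R (a n *\<^sub>R (x + y)))"
      by (rule exp_nat_scaleR[symmetric])
    also have "real (Suc n) *\<^sub>R (a n *\<^sub>R (x + y)) = x + y" by (simp add: a_def del: of_nat_Suc)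
    finally have 4: "exp (a n *\<^sub>R (x + y)) ^ Suc n = exp (x + y)" .
    have 5: "r ^ Suc n = R"
      unfolding r_def R_def exp_of_nat_mult[symmetric] by (simp add: a_def del: of_nat_Suc)
    have "norm ((exp (a n *\<^sub>R x) * exp (a n *\<^sub>R y)) ^ Suc n - exp (a n *\<^sub>R (x + y)) ^ Suc n)
        \<le> real (Suc n) * norm (f (a n)) * r ^ Suc n"
      unfolding f_def by (rule norm_power_diff_le[OF 1 2 3])
    then show ?thesis unfolding 4 5 by (simp add: a_def mult.commute)
  qed
  have "(\<lambda>n. norm (f (a n)) / norm (a n) * R) \<longlonglongrightarrow> 0"
    using tendsto_mult_left_zero[OF na] .
  then have "(\<lambda>n. (exp (a n *\<^sub>R x) * exp (a n *\<^sub>R y)) ^ Suc n - exp (x + y)) \<longlonglongrightarrow> 0"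
    by (rule Lim_null_comparison[OF always_eventually[OF allI[OF bound]]])
  then show ?thesis by (simp only: a_def LIM_zero_iff)
qed

context rank_one
begin

section \<open>Differential calculus along left-invariant fields\<close>

abbreviation "D \<equiv> left_inv_deriv br"

text \<open>Regularity along left-invariant fields, with continuity for the pointwise topology on
  \<open>G\<close>. The group is not given charts, so linearity of \<open>D Y F\<close> in
  \<open>Y\<close> is a theorem, \<open>D_scaleR\<close> and \<open>D_add\<close>, instead of being
  built into a derivative.\<close>

definition C1 :: "(('g \<Rightarrow> 'g) \<Rightarrow> real) \<Rightarrow> bool" where
  "C1 F \<longleftrightarrow> continuous_on G F \<and> (\<forall>Y. continuous_on G (D Y F) \<and>
     (\<forall>g\<in>G. (\<lambda>s. F (g \<circ> ex (s *\<^sub>R Y))) differentiable (at 0)))"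

definition C2 :: "(('g \<Rightarrow> 'g) \<Rightarrow> real) \<Rightarrow> bool" where
  "C2 F \<longleftrightarrow> C1 F \<and> (\<forall>Y. C1 (D Y F))"

lemma C2_C1: "C2 F \<Longrightarrow> C1 F" and C2_D: "C2 F \<Longrightarrow> C1 (D Y F)"
  by (auto simp: C2_def)

lemma C1_continuous: "C1 F \<Longrightarrow> continuous_on G F" and C1_D_continuous: "C1 F \<Longrightarrow> continuous_on G (D Y F)"
  by (auto simp: C1_def)

lemma C1_has_derivative:
  assumes "C1 F" "g \<in> G"
  shows "((\<lambda>s. F (g \<circ> ex (s *\<^sub>R Y))) has_real_derivative D Y F (g \<circ> ex (s *\<^sub>R Y))) (at s)"
proof -
  let ?h = "g \<circ> ex (s *\<^sub>R Y)"
  have "?h \<in> G" using assms(2) by (rule G_comp_ex)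
  then have "(\<lambda>r. F (?h \<circ> ex (r *\<^sub>R Y))) differentiable (at 0)" using assms(1) by (auto simp: C1_def)
  then have "((\<lambda>r. F (?h \<circ> ex (r *\<^sub>R Y))) has_real_derivative D Y F ?h) (at 0)"
    unfolding left_inv_deriv_def by (simp only: DERIV_deriv_iff_real_differentiable)
  moreover have "?h \<circ> ex (r *\<^sub>R Y) = g \<circ> ex ((r + s) *\<^sub>R Y)" for r
    using ex_add[of s r Y] by (simp add: comp_assoc add.commute)
  ultimately have "((\<lambda>r. F (g \<circ> ex ((r + s) *\<^sub>R Y))) has_real_derivative D Y F ?h) (at 0)" by (simp only:)
  then show ?thesis
    using DERIV_shift[of "\<lambda>r. F (g \<circ> ex (r *\<^sub>R Y))" "D Y F ?h" 0 s] by simp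
qed

lemma C1_I:
  assumes "continuous_on G F" "\<And>Y. continuous_on G (F' Y)"
    "\<And>Y g. g \<in> G \<Longrightarrow> ((\<lambda>s. F (g \<circ> ex (s *\<^sub>R Y))) has_real_derivative F' Y g) (at 0)"
  shows "C1 F" and "\<And>Y g. g \<in> G \<Longrightarrow> D Y F g = F' Y g"
proof -
  show D: "D Y F g = F' Y g" if "g \<in> G" for Y g
    unfolding left_inv_deriv_def by (rule DERIV_imp_deriv[OF assms(3)[OF that]])
  show "C1 F"
    unfolding C1_def
  proof (intro conjI allI ballI)
    show "continuous_on G (D Y F)" for Y
      using assms(2) by (subst continuous_on_cong[OF refl D]) auto
    show "(\<lambda>s. F (g \<circ> ex (s *\<^sub>R Y))) differentiable (at 0)" if "g \<in> G" for g Y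
      using assms(3)[OF that] by (auto simp: real_differentiable_def)
  qed (rule assms(1))
qed

lemma C1_has_derivative_0:
  "C1 F \<Longrightarrow> g \<in> G \<Longrightarrow> ((\<lambda>s. F (g \<circ> ex (s *\<^sub>R Y))) has_real_derivative D Y F g) (at 0)"
  using C1_has_derivative[of F g Y 0] by simp

lemma C1_cong:
  assumes "C1 F" "\<And>g. g \<in> G \<Longrightarrow> F' g = F g"
  shows "C1 F'" and "\<And>Y g. g \<in> G \<Longrightarrow> D Y F' g = D Y F g"
proof -
  have e: "((\<lambda>s. F' (g \<circ> ex (s *\<^sub>R Y))) has_real_derivative D Y F g) (at 0)" if "g \<in> G" for g Y
    using C1_has_derivative_0[OF assms(1) that] by (simp add: assms(2) G_comp_ex that)
  have c: "continuous_on G F'" using C1_continuous[OF assms(1)] assms(2) by (simp cong: continuous_on_cong)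
  show "C1 F'" by (rule C1_I(1)[OF c C1_D_continuous[OF assms(1)] e])
  show "\<And>Y g. g \<in> G \<Longrightarrow> D Y F' g = D Y F g" by (rule C1_I(2)[OF c C1_D_continuous[OF assms(1)] e])
qed

lemma C1_mult:
  assumes "C1 F" "C1 H"
  shows "C1 (\<lambda>g. F g * H g)" and "\<And>Y g. g \<in> G \<Longrightarrow> D Y (\<lambda>g. F g * H g) g = D Y F g * H g + F g * D Y H g"
proof -
  have e: "((\<lambda>s. F (g \<circ> ex (s *\<^sub>R Y)) * H (g \<circ> ex (s *\<^sub>R Y))) has_real_derivative D Y F g * H g + F g * D Y H g) (at 0)"
    if "g \<in> G" for g Y
    using DERIV_mult[OF C1_has_derivative_0[OF assms(1) that] C1_has_derivative_0[OF assms(2) that]]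
    by (simp add: mult.commute)
  have c: "continuous_on G (\<lambda>g. F g * H g)" "continuous_on G (\<lambda>g. D Y F g * H g + F g * D Y H g)" for Y
    by (intro continuous_on_mult continuous_on_add C1_continuous[OF assms(1)] C1_continuous[OF assms(2)]
      C1_D_continuous[OF assms(1)] C1_D_continuous[OF assms(2)])+
  show "C1 (\<lambda>g. F g * H g)" by (rule C1_I(1)[OF c e])
  show "\<And>Y g. g \<in> G \<Longrightarrow> D Y (\<lambda>g. F g * H g) g = D Y F g * H g + F g * D Y H g" by (rule C1_I(2)[OF c e])
qed

lemma C1_add:
  assumes "C1 F" "C1 H"
  shows "C1 (\<lambda>g. F g + H g)" and "\<And>Y g. g \<in> G \<Longrightarrow> D Y (\<lambda>g. F g + H g) g = D Y F g + D Y H g"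
proof -
  have e: "((\<lambda>s. F (g \<circ> ex (s *\<^sub>R Y)) + H (g \<circ> ex (s *\<^sub>R Y))) has_real_derivative D Y F g + D Y H g) (at 0)"
    if "g \<in> G" for g Y
    by (rule DERIV_add[OF C1_has_derivative_0[OF assms(1) that] C1_has_derivative_0[OF assms(2) that]])
  have c: "continuous_on G (\<lambda>g. F g + H g)" "continuous_on G (\<lambda>g. D Y F g + D Y H g)" for Y
    by (intro continuous_on_mult continuous_on_add C1_continuous[OF assms(1)] C1_continuous[OF assms(2)]
      C1_D_continuous[OF assms(1)] C1_D_continuous[OF assms(2)])+
  show "C1 (\<lambda>g. F g + H g)" by (rule C1_I(1)[OF c e])
  show "\<And>Y g. g \<in> G \<Longrightarrow> D Y (\<lambda>g. F g + H g) g = D Y F g + D Y H g" by (rule C1_I(2)[OF c e])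
qed

lemma C1_const: "C1 (\<lambda>g. c)" and D_const: "g \<in> G \<Longrightarrow> D Y (\<lambda>g. c) g = 0"
  using C1_I[of "\<lambda>g. c" "\<lambda>Y g. 0"] by auto

lemma C1_compose:
  assumes F: "C1 F" and \<phi>: "\<And>g. g \<in> G \<Longrightarrow> (\<phi> has_real_derivative \<phi>' (F g)) (at (F g))"
    and c': "continuous_on (F ` G) \<phi>'"
  shows "C1 (\<lambda>g. \<phi> (F g))" and "\<And>Y g. g \<in> G \<Longrightarrow> D Y (\<lambda>g. \<phi> (F g)) g = \<phi>' (F g) * D Y F g"
proof -
  have e: "((\<lambda>s. \<phi> (F (g \<circ> ex (s *\<^sub>R Y)))) has_real_derivative \<phi>' (F g) * D Y F g) (at 0)" if "g \<in> G" for g Y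
    by (rule DERIV_chain2[where f=\<phi>, OF _ C1_has_derivative_0[OF F that]]) (use \<phi>[OF that] in simp)
  have "continuous_on (F ` G) \<phi>"
    using \<phi> by (intro continuous_at_imp_continuous_on) (auto dest: DERIV_isCont)
  then have c1: "continuous_on G (\<lambda>g. \<phi> (F g))"
    by (rule continuous_on_compose2[OF _ C1_continuous[OF F] order_refl])
  have c2: "continuous_on G (\<lambda>g. \<phi>' (F g) * D Y F g)" for Y
    by (intro continuous_on_mult C1_D_continuous[OF F]
        continuous_on_compose2[OF c' C1_continuous[OF F] order_refl])
  show "C1 (\<lambda>g. \<phi> (F g))" by (rule C1_I(1)[OF c1 c2 e])
  show "\<And>Y g. g \<in> G \<Longrightarrow> D Y (\<lambda>g. \<phi> (F g)) g = \<phi>' (F g) * D Y F g" by (rule C1_I(2)[OF c1 c2 e])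
qed

lemma C2_I:
  assumes "C1 F" "\<And>Y. C1 (F' Y)" "\<And>Y g. g \<in> G \<Longrightarrow> D Y F g = F' Y g"
  shows "C2 F"
  unfolding C2_def using assms(1) C1_cong(1)[OF assms(2,3)] by blast

lemma C2_mult: assumes "C2 F" "C2 H" shows "C2 (\<lambda>g. F g * H g)"
proof (rule C2_I[where F'="\<lambda>Y g. D Y F g * H g + F g * D Y H g"])
  note c = C2_C1[OF assms(1)] C2_C1[OF assms(2)]
  show "C1 (\<lambda>g. F g * H g)" by (rule C1_mult(1)[OF c])
  show "C1 (\<lambda>g. D Y F g * H g + F g * D Y H g)" for Y
    by (rule C1_add(1)[OF C1_mult(1)[OF C2_D[OF assms(1)] c(2)] C1_mult(1)[OF c(1) C2_D[OF assms(2)]]])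
  show "D Y (\<lambda>g. F g * H g) g = D Y F g * H g + F g * D Y H g" if "g \<in> G" for Y g
    by (rule C1_mult(2)[OF c that])
qed

lemma C2_add: assumes "C2 F" "C2 H" shows "C2 (\<lambda>g. F g + H g)"
proof (rule C2_I[where F'="\<lambda>Y g. D Y F g + D Y H g"])
  note c = C2_C1[OF assms(1)] C2_C1[OF assms(2)]
  show "C1 (\<lambda>g. F g + H g)" by (rule C1_add(1)[OF c])
  show "C1 (\<lambda>g. D Y F g + D Y H g)" for Y
    by (rule C1_add(1)[OF C2_D[OF assms(1)] C2_D[OF assms(2)]])
  show "D Y (\<lambda>g. F g + H g) g = D Y F g + D Y H g" if "g \<in> G" for Y g
    by (rule C1_add(2)[OF c that])
qed

lemma C2_const: "C2 (\<lambda>g. c)"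
  by (rule C2_I[where F'="\<lambda>Y g. 0"]) (rule C1_const | erule D_const)+

lemma C2_compose:
  assumes F: "C2 F" and \<phi>: "\<And>g. g \<in> G \<Longrightarrow> (\<phi> has_real_derivative \<phi>' (F g)) (at (F g))"
    and \<phi>': "\<And>g. g \<in> G \<Longrightarrow> (\<phi>' has_real_derivative \<phi>'' (F g)) (at (F g))"
    and c: "continuous_on (F ` G) \<phi>''"
  shows "C2 (\<lambda>g. \<phi> (F g))"
proof (rule C2_I[where F'="\<lambda>Y g. \<phi>' (F g) * D Y F g"])
  have c': "continuous_on (F ` G) \<phi>'"
    using \<phi>' by (intro continuous_at_imp_continuous_on) (auto dest: DERIV_isCont)
  show "C1 (\<lambda>g. \<phi> (F g))" by (rule C1_compose(1)[OF C2_C1[OF F] \<phi> c'])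
  show "C1 (\<lambda>g. \<phi>' (F g) * D Y F g)" for Y
    by (rule C1_mult(1)[OF C1_compose(1)[OF C2_C1[OF F] \<phi>' c] C2_D[OF F]])
  show "D Y (\<lambda>g. \<phi> (F g)) g = \<phi>' (F g) * D Y F g" if "g \<in> G" for Y g
    by (rule C1_compose(2)[OF C2_C1[OF F] \<phi> c' that])
qed

lemma D_scaleR: assumes "C1 F" "g \<in> G" shows "D (c *\<^sub>R Y) F g = c * D Y F g"
proof -
  have "((\<lambda>s. F (g \<circ> ex ((c * s) *\<^sub>R Y))) has_real_derivative D Y F g * c) (at 0)"
    by (rule DERIV_chain2[where f="\<lambda>s. F (g \<circ> ex (s *\<^sub>R Y))" and g="\<lambda>s. c * s"])
      (auto intro!: derivative_eq_intros simp: C1_has_derivative_0 assms)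
  then show ?thesis unfolding left_inv_deriv_def by (simp add: DERIV_imp_deriv mult.commute)
qed

lemma continuous_on_comp_app:
  fixes g :: "'a::euclidean_space \<Rightarrow> 'a"
  assumes "linear g" "continuous_on S f"
  shows "continuous_on S (\<lambda>x. g \<circ> app (f x))"
proof (rule continuous_on_coordinatewise_then_product)
  fix z
  have "bounded_linear g" using assms(1) by (simp add: linear_conv_bounded_linear)
  then show "continuous_on S (\<lambda>x. (g \<circ> app (f x)) z)"
    unfolding comp_def
    by (intro bounded_linear.continuous_on[of g] bounded_linear.continuous_on[OF app.bounded_linear_left assms(2)])
qed

text \<open>By \<open>trotter\<close>, \<open>ex (s *\<^sub>R (Y + Z))\<close> is a limit of
  products that alternate short steps along \<open>Y\<close> and along \<open>Z\<close>. Each step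
  changes \<open>F\<close> by its length times a derivative close to \<open>D Y F g\<close> or
  \<open>D Z F g\<close>, so the total change is \<open>s * (a + b)\<close> up to
  \<open>2 * e * \<bar>s\<bar>\<close>, uniformly in the number of steps.\<close>

lemma D_add: assumes F: "C1 F" and g: "g \<in> G" shows "D (Y + Z) F g = D Y F g + D Z F g"
proof -
  \<comment> \<open>The group is viewed inside the normed algebra of operators, where the distance
    from 1 of a partial product can be estimated.\<close>
  define \<Gamma> where "\<Gamma> = {T. app T \<in> G}"
  have \<Gamma>_mult: "S * T \<in> \<Gamma>" if "S \<in> \<Gamma>" "T \<in> \<Gamma>" for S T
    using that by (simp add: \<Gamma>_def app_mult' G_comp)
  have \<Gamma>_exp: "exp (s *\<^sub>R ad W) \<in> \<Gamma>" for s W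
    using G_ex[of "s *\<^sub>R W"] by (simp add: \<Gamma>_def ex_app ad_simps)
  have \<Gamma>_1: "1 \<in> \<Gamma>" by (simp add: \<Gamma>_def)
  have cont: "continuous_on \<Gamma> (\<lambda>T. H (g \<circ> app T))" if "continuous_on G H" for H :: "_ \<Rightarrow> real"
    by (rule continuous_on_compose2[OF that continuous_on_comp_app[OF G_linear[OF g] continuous_on_id]])
      (use g in \<open>auto simp: \<Gamma>_def G_comp\<close>)
  define a where "a = D Y F g"
  define b where "b = D Z F g"
  have main: "\<exists>d>0. \<forall>s. \<bar>s\<bar> < d \<longrightarrow> \<bar>F (g \<circ> ex (s *\<^sub>R (Y + Z))) - F g - s * (a + b)\<bar> \<le> 2 * e * \<bar>s\<bar>" if "e > 0" for e
  proof -
    obtain d1 where d1: "d1 > 0" "\<And>T. T \<in> \<Gamma> \<Longrightarrow> norm (T - 1) < d1 \<Longrightarrow> \<bar>D Y F (g \<circ> app T) - a\<bar> < e"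
      using cont[OF C1_D_continuous[OF F]] \<Gamma>_1 \<open>e > 0\<close>
      unfolding continuous_on_iff dist_norm a_def by (metis app_one' comp_id real_norm_def)
    obtain d2 where d2: "d2 > 0" "\<And>T. T \<in> \<Gamma> \<Longrightarrow> norm (T - 1) < d2 \<Longrightarrow> \<bar>D Z F (g \<circ> app T) - b\<bar> < e"
      using cont[OF C1_D_continuous[OF F]] \<Gamma>_1 \<open>e > 0\<close>
      unfolding continuous_on_iff dist_norm b_def by (metis app_one' comp_id real_norm_def)
    define M where "M = norm (ad Y) + norm (ad Z)"
    have "((\<lambda>s. exp (\<bar>s\<bar> * M) - 1) \<longlongrightarrow> exp (\<bar>0\<bar> * M) - 1) (at 0)"
      by (intro tendsto_intros)
    then have "\<forall>\<^sub>F s in at 0. exp (\<bar>s\<bar> * M) - 1 < min d1 d2"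
      by (rule order_tendstoD) (use d1 d2 in simp)
    then obtain d where d: "d > 0" "\<And>s. s \<noteq> 0 \<Longrightarrow> \<bar>s\<bar> < d \<Longrightarrow> exp (\<bar>s\<bar> * M) - 1 < min d1 d2"
      unfolding eventually_at by (auto simp: dist_norm)
    have "\<bar>F (g \<circ> ex (s *\<^sub>R (Y + Z))) - F g - s * (a + b)\<bar> \<le> 2 * e * \<bar>s\<bar>" if s: "\<bar>s\<bar> < d" "s \<noteq> 0" for s
    proof -
      have step: "\<bar>F (g \<circ> app (T * exp (r *\<^sub>R ad W))) - F (g \<circ> app T) - r * c\<bar> \<le> \<bar>r\<bar> * e"
        if T: "T \<in> \<Gamma>" and *: "\<And>r'. \<bar>r'\<bar> \<le> \<bar>r\<bar> \<Longrightarrow> \<bar>D W F (g \<circ> app (T * exp (r' *\<^sub>R ad W))) - c\<bar> < e" for T r W c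
      proof -
        have gT: "g \<circ> app T \<in> G" using g T by (simp add: \<Gamma>_def G_comp)
        define \<phi> where "\<phi> s = F (g \<circ> app (T * exp (s *\<^sub>R ad W))) - s * c" for s
        have eq: "g \<circ> app (T * exp (s *\<^sub>R ad W)) = (g \<circ> app T) \<circ> ex (s *\<^sub>R W)" for s
          by (simp add: app_mult' ex_app ad_simps comp_assoc)
        have "(\<phi> has_real_derivative (D W F (g \<circ> app (T * exp (s *\<^sub>R ad W))) - c)) (at s)" for s
          unfolding \<phi>_def eq by (auto intro!: derivative_eq_intros C1_has_derivative[OF F gT])
        then have "norm (\<phi> r - \<phi> 0) \<le> e * norm (r - 0)"
        proof (intro field_differentiable_bound[of "{-\<bar>r\<bar>..\<bar>r\<bar>}" \<phi>])
          show "norm (D W F (g \<circ> app (T * exp (z *\<^sub>R ad W))) - c) \<le> e" if "z \<in> {-\<bar>r\<bar>..\<bar>r\<bar>}" for z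
          proof -
            have "\<bar>z\<bar> \<le> \<bar>r\<bar>" using that by auto
            from *[OF this] show ?thesis by simp
          qed
        qed (auto intro: has_field_derivative_at_within)
        then show ?thesis by (simp add: \<phi>_def mult.commute)
      qed
      \<comment> \<open>Induction over the partial products. Their exponents add up to at most
        \<open>\<bar>s\<bar> * M\<close>, so all of them stay in the neighbourhood of 1 where both
        derivatives are within \<open>e\<close> of \<open>a\<close> and \<open>b\<close>; every
        factor costs an error \<open>\<bar>r\<bar> * e\<close>.\<close>
      have approx: "\<bar>F (g \<circ> app ((exp (r *\<^sub>R ad Y) * exp (r *\<^sub>R ad Z)) ^ k)) - F g - k * r * (a + b)\<bar> \<le> k * (2 * e * \<bar>r\<bar>)
          \<and> (exp (r *\<^sub>R ad Y) * exp (r *\<^sub>R ad Z)) ^ k \<in> \<Gamma>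
          \<and> norm ((exp (r *\<^sub>R ad Y) * exp (r *\<^sub>R ad Z)) ^ k - 1) \<le> exp (k * \<bar>r\<bar> * M) - 1"
        if "real k * \<bar>r\<bar> \<le> \<bar>s\<bar>" for k r
        using that
      proof (induction k)
        case 0
        then show ?case using g by (simp add: \<Gamma>_1 id_def)
      next
        case (Suc k)
        define P where "P = (exp (r *\<^sub>R ad Y) * exp (r *\<^sub>R ad Z)) ^ k"
        have k: "real k * \<bar>r\<bar> \<le> \<bar>s\<bar>" using Suc(2) by (simp add: algebra_simps)
        have IH: "\<bar>F (g \<circ> app P) - F g - k * r * (a + b)\<bar> \<le> k * (2 * e * \<bar>r\<bar>)" "P \<in> \<Gamma>"
          "norm (P - 1) \<le> exp (k * \<bar>r\<bar> * M) - 1" using Suc(1)[OF k] unfolding P_def by blast+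
        have ex_le: "norm (exp (r' *\<^sub>R ad W) - 1) \<le> exp (\<bar>r\<bar> * norm (ad W)) - 1" if "\<bar>r'\<bar> \<le> \<bar>r\<bar>" for r' W
          using norm_exp_minus_1_le[of "r' *\<^sub>R ad W"] mult_right_mono[OF that, of "norm (ad W)"]
          by (smt (verit) exp_le_cancel_iff norm_ge_zero norm_scaleR)
        have 1: "norm (P * exp (r' *\<^sub>R ad Y) - 1) \<le> exp (k * \<bar>r\<bar> * M + \<bar>r\<bar> * norm (ad Y)) - 1" if "\<bar>r'\<bar> \<le> \<bar>r\<bar>" for r'
          by (rule norm_mult_minus_1_le[OF IH(3) ex_le[OF that]])
        have 2: "norm (P * exp (r *\<^sub>R ad Y) * exp (r' *\<^sub>R ad Z) - 1)
            \<le> exp (k * \<bar>r\<bar> * M + \<bar>r\<bar> * norm (ad Y) + \<bar>r\<bar> * norm (ad Z)) - 1" if "\<bar>r'\<bar> \<le> \<bar>r\<bar>" for r'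
          by (rule norm_mult_minus_1_le[OF 1 ex_le[OF that]]) simp
        have tot: "k * \<bar>r\<bar> * M + \<bar>r\<bar> * norm (ad Y) + \<bar>r\<bar> * norm (ad Z) = real (Suc k) * \<bar>r\<bar> * M"
          by (simp add: M_def algebra_simps)
        have M0: "M \<ge> 0" by (simp add: M_def)
        have tot_le: "real (Suc k) * \<bar>r\<bar> * M \<le> \<bar>s\<bar> * M" by (intro mult_right_mono Suc(2) M0)
        have small: "exp (real (Suc k) * \<bar>r\<bar> * M) - 1 < min d1 d2"
          using d(2)[OF s(2) s(1)] tot_le by (smt (verit) exp_le_cancel_iff)
        have small1: "exp (k * \<bar>r\<bar> * M + \<bar>r\<bar> * norm (ad Y)) - 1 < min d1 d2"
        proof -
          have "k * \<bar>r\<bar> * M + \<bar>r\<bar> * norm (ad Y) \<le> real (Suc k) * \<bar>r\<bar> * M" unfolding tot[symmetric] by simp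
          then have "exp (k * \<bar>r\<bar> * M + \<bar>r\<bar> * norm (ad Y)) \<le> exp (real (Suc k) * \<bar>r\<bar> * M)" by simp
          then show ?thesis using small by linarith
        qed
        have s1: "\<bar>F (g \<circ> app (P * exp (r *\<^sub>R ad Y))) - F (g \<circ> app P) - r * a\<bar> \<le> \<bar>r\<bar> * e"
        proof (rule step[OF IH(2)])
          fix r' assume "\<bar>r'\<bar> \<le> \<bar>r\<bar>"
          then show "\<bar>D Y F (g \<circ> app (P * exp (r' *\<^sub>R ad Y))) - a\<bar> < e"
            using 1[of r'] small1 by (intro d1(2) \<Gamma>_mult IH \<Gamma>_exp) linarith
        qed
        have s2: "\<bar>F (g \<circ> app (P * exp (r *\<^sub>R ad Y) * exp (r *\<^sub>R ad Z))) - F (g \<circ> app (P * exp (r *\<^sub>R ad Y))) - r * b\<bar> \<le> \<bar>r\<bar> * e"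
        proof (rule step[OF \<Gamma>_mult[OF IH(2) \<Gamma>_exp]])
          fix r' assume "\<bar>r'\<bar> \<le> \<bar>r\<bar>"
          then show "\<bar>D Z F (g \<circ> app (P * exp (r *\<^sub>R ad Y) * exp (r' *\<^sub>R ad Z))) - b\<bar> < e"
            using 2[of r'] small unfolding tot by (intro d2(2) \<Gamma>_mult IH \<Gamma>_exp) linarith
        qed
        have PS: "(exp (r *\<^sub>R ad Y) * exp (r *\<^sub>R ad Z)) ^ Suc k = P * exp (r *\<^sub>R ad Y) * exp (r *\<^sub>R ad Z)"
          unfolding P_def power_Suc2 by (simp add: mult.assoc)
        have "real (Suc k) * r * (a + b) = k * r * (a + b) + r * a + r * b"
          "real (Suc k) * (2 * e * \<bar>r\<bar>) = k * (2 * e * \<bar>r\<bar>) + \<bar>r\<bar> * e + \<bar>r\<bar> * e"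
          by (simp_all add: algebra_simps)
        moreover have "P * exp (r *\<^sub>R ad Y) * exp (r *\<^sub>R ad Z) \<in> \<Gamma>"
          by (intro \<Gamma>_mult \<Gamma>_exp IH(2))
        moreover have "norm (P * exp (r *\<^sub>R ad Y) * exp (r *\<^sub>R ad Z) - 1) \<le> exp (real (Suc k) * \<bar>r\<bar> * M) - 1"
          using 2[of r] unfolding tot by simp
        ultimately show ?case
          unfolding PS using s1 s2 IH(1) by linarith
      qed
      define P where "P n = (exp ((s / real (Suc n)) *\<^sub>R ad Y) * exp ((s / real (Suc n)) *\<^sub>R ad Z)) ^ Suc n" for n
      have Peq: "P n = (exp ((1 / real (Suc n)) *\<^sub>R (s *\<^sub>R ad Y)) * exp ((1 / real (Suc n)) *\<^sub>R (s *\<^sub>R ad Z))) ^ Suc n" for n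
        by (simp add: P_def)
      have "P \<longlonglongrightarrow> exp (s *\<^sub>R ad Y + s *\<^sub>R ad Z)"
        using trotter[of "s *\<^sub>R ad Y" "s *\<^sub>R ad Z"] unfolding Peq[symmetric] .
      then have lim: "P \<longlonglongrightarrow> exp (s *\<^sub>R ad (Y + Z))" by (simp add: ad_simps scaleR_add_right)
      have le: "\<bar>s / real (Suc n)\<bar> * real (Suc n) = \<bar>s\<bar>" "s / real (Suc n) * real (Suc n) = s" for n by (auto simp del: of_nat_Suc)
      have P: "\<bar>F (g \<circ> app (P n)) - F g - s * (a + b)\<bar> \<le> 2 * e * \<bar>s\<bar>" "P n \<in> \<Gamma>" for n
      proof -
        have "real (Suc n) * \<bar>s / real (Suc n)\<bar> \<le> \<bar>s\<bar>" using le[of n] by (simp only: mult.commute)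
        note ap = approx[OF this]
        have e1: "real (Suc n) * (2 * e * \<bar>s / real (Suc n)\<bar>) = 2 * e * \<bar>s\<bar>"
          using le(1)[of n] by (metis mult.commute mult.left_commute)
        have e2: "real (Suc n) * (s / real (Suc n)) = s" using le(2)[of n] by (simp only: mult.commute)
        show "\<bar>F (g \<circ> app (P n)) - F g - s * (a + b)\<bar> \<le> 2 * e * \<bar>s\<bar>" "P n \<in> \<Gamma>"
          using ap unfolding P_def e1 e2 by blast+
      qed
      have "(\<lambda>n. F (g \<circ> app (P n))) \<longlonglongrightarrow> F (g \<circ> app (exp (s *\<^sub>R ad (Y + Z))))"
        using continuous_on_tendsto_compose[OF cont[OF C1_continuous[OF F]] lim \<Gamma>_exp] P(2) by simp
      then have "(\<lambda>n. \<bar>F (g \<circ> app (P n)) - F g - s * (a + b)\<bar>) \<longlonglongrightarrow> \<bar>F (g \<circ> app (exp (s *\<^sub>R ad (Y + Z)))) - F g - s * (a + b)\<bar>"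
        by (intro tendsto_intros)
      then have "\<bar>F (g \<circ> app (exp (s *\<^sub>R ad (Y + Z)))) - F g - s * (a + b)\<bar> \<le> 2 * e * \<bar>s\<bar>"
        by (rule tendsto_upperbound) (use P(1) in auto)
      then show ?thesis by (simp add: ex_app ad_simps)
    qed
    then have "\<forall>s. \<bar>s\<bar> < d \<longrightarrow> \<bar>F (g \<circ> ex (s *\<^sub>R (Y + Z))) - F g - s * (a + b)\<bar> \<le> 2 * e * \<bar>s\<bar>"
      by (metis (no_types, opaque_lifting) abs_zero add_0 comp_id diff_self ex_0 mult_zero_left mult_zero_right order_refl scaleR_zero_left diff_zero)
    with d(1) show ?thesis by blast
  qed
  have "((\<lambda>s. F (g \<circ> ex (s *\<^sub>R (Y + Z)))) has_real_derivative a + b) (at 0)"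
    unfolding has_field_derivative_def has_derivative_at_alt
  proof (intro conjI allI impI)
    show "bounded_linear ((*) (a + b))" by (rule bounded_linear_mult_right)
    fix e :: real assume "e > 0"
    then obtain d where "d > 0" "\<And>s. \<bar>s\<bar> < d \<Longrightarrow> \<bar>F (g \<circ> ex (s *\<^sub>R (Y + Z))) - F g - s * (a + b)\<bar> \<le> 2 * (e / 2) * \<bar>s\<bar>"
      using main[of "e / 2"] by auto
    then show "\<exists>d>0. \<forall>y. norm (y - 0) < d \<longrightarrow>
        norm (F (g \<circ> ex (y *\<^sub>R (Y + Z))) - F (g \<circ> ex (0 *\<^sub>R (Y + Z))) - (a + b) * (y - 0)) \<le> e * norm (y - 0)"
      by (intro exI[of _ d]) (simp add: mult.commute)
  qed
  then show ?thesis
    unfolding a_def b_def using C1_has_derivative_0[OF F g] by (rule DERIV_unique[symmetric])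
qed

end

context rank_one
begin

section \<open>The Laplacian as a Casimir operator\<close>

lemma Q_B_p: "Z \<in> p \<Longrightarrow> Q Y Z = B Y Z"
  by (simp add: Q_def p_iff B.minus_right)

lemma Q_p_k: assumes "Y \<in> p" "th Z = Z" shows "Q Y Z = 0"
  using Q_th[of Y Z] assms by (simp add: p_iff Q.minus_left)

text \<open>The same choice as in \<open>laplacian_at\<close>, so that the sum there runs literally
  over \<open>P0\<close>.\<close>

definition P0 :: "'g set" where "P0 = (SOME E. orthonormal_basis_p br th H0 E)"
definition K0 :: "'g set" where "K0 = (SOME E. onb E \<and> span E = {Z. th Z = Z})"

lemma P0_basis: "orthonormal_basis_p br th H0 P0"
proof -
  obtain E where E: "onb E" "span E = p"
    using symmetric_diagonalizable[of id p] subspace_p by (auto simp: linear_id)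
  then have "E \<subseteq> p" using span_superset by blast
  then have "orthonormal_basis_p br th H0 E"
    using E Q_B_p by (auto simp: orthonormal_basis_p_def onb_def B_def subset_iff)
  then show ?thesis unfolding P0_def by (rule someI[of "orthonormal_basis_p br th H0"])
qed

lemma P0: "finite P0" "P0 \<subseteq> p" "span P0 = p" "onb P0"
  using P0_basis Q_B_p by (auto simp: orthonormal_basis_p_def onb_def B_def subset_iff)

lemma K0: "onb K0" "span K0 = {Z. th Z = Z}" "finite K0"
proof -
  have "subspace {Z. th Z = Z}" by (auto simp: subspace_def)
  then have "\<exists>E. onb E \<and> span E = {Z. th Z = Z}"
    using symmetric_diagonalizable[of id "{Z. th Z = Z}"] by (auto simp: linear_id)
  then have "onb K0 \<and> span K0 = {Z. th Z = Z}" unfolding K0_def by (rule someI_ex)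
  then show "onb K0" "span K0 = {Z. th Z = Z}" "finite K0" by (auto simp: onb_def)
qed

lemma K0_th: "Z \<in> K0 \<Longrightarrow> th Z = Z"
  using K0(2) span_base by blast

lemma P0_th: "Y \<in> P0 \<Longrightarrow> th Y = - Y"
  using P0(2) by (auto simp: p_iff)

lemma P0_K0_disjoint: "P0 \<inter> K0 = {}"
proof -
  have False if "e \<in> P0" "e \<in> K0" for e
  proof -
    have "Q e e = 0" using that K0_th P0(2) by (intro Q_p_k) auto
    moreover have "Q e e = 1" using P0(4) that by (simp add: onb_def)
    ultimately show False by linarith
  qed
  then show ?thesis by auto
qed

abbreviation "E0 \<equiv> P0 \<union> K0"

lemma onb_E0: "onb E0"
proof -
  have dj: "f \<notin> K0" if "f \<in> P0" for f
    using that P0_K0_disjoint by auto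
  have "Q e f = 0" "Q f e = 0" "e \<noteq> f" if "e \<in> P0" "f \<in> K0" for e f
  proof -
    show "Q e f = 0" using that K0_th P0(2) by (intro Q_p_k) auto
    then show "Q f e = 0" using Q_sym[of f e] by simp
    show "e \<noteq> f" using that P0_K0_disjoint by auto
  qed
  then show ?thesis using P0(4) K0(1) unfolding onb_def
    by (auto simp: dj)
qed

lemma span_E0: "span E0 = UNIV"
proof -
  have "v \<in> span E0" for v
  proof -
    have "(1/2) *\<^sub>R (v - th v) \<in> span P0" using P0(3) by (simp add: p_iff algebra_simps)
    then have 1: "(1/2) *\<^sub>R (v - th v) \<in> span E0" using span_mono[of P0 E0] by blast
    have "(1/2) *\<^sub>R (v + th v) \<in> span K0" using K0(2) by (simp add: add.commute)
    then have 2: "(1/2) *\<^sub>R (v + th v) \<in> span E0" using span_mono[of K0 E0] by blast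
    have "v = (1/2) *\<^sub>R (v - th v) + (1/2) *\<^sub>R (v + th v)"
      by (simp flip: scaleR_add_right scaleR_add_left)
    then show ?thesis using span_add[OF 1 2] by simp
  qed
  then show ?thesis by auto
qed

text \<open>The value \<open>B e e\<close> on the basis \<open>E0\<close>, that is the signature of
  \<open>B\<close>. The vector dual to \<open>e\<close> for \<open>B\<close> is
  \<open>sg e *\<^sub>R e\<close>, as \<open>expand_B\<close> uses.\<close>

definition sg :: "'g \<Rightarrow> real" where "sg e = (if e \<in> P0 then 1 else - 1)"

lemma sg_B: assumes "e \<in> E0" shows "sg e * B v e = Q v e"
  using assms P0_th K0_th by (auto simp: sg_def Q_def B.minus_right)

lemma B_E0: assumes "e \<in> E0" "f \<in> E0" shows "B e f = (if e = f then sg f else 0)"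
proof -
  have "B e f = sg f * (sg f * B e f)" by (simp add: sg_def)
  then have "B e f = sg f * Q e f" by (simp only: sg_B[OF assms(2)])
  then show ?thesis using onb_E0 assms by (simp add: onb_def)
qed

lemma expand_B: "v = (\<Sum>e\<in>E0. (sg e * B v e) *\<^sub>R e)"
proof -
  have "v = (\<Sum>e\<in>E0. Q v e *\<^sub>R e)" using onb_expand[OF onb_E0, of v] span_E0 by simp
  then show ?thesis by (simp add: sg_B)
qed

lemma finite_E0: "finite E0" using P0(1) K0(3) by simp

text \<open>The tensor summing \<open>sg e\<close> times \<open>e \<otimes> e\<close> is the inverse
  of \<open>B\<close>, and \<open>G\<close> preserves \<open>B\<close>. In coordinates the
  invariance is the relation \<open>c f h = B f h\<close>.\<close>

lemma casimir_invariant: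
  assumes bil: "bilinear \<beta>" and g: "g \<in> G"
  shows "(\<Sum>e\<in>E0. sg e * \<beta> (g e) (g e)) = (\<Sum>e\<in>E0. sg e * \<beta> e e :: real)"
proof -
  interpret \<beta>: bounded_bilinear \<beta> using bil by (simp add: bilinear_conv_bounded_bilinear)
  define c where "c f h = (\<Sum>e\<in>E0. sg e * B (g e) f * B (g e) h)" for f h
  have c: "c f h = B f h" for f h
  proof -
    have "B f h = B (inv g f) (inv g h)" using g by (simp add: G_B G_inv)
    also have "\<dots> = B (\<Sum>e\<in>E0. (sg e * B (inv g f) e) *\<^sub>R e) (inv g h)"
      by (simp flip: expand_B)
    also have "\<dots> = (\<Sum>e\<in>E0. sg e * B (inv g f) e * B e (inv g h))"
      by (simp add: B.sum_left B.scaleR_left)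
    also have "\<dots> = c f h"
      unfolding c_def
    proof (intro sum.cong refl)
      fix e
      have "B (inv g f) e = B (g e) f" "B e (inv g h) = B (g e) h"
        using G_B[OF g, of "inv g f" e] G_B[OF g, of e "inv g h"] g B_sym by (simp_all add: G_inv_simps)
      then show "sg e * B (inv g f) e * B e (inv g h) = sg e * B (g e) f * B (g e) h" by simp
    qed
    finally show ?thesis by simp
  qed
  have "\<beta> (g e) (g e) = (\<Sum>f\<in>E0. \<Sum>h\<in>E0. (sg f * B (g e) f) * ((sg h * B (g e) h) * \<beta> f h))" for e
  proof -
    have "\<beta> (g e) (g e) = \<beta> (\<Sum>f\<in>E0. (sg f * B (g e) f) *\<^sub>R f) (\<Sum>h\<in>E0. (sg h * B (g e) h) *\<^sub>R h)"
      by (simp flip: expand_B)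
    then show ?thesis
      by (simp add: \<beta>.sum_left \<beta>.sum_right \<beta>.scaleR_left \<beta>.scaleR_right sum_distrib_left)
        (subst sum.swap, simp add: mult_ac)
  qed
  then have "(\<Sum>e\<in>E0. sg e * \<beta> (g e) (g e)) =
      (\<Sum>e\<in>E0. \<Sum>f\<in>E0. \<Sum>h\<in>E0. (sg f * sg h * \<beta> f h) * (sg e * B (g e) f * B (g e) h))"
    by (simp add: sum_distrib_left mult_ac)
  also have "\<dots> = (\<Sum>f\<in>E0. \<Sum>h\<in>E0. \<Sum>e\<in>E0. (sg f * sg h * \<beta> f h) * (sg e * B (g e) f * B (g e) h))"
    by (rule trans[OF sum.swap], rule sum.cong[OF refl], rule sum.swap)
  also have "\<dots> = (\<Sum>f\<in>E0. \<Sum>h\<in>E0. (sg f * sg h * \<beta> f h) * B f h)"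
  proof (intro sum.cong refl)
    fix f h
    show "(\<Sum>e\<in>E0. (sg f * sg h * \<beta> f h) * (sg e * B (g e) f * B (g e) h)) = (sg f * sg h * \<beta> f h) * B f h"
      using c[of f h] by (simp only: c_def flip: sum_distrib_left)
  qed
  also have "\<dots> = (\<Sum>f\<in>E0. \<Sum>h\<in>E0. if f = h then sg f * sg h * \<beta> f h * sg h else 0)"
    by (intro sum.cong refl) (simp add: B_E0)
  also have "\<dots> = (\<Sum>f\<in>E0. sg f * \<beta> f f)"
    using finite_E0 by (intro sum.cong refl) (simp add: sg_def)
  finally show ?thesis .
qed

text \<open>The derivative of \<open>u\<close> along the Killing vector field of \<open>V\<close>,
  not a norm. The flow of this field consists of left translations, which preserve the Riemannian
  measure.\<close>

definition L1 :: "'g \<Rightarrow> (('g \<Rightarrow> 'g) set \<Rightarrow> real) \<Rightarrow> ('g \<Rightarrow> 'g) set \<Rightarrow> real" where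
  "L1 V u x = deriv (\<lambda>s. u (translate (ex (s *\<^sub>R V)) x)) 0"

text \<open>The Casimir element, acting by the fields that generate the left translations. It equals the
  Laplacian, and the flow of each field preserves the measure, which gives Green's formula.\<close>
definition lap :: "(('g \<Rightarrow> 'g) set \<Rightarrow> real) \<Rightarrow> ('g \<Rightarrow> 'g) set \<Rightarrow> real" where
  "lap u x = (\<Sum>e\<in>E0. sg e * L1 e (L1 e u) x)"

definition C2X :: "(('g \<Rightarrow> 'g) set \<Rightarrow> real) \<Rightarrow> bool" where
  "C2X u \<longleftrightarrow> C2 (\<lambda>g. u (cs g))"

lemma ex_conj_inv: "g \<in> G \<Longrightarrow> ex (s *\<^sub>R V) \<circ> g = g \<circ> ex (s *\<^sub>R inv g V)"
  using G_conj_ex[of g "s *\<^sub>R inv g V"]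
  by (simp add: linear_scale[OF G_linear] G_inv_simps)

lemma ex_self: "ex (s *\<^sub>R Y) Y = Y"
proof -
  have "app (ad (s *\<^sub>R Y)) Y = 0 *\<^sub>R Y" by (simp add: br.scaleR_left)
  then show ?thesis unfolding ex_app using app_exp_eigen[of "ad (s *\<^sub>R Y)" Y 0] by simp
qed

lemma L1_cs: "g \<in> G \<Longrightarrow> L1 V u (cs g) = D (inv g V) (\<lambda>g. u (cs g)) g"
  unfolding L1_def left_inv_deriv_def by (simp add: ex_conj_inv)

lemma inv_ex_comp: "g \<in> G \<Longrightarrow> inv (g \<circ> ex (s *\<^sub>R inv g V)) V = inv g V"
  using ex_self[of "- s" "inv g V"] by (simp add: inv_comp_G inv_ex)

text \<open>At \<open>cs g\<close> the field of \<open>V\<close> is the left-invariant direction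
  \<open>inv g V\<close>. By \<open>inv_ex_comp\<close> this direction is constant along its own
  flow, so the second derivative acquires no further term.\<close>

lemma L1_L1_cs: assumes g: "g \<in> G"
  shows "L1 V (L1 V u) (cs g) = D (inv g V) (D (inv g V) (\<lambda>g. u (cs g))) g"
proof -
  have "L1 V (L1 V u) (cs g) = deriv (\<lambda>s. L1 V u (cs (g \<circ> ex (s *\<^sub>R inv g V)))) 0"
    unfolding L1_def[of V "L1 V u"] by (simp add: ex_conj_inv g)
  also have "\<dots> = D (inv g V) (D (inv g V) (\<lambda>g. u (cs g))) g"
    unfolding left_inv_deriv_def[of br "inv g V" "D (inv g V) (\<lambda>g. u (cs g))"]
    by (simp only: L1_cs G_comp_ex[OF g] inv_ex_comp[OF g])
  finally show ?thesis .
qed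

lemma translate_flow: "translate (ex (s *\<^sub>R V)) (translate (ex (r *\<^sub>R V)) x) = translate (ex ((s + r) *\<^sub>R V)) x"
  by (simp add: translate_translate ex_add)

lemma L1_has_derivative:
  assumes "C2X u" "x \<in> X"
  shows "((\<lambda>s. u (translate (ex (s *\<^sub>R V)) x)) has_real_derivative L1 V u (translate (ex (s *\<^sub>R V)) x)) (at s)"
    and "((\<lambda>s. L1 V u (translate (ex (s *\<^sub>R V)) x)) has_real_derivative L1 V (L1 V u) (translate (ex (s *\<^sub>R V)) x)) (at s)"
proof -
  obtain g where g: "g \<in> G" "x = cs g" using assms(2) by (auto simp: X_iff)
  have c: "C1 (\<lambda>g. u (cs g))" "C1 (D (inv g V) (\<lambda>g. u (cs g)))"
    using assms(1) by (auto simp: C2X_def C2_def)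
  show "((\<lambda>s. u (translate (ex (s *\<^sub>R V)) x)) has_real_derivative L1 V u (translate (ex (s *\<^sub>R V)) x)) (at s)"
    using C1_has_derivative[OF c(1) g(1), of "inv g V" s]
    by (simp add: g ex_conj_inv L1_cs G_comp_ex inv_ex_comp)
  show "((\<lambda>s. L1 V u (translate (ex (s *\<^sub>R V)) x)) has_real_derivative L1 V (L1 V u) (translate (ex (s *\<^sub>R V)) x)) (at s)"
    unfolding g(2) translate_cs ex_conj_inv[OF g(1)] L1_L1_cs[OF G_comp_ex[OF g(1)]] inv_ex_comp[OF g(1)]
    unfolding L1_cs[OF G_comp_ex[OF g(1)]] inv_ex_comp[OF g(1)]
    by (rule C1_has_derivative[OF c(2) g(1)])
qed

lemma second_derivative_bilinear:
  assumes F: "C2 F" and g: "g \<in> G"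
  shows "bilinear (\<lambda>Y Z. D Y (D Z F) g)"
proof -
  have C: "C1 F" "\<And>Y. C1 (D Y F)" using F by (auto simp: C2_def)
  show ?thesis
    unfolding bilinear_def
  proof (intro conjI allI linearI)
    show "D Y (D (Z + W) F) g = D Y (D Z F) g + D Y (D W F) g" for Y Z W
      using C1_cong(2)[OF C1_add(1)[OF C(2) C(2)], of "D (Z + W) F" Z W g Y] D_add[OF C(1)]
        C1_add(2)[OF C(2) C(2) g] g by simp
    show "D Y (D (c *\<^sub>R Z) F) g = c *\<^sub>R D Y (D Z F) g" for Y Z c
      using C1_cong(2)[OF C1_mult(1)[OF C1_const[of c] C(2)], of "D (c *\<^sub>R Z) F" Z g Y] D_scaleR[OF C(1)]
        C1_mult(2)[OF C1_const[of c] C(2) g] D_const[OF g] g by simp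
  qed (simp_all add: D_add[OF C(2) g] D_scaleR[OF C(2) g])
qed

text \<open>Directions fixed by \<open>th\<close> contribute nothing, because functions on
  \<open>X\<close> are right invariant under \<open>K\<close>. So the sum over \<open>P0\<close> is
  a Casimir sum over \<open>E0\<close>, and \<open>casimir_invariant\<close> replaces each
  \<open>e\<close> by \<open>inv g e\<close>, which turns left-invariant derivatives into
  \<open>L1 e\<close>.\<close>

theorem laplacian_at_eq_lap:
  assumes u: "C2X u" and g: "g \<in> G"
  shows "laplacian_at br th H0 u g = lap u (cs g)"
proof -
  let ?F = "\<lambda>g. u (cs g)"
  define \<beta> where "\<beta> Y Z = D Y (D Z ?F) g" for Y Z
  have bil: "bilinear \<beta>"
    unfolding \<beta>_def using u by (intro second_derivative_bilinear g) (simp add: C2X_def)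
  have z: "\<beta> Z Z = 0" if Z: "Z \<in> K0" for Z
  proof -
    have "ex (s *\<^sub>R Z) \<in> K" for s by (rule K_ex) (simp add: K0_th[OF Z])
    then have "?F (h \<circ> ex (s *\<^sub>R Z)) = ?F h" for h s by (simp add: cs_eqI)
    then have "D Z ?F h = 0" for h unfolding left_inv_deriv_def by simp
    then show ?thesis unfolding \<beta>_def left_inv_deriv_def[of br Z "D Z ?F"] by simp
  qed
  have "laplacian_at br th H0 u g = (\<Sum>Y\<in>P0. \<beta> Y Y)"
    unfolding laplacian_at_def P0_def[symmetric] \<beta>_def ..
  also have "\<dots> = (\<Sum>e\<in>E0. sg e * \<beta> e e)"
    using P0(1) K0(3) P0_K0_disjoint z by (simp add: sum.union_disjoint sg_def)
  also have "\<dots> = (\<Sum>e\<in>E0. sg e * \<beta> (inv g e) (inv g e))"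
    by (rule casimir_invariant[OF bil G_inv[OF g], symmetric])
  also have "\<dots> = lap u (cs g)"
    unfolding lap_def \<beta>_def by (simp add: L1_L1_cs g)
  finally show ?thesis .
qed

lemma continuous_lap: assumes "C2X u" shows "continuous_on G (\<lambda>g. lap u (cs g))"
proof -
  have "continuous_on G (laplacian_at br th H0 u)"
    unfolding laplacian_at_def[abs_def]
    using assms by (intro continuous_on_sum C1_D_continuous C2_D) (simp add: C2X_def)
  then show ?thesis by (simp add: laplacian_at_eq_lap[OF assms] cong: continuous_on_cong)
qed

lemma C2X_continuous: "C2X u \<Longrightarrow> continuous_on G (\<lambda>g. u (cs g))"
  by (simp add: C2X_def C2_C1 C1_continuous)

lemma C2X_mult: "C2X u \<Longrightarrow> C2X v \<Longrightarrow> C2X (\<lambda>x. u x * v x)"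
  unfolding C2X_def by (rule C2_mult)

lemma C2X_add: "C2X u \<Longrightarrow> C2X v \<Longrightarrow> C2X (\<lambda>x. u x + v x)"
  unfolding C2X_def by (rule C2_add)

lemma C2X_const: "C2X (\<lambda>x. c)"
  unfolding C2X_def by (rule C2_const)

lemma L1_L1_add:
  assumes "C2X u" "C2X v" "x \<in> X"
  shows "L1 V (L1 V (\<lambda>x. u x + v x)) x = L1 V (L1 V u) x + L1 V (L1 V v) x"
proof -
  have 1: "L1 V (\<lambda>x. u x + v x) y = L1 V u y + L1 V v y" if "y \<in> X" for y
    unfolding L1_def[of V "\<lambda>x. u x + v x"]
    using DERIV_add[OF L1_has_derivative(1)[OF assms(1) that, of V 0] L1_has_derivative(1)[OF assms(2) that, of V 0]]
    by (simp add: DERIV_imp_deriv)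
  have "L1 V (L1 V (\<lambda>x. u x + v x)) x = deriv (\<lambda>s. L1 V u (translate (ex (s *\<^sub>R V)) x) + L1 V v (translate (ex (s *\<^sub>R V)) x)) 0"
    unfolding L1_def[of V "L1 V (\<lambda>x. u x + v x)"] by (simp add: 1 translate_X assms(3))
  also have "\<dots> = L1 V (L1 V u) x + L1 V (L1 V v) x"
    using DERIV_add[OF L1_has_derivative(2)[OF assms(1,3), of V 0] L1_has_derivative(2)[OF assms(2,3), of V 0]]
    by (simp add: DERIV_imp_deriv)
  finally show ?thesis .
qed

lemma lap_add: "C2X u \<Longrightarrow> C2X v \<Longrightarrow> x \<in> X \<Longrightarrow> lap (\<lambda>x. u x + v x) x = lap u x + lap v x"
  by (simp add: lap_def L1_L1_add sum.distrib algebra_simps)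

lemma lap_const: "lap (\<lambda>x. c) x = 0"
proof -
  have "L1 V (\<lambda>x. c) = (\<lambda>x. 0)" for V c by (rule ext) (simp add: L1_def)
  then show ?thesis by (simp add: lap_def)
qed

lemma lap_cmult: assumes "C2X u" "x \<in> X" shows "lap (\<lambda>x. c * u x) x = c * lap u x"
proof -
  have 1: "L1 V (\<lambda>x. c * u x) y = c * L1 V u y" if "y \<in> X" for y V
    unfolding L1_def[of V "\<lambda>x. c * u x"]
    using DERIV_cmult[OF L1_has_derivative(1)[OF assms(1) that, of V 0], of c]
    by (simp add: DERIV_imp_deriv)
  have "L1 V (L1 V (\<lambda>x. c * u x)) x = deriv (\<lambda>s. c * L1 V u (translate (ex (s *\<^sub>R V)) x)) 0" for V
    unfolding L1_def[of V "L1 V (\<lambda>x. c * u x)"] by (simp add: 1 translate_X assms(2))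
  also have "\<dots> V = c * L1 V (L1 V u) x" for V
    using DERIV_cmult[OF L1_has_derivative(2)[OF assms, of V 0], of c]
    by (simp add: DERIV_imp_deriv)
  finally show ?thesis by (simp add: lap_def sum_distrib_left mult_ac)
qed

end

context rank_one
begin

section \<open>A radial exhaustion function\<close>

definition nG :: "('g \<Rightarrow> 'g) \<Rightarrow> real" where "nG g = (\<Sum>e\<in>P0. Q (g e) (g e))"
text \<open>For \<open>V\<close> in \<open>p\<close>, decompose the vectors \<open>g e\<close> into
  eigenvectors of the symmetric operator \<open>br V\<close> and weight each eigenvalue by the
  squared length of the component. Then \<open>S1 V g / nG g\<close> and
  \<open>S2 V g / nG g\<close> are the mean and the second moment of the eigenvalue.\<close>

definition S1 :: "'g \<Rightarrow> ('g \<Rightarrow> 'g) \<Rightarrow> real" where "S1 V g = (\<Sum>e\<in>P0. Q (br V (g e)) (g e))"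
definition S2 :: "'g \<Rightarrow> ('g \<Rightarrow> 'g) \<Rightarrow> real" where "S2 V g = (\<Sum>e\<in>P0. Q (br V (g e)) (br V (g e)))"
definition var :: "'g \<Rightarrow> real \<Rightarrow> ('g \<Rightarrow> 'g) \<Rightarrow> real" where
  "var V c g = (\<Sum>e\<in>P0. Q (br V (g e) - c *\<^sub>R g e) (br V (g e) - c *\<^sub>R g e))"
text \<open>Along a one-parameter group, \<open>N\<close> is the logarithm of a sum of exponentials. Hence its second
  derivative is four times a variance (see \<open>var\<close>), and all its derivatives are bounded.\<close>
definition N :: "('g \<Rightarrow> 'g) set \<Rightarrow> real" where "N x = ln (nG (SOME g. g \<in> G \<and> cs g = x))"

lemma sum_E0: "(\<And>e. e \<in> K0 \<Longrightarrow> f e = 0) \<Longrightarrow> (\<Sum>e\<in>E0. sg e * f e) = (\<Sum>e\<in>P0. f e)"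
  using P0(1) K0(3) P0_K0_disjoint by (simp add: sum.union_disjoint sg_def)

text \<open>A trace over \<open>p\<close> does not depend on the orthonormal basis. This is read off
  from \<open>casimir_invariant\<close>: after composition with the projection \<open>pp\<close> to
  \<open>p\<close>, the Casimir sum keeps only the terms of \<open>P0\<close>.\<close>

lemma nG_K: assumes g: "g \<in> G" and k: "k \<in> K" shows "nG (g \<circ> k) = nG g"
proof -
  define pp where "pp x = (1/2) *\<^sub>R (x - th x)" for x
  define \<beta> where "\<beta> x y = Q (g (pp x)) (g (pp y))" for x y
  have lin: "linear (\<lambda>x. g (pp x))"
    using G_linear[OF g]
    by (intro linearI) (simp_all add: pp_def linear_add linear_diff linear_scale algebra_simps)
  have bil: "bilinear \<beta>"
    unfolding bilinear_def \<beta>_def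
    by (auto intro!: linearI simp: linear_add[OF lin] linear_scale[OF lin] Q.add_left Q.add_right Q.scaleR_left Q.scaleR_right)
  have g0: "g 0 = 0" using G_linear[OF g] by (rule linear_0)
  have 1: "\<beta> e e = 0" "\<beta> (k e) (k e) = 0" if "e \<in> K0" for e
    using K_th[OF k, of e] K0_th[OF that] by (simp_all add: \<beta>_def pp_def Q.zero_left g0)
  have 2: "\<beta> e e = Q (g e) (g e)" "\<beta> (k e) (k e) = Q (g (k e)) (g (k e))" if "e \<in> P0" for e
  proof -
    have "pp e = e" using P0_th[OF that] by (simp add: pp_def flip: scaleR_2)
    moreover have "th (k e) = - k e"
      using K_th[OF k, of e] P0_th[OF that] linear_neg[OF G_linear[OF K_G[OF k]], of e] by simp
    then have "pp (k e) = k e" by (simp add: pp_def flip: scaleR_2)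
    ultimately show "\<beta> e e = Q (g e) (g e)" "\<beta> (k e) (k e) = Q (g (k e)) (g (k e))"
      by (simp_all add: \<beta>_def)
  qed
  have "nG (g \<circ> k) = (\<Sum>e\<in>P0. \<beta> (k e) (k e))" by (simp add: nG_def 2)
  also have "\<dots> = (\<Sum>e\<in>E0. sg e * \<beta> (k e) (k e))" by (rule sum_E0[symmetric]) (simp add: 1)
  also have "\<dots> = (\<Sum>e\<in>E0. sg e * \<beta> e e)" by (rule casimir_invariant[OF bil K_G[OF k]])
  also have "\<dots> = (\<Sum>e\<in>P0. \<beta> e e)" by (rule sum_E0) (simp add: 1)
  also have "\<dots> = nG g" by (simp add: nG_def 2)
  finally show ?thesis .
qed

lemma N_cs: assumes "g \<in> G" shows "N (cs g) = ln (nG g)"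
proof -
  define h where "h = (SOME h. h \<in> G \<and> cs h = cs g)"
  have h: "h \<in> G" "cs h = cs g" using someI[of "\<lambda>h. h \<in> G \<and> cs h = cs g" g] assms by (auto simp: h_def)
  obtain k where "k \<in> K" "h = g \<circ> k" using cs_eqD[OF h(2)] by blast
  then show ?thesis using nG_K[OF assms] by (simp add: N_def flip: h_def)
qed

lemma nG_left_K: "k \<in> K \<Longrightarrow> nG (k \<circ> g) = nG g"
  by (simp add: nG_def K_Q)

lemma N_K: "k \<in> K \<Longrightarrow> x \<in> X \<Longrightarrow> N (translate k x) = N x"
  by (auto simp: X_iff N_cs G_comp K_G nG_left_K)

lemma G_eq_0: "g \<in> G \<Longrightarrow> g v = 0 \<longleftrightarrow> v = 0"
  using G_inv_simps(2)[of g v] linear_0[OF G_linear[of g]] linear_0[OF G_linear[OF G_inv[of g]]] by auto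

lemma P0_ne: "P0 \<noteq> {}"
proof
  assume "P0 = {}"
  then have "p = {0}" using P0(3) by simp
  moreover have "H0 \<in> p" by (simp add: p_iff)
  ultimately show False using H0_nz by simp
qed

lemma nG_pos: assumes "g \<in> G" shows "nG g > 0"
  unfolding nG_def
proof (rule sum_pos)
  fix e assume "e \<in> P0"
  then have "Q e e = 1" using P0(4) by (simp add: onb_def)
  then have "e \<noteq> 0" by (auto simp: Q.zero_left)
  then show "Q (g e) (g e) > 0" using G_eq_0[OF assms] by (intro Q_pos) simp
qed (use P0(1) P0_ne in auto)

lemma continuous_on_eval: "continuous_on S (\<lambda>g::'g \<Rightarrow> 'g. g a)"
  by (rule continuous_on_subset[OF continuous_on_product_coordinates subset_UNIV])

lemma C1_matrix_coefficient:
  shows "C1 (\<lambda>g. Q (g a) (g b))"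
    and "\<And>Y g. g \<in> G \<Longrightarrow> D Y (\<lambda>g. Q (g a) (g b)) g = Q (g (br Y a)) (g b) + Q (g a) (g (br Y b))"
proof -
  have c: "continuous_on G (\<lambda>g. Q (g a) (g b))"
    "\<And>Y. continuous_on G (\<lambda>g. Q (g (br Y a)) (g b) + Q (g a) (g (br Y b)))"
    by (intro continuous_on_add Q.continuous_on continuous_on_eval)+
  have e: "((\<lambda>s. Q ((g \<circ> ex (s *\<^sub>R Y)) a) ((g \<circ> ex (s *\<^sub>R Y)) b)) has_real_derivative
      Q (g (br Y a)) (g b) + Q (g a) (g (br Y b))) (at 0)" if g: "g \<in> G" for g Y
  proof -
    have bl: "bounded_linear g" using G_linear[OF g] by (simp add: linear_conv_bounded_linear)
    have d: "((\<lambda>s. g (ex (s *\<^sub>R Y) v)) has_vector_derivative g (ex (0 *\<^sub>R Y) (br Y v))) (at 0)" for v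
      by (rule bounded_linear.has_vector_derivative[OF bl has_derivative_ex])
    show ?thesis
      using Q.has_vector_derivative[OF d[of a] d[of b]]
      by (simp add: has_real_derivative_iff_has_vector_derivative add.commute)
  qed
  note I = C1_I[where F="\<lambda>g. Q (g a) (g b)" and F'="\<lambda>Y g. Q (g (br Y a)) (g b) + Q (g a) (g (br Y b))"]
  show "C1 (\<lambda>g. Q (g a) (g b))" by (rule I(1)[OF c e])
  show "\<And>Y g. g \<in> G \<Longrightarrow> D Y (\<lambda>g. Q (g a) (g b)) g = Q (g (br Y a)) (g b) + Q (g a) (g (br Y b))"
    by (rule I(2)[OF c e])
qed

lemma C2_matrix_coefficient: "C2 (\<lambda>g. Q (g a) (g b))"
  by (rule C2_I[where F'="\<lambda>Y g. Q (g (br Y a)) (g b) + Q (g a) (g (br Y b))",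
        OF C1_matrix_coefficient(1) C1_add(1)[OF C1_matrix_coefficient(1) C1_matrix_coefficient(1)]
        C1_matrix_coefficient(2)])

lemma C2_sum: "finite S \<Longrightarrow> (\<And>i. i \<in> S \<Longrightarrow> C2 (F i)) \<Longrightarrow> C2 (\<lambda>g. \<Sum>i\<in>S. F i g)"
  by (induction S rule: finite_induct) (auto intro: C2_add C2_const)

lemma C2_cong: assumes "C2 F" "\<And>g. g \<in> G \<Longrightarrow> F' g = F g" shows "C2 F'"
  by (rule C2_I[where F'="\<lambda>Y. D Y F", OF C1_cong(1)[OF C2_C1[OF assms(1)] assms(2)] C2_D[OF assms(1)]
      C1_cong(2)[OF C2_C1[OF assms(1)] assms(2)]])

lemma C2X_N: "C2X N"
  unfolding C2X_def
proof (rule C2_cong)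
  have "C2 nG" unfolding nG_def[abs_def] by (intro C2_sum P0(1) C2_matrix_coefficient)
  then show "C2 (\<lambda>g. ln (nG g))"
  proof (rule C2_compose[where \<phi>'=inverse and \<phi>''="\<lambda>x. - (inverse x ^ 2)"])
    fix g assume "g \<in> G"
    then have n: "nG g > 0" by (rule nG_pos)
    show "(ln has_real_derivative inverse (nG g)) (at (nG g))" using n by (rule DERIV_ln)
    show "(inverse has_real_derivative - (inverse (nG g))\<^sup>2) (at (nG g))"
      using n DERIV_inverse[of "nG g"] by (simp add: numeral_2_eq_2)
  next
    show "continuous_on (nG ` G) (\<lambda>x. - (inverse x)\<^sup>2)"
      by (intro continuous_intros) (use nG_pos in force)
  qed
qed (simp add: N_cs)

lemma sums_flow:
  assumes V: "V \<in> p" and g: "g \<in> G"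
  shows "((\<lambda>s. nG (ex (s *\<^sub>R V) \<circ> g)) has_real_derivative 2 * S1 V (ex (s *\<^sub>R V) \<circ> g)) (at s)"
    and "((\<lambda>s. S1 V (ex (s *\<^sub>R V) \<circ> g)) has_real_derivative 2 * S2 V (ex (s *\<^sub>R V) \<circ> g)) (at s)"
proof -
  have com: "ex (s *\<^sub>R V) (br V v) = br V (ex (s *\<^sub>R V) v)" for v
    using ex_br[of "s *\<^sub>R V" V v] ex_self[of s V] by simp
  have d: "((\<lambda>s. ex (s *\<^sub>R V) v) has_vector_derivative br V (ex (s *\<^sub>R V) v)) (at s)" for v
    using has_derivative_ex[of V v s UNIV] by (simp add: com)
  have bl: "bounded_linear (br V)" by (rule br.bounded_linear_right)
  have "((\<lambda>s. Q (ex (s *\<^sub>R V) v) (ex (s *\<^sub>R V) v)) has_real_derivative 2 * Q (br V (ex (s *\<^sub>R V) v)) (ex (s *\<^sub>R V) v)) (at s)" for v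
    using Q.has_vector_derivative[OF d[of v] d[of v]] Q_sym[of "ex (s *\<^sub>R V) v"]
    by (simp add: has_real_derivative_iff_has_vector_derivative)
  then show "((\<lambda>s. nG (ex (s *\<^sub>R V) \<circ> g)) has_real_derivative 2 * S1 V (ex (s *\<^sub>R V) \<circ> g)) (at s)"
    unfolding nG_def S1_def sum_distrib_left comp_apply by (intro DERIV_sum)
  have "((\<lambda>s. Q (br V (ex (s *\<^sub>R V) v)) (ex (s *\<^sub>R V) v)) has_real_derivative 2 * Q (br V (ex (s *\<^sub>R V) v)) (br V (ex (s *\<^sub>R V) v))) (at s)" for v
    using Q.has_vector_derivative[OF bounded_linear.has_vector_derivative[OF bl d[of v]] d[of v]]
      ad_p_symmetric[OF V, of "br V (ex (s *\<^sub>R V) v)" "ex (s *\<^sub>R V) v"]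
    by (simp add: has_real_derivative_iff_has_vector_derivative)
  then show "((\<lambda>s. S1 V (ex (s *\<^sub>R V) \<circ> g)) has_real_derivative 2 * S2 V (ex (s *\<^sub>R V) \<circ> g)) (at s)"
    unfolding S2_def S1_def sum_distrib_left comp_apply by (intro DERIV_sum)
qed

lemma L1_N: assumes V: "V \<in> p" and g: "g \<in> G" shows "L1 V N (cs g) = 2 * S1 V g / nG g"
proof -
  have "((\<lambda>s. ln (nG (ex (s *\<^sub>R V) \<circ> g))) has_real_derivative inverse (nG g) * (2 * S1 V g)) (at 0)"
    using DERIV_chain2[where f=ln, OF _ sums_flow(1)[OF V g, of 0]] DERIV_ln[OF nG_pos[OF g]] by simp
  then show ?thesis
    unfolding L1_def by (simp add: N_cs G_comp g DERIV_imp_deriv divide_inverse mult.commute)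
qed

lemma L1_L1_N: assumes V: "V \<in> p" and g: "g \<in> G"
  shows "L1 V (L1 V N) (cs g) = 4 * (S2 V g / nG g - (S1 V g / nG g)\<^sup>2)"
proof -
  have n: "nG g \<noteq> 0" using nG_pos[OF g] by simp
  have "((\<lambda>s. 2 * S1 V (ex (s *\<^sub>R V) \<circ> g) / nG (ex (s *\<^sub>R V) \<circ> g)) has_real_derivative
      ((2 * (2 * S2 V g)) * nG g - (2 * S1 V g) * (2 * S1 V g)) / (nG g * nG g)) (at 0)"
    using DERIV_divide[OF DERIV_cmult[OF sums_flow(2)[OF V g, of 0], of 2] sums_flow(1)[OF V g, of 0]] n by simp
  then have "L1 V (L1 V N) (cs g) = ((2 * (2 * S2 V g)) * nG g - (2 * S1 V g) * (2 * S1 V g)) / (nG g * nG g)"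
    unfolding L1_def[of V "L1 V N"] by (simp add: L1_N V G_comp g DERIV_imp_deriv)
  also have "\<dots> = 4 * (S2 V g / nG g - (S1 V g / nG g)\<^sup>2)"
    using n by (simp add: field_simps power2_eq_square)
  finally show ?thesis .
qed

lemma L1_N_K0: assumes "th Z = Z" "x \<in> X" shows "L1 Z N x = 0" "L1 Z (L1 Z N) x = 0"
proof -
  have "ex (s *\<^sub>R Z) \<in> K" for s by (rule K_ex) (simp add: assms)
  then have 1: "L1 Z N y = 0" if "y \<in> X" for y unfolding L1_def by (simp add: N_K that)
  then show "L1 Z N x = 0" using assms by blast
  show "L1 Z (L1 Z N) x = 0" unfolding L1_def[of Z "L1 Z N"] by (simp add: 1 translate_X assms)
qed

lemma var_eq: "var V c g = S2 V g - 2 * c * S1 V g + c\<^sup>2 * nG g"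
proof -
  have "Q (br V w - c *\<^sub>R w) (br V w - c *\<^sub>R w) = Q (br V w) (br V w) - 2 * c * Q (br V w) w + c\<^sup>2 * Q w w" for w
    using Q_sym[of w "br V w"]
    by (simp add: Q.diff_left Q.diff_right Q.scaleR_left Q.scaleR_right power2_eq_square algebra_simps)
  then show ?thesis
    by (simp add: var_def S1_def S2_def nG_def sum.distrib sum_subtractf sum_distrib_left)
qed

lemma var_min: assumes "g \<in> G" shows "var V (S1 V g / nG g) g \<le> var V c g"
proof -
  have n: "nG g > 0" using assms by (rule nG_pos)
  have "var V c g - var V (S1 V g / nG g) g = nG g * (c - S1 V g / nG g)\<^sup>2"
    unfolding var_eq using n by (simp add: field_simps power2_eq_square)
  moreover have "\<dots> \<ge> 0" using n by simp
  ultimately show ?thesis by linarith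
qed

lemma L1_L1_N_var: assumes V: "V \<in> p" and g: "g \<in> G"
  shows "L1 V (L1 V N) (cs g) = 4 * var V (S1 V g / nG g) g / nG g"
  unfolding L1_L1_N[OF V g] var_eq using nG_pos[OF g] by (simp add: field_simps power2_eq_square)

lemma L1_L1_N_nonneg: assumes V: "V \<in> p" and x: "x \<in> X" shows "L1 V (L1 V N) x \<ge> 0"
proof -
  obtain g where g: "g \<in> G" "x = cs g" using x by (auto simp: X_iff)
  have "var V c g \<ge> 0" for c unfolding var_def by (simp add: sum_nonneg)
  then show ?thesis using nG_pos[OF g(1)] by (simp add: L1_L1_N_var V g)
qed

lemma lap_N: "x \<in> X \<Longrightarrow> lap N x = (\<Sum>V\<in>P0. L1 V (L1 V N) x)"
  unfolding lap_def by (rule sum_E0) (simp add: L1_N_K0 K0_th)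

lemma operator_bound:
  obtains b where "b > 0" "\<And>T v. Q (app T v) (app T v) \<le> b * (norm T)\<^sup>2 * Q v v"
proof -
  obtain m where m: "0 < m" "\<And>v. m * (norm v)\<^sup>2 \<le> Q v v" using Q_ge by blast
  obtain M where M: "0 < M" "\<And>v. Q v v \<le> M * (norm v)\<^sup>2" using Q_le by blast
  have "Q (app T v) (app T v) \<le> M / m * (norm T)\<^sup>2 * Q v v" for T v
  proof -
    have "Q (app T v) (app T v) \<le> M * (norm (app T v))\<^sup>2" by (rule M)
    also have "\<dots> \<le> M * (norm T * norm v)\<^sup>2"
      using M(1) by (intro mult_left_mono power_mono norm_app) auto
    also have "\<dots> = M * (norm T)\<^sup>2 * (norm v)\<^sup>2" by (simp add: power_mult_distrib)
    also have "\<dots> \<le> M * (norm T)\<^sup>2 * (Q v v / m)"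
      using M(1) m by (intro mult_left_mono) (auto simp: pos_le_divide_eq mult.commute)
    finally show ?thesis by simp
  qed
  then show thesis using that[of "M / m"] M m by simp
qed

lemma flow_bound:
  obtains M where "M \<ge> 1"
    "\<And>V s v. V \<in> P0 \<Longrightarrow> \<bar>s\<bar> \<le> 1 \<Longrightarrow> Q (ex (s *\<^sub>R V) v) (ex (s *\<^sub>R V) v) \<le> M * Q v v"
    "\<And>V v. V \<in> P0 \<Longrightarrow> Q (br V v) (br V v) \<le> M * Q v v"
proof -
  obtain b where b: "b > 0" "\<And>T v. Q (app T v) (app T v) \<le> b * (norm T)\<^sup>2 * Q v v"
    using operator_bound by blast
  define a where "a = (\<Sum>V\<in>P0. norm (ad V))"
  have a: "norm (ad V) \<le> a" if "V \<in> P0" for V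
    unfolding a_def using P0(1) that by (intro member_le_sum) auto
  have a0: "a \<ge> 0" unfolding a_def by (intro sum_nonneg) auto
  define M where "M = b * (exp a)\<^sup>2 + b * a\<^sup>2 + 1"
  have M: "b * (exp a)\<^sup>2 \<le> M" "b * a\<^sup>2 \<le> M" "1 \<le> M" using b(1) by (auto simp: M_def)
  show thesis
  proof (rule that[OF M(3)])
    fix V v and s :: real assume V: "V \<in> P0" and s: "\<bar>s\<bar> \<le> 1"
    have "norm (exp (s *\<^sub>R ad V)) \<le> exp (norm (s *\<^sub>R ad V))" by (rule norm_exp)
    also have "\<dots> \<le> exp a"
    proof -
      have "\<bar>s\<bar> * norm (ad V) \<le> 1 * a" using s a[OF V] a0 by (intro mult_mono) auto
      then show ?thesis by simp
    qed
    finally have n: "norm (exp (s *\<^sub>R ad V)) \<le> exp a" .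
    have "Q (ex (s *\<^sub>R V) v) (ex (s *\<^sub>R V) v) \<le> b * (norm (exp (s *\<^sub>R ad V)))\<^sup>2 * Q v v"
      using b(2)[of "exp (s *\<^sub>R ad V)" v] by (simp add: ex_app ad_simps)
    also have "\<dots> \<le> b * (exp a)\<^sup>2 * Q v v"
      using b(1) n by (intro mult_right_mono mult_left_mono power_mono) auto
    also have "\<dots> \<le> M * Q v v" using M by (intro mult_right_mono) auto
    finally show "Q (ex (s *\<^sub>R V) v) (ex (s *\<^sub>R V) v) \<le> M * Q v v" .
  next
    fix V v assume V: "V \<in> P0"
    have "Q (br V v) (br V v) \<le> b * (norm (ad V))\<^sup>2 * Q v v" using b(2)[of "ad V" v] by simp
    also have "\<dots> \<le> b * a\<^sup>2 * Q v v"
      using b(1) a[OF V] by (intro mult_right_mono mult_left_mono power_mono) auto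
    also have "\<dots> \<le> M * Q v v" using M by (intro mult_right_mono) auto
    finally show "Q (br V v) (br V v) \<le> M * Q v v" .
  qed
qed

lemma N_derivative_bounds:
  obtains C where "C > 0" "\<And>V x. V \<in> P0 \<Longrightarrow> x \<in> X \<Longrightarrow> \<bar>L1 V N x\<bar> \<le> C"
    "\<And>V x. V \<in> P0 \<Longrightarrow> x \<in> X \<Longrightarrow> L1 V (L1 V N) x \<le> C"
proof -
  obtain M where M: "M \<ge> 1" "\<And>V v. V \<in> P0 \<Longrightarrow> Q (br V v) (br V v) \<le> M * Q v v" by (rule flow_bound) auto
  have 1: "\<bar>L1 V N x\<bar> \<le> 4 * M" and 2: "L1 V (L1 V N) x \<le> 4 * M" if V: "V \<in> P0" and x: "x \<in> X" for V x
  proof -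
    obtain g where g: "g \<in> G" "x = cs g" using x by (auto simp: X_iff)
    have Vp: "V \<in> p" using V P0(2) by auto
    have n: "nG g > 0" by (rule nG_pos[OF g(1)])
    have q: "\<bar>Q (br V v) v\<bar> \<le> M * Q v v" for v
    proof -
      have "(Q (br V v) v)\<^sup>2 \<le> Q (br V v) (br V v) * Q v v" by (rule Q_cauchy)
      also have "\<dots> \<le> (M * Q v v) * (M * Q v v)"
      proof (rule mult_mono[OF M(2)[OF V]])
        show "Q v v \<le> M * Q v v" using mult_right_mono[OF M(1), of "Q v v"] by simp
      qed (use M(1) in auto)
      finally have "(Q (br V v) v)\<^sup>2 \<le> (M * Q v v)\<^sup>2" by (simp add: power2_eq_square)
      then show ?thesis using M(1) by (intro power2_le_imp_le[of "\<bar>Q (br V v) v\<bar>"]) auto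
    qed
    have "\<bar>S1 V g\<bar> \<le> (\<Sum>e\<in>P0. \<bar>Q (br V (g e)) (g e)\<bar>)" unfolding S1_def by (rule sum_abs)
    also have "\<dots> \<le> M * nG g" unfolding nG_def sum_distrib_left by (intro sum_mono q)
    finally have s1: "\<bar>S1 V g\<bar> \<le> M * nG g" .
    then have "\<bar>S1 V g / nG g\<bar> \<le> M" using n by (simp add: pos_divide_le_eq)
    then show "\<bar>L1 V N x\<bar> \<le> 4 * M" using M(1) unfolding g(2) L1_N[OF Vp g(1)] by simp
    have "S2 V g \<le> M * nG g" unfolding S2_def nG_def sum_distrib_left by (intro sum_mono M(2) V)
    then have "S2 V g / nG g \<le> M" using n by (simp add: pos_divide_le_eq)
    then show "L1 V (L1 V N) x \<le> 4 * M" unfolding g(2) L1_L1_N[OF Vp g(1)]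
      using zero_le_power2[of "S1 V g / nG g"] by (simp add: diff_le_eq add_increasing2)
  qed
  show thesis by (rule that[of "4 * M"]) (use M(1) 1 2 in auto)
qed

lemma exp_invariant_subspace:
  assumes W: "subspace W" "\<And>w. w \<in> W \<Longrightarrow> app T w \<in> W" and w: "w \<in> W"
  shows "app (exp T) w \<in> W"
proof -
  have "(\<lambda>n. app (T ^ n /\<^sub>R fact n) w) sums app (exp T) w"
    using bounded_linear.sums[OF app.bounded_linear_left exp_converges] .
  then have lim: "(\<lambda>n. \<Sum>i<n. app (T ^ i /\<^sub>R fact i) w) \<longlonglongrightarrow> app (exp T) w" by (simp add: sums_def)
  have "app (T ^ i) w \<in> W" for i by (induction i) (use w W(2) in auto)
  then have "app (T ^ i /\<^sub>R fact i) w \<in> W" for i using W(1) by (simp add: app.scaleR_left subspace_scale)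
  then have "(\<Sum>i<n. app (T ^ i /\<^sub>R fact i) w) \<in> W" for n using W(1) by (intro subspace_sum)
  then show ?thesis using closed_sequentially[OF closed_subspace[OF W(1)] _ lim] by blast
qed

text \<open>\<open>zp\<close> is an ideal, so by \<open>Q_br\<close> its orthogonal complement
  \<open>W\<close> is invariant under every \<open>br V\<close>, hence under the exponentials and
  under \<open>G\<close>. It contains \<open>p\<close> because \<open>zp\<close> is fixed by
  \<open>th\<close>.\<close>

lemma G_p_orthogonal_zp:
  assumes "g \<in> G" "e \<in> p" "z \<in> zp" shows "Q (g e) z = 0"
proof -
  define W where "W = {v. \<forall>z\<in>zp. Q v z = 0}"
  have sub: "subspace W" by (auto simp: W_def subspace_def Q.add_left Q.scaleR_left Q.zero_left)
  have zbr: "br V z \<in> zp" if z: "z \<in> zp" for V z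
  proof -
    define Vp where "Vp = (1/2) *\<^sub>R (V - th V)"
    define Vk where "Vk = (1/2) *\<^sub>R (V + th V)"
    have V: "V = Vp + Vk" by (simp add: Vp_def Vk_def flip: scaleR_add_right scaleR_2)
    have th: "th Vp = - Vp" "th Vk = Vk" by (simp_all add: Vp_def Vk_def algebra_simps)
    have "br V z = br Vk z" using z th(1) by (simp add: V br.add_left zp_def)
    moreover have "br Y (br Vk z) = 0" if Y: "th Y = - Y" for Y
    proof -
      have "th (br Y Vk) = - br Y Vk" by (simp add: th_br Y th br.minus_left)
      then have "br (br Y Vk) z = 0" "br Y z = 0" using z Y by (auto simp: zp_def)
      then show ?thesis using br_deriv[of Y Vk z] by (simp add: br.zero_right)
    qed
    ultimately show ?thesis by (simp add: zp_def)
  qed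
  have Wbr: "br V w \<in> W" if "w \<in> W" for V w
    using that zbr by (auto simp: W_def Q_br)
  have "g e \<in> W" using assms(1,2)
  proof (induction arbitrary: e rule: adjoint_group.induct)
    case one
    then show ?case using zp_th Q_p_k by (auto simp: W_def)
  next
    case (step g V)
    have "g w \<in> W" if "w \<in> W" for w
      using step(1) that
    proof (induction arbitrary: w rule: adjoint_group.induct)
      case (step g V)
      have "ex V w \<in> W"
        unfolding ex_app by (rule exp_invariant_subspace[OF sub _ step(3)]) (simp add: Wbr)
      then show ?case using step(2) by simp
    qed simp
    moreover have "ex V e \<in> W"
      unfolding ex_app
    proof (rule exp_invariant_subspace[OF sub])
      show "app (ad V) w \<in> W" if "w \<in> W" for w using Wbr[OF that] by simp
      show "e \<in> W" using step(3) zp_th Q_p_k by (auto simp: W_def)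
    qed
    ultimately show ?case by simp
  qed
  then show ?thesis using assms(3) by (auto simp: W_def)
qed

text \<open>By \<open>L1_L1_N_var\<close>, \<open>lap N\<close> is four times a sum of variances
  divided by \<open>nG\<close>. If the sum over \<open>V\<close> is taken first, each vector
  \<open>g e\<close> is orthogonal to \<open>zp\<close> and \<open>variance_bound\<close> applies,
  with the common mean as \<open>mu\<close> for all \<open>e\<close>.\<close>

lemma lap_N_pos: obtains c where "c > 0" "\<And>x. x \<in> X \<Longrightarrow> c \<le> lap N x"
proof -
  obtain c where c: "0 < c" "\<And>v mu. (\<And>z. z \<in> zp \<Longrightarrow> Q v z = 0) \<Longrightarrow>
       c * Q v v \<le> (\<Sum>Y\<in>P0. Q (br Y v - mu Y *\<^sub>R v) (br Y v - mu Y *\<^sub>R v))"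
    using variance_bound[OF P0(1,3)] by blast
  have "4 * c \<le> lap N x" if x: "x \<in> X" for x
  proof -
    obtain g where g: "g \<in> G" "x = cs g" using x by (auto simp: X_iff)
    have n: "nG g > 0" by (rule nG_pos[OF g(1)])
    have "c * nG g \<le> (\<Sum>e\<in>P0. \<Sum>V\<in>P0. Q (br V (g e) - (S1 V g / nG g) *\<^sub>R g e) (br V (g e) - (S1 V g / nG g) *\<^sub>R g e))"
      unfolding nG_def[of g] sum_distrib_left
      by (intro sum_mono c(2) G_p_orthogonal_zp[OF g(1)]) (use P0(2) in auto)
    also have "\<dots> = (\<Sum>V\<in>P0. var V (S1 V g / nG g) g)" unfolding var_def by (rule sum.swap)
    finally have "4 * c \<le> (\<Sum>V\<in>P0. 4 * var V (S1 V g / nG g) g / nG g)"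
      using n by (simp add: pos_le_divide_eq mult_ac flip: sum_divide_distrib sum_distrib_left)
    also have "\<dots> = lap N x"
      unfolding g(2) lap_N[OF x, unfolded g(2)] using P0(2) g(1)
      by (intro sum.cong refl) (auto simp: L1_L1_N_var)
    finally show ?thesis .
  qed
  then show thesis using c(1) by (intro that[of "4 * c"]) auto
qed

lemma lap_N_le: obtains C where "C > 0" "\<And>x. x \<in> X \<Longrightarrow> \<bar>lap N x\<bar> \<le> C"
    "\<And>x. x \<in> X \<Longrightarrow> (\<Sum>V\<in>P0. (L1 V N x)\<^sup>2) \<le> C"
proof -
  obtain C where C: "C > 0" "\<And>V x. V \<in> P0 \<Longrightarrow> x \<in> X \<Longrightarrow> \<bar>L1 V N x\<bar> \<le> C"
    "\<And>V x. V \<in> P0 \<Longrightarrow> x \<in> X \<Longrightarrow> L1 V (L1 V N) x \<le> C"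
    using N_derivative_bounds by blast
  define n where "n = real (card P0)"
  have n0: "n \<ge> 0" by (simp add: n_def)
  have 1: "\<bar>lap N x\<bar> \<le> n * C" if x: "x \<in> X" for x
  proof -
    have "0 \<le> lap N x" unfolding lap_N[OF x] using x P0(2) by (intro sum_nonneg L1_L1_N_nonneg) auto
    moreover have "lap N x \<le> n * C" unfolding lap_N[OF x] n_def
      using sum_bounded_above[of P0 "\<lambda>V. L1 V (L1 V N) x" C] C(3) x by simp
    ultimately show ?thesis by simp
  qed
  have 2: "(\<Sum>V\<in>P0. (L1 V N x)\<^sup>2) \<le> n * C\<^sup>2" if x: "x \<in> X" for x
  proof -
    have "(L1 V N x)\<^sup>2 \<le> C\<^sup>2" if "V \<in> P0" for V
      using C(1) C(2)[OF that x] abs_le_square_iff[of "L1 V N x" C] by simp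
    then show ?thesis unfolding n_def using sum_bounded_above[of P0 "\<lambda>V. (L1 V N x)\<^sup>2" "C\<^sup>2"] by simp
  qed
  show thesis
  proof (rule that[of "n * C + n * C\<^sup>2 + 1"])
    have nn: "n * C \<ge> 0" "n * C\<^sup>2 \<ge> 0" using n0 C(1) by auto
    then show "n * C + n * C\<^sup>2 + 1 > 0" by linarith
    show "\<bar>lap N x\<bar> \<le> n * C + n * C\<^sup>2 + 1" if "x \<in> X" for x using 1[OF that] nn by linarith
    show "(\<Sum>V\<in>P0. (L1 V N x)\<^sup>2) \<le> n * C + n * C\<^sup>2 + 1" if "x \<in> X" for x using 2[OF that] nn by linarith
  qed
qed

text \<open>Each increment is \<open>L1 V (L1 V N)\<close> at an intermediate point of the flow, the
  coset of \<open>h\<close>. Moving along the flow for a time of at most 1 changes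
  \<open>Q v v\<close> by a factor of at most \<open>M\<close>, and the mean at \<open>g\<close>
  minimizes the variance there; so the second derivative at \<open>x\<close> is at most
  \<open>M\<^sup>2\<close> times the one at \<open>cs h\<close>. Summing over \<open>V\<close>
  brings in \<open>lap_N_pos\<close>.\<close>

lemma escape:
  obtains \<kappa> where "\<kappa> > 0"
    "\<And>x. x \<in> X \<Longrightarrow> \<kappa> \<le> (\<Sum>V\<in>P0. L1 V N (translate (ex V) x) - L1 V N x)"
proof -
  obtain M where M: "M \<ge> 1"
    "\<And>V s v. V \<in> P0 \<Longrightarrow> \<bar>s\<bar> \<le> 1 \<Longrightarrow> Q (ex (s *\<^sub>R V) v) (ex (s *\<^sub>R V) v) \<le> M * Q v v"
    by (rule flow_bound) auto
  obtain c where c: "c > 0" "\<And>x. x \<in> X \<Longrightarrow> c \<le> lap N x" by (rule lap_N_pos) auto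
  have main: "L1 V (L1 V N) x / M\<^sup>2 \<le> L1 V N (translate (ex V) x) - L1 V N x"
    if V: "V \<in> P0" and x: "x \<in> X" for V x
  proof -
    obtain g where g: "g \<in> G" "x = cs g" using x by (auto simp: X_iff)
    have Vp: "V \<in> p" using V P0(2) by auto
    define \<phi> where "\<phi> s = L1 V N (translate (ex (s *\<^sub>R V)) x)" for s
    have "\<exists>z>0. z < 1 \<and> \<phi> 1 - \<phi> 0 = (1 - 0) * L1 V (L1 V N) (translate (ex (z *\<^sub>R V)) x)"
      by (rule MVT2) (auto simp: \<phi>_def intro: L1_has_derivative(2)[OF C2X_N x])
    then obtain z where z: "0 < z" "z < 1" "\<phi> 1 - \<phi> 0 = L1 V (L1 V N) (translate (ex (z *\<^sub>R V)) x)"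
      by auto
    define h where "h = ex (z *\<^sub>R V) \<circ> g"
    have hG: "h \<in> G" unfolding h_def by (intro G_comp g G_ex)
    have n: "nG g > 0" "nG h > 0" using nG_pos g hG by auto
    have nh: "nG h \<le> M * nG g"
      unfolding nG_def sum_distrib_left h_def comp_apply using V z by (intro sum_mono M(2)) auto
    define m where "m = S1 V h / nG h"
    have vh: "var V m g \<le> M * var V m h"
      unfolding var_def sum_distrib_left
    proof (intro sum_mono)
      fix e
      let ?w = "br V (h e) - m *\<^sub>R h e"
      have l: "linear (ex (- z *\<^sub>R V))" by (rule G_linear) simp
      have s: "ex (- z *\<^sub>R V) (h e) = g e" by (simp add: h_def)
      have "ex (- z *\<^sub>R V) ?w = br V (g e) - m *\<^sub>R g e"
        using ex_br[of "- z *\<^sub>R V" V "h e"] ex_self[of "- z" V]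
        by (simp only: linear_diff[OF l] linear_scale[OF l] s)
      then show "Q (br V (g e) - m *\<^sub>R g e) (br V (g e) - m *\<^sub>R g e) \<le> M * Q ?w ?w"
        using M(2)[OF V, of "- z" ?w] z by simp
    qed
    have v0: "0 \<le> var V m h" unfolding var_def by (simp add: sum_nonneg)
    have "L1 V (L1 V N) x = 4 * var V (S1 V g / nG g) g / nG g"
      unfolding g(2) by (rule L1_L1_N_var[OF Vp g(1)])
    also have "\<dots> \<le> 4 * (M * var V m h) / nG g"
      using var_min[OF g(1), of V m] vh n by (intro divide_right_mono) auto
    also have "\<dots> \<le> 4 * (M * var V m h) / (nG h / M)"
      using M(1) nh n v0 by (intro divide_left_mono) (auto simp: pos_divide_le_eq mult.commute)
    also have "\<dots> = M\<^sup>2 * (4 * var V m h / nG h)" by (simp add: power2_eq_square)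
    also have "4 * var V m h / nG h = L1 V (L1 V N) (cs h)"
      unfolding m_def by (rule L1_L1_N_var[OF Vp hG, symmetric])
    also have "\<dots> = \<phi> 1 - \<phi> 0" unfolding z(3) g(2) h_def by simp
    finally show ?thesis using M(1) by (simp add: \<phi>_def pos_divide_le_eq mult.commute)
  qed
  have "c / M\<^sup>2 \<le> (\<Sum>V\<in>P0. L1 V N (translate (ex V) x) - L1 V N x)" if x: "x \<in> X" for x
  proof -
    have "c / M\<^sup>2 \<le> lap N x / M\<^sup>2" using c(2)[OF x] by (intro divide_right_mono) auto
    also have "\<dots> = (\<Sum>V\<in>P0. L1 V (L1 V N) x / M\<^sup>2)" unfolding lap_N[OF x] by (rule sum_divide_distrib)
    also have "\<dots> \<le> (\<Sum>V\<in>P0. L1 V N (translate (ex V) x) - L1 V N x)"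
      by (intro sum_mono main x)
    finally show ?thesis .
  qed
  then show thesis using c(1) M(1) by (intro that[of "c / M\<^sup>2"]) auto
qed

section \<open>The profile of \<open>N\<close> along a ray, and properness\<close>

definition nu :: "real \<Rightarrow> real" where "nu r = nG (ex (r *\<^sub>R H0))"

lemma H0_p: "H0 \<in> p" by (simp add: p_iff)

lemma nu_derivative:
  "(nu has_real_derivative 2 * S1 H0 (ex (r *\<^sub>R H0))) (at r)"
  "((\<lambda>r. S1 H0 (ex (r *\<^sub>R H0))) has_real_derivative 2 * S2 H0 (ex (r *\<^sub>R H0))) (at r)"
  using sums_flow[OF H0_p G_id, of r] by (simp_all add: nu_def[abs_def])

text \<open>Otherwise \<open>br H0\<close> would vanish on \<open>p\<close>, against
  \<open>root_vector\<close>.\<close>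

lemma S2_H0_pos: "S2 H0 (ex (r *\<^sub>R H0)) > 0"
proof -
  have "\<exists>e\<in>P0. br H0 e \<noteq> 0"
  proof (rule ccontr)
    assume "\<not> ?thesis"
    then have z: "br H0 e = 0" if "e \<in> P0" for e using that by auto
    have "br H0 v = 0" if "v \<in> span P0" for v
      using that by (induction rule: span_induct_alt) (auto simp: br.zero_right br.add_right br.scaleR_right z)
    moreover obtain Xp Xk where X: "th Xp = - Xp" "th Xk = Xk" "br H0 Xp = Xk" "br H0 Xk = Xp" "Xp \<noteq> 0"
      by (rule root_vector)
    ultimately have "br H0 Xp = 0" using P0(3) by (simp add: p_iff)
    then show False using X by (simp add: br.zero_right)
  qed
  then obtain e where e: "e \<in> P0" "br H0 e \<noteq> 0" by blast
  have "ex (r *\<^sub>R H0) (br H0 e) \<noteq> 0" using e(2) by (simp add: G_eq_0)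
  then have "br H0 (ex (r *\<^sub>R H0) e) \<noteq> 0" using ex_br[of "r *\<^sub>R H0" H0 e] ex_self[of r H0] by simp
  then show ?thesis unfolding S2_def
    by (intro sum_pos2[OF P0(1) e(1) Q_pos]) auto
qed

lemma S1_H0_0: "S1 H0 id = 0"
proof -
  have "Q (br H0 e) e = 0" if e: "e \<in> P0" for e
    using Q_p_k[of e "br H0 e"] e P0(2) P0_th[OF e] Q_sym[of e] by (auto simp: th_br br.minus_left br.minus_right)
  then show ?thesis by (simp add: S1_def)
qed

lemma S1_H0_mono:
  assumes "r < s" shows "S1 H0 (ex (r *\<^sub>R H0)) < S1 H0 (ex (s *\<^sub>R H0))"
  using assms
proof (rule DERIV_pos_imp_increasing)
  fix z assume "r \<le> z" "z \<le> s"
  have "0 < 2 * S2 H0 (ex (z *\<^sub>R H0))" by (simp add: S2_H0_pos)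
  then show "\<exists>y. ((\<lambda>r. S1 H0 (ex (r *\<^sub>R H0))) has_real_derivative y) (at z) \<and> 0 < y"
    using nu_derivative(2)[of z] by blast
qed

lemma S1_H0_pos: "r > 0 \<Longrightarrow> S1 H0 (ex (r *\<^sub>R H0)) > 0"
  using S1_H0_mono[of 0 r] by (simp add: S1_H0_0)

lemma nu_strict_mono: assumes "0 \<le> r" "r < s" shows "nu r < nu s"
proof -
  have "\<exists>z>r. z < s \<and> nu s - nu r = (s - r) * (2 * S1 H0 (ex (z *\<^sub>R H0)))"
    using assms(2) nu_derivative(1) by (rule MVT2)
  then obtain z where "r < z" "z < s" "nu s - nu r = (s - r) * (2 * S1 H0 (ex (z *\<^sub>R H0)))" by auto
  moreover have "(s - r) * (2 * S1 H0 (ex (z *\<^sub>R H0))) > 0"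
    using assms \<open>r < z\<close> S1_H0_pos[of z] by simp
  ultimately show ?thesis by linarith
qed

text \<open>Beyond 1 the derivative of \<open>nu\<close> is at least its value at 1, since
  \<open>S1 H0\<close> increases along the ray. Linear growth makes the sublevel sets of
  \<open>N\<close> bounded in \<open>N_proper\<close>.\<close>

lemma nu_growth: assumes "1 \<le> r" shows "(r - 1) * (2 * S1 H0 (ex H0)) \<le> nu r"
proof (cases "r = 1")
  case True
  then show ?thesis using nG_pos[of "ex (r *\<^sub>R H0)"] by (simp add: nu_def)
next
  case False
  then have "1 < r" using assms by simp
  then have "\<exists>z>1. z < r \<and> nu r - nu 1 = (r - 1) * (2 * S1 H0 (ex (z *\<^sub>R H0)))"
    using nu_derivative(1) by (rule MVT2)
  then obtain z where z: "1 < z" "z < r" "nu r - nu 1 = (r - 1) * (2 * S1 H0 (ex (z *\<^sub>R H0)))" by auto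
  have "(r - 1) * (2 * S1 H0 (ex H0)) \<le> (r - 1) * (2 * S1 H0 (ex (z *\<^sub>R H0)))"
    using S1_H0_mono[OF z(1)] assms by (intro mult_left_mono) auto
  also have "\<dots> \<le> nu r" using z(3) nG_pos[of "ex (1 *\<^sub>R H0)"] by (simp add: nu_def)
  finally show ?thesis .
qed

lemma continuous_ex: "continuous_on S ex"
proof (rule continuous_on_coordinatewise_then_product)
  fix v
  have "continuous_on S (\<lambda>Y. app (exp (ad Y)) v)"
    by (intro bounded_linear.continuous_on[OF app.bounded_linear_left]
        continuous_on_compose2[OF continuous_exp_algebra continuous_ad[OF continuous_on_id]]) auto
  then show "continuous_on S (\<lambda>Y. ex Y v)" by (simp add: ex_app)
qed

lemma continuous_E:
  assumes "continuous_on G (\<lambda>g. f (cs g))" shows "continuous_on S (\<lambda>Y. f (E Y))"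
  unfolding E_def by (rule continuous_on_compose2[OF assms continuous_ex]) auto

lemma N_E: assumes "Y \<in> p" shows "N (E Y) = ln (nu (sqrt (Q Y Y)))"
proof -
  have "N (E Y) = N (E (sqrt (Q Y Y) *\<^sub>R H0))"
    by (rule K_invariant_radial[OF N_K continuous_E[OF C2X_continuous[OF C2X_N]] assms])
  then show ?thesis by (simp add: E_def N_cs nu_def)
qed

lemma nu_pos: "nu r > 0" by (simp add: nu_def nG_pos)

lemma N_inject: assumes "Y \<in> p" "Y' \<in> p" "N (E Y) = N (E Y')" shows "Q Y Y = Q Y' Y'"
proof -
  have "nu (sqrt (Q Y Y)) = nu (sqrt (Q Y' Y'))" using assms nu_pos by (simp add: N_E)
  moreover have "sqrt (Q Y Y) \<ge> 0" "sqrt (Q Y' Y') \<ge> 0" by auto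
  ultimately have "sqrt (Q Y Y) = sqrt (Q Y' Y')"
    using nu_strict_mono by (metis less_irrefl linorder_cases)
  then show ?thesis by simp
qed

lemma N_org_le: assumes "x \<in> X" shows "N org \<le> N x"
proof -
  obtain Y where Y: "Y \<in> p" "x = E Y" using X_E[OF assms] by blast
  have 0: "N org = ln (nu 0)" by (simp add: org_cs N_cs nu_def)
  have "nu 0 \<le> nu (sqrt (Q Y Y))"
  proof (cases "sqrt (Q Y Y) = 0")
    case False
    then have "0 < sqrt (Q Y Y)" using Q_nonneg[of Y] by (simp add: less_le)
    then show ?thesis using nu_strict_mono[of 0 "sqrt (Q Y Y)"] by simp
  qed (simp add: Q.zero_left)
  then show ?thesis using Y nu_pos by (simp add: 0 N_E)
qed

lemma N_proper: obtains \<rho> where "\<And>Y. Y \<in> p \<Longrightarrow> N (E Y) \<le> R \<Longrightarrow> norm Y \<le> \<rho>"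
proof -
  obtain m where m: "0 < m" "\<And>v. m * (norm v)\<^sup>2 \<le> Q v v" using Q_ge by blast
  define s where "s = 2 * S1 H0 (ex H0)"
  have s: "s > 0" using S1_H0_pos[of 1] by (simp add: s_def)
  define r0 where "r0 = exp R / s + 1"
  have r0: "r0 \<ge> 1" using s by (simp add: r0_def)
  have "norm Y \<le> sqrt (r0\<^sup>2 / m)" if Y: "Y \<in> p" "N (E Y) \<le> R" for Y
  proof -
    let ?r = "sqrt (Q Y Y)"
    have "ln (nu ?r) \<le> R" using Y by (simp add: N_E)
    then have "exp (ln (nu ?r)) \<le> exp R" by (simp only: exp_le_cancel_iff)
    then have "nu ?r \<le> exp R" using nu_pos[of ?r] by simp
    have "?r \<le> r0"
    proof (cases "?r \<le> 1")
      case False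
      then have "(?r - 1) * s \<le> nu ?r" unfolding s_def by (intro nu_growth) simp
      then have "(?r - 1) * s \<le> exp R" using \<open>nu ?r \<le> exp R\<close> by linarith
      then have "?r - 1 \<le> exp R / s" using s by (simp only: pos_le_divide_eq)
      then show ?thesis by (simp add: r0_def)
    qed (use r0 in linarith)
    then have "?r\<^sup>2 \<le> r0\<^sup>2" by (intro power_mono) auto
    then have "Q Y Y \<le> r0\<^sup>2" by simp
    then have "(norm Y)\<^sup>2 \<le> r0\<^sup>2 / m" using m(2)[of Y] m(1) by (simp add: pos_le_divide_eq mult.commute)
    then show ?thesis by (rule real_le_rsqrt)
  qed
  then show thesis using that by blast
qed

end

context rank_one
begin

section \<open>Distances\<close>

lemma p_part_p: "p_part th V \<in> p"
  by (simp add: p_part_def p_iff algebra_simps)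

lemma curve_length_nonneg: "curve_length br th H0 W \<ge> 0"
proof -
  have "0 \<le> p_inner br H0 (p_part th V) (p_part th V)" for V
    using Q_B_p[OF p_part_p, of "p_part th V"] Q_nonneg[of "p_part th V"] by (simp add: B_def)
  then show ?thesis
    unfolding curve_length_def
    by (cases "(\<lambda>t. sqrt (p_inner br H0 (p_part th (W t)) (p_part th (W t)))) integrable_on {0..1}")
      (auto simp: not_integrable_integral intro!: Henstock_Kurzweil_Integration.integral_nonneg)
qed

text \<open>The ray from \<open>E Y\<close> to the origin is an admissible curve. This upper bound
  puts sublevel sets of \<open>N\<close> into metric balls, which yields finite measure in
  \<open>small_sublevel_finite\<close> and bounded support in
  \<open>continuous_support\<close>.\<close>

lemma geo_dist_le:
  assumes Y: "Y \<in> p" shows "geo_dist br th H0 (E Y) org \<le> sqrt (Q Y Y)"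
  unfolding geo_dist_def
proof (rule cInf_lower)
  define c where "c t = ex ((1 - t) *\<^sub>R Y)" for t :: real
  have "C1_curve br c (\<lambda>t. - Y)"
    unfolding C1_curve_def
  proof (intro conjI ballI allI)
    fix t :: real and Z
    have "((\<lambda>s. ex (s *\<^sub>R - Y) (ex Y Z)) has_vector_derivative ex (t *\<^sub>R - Y) (br (- Y) (ex Y Z))) (at t within {0..1})"
      by (rule has_derivative_ex)
    moreover have e: "ex (s *\<^sub>R - Y) (ex Y W) = c s W" for s W
      using fun_cong[OF ex_add[of "- s" 1 Y], of W] by (simp add: c_def)
    moreover have "br (- Y) (ex Y Z) = ex Y (br (- Y) Z)"
      using ex_br[of Y Y Z] ex_self[of 1 Y] by (simp add: br.minus_left linear_neg[OF G_linear[OF G_ex]])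
    ultimately show "((\<lambda>s. c s Z) has_vector_derivative c t (br (- Y) Z)) (at t within {0..1})" by simp
  qed (auto simp: c_def)
  moreover have "curve_length br th H0 (\<lambda>t. - Y) = sqrt (Q Y Y)"
  proof -
    have "- Y - Y = 2 *\<^sub>R (- Y)" by (simp add: scaleR_2)
    then have "p_part th (- Y) = - Y" using Y by (simp add: p_part_def p_iff)
    then show ?thesis
      using Q_B_p[OF Y, of Y] by (simp add: curve_length_def B.minus_left B.minus_right flip: B_def)
  qed
  moreover have "cs (c 0) = E Y" "cs (c 1) = org" by (simp_all add: c_def E_def org_cs)
  ultimately show "sqrt (Q Y Y) \<in> {curve_length br th H0 W |c W. C1_curve br c W \<and> cs (c 0) = E Y \<and> cs (c 1) = org}"
    by force
qed (auto intro!: bdd_belowI[of _ 0] simp: curve_length_nonneg)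

lemma geo_dist_K:
  assumes k: "k \<in> K" shows "geo_dist br th H0 (translate k x) org = geo_dist br th H0 x org"
proof -
  define L where "L x = {curve_length br th H0 W |c W. C1_curve br c W \<and> cs (c 0) = x \<and> cs (c 1) = org}" for x
  have sub: "L y \<subseteq> L (translate l y)" if l: "l \<in> K" for l y
  proof
    fix r assume "r \<in> L y"
    then obtain c W where c: "r = curve_length br th H0 W" "C1_curve br c W" "cs (c 0) = y" "cs (c 1) = org"
      by (auto simp: L_def)
    have bl: "bounded_linear l" using G_linear[OF K_G[OF l]] by (simp add: linear_conv_bounded_linear)
    have "C1_curve br (\<lambda>t. l \<circ> c t) W"
      unfolding C1_curve_def
    proof (intro conjI ballI allI)
      fix t :: real and Z assume t: "t \<in> {0..1}"
      show "l \<circ> c t \<in> G" using c(2) t by (intro G_comp K_G[OF l]) (simp add: C1_curve_def)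
      have "((\<lambda>s. l (c s Z)) has_vector_derivative l (c t (br (W t) Z))) (at t within {0..1})"
        using c(2) t by (intro bounded_linear.has_vector_derivative[OF bl]) (simp add: C1_curve_def)
      then show "((\<lambda>s. (l \<circ> c s) Z) has_vector_derivative (l \<circ> c t) (br (W t) Z)) (at t within {0..1})" by simp
    qed (use c(2) in \<open>simp add: C1_curve_def\<close>)
    moreover have "cs (l \<circ> c 0) = translate l y" "cs (l \<circ> c 1) = org"
      using c(3,4) translate_K_org[OF l] by (simp_all flip: translate_cs)
    ultimately show "r \<in> L (translate l y)" using c(1) unfolding L_def by blast
  qed
  have "L (translate k x) \<subseteq> L (translate (inv k) (translate k x))" by (rule sub[OF K_inv[OF k]])
  also have "translate (inv k) (translate k x) = x" by (rule translate_inv[OF K_G[OF k]])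
  finally have "L (translate k x) = L x" using sub[OF k, of x] by blast
  then show ?thesis by (simp add: geo_dist_def L_def)
qed

lemma radial_K:
  assumes "radial br th H0 f" "k \<in> K" "x \<in> X" shows "f (translate k x) = f x"
  using assms geo_dist_K[OF assms(2), of x] translate_X[OF K_G[OF assms(2)] assms(3)]
  unfolding radial_def org_def by blast

text \<open>The operators \<open>ex (s *\<^sub>R V)\<close> distort \<open>Q\<close> by a bounded
  factor, which the logarithm turns into an additive constant. Hence supports described by
  \<open>N\<close> move only a bounded amount along a flow.\<close>

lemma N_flow_bound:
  obtains c where "c \<ge> 0" "\<And>s x. \<bar>s\<bar> \<le> 1 \<Longrightarrow> x \<in> X \<Longrightarrow> N (translate (ex (s *\<^sub>R V)) x) \<le> N x + c"
proof -
  obtain b where b: "b > 0" "\<And>T v. Q (app T v) (app T v) \<le> b * (norm T)\<^sup>2 * Q v v"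
    using operator_bound by blast
  define M where "M = b * (exp (norm (ad V)))\<^sup>2 + 1"
  have M: "M \<ge> 1" using b(1) by (simp add: M_def)
  have q: "Q (ex (s *\<^sub>R V) v) (ex (s *\<^sub>R V) v) \<le> M * Q v v" if s: "\<bar>s\<bar> \<le> 1" for s v
  proof -
    have "norm (exp (s *\<^sub>R ad V)) \<le> exp (norm (s *\<^sub>R ad V))" by (rule norm_exp)
    also have "\<dots> \<le> exp (norm (ad V))" using mult_right_mono[OF s, of "norm (ad V)"] by simp
    finally have n: "norm (exp (s *\<^sub>R ad V)) \<le> exp (norm (ad V))" .
    have "Q (ex (s *\<^sub>R V) v) (ex (s *\<^sub>R V) v) \<le> b * (norm (exp (s *\<^sub>R ad V)))\<^sup>2 * Q v v"
      using b(2)[of "exp (s *\<^sub>R ad V)" v] by (simp add: ex_app ad_simps)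
    also have "\<dots> \<le> b * (exp (norm (ad V)))\<^sup>2 * Q v v"
      using b(1) n by (intro mult_right_mono mult_left_mono power_mono) auto
    also have "\<dots> \<le> M * Q v v" by (intro mult_right_mono) (auto simp: M_def)
    finally show ?thesis .
  qed
  show thesis
  proof (rule that[of "ln M"])
    show "0 \<le> ln M" using M by simp
    fix s :: real and x assume s: "\<bar>s\<bar> \<le> 1" and "x \<in> X"
    then obtain g where g: "g \<in> G" "x = cs g" by (auto simp: X_iff)
    have "nG (ex (s *\<^sub>R V) \<circ> g) \<le> M * nG g"
      unfolding nG_def sum_distrib_left comp_apply by (intro sum_mono q s)
    then have "ln (nG (ex (s *\<^sub>R V) \<circ> g)) \<le> ln (M * nG g)"
      using nG_pos[OF G_comp[OF g(1) G_ex[of "s *\<^sub>R V"]]] M nG_pos[OF g(1)] by (subst ln_le_cancel_iff) auto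
    also have "\<dots> = ln (nG g) + ln M" using M nG_pos[OF g(1)] by (subst ln_mult) auto
    finally show "N (translate (ex (s *\<^sub>R V)) x) \<le> N x + ln M" by (simp add: g N_cs G_comp)
  qed
qed

definition CN :: "real \<Rightarrow> 'g set" where "CN R = {Y \<in> p. N (E Y) \<le> R}"

lemma compact_CN: "compact (CN R)"
proof -
  obtain \<rho> where \<rho>: "\<And>Y. Y \<in> p \<Longrightarrow> N (E Y) \<le> R \<Longrightarrow> norm Y \<le> \<rho>" using N_proper[of R] by blast
  have "closed {Y. N (E Y) \<le> R}"
    by (intro closed_Collect_le continuous_E[OF C2X_continuous[OF C2X_N]] continuous_on_const)
  then have "closed (p \<inter> {Y. N (E Y) \<le> R})" using closed_subspace[OF subspace_p] by (intro closed_Int)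
  moreover have "CN R = p \<inter> {Y. N (E Y) \<le> R}" by (auto simp: CN_def)
  moreover have "bounded (CN R)" using \<rho> by (intro boundedI[of _ \<rho>]) (auto simp: CN_def)
  ultimately show ?thesis by (simp add: compact_eq_bounded_closed)
qed

lemma X_CN: assumes "x \<in> X" "N x \<le> R" obtains Y where "Y \<in> CN R" "x = E Y"
  using X_E[OF assms(1)] assms(2) by (metis (mono_tags, lifting) CN_def mem_Collect_eq)

lemma bounded_on_sublevel:
  fixes f :: "('g \<Rightarrow> 'g) set \<Rightarrow> real"
  assumes "continuous_on G (\<lambda>g. f (cs g))"
  obtains C where "C \<ge> 0" "\<And>x. x \<in> X \<Longrightarrow> N x \<le> R \<Longrightarrow> \<bar>f x\<bar> \<le> C"
proof -
  have "compact ((\<lambda>Y. f (E Y)) ` CN R)"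
    by (rule compact_continuous_image[OF continuous_E[OF assms] compact_CN])
  then have "bounded ((\<lambda>Y. f (E Y)) ` CN R)" by (rule compact_imp_bounded)
  then obtain C where C: "\<And>Y. Y \<in> CN R \<Longrightarrow> \<bar>f (E Y)\<bar> \<le> C" unfolding bounded_iff by auto
  have "\<bar>f x\<bar> \<le> max C 0" if "x \<in> X" "N x \<le> R" for x
    using X_CN[OF that] C by (metis max.coboundedI1)
  then show thesis by (intro that[of "max C 0"]) auto
qed

text \<open>Inversion is not visibly continuous for pointwise convergence. As \<open>sy g\<close> is
  \<open>g\<close> times its \<open>Q\<close>-adjoint, it can be written as a sum over
  \<open>E0\<close> in which only \<open>g\<close> itself occurs.\<close>

lemma continuous_sy: "continuous_on G sy"
proof (rule continuous_on_coordinatewise_then_product)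
  fix v
  have "sy g v = (\<Sum>b\<in>E0. Q v (g b) *\<^sub>R g b)" if g: "g \<in> G" for g
  proof -
    define gt where "gt = th (inv g (th v))"
    have "gt = (\<Sum>b\<in>E0. Q gt b *\<^sub>R b)" using onb_expand[OF onb_E0, of gt] span_E0 by simp
    also have "\<dots> = (\<Sum>b\<in>E0. Q v (g b) *\<^sub>R b)"
      using G_Q[OF g, of _ v] by (intro sum.cong refl) (simp add: gt_def Q_sym[of _ v] Q_sym[of "th (inv g (th v))"])
    finally have "g gt = g (\<Sum>b\<in>E0. Q v (g b) *\<^sub>R b)" by simp
    then show ?thesis
      by (simp add: sy_def gt_def linear_sum[OF G_linear[OF g]] linear_scale[OF G_linear[OF g]])
  qed
  then show "continuous_on G (\<lambda>g. sy g v)"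
    by (subst continuous_on_cong[OF refl]) (assumption,
        intro continuous_on_sum continuous_on_scaleR Q.continuous_on continuous_on_const continuous_on_eval)
qed

lemma sy_in_G: assumes "g \<in> G" shows "sy g \<in> G"
proof -
  have "sy g = g \<circ> (th \<circ> inv g \<circ> th)" by (auto simp: sy_def)
  then show ?thesis using G_comp[OF G_conj_th[OF G_inv[OF assms]] assms] by simp
qed

lemma continuous_endo_of_sy: "continuous_on G (\<lambda>g. endo_of (sy g))"
proof -
  have bil: "bilinear (\<lambda>w x. (x \<bullet> b) *\<^sub>R w)" for b :: 'g
    unfolding bilinear_def by (auto intro!: linearI simp: algebra_simps inner_add_left)
  have lin: "linear (\<lambda>x. (x \<bullet> b) *\<^sub>R w)" for b w :: 'g
    by (rule linearI) (simp_all add: inner_add_left algebra_simps)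
  have c: "continuous_on G (\<lambda>g. endo_of (\<lambda>x. (x \<bullet> b) *\<^sub>R sy g b))" for b
  proof (rule bounded_linear.continuous_on[of "\<lambda>w. endo_of (\<lambda>x. (x \<bullet> b) *\<^sub>R w)"])
    show "bounded_linear (\<lambda>w. endo_of (\<lambda>x. (x \<bullet> b) *\<^sub>R w))"
      using linear_endo_of_bilinear[OF bil] by (simp add: linear_conv_bounded_linear)
    show "continuous_on G (\<lambda>g. sy g b)"
      using continuous_on_compose2[OF continuous_on_eval continuous_sy] by auto
  qed
  have "endo_of (sy g) = (\<Sum>b\<in>Basis. endo_of (\<lambda>x. (x \<bullet> b) *\<^sub>R sy g b))" if g: "g \<in> G" for g
  proof (rule endo_eqI)
    fix x
    have l: "linear (sy g)" by (rule G_linear[OF sy_in_G[OF g]])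
    have "sy g x = sy g (\<Sum>b\<in>Basis. (x \<bullet> b) *\<^sub>R b)" by (simp add: euclidean_representation)
    also have "\<dots> = (\<Sum>b\<in>Basis. (x \<bullet> b) *\<^sub>R sy g b)" by (simp add: linear_sum[OF l] linear_scale[OF l])
    finally show "app (endo_of (sy g)) x = app (\<Sum>b\<in>Basis. endo_of (\<lambda>x. (x \<bullet> b) *\<^sub>R sy g b)) x"
      by (simp add: app.sum_left lin l)
  qed
  moreover have "continuous_on G (\<lambda>g. \<Sum>b\<in>Basis. endo_of (\<lambda>x. (x \<bullet> b) *\<^sub>R sy g b))"
    by (intro continuous_on_sum c)
  ultimately show ?thesis by (simp cong: continuous_on_cong)
qed

lemma cs_eq_E_iff: assumes g: "g \<in> G" and Y: "Y \<in> p" shows "cs g = E Y \<longleftrightarrow> sy g = ex (2 *\<^sub>R Y)"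
proof
  assume "cs g = E Y"
  then obtain k where "k \<in> K" "g = ex Y \<circ> k" using cs_eqD[of g "ex Y"] by (auto simp: E_def)
  then show "sy g = ex (2 *\<^sub>R Y)" using sy_K[of "ex Y" k] sy_ex[OF Y] by simp
next
  assume s: "sy g = ex (2 *\<^sub>R Y)"
  obtain Y' k where Y': "Y' \<in> p" "k \<in> K" "g = ex Y' \<circ> k" by (rule cartan_decomposition[OF g])
  then have "ex (2 *\<^sub>R Y') = ex (2 *\<^sub>R Y)" using sy_K[of "ex Y'" k] sy_ex[OF Y'(1)] s by simp
  then have "2 *\<^sub>R Y' = 2 *\<^sub>R Y" using Y Y'(1) by (intro ex_inject) (auto simp: p_iff)
  then show "cs g = E Y" using Y' by (simp add: E_def cs_eqI)
qed

definition lg :: "('g \<Rightarrow> 'g) set \<Rightarrow> 'g" where "lg x = (SOME Y. Y \<in> p \<and> E Y = x)"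

lemma lg: assumes "x \<in> X" shows "lg x \<in> p" "E (lg x) = x"
proof -
  have "\<exists>Y. Y \<in> p \<and> E Y = x" using X_E[OF assms] by metis
  then have "lg x \<in> p \<and> E (lg x) = x" unfolding lg_def by (rule someI_ex)
  then show "lg x \<in> p" "E (lg x) = x" by auto
qed

lemma lg_E: "Y \<in> p \<Longrightarrow> lg (E Y) = Y"
  by (rule E_inject) (auto simp: lg)

lemma continuous_left_mult:
  fixes S :: "('g \<Rightarrow> 'g) set"
  assumes a: "a \<in> G" shows "continuous_on S (\<lambda>g. a \<circ> g)"
proof (rule continuous_on_coordinatewise_then_product)
  fix v
  have "bounded_linear a" using G_linear[OF a] by (simp add: linear_conv_bounded_linear)
  from bounded_linear.continuous_on[OF this continuous_on_eval[of S v]]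
  show "continuous_on S (\<lambda>g. (a \<circ> g) v)" unfolding comp_apply .
qed

end

locale rank_one_measure = rank_one br th A alpha H0
  for br :: "'g::euclidean_space \<Rightarrow> 'g \<Rightarrow> 'g" and th A alpha H0 +
  fixes \<mu> :: "('g \<Rightarrow> 'g) set measure"
  assumes riem: "riemannian_measure br th H0 \<mu>"
begin

section \<open>The invariant measure\<close>

lemma space_mu [simp]: "space \<mu> = X" and sets_mu: "sets \<mu> = sets (borel_sym br th)"
  and mu_inv: "g \<in> G \<Longrightarrow> S \<in> sets \<mu> \<Longrightarrow> emeasure \<mu> (translate g ` S) = emeasure \<mu> S"
  using riem by (auto simp: riemannian_measure_def)

lemma open_sets_mu:
  assumes "U \<subseteq> X" "openin (top_of_set G) {g \<in> G. cs g \<in> U}" shows "U \<in> sets \<mu>"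
proof -
  have "{U. U \<subseteq> X \<and> openin (top_of_set G) {g \<in> G. cs g \<in> U}} \<subseteq> Pow X" by auto
  then show ?thesis using assms by (simp add: sets_mu borel_sym_def sets_measure_of sigma_sets.Basic)
qed

lemma measurable_into_mu:
  assumes "f \<in> space M' \<rightarrow> X"
    "\<And>U. U \<subseteq> X \<Longrightarrow> openin (top_of_set G) {g \<in> G. cs g \<in> U} \<Longrightarrow> f -` U \<inter> space M' \<in> sets M'"
  shows "f \<in> measurable M' \<mu>"
proof -
  have "f \<in> measurable M' (borel_sym br th)"
    unfolding borel_sym_def by (rule measurable_measure_of) (use assms in auto)
  then show ?thesis by (simp add: measurable_cong_sets[OF refl sets_mu])
qed

lemma measurable_translate: assumes a: "a \<in> G" shows "translate a \<in> measurable \<mu> \<mu>"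
proof (rule measurable_into_mu)
  fix U assume U: "U \<subseteq> X" "openin (top_of_set G) {g \<in> G. cs g \<in> U}"
  show "translate a -` U \<inter> space \<mu> \<in> sets \<mu>"
  proof (rule open_sets_mu)
    have "openin (top_of_set G) (G \<inter> (\<lambda>g. a \<circ> g) -` {g \<in> G. cs g \<in> U})"
      by (rule continuous_openin_preimage[OF continuous_left_mult[OF a] _ U(2)]) (auto simp: a G_comp)
    moreover have "G \<inter> (\<lambda>g. a \<circ> g) -` {g \<in> G. cs g \<in> U} = {g \<in> G. cs g \<in> translate a -` U \<inter> space \<mu>}"
      by (auto simp: a G_comp)
    ultimately show "openin (top_of_set G) {g \<in> G. cs g \<in> translate a -` U \<inter> space \<mu>}" by simp
  qed auto
qed (auto simp: translate_X a)

lemma translate_image: "a \<in> G \<Longrightarrow> S \<subseteq> X \<Longrightarrow> translate a ` S = translate (inv a) -` S \<inter> X"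
  by (auto simp: translate_inv translate_X G_inv subset_iff intro!: image_eqI[of _ _ "translate (inv a) _"])

lemma distr_translate: assumes a: "a \<in> G" shows "distr \<mu> \<mu> (translate a) = \<mu>"
proof (rule measure_eqI)
  fix S assume "S \<in> sets (distr \<mu> \<mu> (translate a))"
  then have S: "S \<in> sets \<mu>" by simp
  then have SX: "S \<subseteq> X" using sets.sets_into_space by fastforce
  have bij: "inv (inv a) = a" using G_bij[OF a] by (rule inv_inv_eq)
  have "emeasure (distr \<mu> \<mu> (translate a)) S = emeasure \<mu> (translate a -` S \<inter> X)"
    using measurable_translate[OF a] S by (simp add: emeasure_distr)
  also have "translate a -` S \<inter> X = translate (inv a) ` S"
    using translate_image[OF G_inv[OF a] SX] by (simp add: bij)
  also have "emeasure \<mu> \<dots> = emeasure \<mu> S" by (rule mu_inv[OF G_inv[OF a] S])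
  finally show "emeasure (distr \<mu> \<mu> (translate a)) S = emeasure \<mu> S" .
qed simp

lemma integral_translate:
  fixes f :: "_ \<Rightarrow> 'b::{banach,second_countable_topology}"
  assumes "a \<in> G" "f \<in> borel_measurable \<mu>"
  shows "(\<integral>x. f (translate a x) \<partial>\<mu>) = (\<integral>x. f x \<partial>\<mu>)"
  using integral_distr[OF measurable_translate[OF assms(1)] , of f] assms by (simp add: distr_translate)

lemma integrable_translate:
  fixes f :: "_ \<Rightarrow> 'b::{banach,second_countable_topology}"
  assumes "a \<in> G" "integrable \<mu> f" shows "integrable \<mu> (\<lambda>x. f (translate a x))"
  using integrable_distr[OF measurable_translate[OF assms(1)], of f] assms by (simp add: distr_translate)

lemma measurable_continuous:
  fixes f :: "_ \<Rightarrow> 'b::topological_space"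
  assumes "continuous_on G (\<lambda>g. f (cs g))" shows "f \<in> borel_measurable \<mu>"
proof (rule borel_measurableI)
  fix S :: "'b set" assume S: "open S"
  show "f -` S \<inter> space \<mu> \<in> sets \<mu>"
  proof (rule open_sets_mu)
    have "openin (top_of_set G) (G \<inter> (\<lambda>g. f (cs g)) -` S)"
      using assms S by (rule continuous_openin_preimage_gen)
    moreover have "G \<inter> (\<lambda>g. f (cs g)) -` S = {g \<in> G. cs g \<in> f -` S \<inter> space \<mu>}" by auto
    ultimately show "openin (top_of_set G) {g \<in> G. cs g \<in> f -` S \<inter> space \<mu>}" by simp
  qed auto
qed

lemma measurable_N [measurable]: "N \<in> borel_measurable \<mu>"
  by (rule measurable_continuous[OF C2X_continuous[OF C2X_N]])

text \<open>Finiteness is hidden in the normalization of \<open>riemannian_measure\<close>: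
  \<open>measure\<close> is 0 on nonmeasurable sets and on sets of infinite measure, so a ratio
  tending to 1 forces small balls to be measurable with finite measure.\<close>

lemma small_sublevel_finite:
  obtains R0 where "R0 > N org" "emeasure \<mu> {x \<in> X. N x < R0} < \<infinity>"
proof -
  let ?B = "\<lambda>r. {x \<in> X. geo_dist br th H0 x org < r}"
  have "((\<lambda>r. measure \<mu> (?B r) / (unit_ball_vol (real (dim p)) * r ^ dim p)) \<longlongrightarrow> 1) (at_right 0)"
    using riem by (simp add: riemannian_measure_def org_def)
  then have "\<forall>\<^sub>F r in at_right 0. measure \<mu> (?B r) / (unit_ball_vol (real (dim p)) * r ^ dim p) > 0"
    by (rule order_tendstoD) simp
  then obtain b :: real where b: "b > 0" "\<And>r. 0 < r \<Longrightarrow> r < b \<Longrightarrow> measure \<mu> (?B r) / (unit_ball_vol (real (dim p)) * r ^ dim p) > 0"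
    unfolding eventually_at_right_field by auto
  define r where "r = b / 2"
  have r: "r > 0" "measure \<mu> (?B r) \<noteq> 0" using b(1) b(2)[of r] by (auto simp: r_def)
  then have fin: "emeasure \<mu> (?B r) < \<infinity>" by (simp add: measure_def less_top[symmetric]) (metis enn2real_top)
  have sets: "?B r \<in> sets \<mu>" using r(2) measure_notin_sets by blast
  define R0 where "R0 = ln (nu r)"
  have "{x \<in> X. N x < R0} \<subseteq> ?B r"
  proof safe
    fix x assume x: "x \<in> X" "N x < R0"
    obtain Y where Y: "Y \<in> p" "x = E Y" using X_E[OF x(1)] by blast
    have "nu (sqrt (Q Y Y)) < nu r" using x(2) Y nu_pos by (simp add: N_E R0_def)
    then have "sqrt (Q Y Y) < r" using nu_strict_mono[of r "sqrt (Q Y Y)"] r(1)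
      by (metis less_asym less_eq_real_def linorder_neqE_linordered_idom)
    then show "geo_dist br th H0 x org < r" using geo_dist_le[OF Y(1)] Y(2) by simp
  qed
  then have "emeasure \<mu> {x \<in> X. N x < R0} \<le> emeasure \<mu> (?B r)" by (rule emeasure_mono[OF _ sets])
  then have "emeasure \<mu> {x \<in> X. N x < R0} < \<infinity>" using fin by (rule le_less_trans)
  moreover have "N org < R0"
  proof -
    have "ln (nu 0) < ln (nu r)" using nu_strict_mono[of 0 r] r(1) nu_pos[of 0] nu_pos[of r] by simp
    then show ?thesis by (simp add: R0_def org_cs N_cs nu_def)
  qed
  ultimately show thesis by (rule that[rotated])
qed

lemma sets_sublevel [measurable]: "{x \<in> X. N x \<le> R} \<in> sets \<mu>" "{x \<in> X. N x < R} \<in> sets \<mu>"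
  using measurable_N by (simp_all flip: space_mu)

text \<open>The sets \<open>V Y\<close> are open and \<open>CN R\<close> is compact, so finitely
  many translates of one small sublevel set cover, all of the same finite measure.\<close>

lemma finite_sublevel: "emeasure \<mu> {x \<in> X. N x \<le> R} < \<infinity>"
proof -
  obtain R0 where R0: "R0 > N org" "emeasure \<mu> {x \<in> X. N x < R0} < \<infinity>" by (rule small_sublevel_finite)
  let ?U = "{x \<in> X. N x < R0}"
  define V where "V Y = {Y'. N (translate (ex (- Y)) (E Y')) < R0}" for Y
  have oV: "open (V Y)" for Y
  proof -
    have "continuous_on UNIV (\<lambda>Y'. N (cs (ex (- Y) \<circ> ex Y')))"
    proof (rule continuous_on_compose2[OF C2X_continuous[OF C2X_N]])
      show "continuous_on UNIV (\<lambda>Y'. ex (- Y) \<circ> ex Y')"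
        unfolding ex_app[of "_::'g"]
        by (rule continuous_on_comp_app[OF linear_app])
          (rule continuous_on_compose2[OF continuous_exp_algebra continuous_ad[OF continuous_on_id] subset_UNIV])
    qed (auto intro: G_comp)
    then show ?thesis unfolding V_def E_def translate_cs by (intro open_Collect_less continuous_on_const)
  qed
  have "Y \<in> V Y" for Y
    using R0(1) by (simp add: V_def E_def org_cs)
  then have cover: "CN R \<subseteq> (\<Union>Y\<in>CN R. V Y)" by blast
  obtain T where T: "T \<subseteq> CN R" "finite T" "CN R \<subseteq> (\<Union>Y\<in>T. V Y)"
    by (rule compactE_image[OF compact_CN oV cover])
  have sub: "{x \<in> X. N x \<le> R} \<subseteq> (\<Union>Y\<in>T. translate (ex Y) ` ?U)"
  proof safe
    fix x assume x: "x \<in> X" "N x \<le> R"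
    obtain Y' where Y': "Y' \<in> CN R" "x = E Y'" by (rule X_CN[OF x])
    then obtain Y where Y: "Y \<in> T" "Y' \<in> V Y" using T(3) by blast
    have "x = translate (ex Y) (translate (ex (- Y)) x)"
      using translate_inv(2)[of "ex Y" x] by (simp add: inv_ex)
    moreover have "translate (ex (- Y)) x \<in> ?U" using Y(2) Y'(2) x by (simp add: V_def translate_X)
    ultimately show "x \<in> (\<Union>Y\<in>T. translate (ex Y) ` ?U)" using Y(1) by blast
  qed
  have tU: "translate (ex Y) ` ?U \<in> sets \<mu>" for Y
  proof -
    have "translate (ex Y) ` ?U = translate (inv (ex Y)) -` ?U \<inter> X" by (rule translate_image) auto
    also have "\<dots> \<in> sets \<mu>"
      using measurable_sets[OF measurable_translate[OF G_inv[OF G_ex]] sets_sublevel(2)] by simp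
    finally show ?thesis .
  qed
  have "emeasure \<mu> {x \<in> X. N x \<le> R} \<le> emeasure \<mu> (\<Union>Y\<in>T. translate (ex Y) ` ?U)"
    using T(2) tU by (intro emeasure_mono[OF sub]) auto
  also have "\<dots> \<le> (\<Sum>Y\<in>T. emeasure \<mu> (translate (ex Y) ` ?U))"
    using T(2) tU by (intro emeasure_subadditive_finite) auto
  also have "\<dots> = (\<Sum>Y\<in>T. emeasure \<mu> ?U)" by (simp add: mu_inv sets_sublevel)
  also have "\<dots> < \<infinity>" using R0(2) T(2) by (simp add: ennreal_mult_less_top of_nat_less_top)
  finally show ?thesis .
qed

sublocale sigma_finite_measure \<mu>
proof
  show "\<exists>A. countable A \<and> A \<subseteq> sets \<mu> \<and> \<Union>A = space \<mu> \<and> (\<forall>a\<in>A. emeasure \<mu> a \<noteq> \<infinity>)"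
  proof (intro exI[of _ "range (\<lambda>n::nat. {x \<in> X. N x \<le> n})"] conjI)
    show "\<Union> (range (\<lambda>n::nat. {x \<in> X. N x \<le> n})) = space \<mu>"
      using real_arch_simple by auto
  qed (use finite_sublevel in \<open>auto simp: less_top\<close>)
qed

lemma measurable_lg [measurable]: "lg \<in> borel_measurable \<mu>"
proof -
  have comp: "{x \<in> X. lg x \<in> C} \<in> sets \<mu>" if C: "compact C" for C
  proof -
    have eq: "{x \<in> X. lg x \<in> C} = E ` (C \<inter> p)"
      using lg lg_E by (auto simp: image_iff)
    have "compact (C \<inter> p)" using C closed_subspace[OF subspace_p] by (rule compact_Int_closed)
    then have "compact ((\<lambda>Y. exp (ad (2 *\<^sub>R Y))) ` (C \<inter> p))"
      by (rule compact_continuous_image[rotated])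
        (rule continuous_on_compose2[OF continuous_exp_algebra continuous_ad subset_UNIV],
          intro continuous_intros)
    then have "closed ((\<lambda>Y. exp (ad (2 *\<^sub>R Y))) ` (C \<inter> p))" by (rule compact_imp_closed)
    then have op: "open (- (\<lambda>Y. exp (ad (2 *\<^sub>R Y))) ` (C \<inter> p))" by (simp add: open_Compl)
    have "X - E ` (C \<inter> p) \<in> sets \<mu>"
    proof (rule open_sets_mu)
      have "openin (top_of_set G) (G \<inter> (\<lambda>g. endo_of (sy g)) -` (- (\<lambda>Y. exp (ad (2 *\<^sub>R Y))) ` (C \<inter> p)))"
        by (rule continuous_openin_preimage_gen[OF continuous_endo_of_sy op])
      moreover have "G \<inter> (\<lambda>g. endo_of (sy g)) -` (- (\<lambda>Y. exp (ad (2 *\<^sub>R Y))) ` (C \<inter> p)) = {g \<in> G. cs g \<in> X - E ` (C \<inter> p)}"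
      proof -
        have *: "cs g = E Y \<longleftrightarrow> endo_of (sy g) = exp (ad (2 *\<^sub>R Y))" if "g \<in> G" "Y \<in> p" for g Y
          using cs_eq_E_iff[OF that] endo_of_G[OF sy_in_G[OF that(1)]]
          by (metis app_eq_iff ex_app)
        have "endo_of (sy g) \<in> (\<lambda>Y. exp (ad (2 *\<^sub>R Y))) ` (C \<inter> p) \<longleftrightarrow> cs g \<in> E ` (C \<inter> p)" if "g \<in> G" for g
          unfolding image_iff by (rule bex_cong[OF refl]) (use *[OF that] in auto)
        then show ?thesis by auto
      qed
      ultimately show "openin (top_of_set G) {g \<in> G. cs g \<in> X - E ` (C \<inter> p)}" by simp
    qed auto
    then have "X - (X - E ` (C \<inter> p)) \<in> sets \<mu>" using sets.compl_sets[of "X - E ` (C \<inter> p)" \<mu>] by simp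
    moreover have "X - (X - E ` (C \<inter> p)) = E ` (C \<inter> p)" by auto
    ultimately show ?thesis using eq by simp
  qed
  have "lg \<in> measurable \<mu> (sigma UNIV (Collect closed))"
  proof (rule measurable_measure_of)
    fix S :: "'g set" assume "S \<in> Collect closed"
    then have S: "closed S" by simp
    have "lg -` S \<inter> space \<mu> = (\<Union>n::nat. {x \<in> X. lg x \<in> S \<inter> cball 0 n})"
      using real_arch_simple by auto
    also have "\<dots> \<in> sets \<mu>"
      by (intro sets.countable_UN image_subsetI comp closed_Int_compact S compact_cball)
    finally show "lg -` S \<inter> space \<mu> \<in> sets \<mu>" .
  qed auto
  then show ?thesis by (simp add: borel_eq_closed)
qed

text \<open>Rounding the coordinate \<open>lg x\<close> to a countable grid gives measurable
  functions, and continuity in the second variable recovers the limit. A rounded point may leave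
  \<open>p\<close>, where \<open>E\<close> is still defined.\<close>

lemma measurable_Caratheodory:
  fixes f :: "'c \<Rightarrow> ('g \<Rightarrow> 'g) set \<Rightarrow> real"
  assumes m: "\<And>x. x \<in> X \<Longrightarrow> (\<lambda>a. f a x) \<in> borel_measurable M'"
    and c: "\<And>a. a \<in> space M' \<Longrightarrow> continuous_on G (\<lambda>g. f a (cs g))"
  shows "(\<lambda>(a, x). f a x) \<in> borel_measurable (M' \<Otimes>\<^sub>M \<mu>)"
proof -
  define rd where "rd n Y = (\<Sum>b\<in>Basis. (of_int \<lfloor>2 ^ n * (Y \<bullet> b)\<rfloor> / 2 ^ n) *\<^sub>R b)" for n :: nat and Y :: 'g
  have rd_lim: "(\<lambda>n. rd n Y) \<longlonglongrightarrow> Y" for Y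
  proof -
    have "(\<lambda>n. of_int \<lfloor>2 ^ n * y\<rfloor> / 2 ^ n) \<longlonglongrightarrow> y" for y :: real
    proof (rule LIM_zero_cancel, rule Lim_null_comparison)
      show "\<forall>\<^sub>F n in sequentially. norm (of_int \<lfloor>2 ^ n * y\<rfloor> / 2 ^ n - y) \<le> (1 / 2) ^ n"
      proof (intro always_eventually allI)
        fix n
        have "\<bar>of_int \<lfloor>2 ^ n * y\<rfloor> - 2 ^ n * y\<bar> \<le> 1" by linarith
        moreover have "of_int \<lfloor>2 ^ n * y\<rfloor> / 2 ^ n - y = (of_int \<lfloor>2 ^ n * y\<rfloor> - 2 ^ n * y) / 2 ^ n"
          by (simp add: field_simps)
        ultimately show "norm (of_int \<lfloor>2 ^ n * y\<rfloor> / 2 ^ n - y) \<le> (1 / 2) ^ n"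
          by (simp add: power_divide divide_right_mono)
      qed
    qed (rule LIMSEQ_power_zero, simp)
    then have "(\<lambda>n. rd n Y) \<longlonglongrightarrow> (\<Sum>b\<in>Basis. (Y \<bullet> b) *\<^sub>R b)"
      unfolding rd_def by (intro tendsto_sum tendsto_scaleR tendsto_const)
    then show ?thesis by (simp add: euclidean_representation)
  qed
  have rd_meas [measurable]: "rd n \<in> borel_measurable borel" for n
    unfolding rd_def[abs_def] by measurable
  have rd_count: "countable (range (rd n))" for n
  proof -
    have "range (rd n) \<subseteq> (\<lambda>k. \<Sum>b\<in>Basis. (of_int (k b) / 2 ^ n) *\<^sub>R b) ` (Pi\<^sub>E Basis (\<lambda>_. UNIV :: int set))"
    proof safe
      fix Y
      show "rd n Y \<in> (\<lambda>k. \<Sum>b\<in>Basis. (of_int (k b) / 2 ^ n) *\<^sub>R b) ` (Pi\<^sub>E Basis (\<lambda>_. UNIV :: int set))"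
        by (rule image_eqI[of _ _ "\<lambda>b\<in>Basis. \<lfloor>2 ^ n * (Y \<bullet> b)\<rfloor>"]) (auto simp: rd_def)
    qed
    moreover have "countable (Pi\<^sub>E (Basis :: 'g set) (\<lambda>_. UNIV :: int set))"
      by (rule countable_PiE) auto
    ultimately show ?thesis by (rule countable_subset[OF _ countable_image])
  qed
  have step: "(\<lambda>z. f (fst z) (E (rd n (lg (snd z))))) \<in> borel_measurable (M' \<Otimes>\<^sub>M \<mu>)" for n
  proof (rule measurable_compose_countable'[where f="\<lambda>q z. f (fst z) (E q)" and g="\<lambda>z. rd n (lg (snd z))" and I="range (rd n)"])
    show "(\<lambda>z. f (fst z) (E q)) \<in> borel_measurable (M' \<Otimes>\<^sub>M \<mu>)" for q
      using measurable_compose[OF measurable_fst m[OF E_X]] .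
    show "(\<lambda>z. rd n (lg (snd z))) \<in> measurable (M' \<Otimes>\<^sub>M \<mu>) (count_space (range (rd n)))"
    proof (subst measurable_count_space_eq_countable[OF rd_count], intro conjI ballI)
      fix q assume "q \<in> range (rd n)"
      have "(\<lambda>z. rd n (lg (snd z))) \<in> borel_measurable (M' \<Otimes>\<^sub>M \<mu>)" by measurable
      then show "(\<lambda>z. rd n (lg (snd z))) -` {q} \<inter> space (M' \<Otimes>\<^sub>M \<mu>) \<in> sets (M' \<Otimes>\<^sub>M \<mu>)"
        by (rule measurable_sets) simp
    qed auto
  qed (rule rd_count)
  show ?thesis
  proof (rule borel_measurable_LIMSEQ_real[OF _ step])
    fix z assume "z \<in> space (M' \<Otimes>\<^sub>M \<mu>)"
    then have z: "fst z \<in> space M'" "snd z \<in> X" by (auto simp: space_pair_measure)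
    have "(\<lambda>n. f (fst z) (E (rd n (lg (snd z))))) \<longlonglongrightarrow> f (fst z) (E (lg (snd z)))"
      using continuous_on_tendsto_compose[OF continuous_E[OF c[OF z(1)], of UNIV] rd_lim] by simp
    then show "(\<lambda>n. f (fst z) (E (rd n (lg (snd z))))) \<longlonglongrightarrow> (case z of (a, x) \<Rightarrow> f a x)"
      using z(2) by (simp add: lg case_prod_beta)
  qed
qed

lemma integrable_bounded_support:
  fixes f :: "_ \<Rightarrow> real"
  assumes "f \<in> borel_measurable \<mu>" "\<And>x. x \<in> X \<Longrightarrow> N x \<le> R \<Longrightarrow> \<bar>f x\<bar> \<le> C" "\<And>x. x \<in> X \<Longrightarrow> N x > R \<Longrightarrow> f x = 0"
  shows "integrable \<mu> f"
proof (rule Bochner_Integration.integrable_bound)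
  show "integrable \<mu> (\<lambda>x. C * indicator {x \<in> X. N x \<le> R} x)"
    using finite_sublevel[of R] by (intro integrable_mult_right integrable_real_indicator) auto
  show "AE x in \<mu>. norm (f x) \<le> norm (C * indicator {x \<in> X. N x \<le> R} x)"
  proof (rule AE_I2)
    fix x assume "x \<in> space \<mu>"
    then show "norm (f x) \<le> norm (C * indicator {x \<in> X. N x \<le> R} x)"
      using assms(2)[of x] assms(3)[of x] by (cases "N x \<le> R") auto
  qed
qed (rule assms(1))

end

section \<open>A smooth step function\<close>

lemma has_derivative_pos_power:
  fixes z :: real
  assumes "k \<ge> 1"
  shows "((\<lambda>z. max 0 z ^ Suc k) has_real_derivative (1 + real k) * max 0 z ^ k) (at z)"
proof (cases z "0::real" rule: linorder_cases)
  case less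
  have "((\<lambda>z. 0) has_real_derivative (1 + real k) * max 0 z ^ k) (at z)"
    using less assms by (simp add: zero_power)
  then show ?thesis
    by (rule has_field_derivative_transform_within_open[where S="{..<0}"]) (use less in auto)
next
  case greater
  have "((\<lambda>z. z ^ Suc k) has_real_derivative (1 + real k) * max 0 z ^ k) (at z)"
    using greater DERIV_pow[of "Suc k" z] by simp
  then show ?thesis
    by (rule has_field_derivative_transform_within_open[where S="{0<..}"]) (use greater in auto)
next
  case equal
  have "((\<lambda>y. (max 0 y ^ Suc k - max 0 z ^ Suc k) / (y - z)) \<longlongrightarrow> 0) (at z)"
  proof (rule Lim_null_comparison)
    show "\<forall>\<^sub>F y in at z. norm ((max 0 y ^ Suc k - max 0 z ^ Suc k) / (y - z)) \<le> \<bar>y\<bar> ^ k"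
      by (auto simp: equal max_def intro!: always_eventually)
    show "((\<lambda>y. \<bar>y\<bar> ^ k) \<longlongrightarrow> 0) (at z)"
      using assms equal by (auto intro!: tendsto_eq_intros)
  qed
  then show ?thesis using assms equal by (simp add: has_field_derivative_iff zero_power)
qed

lemma smooth_step:
  obtains ch ch' ch'' :: "real \<Rightarrow> real" and C :: real where
    "\<And>t. (ch has_real_derivative ch' t) (at t)" "\<And>t. (ch' has_real_derivative ch'' t) (at t)"
    "continuous_on UNIV ch''" "\<And>t. t \<le> 1 \<Longrightarrow> ch t = 1" "\<And>t. 2 \<le> t \<Longrightarrow> ch t = 0"
    "\<And>t. 0 \<le> ch t" "\<And>t. ch t \<le> 1" "\<And>t. \<bar>ch' t\<bar> \<le> C" "\<And>t. \<bar>ch'' t\<bar> \<le> C"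
proof -
  define m where "m k z = max 0 z ^ k" for k :: nat and z :: real
  \<comment> \<open>For \<open>t \<le> 1\<close> the inner cube is at least 1, so the outer argument
    is not positive and \<open>ch t = 1\<close>; for \<open>t \<ge> 2\<close> the inner cube
    vanishes and \<open>ch t = 0\<close>. Cubes of the positive part are twice continuously
    differentiable.\<close>
  define ch where "ch t = 1 - m 3 (1 - m 3 (2 - t))" for t
  define ch' where "ch' t = - (9 * (m 2 (1 - m 3 (2 - t)) * m 2 (2 - t)))" for t
  define ch'' where "ch'' t = - (9 * (2 * m 1 (1 - m 3 (2 - t)) * (3 * m 2 (2 - t)) * m 2 (2 - t)
      - m 2 (1 - m 3 (2 - t)) * (2 * m 1 (2 - t))))" for t
  have m3: "(m 3 has_real_derivative 3 * m 2 z) (at z)" and m2: "(m 2 has_real_derivative 2 * m 1 z) (at z)" for z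
    using has_derivative_pos_power[of 2 z] has_derivative_pos_power[of 1 z]
    by (simp_all add: m_def[abs_def] numeral_3_eq_3 numeral_2_eq_2)
  have s: "((\<lambda>t. 2 - t) has_real_derivative - 1) (at t)" for t :: real
    by (auto intro!: derivative_eq_intros)
  have i: "((\<lambda>t. m 3 (2 - t)) has_real_derivative - (3 * m 2 (2 - t))) (at t)" for t
    using DERIV_chain2[OF m3 s[of t]] by simp
  have i2: "((\<lambda>t. m 2 (2 - t)) has_real_derivative - (2 * m 1 (2 - t))) (at t)" for t
    using DERIV_chain2[OF m2 s[of t]] by simp
  have j: "((\<lambda>t. 1 - m 3 (2 - t)) has_real_derivative 3 * m 2 (2 - t)) (at t)" for t
    using DERIV_diff[OF DERIV_const[of 1] i[of t]] by simp
  have d1: "(ch has_real_derivative ch' t) (at t)" for t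
    using DERIV_diff[OF DERIV_const[of 1] DERIV_chain2[OF m3 j[of t]]]
    by (simp add: ch_def[abs_def] ch'_def)
  have d2: "(ch' has_real_derivative ch'' t) (at t)" for t
    using DERIV_minus[OF DERIV_cmult[OF DERIV_mult[OF DERIV_chain2[OF m2 j[of t]] i2[of t]], of 9]]
    unfolding ch'_def[abs_def] ch''_def by (rule has_field_derivative_cong_ev[THEN iffD1, rotated -1])
      (auto simp: algebra_simps)
  have mc: "continuous_on S (\<lambda>t. m k (f t))" if "continuous_on S f" for S k and f :: "real \<Rightarrow> real"
    unfolding m_def using that by (intro continuous_intros)
  have c1: "continuous_on S ch'" and c2: "continuous_on S ch''" for S
    unfolding ch'_def[abs_def] ch''_def[abs_def] by (intro continuous_intros mc)+
  have one: "m 3 (2 - t) \<ge> 1" if "t \<le> 1" for t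
    unfolding m_def using that by (intro one_le_power) auto
  have z1: "ch' t = 0 \<and> ch'' t = 0 \<and> ch t = 1" if "t \<le> 1" for t
    using one[OF that] by (simp add: ch'_def ch''_def ch_def m_def)
  have z2: "ch' t = 0 \<and> ch'' t = 0 \<and> ch t = 0" if "t \<ge> 2" for t
    using that by (simp add: ch'_def ch''_def ch_def m_def)
  have bd: "\<exists>C. \<forall>t\<in>{1..2}. \<bar>f t\<bar> \<le> C" if "continuous_on {1..2} f" for f :: "real \<Rightarrow> real"
    using compact_imp_bounded[OF compact_continuous_image[OF that compact_Icc]]
    unfolding bounded_iff by auto
  obtain C1 C2 where C: "\<And>t. t \<in> {1..2} \<Longrightarrow> \<bar>ch' t\<bar> \<le> C1" "\<And>t. t \<in> {1..2} \<Longrightarrow> \<bar>ch'' t\<bar> \<le> C2"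
    using bd[OF c1] bd[OF c2] by blast
  define C where "C = max C1 C2"
  have "\<bar>ch' 1\<bar> \<le> C1" by (rule C(1)) simp
  then have C0: "C \<ge> 0" unfolding C_def by linarith
  have w: "0 \<le> m k z" for k z by (simp add: m_def)
  show thesis
  proof (rule that[OF d1 d2 c2, where C=C])
    fix t :: real
    show "ch t = 1" if "t \<le> 1" using z1[OF that] by simp
    show "ch t = 0" if "2 \<le> t" using z2[OF that] by simp
    have "m 3 (1 - m 3 (2 - t)) \<le> 1" using w[of 3 "2 - t"] unfolding m_def by (intro power_le_one) auto
    then show "0 \<le> ch t" by (simp add: ch_def)
    show "ch t \<le> 1" using w[of 3 "1 - m 3 (2 - t)"] by (simp add: ch_def)
    consider "t \<le> 1" | "t \<in> {1..2}" | "t \<ge> 2" by force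
    then show "\<bar>ch' t\<bar> \<le> C"
      by cases (use z1[of t] z2[of t] C0 C(1)[of t] in \<open>auto simp: C_def\<close>)
    consider "t \<le> 1" | "t \<in> {1..2}" | "t \<ge> 2" by force
    then show "\<bar>ch'' t\<bar> \<le> C"
      by cases (use z1[of t] z2[of t] C0 C(2)[of t] in \<open>auto simp: C_def\<close>)
  qed
qed

lemma average_le: "\<bar>a\<bar> \<le> c \<Longrightarrow> \<bar>b\<bar> \<le> c \<Longrightarrow> \<bar>(a + b) / 2\<bar> \<le> (c::real)"
  by (auto simp: abs_le_iff)

lemma second_difference_mean_value:
  fixes f :: "real \<Rightarrow> real"
  assumes f: "\<And>t. (f has_real_derivative f' t) (at t)" "\<And>t. (f' has_real_derivative f'' t) (at t)" and s: "s > 0"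
  obtains a b where "\<bar>a\<bar> \<le> s" "\<bar>b\<bar> \<le> s" "f s + f (- s) - 2 * f 0 = s\<^sup>2 / 2 * (f'' a + f'' b)"
proof -
  have T: "\<exists>a. \<bar>a\<bar> \<le> s \<and> g s = g 0 + g' 0 * s + g'' a / 2 * s\<^sup>2"
    if g: "\<And>t. (g has_real_derivative g' t) (at t)" "\<And>t. (g' has_real_derivative g'' t) (at t)"
    for g g' g'' :: "real \<Rightarrow> real"
  proof -
    define diff where "diff m = (if m = 0 then g else if m = 1 then g' else g'')" for m :: nat
    have "\<exists>t>0. t < s \<and> g s = (\<Sum>m<2. diff m 0 / fact m * s ^ m) + diff 2 t / fact 2 * s ^ 2"
      by (rule Maclaurin[OF s]) (auto simp: diff_def less_2_cases_iff g)
    then obtain t where "0 < t" "t < s" "g s = (\<Sum>m<2. diff m 0 / fact m * s ^ m) + diff 2 t / fact 2 * s ^ 2" by auto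
    then show ?thesis by (intro exI[of _ t]) (simp add: diff_def numeral_2_eq_2)
  qed
  obtain a where a: "\<bar>a\<bar> \<le> s" "f s = f 0 + f' 0 * s + f'' a / 2 * s\<^sup>2" using T[OF f] by blast
  have s': "(uminus has_real_derivative - 1) (at t)" for t :: real
    using DERIV_minus[of "\<lambda>x. x" 1 t UNIV] by simp
  have n1: "((\<lambda>t. f (- t)) has_real_derivative - f' (- t)) (at t)" for t
    using DERIV_chain2[OF f(1) s'[of t]] by simp
  have n2: "((\<lambda>t. - f' (- t)) has_real_derivative f'' (- t)) (at t)" for t
    using DERIV_minus[OF DERIV_chain2[OF f(2) s'[of t]]] by simp
  obtain b where b: "\<bar>b\<bar> \<le> s" "f (- s) = f 0 + - f' 0 * s + f'' (- b) / 2 * s\<^sup>2"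
    using T[OF n1 n2] by auto
  show thesis
    by (rule that[of a "- b"]) (use a b in \<open>auto simp: field_simps\<close>)
qed

context rank_one
begin

section \<open>Cutoff functions\<close>

lemma L1_L1_compose_N:
  assumes \<phi>: "\<And>t. (\<phi> has_real_derivative \<phi>' t) (at t)" "\<And>t. (\<phi>' has_real_derivative \<phi>'' t) (at t)"
    and x: "x \<in> X"
  shows "L1 V (L1 V (\<lambda>x. \<phi> (N x))) x = \<phi>' (N x) * L1 V (L1 V N) x + \<phi>'' (N x) * (L1 V N x)\<^sup>2"
proof -
  note d = L1_has_derivative[OF C2X_N, of _ V 0, simplified]
  have 1: "L1 V (\<lambda>x. \<phi> (N x)) y = \<phi>' (N y) * L1 V N y" if "y \<in> X" for y
    unfolding L1_def[of V "\<lambda>x. \<phi> (N x)"]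
    using DERIV_chain2[OF \<phi>(1) d(1)[OF that]] by (simp add: DERIV_imp_deriv)
  have "L1 V (L1 V (\<lambda>x. \<phi> (N x))) x =
      deriv (\<lambda>s. \<phi>' (N (translate (ex (s *\<^sub>R V)) x)) * L1 V N (translate (ex (s *\<^sub>R V)) x)) 0"
    unfolding L1_def[of V "L1 V (\<lambda>x. \<phi> (N x))"] by (simp add: 1 translate_X x)
  also have "\<dots> = \<phi>'' (N x) * L1 V N x * L1 V N x + L1 V (L1 V N) x * \<phi>' (N x)"
    using DERIV_mult[OF DERIV_chain2[OF \<phi>(2) d(1)[OF x]] d(2)[OF x]] by (simp add: DERIV_imp_deriv)
  finally show ?thesis by (simp add: power2_eq_square mult_ac)
qed

lemma C2X_compose_N:
  assumes "\<And>t. (\<phi> has_real_derivative \<phi>' t) (at t)" "\<And>t. (\<phi>' has_real_derivative \<phi>'' t) (at t)"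
    "continuous_on UNIV \<phi>''"
  shows "C2X (\<lambda>x. \<phi> (N x))"
  unfolding C2X_def
  by (rule C2_compose[OF C2X_N[unfolded C2X_def] assms(1,2) continuous_on_subset[OF assms(3) subset_UNIV]])

lemma lap_compose_N:
  assumes \<phi>: "\<And>t. (\<phi> has_real_derivative \<phi>' t) (at t)" "\<And>t. (\<phi>' has_real_derivative \<phi>'' t) (at t)"
    and x: "x \<in> X"
  shows "lap (\<lambda>x. \<phi> (N x)) x = \<phi>' (N x) * lap N x + \<phi>'' (N x) * (\<Sum>V\<in>P0. (L1 V N x)\<^sup>2)"
proof -
  have "(\<Sum>e\<in>E0. sg e * (L1 e N x)\<^sup>2) = (\<Sum>V\<in>P0. (L1 V N x)\<^sup>2)"
    by (rule sum_E0) (simp add: L1_N_K0 K0_th x)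
  moreover have "lap (\<lambda>x. \<phi> (N x)) x = \<phi>' (N x) * lap N x + \<phi>'' (N x) * (\<Sum>e\<in>E0. sg e * (L1 e N x)\<^sup>2)"
    unfolding lap_def L1_L1_compose_N[OF assms] sum_distrib_left
    by (simp add: sum.distrib distrib_left mult_ac)
  ultimately show ?thesis by simp
qed

text \<open>A fixed step function of \<open>N\<close>, stretched to the width \<open>b - a\<close>.
  The chain rule involves \<open>lap N\<close> and the squared first derivatives, both bounded by
  \<open>lap_N_le\<close>; so \<open>C\<close> does not depend on \<open>a\<close> and
  \<open>b\<close>, and wide cutoffs have small Laplacian.\<close>

lemma cutoff:
  obtains C where "C \<ge> 0" "\<And>a b. a < b \<Longrightarrow> \<exists>\<eta>. C2X \<eta> \<and> (\<forall>x. 0 \<le> \<eta> x \<and> \<eta> x \<le> 1) \<and>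
    (\<forall>x. N x \<le> a \<longrightarrow> \<eta> x = 1) \<and> (\<forall>x. b \<le> N x \<longrightarrow> \<eta> x = 0) \<and>
    (\<forall>x\<in>X. \<bar>lap \<eta> x\<bar> \<le> C * (1 / (b - a) + 1 / (b - a)\<^sup>2))"
proof -
  obtain ch ch' ch'' :: "real \<Rightarrow> real" and C where ch:
    "\<And>t. (ch has_real_derivative ch' t) (at t)" "\<And>t. (ch' has_real_derivative ch'' t) (at t)"
    "continuous_on UNIV ch''" "\<And>t. t \<le> 1 \<Longrightarrow> ch t = 1" "\<And>t. 2 \<le> t \<Longrightarrow> ch t = 0"
    "\<And>t. 0 \<le> ch t" "\<And>t. ch t \<le> 1" "\<And>t. \<bar>ch' t\<bar> \<le> C" "\<And>t. \<bar>ch'' t\<bar> \<le> C"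
    using smooth_step by metis
  obtain D where D: "D > 0" "\<And>x. x \<in> X \<Longrightarrow> \<bar>lap N x\<bar> \<le> D" "\<And>x. x \<in> X \<Longrightarrow> (\<Sum>V\<in>P0. (L1 V N x)\<^sup>2) \<le> D"
    using lap_N_le by blast
  have C0: "C \<ge> 0" using ch(8)[of 0] by linarith
  show thesis
  proof (rule that[of "C * D"])
    fix a b :: real assume ab: "a < b"
    define r where "r = 1 / (b - a)"
    have r: "r > 0" using ab by (simp add: r_def)
    define \<phi> where "\<phi> t = ch (1 + r * (t - a))" for t
    define \<phi>' where "\<phi>' t = ch' (1 + r * (t - a)) * r" for t
    define \<phi>'' where "\<phi>'' t = ch'' (1 + r * (t - a)) * r * r" for t
    have l: "((\<lambda>t. 1 + r * (t - a)) has_real_derivative r) (at t)" for t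
      by (auto intro!: derivative_eq_intros)
    have d1: "(\<phi> has_real_derivative \<phi>' t) (at t)" for t
      using DERIV_chain2[OF ch(1) l[of t]] by (simp add: \<phi>_def[abs_def] \<phi>'_def)
    have d2: "(\<phi>' has_real_derivative \<phi>'' t) (at t)" for t
      using DERIV_cmult_right[OF DERIV_chain2[OF ch(2) l[of t]], of r] by (simp add: \<phi>'_def[abs_def] \<phi>''_def)
    have c: "continuous_on UNIV \<phi>''"
      unfolding \<phi>''_def by (intro continuous_intros continuous_on_compose2[OF ch(3)]) auto
    have "\<bar>lap (\<lambda>x. \<phi> (N x)) x\<bar> \<le> C * D * (1 / (b - a) + 1 / (b - a)\<^sup>2)" if x: "x \<in> X" for x
    proof -
      have "\<bar>lap (\<lambda>x. \<phi> (N x)) x\<bar> \<le> \<bar>\<phi>' (N x)\<bar> * \<bar>lap N x\<bar> + \<bar>\<phi>'' (N x)\<bar> * \<bar>\<Sum>V\<in>P0. (L1 V N x)\<^sup>2\<bar>"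
        unfolding lap_compose_N[OF d1 d2 x] abs_mult[symmetric] by (rule abs_triangle_ineq)
      also have "\<dots> \<le> (C * r) * D + (C * r * r) * D"
      proof (intro add_mono mult_mono)
        show "\<bar>\<phi>' (N x)\<bar> \<le> C * r" using ch(8) r by (simp add: \<phi>'_def abs_mult mult_right_mono)
        show "\<bar>\<phi>'' (N x)\<bar> \<le> C * r * r" using ch(9) r by (simp add: \<phi>''_def abs_mult mult_right_mono)
        show "\<bar>\<Sum>V\<in>P0. (L1 V N x)\<^sup>2\<bar> \<le> D" using D(3)[OF x] by (simp add: sum_nonneg)
      qed (use D(2)[OF x] C0 r in auto)
      also have "\<dots> = C * D * (r + r * r)" by (simp add: algebra_simps)
      finally show ?thesis by (simp add: r_def power2_eq_square)
    qed
    moreover have "\<phi> (N x) = 1" if "N x \<le> a" for x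
    proof -
      have "r * (N x - a) \<le> 0" using r that by (simp add: mult_le_0_iff)
      then show ?thesis by (simp add: \<phi>_def ch(4))
    qed
    moreover have "\<phi> (N x) = 0" if "b \<le> N x" for x
    proof -
      have "r * (N x - a) \<ge> r * (b - a)" using r that by (intro mult_left_mono) auto
      then have "r * (N x - a) \<ge> 1" using ab by (simp add: r_def)
      then show ?thesis by (simp add: \<phi>_def ch(5))
    qed
    ultimately show "\<exists>\<eta>. C2X \<eta> \<and> (\<forall>x. 0 \<le> \<eta> x \<and> \<eta> x \<le> 1) \<and>
      (\<forall>x. N x \<le> a \<longrightarrow> \<eta> x = 1) \<and> (\<forall>x. b \<le> N x \<longrightarrow> \<eta> x = 0) \<and>
      (\<forall>x\<in>X. \<bar>lap \<eta> x\<bar> \<le> C * D * (1 / (b - a) + 1 / (b - a)\<^sup>2))"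
      by (intro exI[of _ "\<lambda>x. \<phi> (N x)"]) (use C2X_compose_N[OF d1 d2 c] ch(6,7) in \<open>simp add: \<phi>_def\<close>)
  qed (use C0 D(1) in simp)
qed

section \<open>Green's formula\<close>

text \<open>The direction \<open>inv g V\<close> varies with \<open>g\<close>; its coefficients in
  \<open>E0\<close> are \<open>sg e * B V (g e)\<close>, in which no inverse occurs and which are
  therefore continuous.\<close>

lemma continuous_L1_L1:
  assumes u: "C2X u" shows "continuous_on G (\<lambda>g. L1 V (L1 V u) (cs g))"
proof -
  let ?F = "\<lambda>g. u (cs g)"
  have eq: "L1 V (L1 V u) (cs g) =
      (\<Sum>e\<in>E0. \<Sum>f\<in>E0. (sg e * B V (g e)) * ((sg f * B V (g f)) * D e (D f ?F) g))" if g: "g \<in> G" for g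
  proof -
    interpret \<beta>: bounded_bilinear "\<lambda>Y Z. D Y (D Z ?F) g"
      using second_derivative_bilinear[OF u[unfolded C2X_def] g] by (simp add: bilinear_conv_bounded_bilinear)
    have ex: "inv g V = (\<Sum>e\<in>E0. (sg e * B V (g e)) *\<^sub>R e)"
      using expand_B[of "inv g V"] G_B[OF g, of "inv g V"] by (simp add: G_inv_simps g)
    have "L1 V (L1 V u) (cs g) = D (\<Sum>e\<in>E0. (sg e * B V (g e)) *\<^sub>R e) (D (\<Sum>e\<in>E0. (sg e * B V (g e)) *\<^sub>R e) ?F) g"
      by (simp add: L1_L1_cs g ex)
    then show ?thesis
      by (simp add: \<beta>.sum_left \<beta>.sum_right \<beta>.scaleR_left \<beta>.scaleR_right sum_distrib_left)
        (subst sum.swap, simp add: mult_ac)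
  qed
  have "continuous_on G (\<lambda>g. \<Sum>e\<in>E0. \<Sum>f\<in>E0. (sg e * B V (g e)) * ((sg f * B V (g f)) * D e (D f ?F) g))"
    using u unfolding C2X_def
    by (intro continuous_on_sum continuous_on_mult continuous_on_const B.continuous_on continuous_on_eval
        C1_D_continuous C2_D)
  then show ?thesis by (simp add: eq cong: continuous_on_cong)
qed

text \<open>The symmetric second difference quotient along the flow of \<open>V\<close>. Invariance
  of the measure alone moves it from one factor of an integral to the other.\<close>

definition sd :: "'g \<Rightarrow> real \<Rightarrow> (('g \<Rightarrow> 'g) set \<Rightarrow> real) \<Rightarrow> ('g \<Rightarrow> 'g) set \<Rightarrow> real" where
  "sd V s u x = (u (translate (ex (s *\<^sub>R V)) x) + u (translate (ex (- s *\<^sub>R V)) x) - 2 * u x) / s\<^sup>2"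

lemma sd_mean_value:
  assumes "C2X u" "x \<in> X" "s > 0"
  obtains a b where "\<bar>a\<bar> \<le> s" "\<bar>b\<bar> \<le> s"
    "sd V s u x = (L1 V (L1 V u) (translate (ex (a *\<^sub>R V)) x) + L1 V (L1 V u) (translate (ex (b *\<^sub>R V)) x)) / 2"
proof -
  obtain a b where "\<bar>a\<bar> \<le> s" "\<bar>b\<bar> \<le> s"
    "u (translate (ex (s *\<^sub>R V)) x) + u (translate (ex ((- s) *\<^sub>R V)) x) - 2 * u (translate (ex (0 *\<^sub>R V)) x)
     = s\<^sup>2 / 2 * (L1 V (L1 V u) (translate (ex (a *\<^sub>R V)) x) + L1 V (L1 V u) (translate (ex (b *\<^sub>R V)) x))"
    by (rule second_difference_mean_value[where f="\<lambda>s. u (translate (ex (s *\<^sub>R V)) x)",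
          OF L1_has_derivative(1)[OF assms(1,2)] L1_has_derivative(2)[OF assms(1,2)] assms(3)])
  then show thesis using assms(3) by (intro that[of a b]) (simp_all add: sd_def field_simps)
qed

lemma flow_continuous:
  assumes "continuous_on G (\<lambda>g. f (cs g))" "x \<in> X"
  shows "continuous_on S (\<lambda>s. f (translate (ex (s *\<^sub>R V)) x))"
proof -
  obtain g where g: "g \<in> G" "x = cs g" using assms(2) by (auto simp: X_iff)
  have "continuous_on S (\<lambda>s. ex (s *\<^sub>R V) \<circ> g)"
  proof (rule continuous_on_coordinatewise_then_product)
    fix v
    show "continuous_on S (\<lambda>s. (ex (s *\<^sub>R V) \<circ> g) v)"
      unfolding comp_apply
      by (rule continuous_on_compose2[OF continuous_on_eval continuous_on_compose2[OF continuous_ex]])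
        (auto intro!: continuous_intros)
  qed
  then have "continuous_on S (\<lambda>s. f (cs (ex (s *\<^sub>R V) \<circ> g)))"
    by (rule continuous_on_compose2[OF assms(1)]) (auto intro: G_comp g)
  then show ?thesis by (simp add: g)
qed

lemma sd_tendsto:
  assumes u: "C2X u" and x: "x \<in> X"
  shows "(\<lambda>n. sd V (1 / real (Suc n)) u x) \<longlonglongrightarrow> L1 V (L1 V u) x"
proof -
  define f where "f s = L1 V (L1 V u) (translate (ex (s *\<^sub>R V)) x)" for s
  have "\<exists>a b. \<bar>a\<bar> \<le> 1 / real (Suc n) \<and> \<bar>b\<bar> \<le> 1 / real (Suc n) \<and> sd V (1 / real (Suc n)) u x = (f a + f b) / 2" for n
    using sd_mean_value[OF u x, of "1 / real (Suc n)" V] unfolding f_def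
    by (metis of_nat_0_less_iff zero_less_Suc zero_less_divide_1_iff)
  then obtain a b where ab: "\<And>n. \<bar>a n\<bar> \<le> 1 / real (Suc n)" "\<And>n. \<bar>b n\<bar> \<le> 1 / real (Suc n)"
    "\<And>n. sd V (1 / real (Suc n)) u x = (f (a n) + f (b n)) / 2" by metis
  have l: "(\<lambda>n. 1 / real (Suc n)) \<longlonglongrightarrow> 0" using LIMSEQ_inverse_real_of_nat by (simp add: inverse_eq_divide)
  have "a \<longlonglongrightarrow> 0" "b \<longlonglongrightarrow> 0" by (rule Lim_null_comparison[OF _ l], use ab in auto)+
  moreover have "isCont f 0"
    using flow_continuous[OF continuous_L1_L1[OF u] x, of UNIV V V]
    by (simp add: f_def[abs_def] continuous_on_eq_continuous_at)
  ultimately have "(\<lambda>n. f (a n)) \<longlonglongrightarrow> f 0" "(\<lambda>n. f (b n)) \<longlonglongrightarrow> f 0"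
    by (auto intro: isCont_tendsto_compose)
  then have "(\<lambda>n. (f (a n) + f (b n)) / 2) \<longlonglongrightarrow> (f 0 + f 0) / 2" by (intro tendsto_intros) auto
  then show ?thesis by (simp add: ab f_def del: of_nat_Suc)
qed

end

context rank_one_measure
begin

lemma integral_sd_tendsto:
  assumes u: "C2X u" and w: "w \<in> borel_measurable \<mu>" "\<And>x. x \<in> X \<Longrightarrow> N x \<le> R \<Longrightarrow> \<bar>w x\<bar> \<le> Cw"
    "\<And>x. x \<in> X \<Longrightarrow> N x > R \<Longrightarrow> w x = 0"
  shows "(\<lambda>n. \<integral>x. sd V (1 / real (Suc n)) u x * w x \<partial>\<mu>) \<longlonglongrightarrow> (\<integral>x. L1 V (L1 V u) x * w x \<partial>\<mu>)"
proof -
  obtain c where c: "c \<ge> 0" "\<And>s x. \<bar>s\<bar> \<le> 1 \<Longrightarrow> x \<in> X \<Longrightarrow> N (translate (ex (s *\<^sub>R V)) x) \<le> N x + c"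
    using N_flow_bound[of V] by blast
  obtain C where C: "C \<ge> 0" "\<And>x. x \<in> X \<Longrightarrow> N x \<le> R + c \<Longrightarrow> \<bar>L1 V (L1 V u) x\<bar> \<le> C"
    using bounded_on_sublevel[OF continuous_L1_L1[OF u], of "R + c" V] by blast
  have mu [measurable]: "u \<in> borel_measurable \<mu>" by (rule measurable_continuous[OF C2X_continuous[OF u]])
  have mL: "L1 V (L1 V u) \<in> borel_measurable \<mu>" by (rule measurable_continuous[OF continuous_L1_L1[OF u]])
  have msd: "sd V s u \<in> borel_measurable \<mu>" for s
    unfolding sd_def[abs_def]
    by (intro borel_measurable_divide borel_measurable_diff borel_measurable_add borel_measurable_times
        borel_measurable_const measurable_compose[OF measurable_translate mu] mu) auto
  show ?thesis
  proof (rule integral_dominated_convergence[where w="\<lambda>x. C * \<bar>w x\<bar>"])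
    show "integrable \<mu> (\<lambda>x. C * \<bar>w x\<bar>)"
      using integrable_bounded_support[OF w] by (intro integrable_mult_right integrable_abs)
    show "AE x in \<mu>. (\<lambda>n. sd V (1 / real (Suc n)) u x * w x) \<longlonglongrightarrow> L1 V (L1 V u) x * w x"
      using sd_tendsto[OF u] by (intro AE_I2 tendsto_mult_right) auto
    show "AE x in \<mu>. norm (sd V (1 / real (Suc n)) u x * w x) \<le> C * \<bar>w x\<bar>" for n
    proof (rule AE_I2)
      fix x assume "x \<in> space \<mu>"
      then have x: "x \<in> X" by simp
      show "norm (sd V (1 / real (Suc n)) u x * w x) \<le> C * \<bar>w x\<bar>"
      proof (cases "N x \<le> R")
        case True
        obtain a b where ab: "\<bar>a\<bar> \<le> 1 / real (Suc n)" "\<bar>b\<bar> \<le> 1 / real (Suc n)"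
          "sd V (1 / real (Suc n)) u x = (L1 V (L1 V u) (translate (ex (a *\<^sub>R V)) x) + L1 V (L1 V u) (translate (ex (b *\<^sub>R V)) x)) / 2"
          using sd_mean_value[OF u x, of "1 / real (Suc n)" V] by auto
        have "1 / real (Suc n) \<le> 1" by simp
        then have "\<bar>a\<bar> \<le> 1" "\<bar>b\<bar> \<le> 1" using ab(1,2) by linarith+
        then have "\<bar>L1 V (L1 V u) (translate (ex (a *\<^sub>R V)) x)\<bar> \<le> C" "\<bar>L1 V (L1 V u) (translate (ex (b *\<^sub>R V)) x)\<bar> \<le> C"
          using c(2)[of a x] c(2)[of b x] x True by (auto intro!: C(2) translate_X)
        then have "\<bar>sd V (1 / real (Suc n)) u x\<bar> \<le> C" unfolding ab(3) by (rule average_le)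
        then show ?thesis by (simp add: abs_mult mult_right_mono)
      qed (use w(3)[OF x] in auto)
    qed
  qed (use w(1) msd mL in auto)
qed

text \<open>For each step size the identity holds exactly with \<open>sd V s\<close> in place of the
  second derivative, by translating the variable of integration; dominated convergence then gives
  the derivatives.\<close>

lemma green_L1:
  assumes u: "C2X u" and \<theta>: "C2X \<theta>" "\<And>x. x \<in> X \<Longrightarrow> N x > R \<Longrightarrow> \<theta> x = 0"
  shows "(\<integral>x. L1 V (L1 V u) x * \<theta> x \<partial>\<mu>) = (\<integral>x. L1 V (L1 V \<theta>) x * u x \<partial>\<mu>)"
proof -
  obtain c where c: "c \<ge> 0" "\<And>s x. \<bar>s\<bar> \<le> 1 \<Longrightarrow> x \<in> X \<Longrightarrow> N (translate (ex (s *\<^sub>R V)) x) \<le> N x + c"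
    using N_flow_bound[of V] by blast
  define R' where "R' = R + c"
  have mu: "u \<in> borel_measurable \<mu>" and mt: "\<theta> \<in> borel_measurable \<mu>"
    by (rule measurable_continuous[OF C2X_continuous], fact)+
  obtain Cu where Cu: "Cu \<ge> 0" "\<And>x. x \<in> X \<Longrightarrow> N x \<le> R' \<Longrightarrow> \<bar>u x\<bar> \<le> Cu"
    using bounded_on_sublevel[OF C2X_continuous[OF u], of R'] by blast
  obtain Ct where Ct: "Ct \<ge> 0" "\<And>x. x \<in> X \<Longrightarrow> N x \<le> R' \<Longrightarrow> \<bar>\<theta> x\<bar> \<le> Ct"
    using bounded_on_sublevel[OF C2X_continuous[OF \<theta>(1)], of R'] by blast
  have t0: "\<theta> (translate (ex (s *\<^sub>R V)) x) = 0" if "\<bar>s\<bar> \<le> 1" "x \<in> X" "N x > R'" for s x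
  proof (rule \<theta>(2))
    show "translate (ex (s *\<^sub>R V)) x \<in> X" using that by (simp add: translate_X)
    have "N x = N (translate (ex (- s *\<^sub>R V)) (translate (ex (s *\<^sub>R V)) x))"
      using translate_flow[of "- s" V s x] by simp
    also have "\<dots> \<le> N (translate (ex (s *\<^sub>R V)) x) + c" using that by (intro c(2) translate_X) auto
    finally show "R < N (translate (ex (s *\<^sub>R V)) x)" using that by (simp add: R'_def)
  qed
  \<comment> \<open>\<open>R'\<close> leaves room for the flow: \<open>\<theta>\<close> and its
    translates by times up to 1 vanish where \<open>N > R'\<close>. Cutting \<open>u\<close> off
    there changes no product with them and gives the bounded support demanded by
    \<open>integral_sd_tendsto\<close>.\<close>
  define w where "w x = u x * indicator {x \<in> X. N x \<le> R'} x" for x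
  have mw: "w \<in> borel_measurable \<mu>"
    unfolding w_def using mu by (intro borel_measurable_times borel_measurable_indicator sets_sublevel)
  have w: "\<bar>w x\<bar> \<le> Cu" if "x \<in> X" "N x \<le> R'" for x using Cu(2)[OF that] that by (simp add: w_def)
  have w0: "w x = 0" if "x \<in> X" "N x > R'" for x using that by (simp add: w_def)
  have bt: "\<bar>\<theta> x\<bar> \<le> Ct" if "x \<in> X" "N x \<le> R" for x using Ct(2)[OF that(1)] that c(1) by (simp add: R'_def)
  have l1: "(\<lambda>n. \<integral>x. sd V (1 / real (Suc n)) u x * \<theta> x \<partial>\<mu>) \<longlonglongrightarrow> (\<integral>x. L1 V (L1 V u) x * \<theta> x \<partial>\<mu>)"
    by (rule integral_sd_tendsto[OF u mt bt \<theta>(2)])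
  have l2: "(\<lambda>n. \<integral>x. sd V (1 / real (Suc n)) \<theta> x * w x \<partial>\<mu>) \<longlonglongrightarrow> (\<integral>x. L1 V (L1 V \<theta>) x * w x \<partial>\<mu>)"
    by (rule integral_sd_tendsto[OF \<theta>(1) mw w w0])
  have L0: "L1 V (L1 V \<theta>) x = 0" if "x \<in> X" "N x > R'" for x
  proof -
    have "(\<lambda>n. sd V (1 / real (Suc n)) \<theta> x) \<longlonglongrightarrow> L1 V (L1 V \<theta>) x" by (rule sd_tendsto[OF \<theta>(1) that(1)])
    moreover have "sd V (1 / real (Suc n)) \<theta> x = 0" for n
    proof -
      have "\<bar>1 / real (Suc n)\<bar> \<le> 1" "\<bar>- (1 / real (Suc n))\<bar> \<le> 1" by auto
      then show ?thesis
        using t0[OF _ that, of "1 / real (Suc n)"] t0[OF _ that, of "- (1 / real (Suc n))"] t0[OF _ that, of 0]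
        unfolding sd_def by simp
    qed
    ultimately show ?thesis by (simp add: LIMSEQ_const_iff)
  qed
  have "(\<integral>x. sd V s u x * \<theta> x \<partial>\<mu>) = (\<integral>x. sd V s \<theta> x * w x \<partial>\<mu>)" if s: "0 < s" "s \<le> 1" for s
  proof -
    define T where "T r x = translate (ex (r *\<^sub>R V)) x" for r x
    have mT: "(\<lambda>x. f (T r x)) \<in> borel_measurable \<mu>" if "f \<in> borel_measurable \<mu>" for f :: "_ \<Rightarrow> real" and r
      unfolding T_def by (rule measurable_compose[OF measurable_translate that]) simp
    have TX: "T r x \<in> X" if "x \<in> X" for r x using that by (simp add: T_def translate_X)
    have TT: "T r (T (- r) x) = x" for r x using translate_flow[of r V "- r" x] by (simp add: T_def)
    have i1: "integrable \<mu> (\<lambda>x. u (T r x) * \<theta> x)" if r: "\<bar>r\<bar> \<le> 1" for r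
    proof (rule integrable_bounded_support[where R=R and C="Cu * Ct"])
      fix x assume x: "x \<in> X" "N x \<le> R"
      have "\<bar>u (T r x)\<bar> \<le> Cu" using c(2)[OF r x(1)] x TX[OF x(1)] by (intro Cu) (auto simp: R'_def T_def)
      then show "\<bar>u (T r x) * \<theta> x\<bar> \<le> Cu * Ct"
        unfolding abs_mult using bt[OF x] Cu(1) by (intro mult_mono) auto
    qed (use mT[OF mu] mt \<theta>(2) in auto)
    have i2: "integrable \<mu> (\<lambda>x. \<theta> (T r x) * u x)" if r: "\<bar>r\<bar> \<le> 1" for r
    proof -
      have "integrable \<mu> (\<lambda>x. (\<lambda>x. u (T (- r) x) * \<theta> x) (translate (ex (r *\<^sub>R V)) x))"
        using r by (intro integrable_translate i1) auto
      moreover have "T (- r) (translate (ex (r *\<^sub>R V)) x) = x" for x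
        using TT[of "- r" x] by (simp add: T_def)
      ultimately show ?thesis by (simp add: T_def mult.commute)
    qed
    have e: "(\<integral>x. u (T r x) * \<theta> x \<partial>\<mu>) = (\<integral>x. \<theta> (T (- r) x) * u x \<partial>\<mu>)" for r
    proof -
      have "(\<integral>x. u (T r x) * \<theta> x \<partial>\<mu>) = (\<integral>x. (\<lambda>x. u (T r x) * \<theta> x) (translate (ex (- r *\<^sub>R V)) x) \<partial>\<mu>)"
        by (rule integral_translate[symmetric]) (use mT[OF mu] mt in auto)
      moreover have "T r (translate (ex (- r *\<^sub>R V)) x) = x" for x using TT[of r x] by (simp add: T_def)
      ultimately show ?thesis by (simp add: T_def mult.commute)
    qed
    have T0: "T 0 x = x" for x by (simp add: T_def)
    have s': "\<bar>s\<bar> \<le> 1" "\<bar>- s\<bar> \<le> 1" "\<bar>0::real\<bar> \<le> 1" using s by auto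
    have "(\<integral>x. sd V s u x * \<theta> x \<partial>\<mu>) = (\<integral>x. (u (T s x) * \<theta> x + u (T (- s) x) * \<theta> x - 2 * (u (T 0 x) * \<theta> x)) / s\<^sup>2 \<partial>\<mu>)"
      by (simp add: sd_def T_def T0[unfolded T_def] field_simps)
    also have "\<dots> = ((\<integral>x. u (T s x) * \<theta> x \<partial>\<mu>) + (\<integral>x. u (T (- s) x) * \<theta> x \<partial>\<mu>) - 2 * (\<integral>x. u (T 0 x) * \<theta> x \<partial>\<mu>)) / s\<^sup>2"
      using i1[OF s'(1)] i1[OF s'(2)] i1[OF s'(3)] by simp
    also have "\<dots> = ((\<integral>x. \<theta> (T (- s) x) * u x \<partial>\<mu>) + (\<integral>x. \<theta> (T s x) * u x \<partial>\<mu>) - 2 * (\<integral>x. \<theta> (T 0 x) * u x \<partial>\<mu>)) / s\<^sup>2"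
      using e[of s] e[of "- s"] e[of 0] by simp
    also have "\<dots> = (\<integral>x. (\<theta> (T (- s) x) * u x + \<theta> (T s x) * u x - 2 * (\<theta> (T 0 x) * u x)) / s\<^sup>2 \<partial>\<mu>)"
      using i2[OF s'(1)] i2[OF s'(2)] i2[OF s'(3)] by simp
    also have "\<dots> = (\<integral>x. sd V s \<theta> x * w x \<partial>\<mu>)"
    proof (rule Bochner_Integration.integral_cong[OF refl])
      fix x assume "x \<in> space \<mu>"
      then have x: "x \<in> X" by simp
      show "(\<theta> (T (- s) x) * u x + \<theta> (T s x) * u x - 2 * (\<theta> (T 0 x) * u x)) / s\<^sup>2 = sd V s \<theta> x * w x"
      proof (cases "N x \<le> R'")
        case True
        then show ?thesis using x by (simp add: sd_def T_def w_def T0[unfolded T_def] field_simps)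
      next
        case False
        then have "\<theta> (T s x) = 0" "\<theta> (T (- s) x) = 0" "\<theta> (T 0 x) = 0" "w x = 0"
          using x t0[OF s'(1) x] t0[OF s'(2) x] t0[OF s'(3) x] w0[OF x] by (simp_all add: T_def)
        then show ?thesis by simp
      qed
    qed
    finally show ?thesis .
  qed
  then have "(\<integral>x. sd V (1 / real (Suc n)) u x * \<theta> x \<partial>\<mu>) = (\<integral>x. sd V (1 / real (Suc n)) \<theta> x * w x \<partial>\<mu>)" for n by simp
  then have "(\<integral>x. L1 V (L1 V u) x * \<theta> x \<partial>\<mu>) = (\<integral>x. L1 V (L1 V \<theta>) x * w x \<partial>\<mu>)"
    using l1 l2 LIMSEQ_unique by simp
  also have "\<dots> = (\<integral>x. L1 V (L1 V \<theta>) x * u x \<partial>\<mu>)"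
  proof (rule Bochner_Integration.integral_cong[OF refl])
    fix x assume "x \<in> space \<mu>"
    then show "L1 V (L1 V \<theta>) x * w x = L1 V (L1 V \<theta>) x * u x"
      using L0[of x] by (cases "N x \<le> R'") (auto simp: w_def)
  qed
  finally show ?thesis .
qed

text \<open>Along the flow \<open>\<phi>\<close> stays above \<open>R\<close> for a short time, so
  \<open>\<theta>\<close> and its derivatives vanish there. The cases \<open>\<phi> = N\<close> and
  \<open>\<phi> = - N\<close> give locality outside and inside sublevel sets.\<close>

lemma L1_L1_local:
  fixes \<phi> :: "_ \<Rightarrow> real"
  assumes \<phi>: "continuous_on G (\<lambda>g. \<phi> (cs g))"
    and \<theta>: "C2X \<theta>" "\<And>x. x \<in> X \<Longrightarrow> \<phi> x > R \<Longrightarrow> \<theta> x = 0" and x: "x \<in> X" "\<phi> x > R"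
  shows "L1 V (L1 V \<theta>) x = 0"
proof -
  have c: "continuous_on UNIV (\<lambda>s. \<phi> (translate (ex (s *\<^sub>R V)) x))"
    by (rule flow_continuous[OF \<phi> x(1)])
  have "open {s. R < \<phi> (translate (ex (s *\<^sub>R V)) x)}" by (intro open_Collect_less continuous_on_const c)
  moreover have "0 \<in> {s. R < \<phi> (translate (ex (s *\<^sub>R V)) x)}" using x by simp
  ultimately obtain d where d: "d > 0" "ball 0 d \<subseteq> {s. R < \<phi> (translate (ex (s *\<^sub>R V)) x)}"
    using open_contains_ball by blast
  have z: "L1 V \<theta> (translate (ex (s *\<^sub>R V)) x) = 0" if "s \<in> ball 0 d" for s
  proof -
    have "((\<lambda>s. \<theta> (translate (ex (s *\<^sub>R V)) x)) has_real_derivative 0) (at s)"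
      by (rule has_field_derivative_transform_within_open[OF DERIV_const open_ball that])
        (use d \<theta>(2) x in \<open>auto simp: translate_X subset_iff\<close>)
    then show ?thesis using L1_has_derivative(1)[OF \<theta>(1) x(1)] DERIV_unique by blast
  qed
  have "((\<lambda>s. L1 V \<theta> (translate (ex (s *\<^sub>R V)) x)) has_real_derivative 0) (at 0)"
    by (rule has_field_derivative_transform_within_open[OF DERIV_const open_ball, of 0 0 d]) (use z d in auto)
  then show ?thesis using L1_has_derivative(2)[OF \<theta>(1) x(1), of V 0] DERIV_unique by fastforce
qed

lemma support_L1_L1:
  assumes "C2X \<theta>" "\<And>x. x \<in> X \<Longrightarrow> N x > R \<Longrightarrow> \<theta> x = 0" "x \<in> X" "N x > R"
  shows "L1 V (L1 V \<theta>) x = 0"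
  by (rule L1_L1_local[OF C2X_continuous[OF C2X_N] assms])

lemma lap_zero_below:
  assumes \<theta>: "C2X \<theta>" "\<And>x. x \<in> X \<Longrightarrow> N x < R \<Longrightarrow> \<theta> x = 0" and x: "x \<in> X" "N x < R"
  shows "lap \<theta> x = 0"
proof -
  have "continuous_on G (\<lambda>g. - N (cs g))" by (rule continuous_on_minus[OF C2X_continuous[OF C2X_N]])
  then have "L1 V (L1 V \<theta>) x = 0" for V
    by (rule L1_L1_local[where R="- R"]) (use \<theta> x in auto)
  then show ?thesis by (simp add: lap_def)
qed

lemma support_lap:
  assumes "C2X \<theta>" "\<And>x. x \<in> X \<Longrightarrow> N x > R \<Longrightarrow> \<theta> x = 0" "x \<in> X" "N x > R"
  shows "lap \<theta> x = 0"
  unfolding lap_def using support_L1_L1[OF assms] by simp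

theorem green:
  assumes u: "C2X u" and \<theta>: "C2X \<theta>" "\<And>x. x \<in> X \<Longrightarrow> N x > R \<Longrightarrow> \<theta> x = 0"
  shows "(\<integral>x. lap u x * \<theta> x \<partial>\<mu>) = (\<integral>x. lap \<theta> x * u x \<partial>\<mu>)"
proof -
  have m: "f \<in> borel_measurable \<mu>" if "C2X f" for f by (rule measurable_continuous[OF C2X_continuous[OF that]])
  have mL: "L1 V (L1 V f) \<in> borel_measurable \<mu>" if "C2X f" for f V
    by (rule measurable_continuous[OF continuous_L1_L1[OF that]])
  have i: "integrable \<mu> (\<lambda>x. a x * b x)"
    if c: "continuous_on G (\<lambda>g. a (cs g))" "continuous_on G (\<lambda>g. b (cs g))"
      and z: "\<And>x. x \<in> X \<Longrightarrow> N x > R \<Longrightarrow> a x * b x = 0" for a b :: "_ \<Rightarrow> real"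
  proof -
    have cc: "continuous_on G (\<lambda>g. a (cs g) * b (cs g))" by (intro continuous_on_mult c)
    obtain C where "C \<ge> 0" "\<And>x. x \<in> X \<Longrightarrow> N x \<le> R \<Longrightarrow> \<bar>a x * b x\<bar> \<le> C"
      using bounded_on_sublevel[of "\<lambda>x. a x * b x", OF cc, of R] by blast
    then show ?thesis
      by (intro integrable_bounded_support[OF measurable_continuous[OF cc]]) (use z in auto)
  qed
  have "(\<integral>x. lap u x * \<theta> x \<partial>\<mu>) = (\<integral>x. (\<Sum>e\<in>E0. sg e * (L1 e (L1 e u) x * \<theta> x)) \<partial>\<mu>)"
    by (simp add: lap_def sum_distrib_right mult.assoc)
  also have "\<dots> = (\<Sum>e\<in>E0. sg e * (\<integral>x. L1 e (L1 e u) x * \<theta> x \<partial>\<mu>))"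
    using \<theta>(2) by (subst Bochner_Integration.integral_sum)
      (auto intro!: integrable_mult_right i[OF continuous_L1_L1[OF u] C2X_continuous[OF \<theta>(1)]])
  also have "\<dots> = (\<Sum>e\<in>E0. sg e * (\<integral>x. L1 e (L1 e \<theta>) x * u x \<partial>\<mu>))"
    by (simp add: green_L1[OF assms])
  also have "\<dots> = (\<integral>x. (\<Sum>e\<in>E0. sg e * (L1 e (L1 e \<theta>) x * u x)) \<partial>\<mu>)"
    using support_L1_L1[OF \<theta>] by (subst Bochner_Integration.integral_sum)
      (auto intro!: integrable_mult_right i[OF continuous_L1_L1[OF \<theta>(1)] C2X_continuous[OF u]])
  also have "\<dots> = (\<integral>x. lap \<theta> x * u x \<partial>\<mu>)"
    by (simp add: lap_def sum_distrib_right mult.assoc)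
  finally show ?thesis .
qed

end

section \<open>The heat semigroup\<close>

lemma has_derivative_integral:
  fixes F :: "real \<Rightarrow> 'a \<Rightarrow> real"
  assumes ab: "a < s0" "s0 < b"
    and F: "\<And>s. a < s \<Longrightarrow> s < b \<Longrightarrow> integrable M (F s)"
    and d: "\<And>s y. a < s \<Longrightarrow> s < b \<Longrightarrow> y \<in> space M \<Longrightarrow> ((\<lambda>s. F s y) has_real_derivative F' s y) (at s)"
    and w: "integrable M w" "\<And>s y. a < s \<Longrightarrow> s < b \<Longrightarrow> y \<in> space M \<Longrightarrow> \<bar>F' s y\<bar> \<le> w y"
    and m: "F' s0 \<in> borel_measurable M"
  shows "((\<lambda>s. \<integral>y. F s y \<partial>M) has_real_derivative (\<integral>y. F' s0 y \<partial>M)) (at s0)"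
proof -
  let ?I = "{a<..<b}"
  have "((\<lambda>s. ((\<integral>y. F s y \<partial>M) - (\<integral>y. F s0 y \<partial>M)) / (s - s0)) \<longlongrightarrow> (\<integral>y. F' s0 y \<partial>M)) (at s0 within ?I)"
    unfolding tendsto_at_iff_sequentially comp_def
  proof (intro allI impI)
    fix S :: "nat \<Rightarrow> real" assume S: "\<forall>i. S i \<in> ?I - {s0}" and lim: "S \<longlonglongrightarrow> s0"
    have SI: "a < S n" "S n < b" "S n \<noteq> s0" for n using S by auto
    have eq: "((\<integral>y. F (S n) y \<partial>M) - (\<integral>y. F s0 y \<partial>M)) / (S n - s0) = (\<integral>y. (F (S n) y - F s0 y) / (S n - s0) \<partial>M)" for n
      using F[OF SI(1,2)] F[OF ab] by simp
    have "(\<lambda>n. \<integral>y. (F (S n) y - F s0 y) / (S n - s0) \<partial>M) \<longlonglongrightarrow> (\<integral>y. F' s0 y \<partial>M)"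
    proof (rule integral_dominated_convergence[OF m _ w(1)])
      show "(\<lambda>y. (F (S n) y - F s0 y) / (S n - s0)) \<in> borel_measurable M" for n
        using F[OF SI(1,2)] F[OF ab] by (intro borel_measurable_divide borel_measurable_diff) auto
      show "AE y in M. (\<lambda>n. (F (S n) y - F s0 y) / (S n - s0)) \<longlonglongrightarrow> F' s0 y"
      proof (rule AE_I2)
        fix y assume "y \<in> space M"
        then have "((\<lambda>s. (F s y - F s0 y) / (s - s0)) \<longlongrightarrow> F' s0 y) (at s0)"
          using d[OF ab] by (simp add: has_field_derivative_iff)
        then show "(\<lambda>n. (F (S n) y - F s0 y) / (S n - s0)) \<longlonglongrightarrow> F' s0 y"
          unfolding tendsto_at_iff_sequentially comp_def using SI(3) lim by auto
      qed
      show "AE y in M. norm ((F (S n) y - F s0 y) / (S n - s0)) \<le> w y" for n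
      proof (rule AE_I2)
        fix y assume y: "y \<in> space M"
        have "norm (F (S n) y - F s0 y) \<le> w y * norm (S n - s0)"
          by (rule field_differentiable_bound[of ?I "\<lambda>s. F s y" "\<lambda>s. F' s y"])
            (use SI ab y d w(2) in \<open>auto intro: has_field_derivative_at_within\<close>)
        then show "norm ((F (S n) y - F s0 y) / (S n - s0)) \<le> w y"
          using SI(3)[of n] by (simp add: abs_divide divide_le_eq)
      qed
    qed
    then show "(\<lambda>n. ((\<integral>y. F (S n) y \<partial>M) - (\<integral>y. F s0 y \<partial>M)) / (S n - s0)) \<longlonglongrightarrow> (\<integral>y. F' s0 y \<partial>M)"
      unfolding eq .
  qed
  moreover have "at s0 within ?I = at s0" using ab by (intro at_within_open) auto
  ultimately show ?thesis by (simp add: has_field_derivative_iff)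
qed

context rank_one
begin

lemma D_left: "D Y (\<lambda>g. F (a \<circ> g)) g = D Y F (a \<circ> g)"
  by (simp add: left_inv_deriv_def comp_assoc)

lemma C1_left: assumes F: "C1 F" and a: "a \<in> G" shows "C1 (\<lambda>g. F (a \<circ> g))"
  unfolding C1_def
proof (intro conjI allI ballI)
  have c: "continuous_on G (\<lambda>g. H (a \<circ> g))" if "continuous_on G H" for H :: "_ \<Rightarrow> real"
    by (rule continuous_on_compose2[OF that continuous_left_mult[OF a]]) (auto intro: G_comp a)
  show "continuous_on G (\<lambda>g. F (a \<circ> g))" by (rule c[OF C1_continuous[OF F]])
  show "continuous_on G (D Y (\<lambda>g. F (a \<circ> g)))" for Y
    unfolding D_left[abs_def] by (rule c[OF C1_D_continuous[OF F]])
  show "(\<lambda>s. F (a \<circ> (g \<circ> ex (s *\<^sub>R Y)))) differentiable (at 0)" if "g \<in> G" for g Y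
    using F G_comp[OF that a] by (auto simp: C1_def simp flip: comp_assoc)
qed

lemma C2_left: assumes "C2 F" "a \<in> G" shows "C2 (\<lambda>g. F (a \<circ> g))"
  using assms C1_left unfolding C2_def D_left[abs_def] by simp

lemma C2X_translate: assumes "C2X u" "a \<in> G" shows "C2X (\<lambda>x. u (translate a x))"
  using C2_left[OF assms(1)[unfolded C2X_def] assms(2)] by (simp add: C2X_def)

lemma lap_translate: assumes u: "C2X u" and a: "a \<in> G" and x: "x \<in> X"
  shows "lap (\<lambda>x. u (translate a x)) x = lap u (translate a x)"
proof -
  obtain g where g: "g \<in> G" "x = cs g" using x by (auto simp: X_iff)
  have "D Y (\<lambda>g. u (cs (a \<circ> g))) = (\<lambda>g. D Y (\<lambda>g. u (cs g)) (a \<circ> g))" for Y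
    by (rule ext) (rule D_left)
  then have "D Y (D Y (\<lambda>g. u (translate a (cs g)))) g = D Y (D Y (\<lambda>g. u (cs g))) (a \<circ> g)" for Y
    unfolding translate_cs by (simp only: D_left)
  then have "laplacian_at br th H0 (\<lambda>x. u (translate a x)) g = laplacian_at br th H0 u (a \<circ> g)"
    by (simp add: laplacian_at_def)
  then show ?thesis
    using laplacian_at_eq_lap[OF C2X_translate[OF u a] g(1)] laplacian_at_eq_lap[OF u G_comp[OF g(1) a]] g(2)
    by simp
qed

lemma Ck_continuous_slice:
  assumes "continuous_on ({0<..} \<times> G) (\<lambda>(t, g). u t g)" "(t::real) > 0"
  shows "continuous_on G (u t)"
proof -
  have "continuous_on G (\<lambda>g. (t, g))"
    by (rule continuous_on_Pair[OF continuous_on_const continuous_on_id])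
  moreover have "(\<lambda>g. (t, g)) ` G \<subseteq> {0<..} \<times> G" using assms(2) by auto
  ultimately show ?thesis using continuous_on_compose2[OF assms(1)] by fastforce
qed

lemma Ck_Suc_C1:
  assumes "Ck_time_group br (Suc k) u" "t > 0" shows "C1 (u t)"
proof -
  have c0: "continuous_on ({0<..} \<times> G) (\<lambda>(t, g). v t g)" if "Ck_time_group br k v" for v
    using that by (cases k) auto
  show ?thesis
    unfolding C1_def
  proof (intro conjI allI ballI)
    have "continuous_on ({0<..} \<times> G) (\<lambda>(t, g). u t g)" using assms(1) by simp
    then show "continuous_on G (u t)" by (rule Ck_continuous_slice[OF _ assms(2)])
    show "continuous_on G (D Y (u t))" for Y
    proof -
      have "Ck_time_group br k (\<lambda>t. D Y (u t))" using assms(1) by simp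
      from Ck_continuous_slice[OF c0[OF this] assms(2)] show ?thesis .
    qed
    show "(\<lambda>s. u t (g \<circ> ex (s *\<^sub>R Y))) differentiable (at 0)" if "g \<in> G" for g Y
      using assms that by simp
  qed
qed

lemma Ck_2_C2:
  assumes "Ck_time_group br (Suc (Suc k)) u" "t > 0" shows "C2 (u t)"
  unfolding C2_def
proof (intro conjI allI)
  show "C1 (u t)" using assms by (rule Ck_Suc_C1)
  show "C1 (D Y (u t))" for Y
  proof -
    have "Ck_time_group br (Suc k) (\<lambda>t. D Y (u t))" using assms(1) by simp
    from Ck_Suc_C1[OF this assms(2)] show ?thesis .
  qed
qed

lemma continuous_support:
  assumes c: "continuous_on G (\<lambda>g. f (cs g))" and z: "\<And>x. x \<in> X \<Longrightarrow> N x > R \<Longrightarrow> f x = 0"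
  shows "continuous_compact_support br th H0 f"
  unfolding continuous_compact_support_def
proof (intro conjI)
  obtain \<rho> where \<rho>: "\<And>Y. Y \<in> p \<Longrightarrow> N (E Y) \<le> R \<Longrightarrow> norm Y \<le> \<rho>" using N_proper[of R] by blast
  obtain M where M: "0 < M" "\<And>v. Q v v \<le> M * (norm v)\<^sup>2" using Q_le by blast
  show "\<exists>R. \<forall>x\<in>X. R < geo_dist br th H0 x (origin br th) \<longrightarrow> f x = 0"
  proof (intro exI[of _ "sqrt (M * \<rho>\<^sup>2)"] ballI impI)
    fix x assume x: "x \<in> X" and d: "sqrt (M * \<rho>\<^sup>2) < geo_dist br th H0 x (origin br th)"
    obtain Y where Y: "Y \<in> p" "x = E Y" using X_E[OF x] by blast
    have "\<not> N x \<le> R"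
    proof
      assume "N x \<le> R"
      then have "norm Y \<le> \<rho>" using \<rho> Y by simp
      then have "(norm Y)\<^sup>2 \<le> \<rho>\<^sup>2" by (intro power_mono) auto
      then have "M * (norm Y)\<^sup>2 \<le> M * \<rho>\<^sup>2" using M(1) by simp
      then have "Q Y Y \<le> M * \<rho>\<^sup>2" using M(2)[of Y] by (rule order_trans[rotated])
      then have "sqrt (Q Y Y) \<le> sqrt (M * \<rho>\<^sup>2)" by (rule real_sqrt_le_mono)
      moreover have "geo_dist br th H0 x (origin br th) \<le> sqrt (Q Y Y)"
        using geo_dist_le[OF Y(1)] Y(2) unfolding org_def by simp
      ultimately show False using d by linarith
    qed
    then show "f x = 0" using z x by simp
  qed
qed (rule c)

end

locale rank_one_heat = rank_one_measure br th A alpha H0 \<mu>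
  for br :: "'g::euclidean_space \<Rightarrow> 'g \<Rightarrow> 'g" and th A alpha H0 \<mu> +
  fixes h
  assumes heat: "heat_kernel br th H0 \<mu> h"
begin

section \<open>Elementary properties of the heat kernel\<close>

lemma h_Ck: "y \<in> X \<Longrightarrow> Ck_time_group br k (\<lambda>u g. h u (cs g) y)"
  using heat by (simp add: heat_kernel_def)

lemma h_nonneg: "u > 0 \<Longrightarrow> x \<in> X \<Longrightarrow> y \<in> X \<Longrightarrow> 0 \<le> h u x y"
  and h_sym: "u > 0 \<Longrightarrow> x \<in> X \<Longrightarrow> y \<in> X \<Longrightarrow> h u x y = h u y x"
  and h_nn_le: "u > 0 \<Longrightarrow> x \<in> X \<Longrightarrow> (\<integral>\<^sup>+ y. ennreal (h u x y) \<partial>\<mu>) \<le> 1"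
  and h_semigroup: "u > 0 \<Longrightarrow> v > 0 \<Longrightarrow> x \<in> X \<Longrightarrow> y \<in> X \<Longrightarrow> h (u + v) x y = (\<integral>z. h u x z * h v z y \<partial>\<mu>)"
  using heat by (auto simp: heat_kernel_def)

lemma h_C2X: "u > 0 \<Longrightarrow> y \<in> X \<Longrightarrow> C2X (\<lambda>x. h u x y)"
  unfolding C2X_def using Ck_2_C2[OF h_Ck] .

lemma h_time:
  assumes u: "u > 0" and xy: "x \<in> X" "y \<in> X"
  shows "((\<lambda>s. h s x y) has_real_derivative lap (\<lambda>x. h u x y) x) (at u)"
proof -
  obtain g where g: "g \<in> G" "x = cs g" using xy by (auto simp: X_iff)
  have "(\<lambda>s. h s x y) differentiable (at u)" using h_Ck[OF xy(2), of "Suc 0"] u g by auto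
  then have "((\<lambda>s. h s x y) has_real_derivative deriv (\<lambda>s. h s x y) u) (at u)"
    by (simp only: DERIV_deriv_iff_real_differentiable)
  also have "deriv (\<lambda>s. h s x y) u = laplacian_at br th H0 (\<lambda>x. h u x y) g"
    using heat u xy(2) g by (auto simp: heat_kernel_def)
  also have "\<dots> = lap (\<lambda>x. h u x y) x" unfolding g(2) by (rule laplacian_at_eq_lap[OF h_C2X[OF u xy(2)] g(1)])
  finally show ?thesis .
qed

lemma h_continuous: assumes "y \<in> X"
  shows "continuous_on ({0<..} \<times> G) (\<lambda>(t, g). h t (cs g) y)"
    and "continuous_on ({0<..} \<times> G) (\<lambda>(t, g). lap (\<lambda>x. h t x y) (cs g))"
proof -
  show "continuous_on ({0<..} \<times> G) (\<lambda>(t, g). h t (cs g) y)" using h_Ck[OF assms, of 0] by simp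
  have "continuous_on ({0<..} \<times> G) (\<lambda>(t, g). deriv (\<lambda>s. h s (cs g) y) t)"
    using h_Ck[OF assms, of "Suc 0"] by simp
  moreover have "deriv (\<lambda>s. h s (cs g) y) t = lap (\<lambda>x. h t x y) (cs g)" if "t > 0" "g \<in> G" for t g
    by (rule DERIV_imp_deriv[OF h_time]) (use that assms in auto)
  ultimately show "continuous_on ({0<..} \<times> G) (\<lambda>(t, g). lap (\<lambda>x. h t x y) (cs g))"
    by (subst continuous_on_cong[OF refl, where g="\<lambda>(t, g). deriv (\<lambda>s. h s (cs g) y) t"]) auto
qed

lemma h_continuous_E:
  assumes "y \<in> X" "S \<subseteq> {0<..} \<times> UNIV"
  shows "continuous_on S (\<lambda>(t, Y). h t (E Y) y)" "continuous_on S (\<lambda>(t, Y). lap (\<lambda>x. h t x y) (E Y))"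
proof -
  have c: "continuous_on S (\<lambda>(t, Y). (t, ex Y))"
    unfolding case_prod_beta
    by (intro continuous_on_Pair continuous_on_fst continuous_on_id
        continuous_on_compose2[OF continuous_ex[of UNIV] continuous_on_snd[OF continuous_on_id] subset_UNIV])
  have i: "(\<lambda>(t, Y). (t, ex Y)) ` S \<subseteq> {0<..} \<times> G" using assms(2) by auto
  show "continuous_on S (\<lambda>(t, Y). h t (E Y) y)"
    using continuous_on_compose2[OF h_continuous(1)[OF assms(1)] c i] by (simp add: case_prod_beta E_def)
  show "continuous_on S (\<lambda>(t, Y). lap (\<lambda>x. h t x y) (E Y))"
    using continuous_on_compose2[OF h_continuous(2)[OF assms(1)] c i] by (simp add: case_prod_beta E_def)
qed

lemma h_continuous_1: "u > 0 \<Longrightarrow> y \<in> X \<Longrightarrow> continuous_on G (\<lambda>g. h u (cs g) y)"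
  by (rule C2X_continuous[OF h_C2X])

lemma h_continuous_2: assumes "u > 0" "x \<in> X" shows "continuous_on G (\<lambda>g. h u x (cs g))"
  using h_continuous_1[OF assms] h_sym[OF assms(1) _ assms(2)] by (simp cong: continuous_on_cong)

lemma h_measurable: "u > 0 \<Longrightarrow> x \<in> X \<Longrightarrow> (\<lambda>y. h u x y) \<in> borel_measurable \<mu>"
  by (rule measurable_continuous[OF h_continuous_2])

lemma h_integrable: assumes "u > 0" "x \<in> X" shows "integrable \<mu> (\<lambda>y. h u x y)"
proof (rule integrableI_bounded[OF h_measurable[OF assms]])
  have "(\<integral>\<^sup>+ y. ennreal (norm (h u x y)) \<partial>\<mu>) = (\<integral>\<^sup>+ y. ennreal (h u x y) \<partial>\<mu>)"
    by (intro nn_integral_cong) (simp add: h_nonneg assms)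
  also have "\<dots> \<le> 1" by (rule h_nn_le[OF assms])
  finally show "(\<integral>\<^sup>+ y. ennreal (norm (h u x y)) \<partial>\<mu>) < \<infinity>" by (simp add: le_less_trans)
qed

lemma h_nn_eq: "u > 0 \<Longrightarrow> x \<in> X \<Longrightarrow> (\<integral>\<^sup>+ y. ennreal (h u x y) \<partial>\<mu>) = ennreal (\<integral>y. h u x y \<partial>\<mu>)"
  by (intro nn_integral_eq_integral h_integrable AE_I2) (simp_all add: h_nonneg)

lemma h_integral_le: "u > 0 \<Longrightarrow> x \<in> X \<Longrightarrow> (\<integral>y. h u x y \<partial>\<mu>) \<le> 1"
  using h_nn_le[of u x] h_nn_eq[of u x] by simp

definition Hs :: "real \<Rightarrow> (('g \<Rightarrow> 'g) set \<Rightarrow> real) \<Rightarrow> ('g \<Rightarrow> 'g) set \<Rightarrow> real" where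
  "Hs u f x = (\<integral>y. h u x y * f y \<partial>\<mu>)"

lemma h_mult_integrable:
  assumes "u > 0" "x \<in> X" "f \<in> borel_measurable \<mu>" "\<And>y. y \<in> X \<Longrightarrow> \<bar>f y\<bar> \<le> C"
  shows "integrable \<mu> (\<lambda>y. h u x y * f y)"
proof (rule Bochner_Integration.integrable_bound[OF integrable_mult_left[OF h_integrable[OF assms(1,2)], of C]])
  show "AE y in \<mu>. norm (h u x y * f y) \<le> norm (h u x y * C)"
  proof (rule AE_I2)
    fix y assume "y \<in> space \<mu>"
    then have "\<bar>f y\<bar> \<le> \<bar>C\<bar>" using assms(4)[of y] by simp
    then show "norm (h u x y * f y) \<le> norm (h u x y * C)" by (simp add: abs_mult mult_left_mono)
  qed
qed (use h_measurable[OF assms(1,2)] assms(3) in simp)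

lemma Hs_mono:
  assumes u: "u > 0" "x \<in> X" and f: "f \<in> borel_measurable \<mu>" "\<And>y. y \<in> X \<Longrightarrow> \<bar>f y\<bar> \<le> C"
    and g: "g \<in> borel_measurable \<mu>" "\<And>y. y \<in> X \<Longrightarrow> \<bar>g y\<bar> \<le> C'" and le: "\<And>y. y \<in> X \<Longrightarrow> f y \<le> g y"
  shows "Hs u f x \<le> Hs u g x"
  unfolding Hs_def
  by (rule integral_mono[OF h_mult_integrable[OF u f] h_mult_integrable[OF u g]])
    (auto intro!: mult_left_mono le h_nonneg u)

lemma Hs_bound:
  assumes u: "u > 0" "x \<in> X" and f: "f \<in> borel_measurable \<mu>" "\<And>y. y \<in> X \<Longrightarrow> \<bar>f y\<bar> \<le> C"
  shows "\<bar>Hs u f x\<bar> \<le> C"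
proof -
  have C: "C \<ge> 0" using f(2)[OF org_X] by linarith
  have "\<bar>Hs u f x\<bar> \<le> (\<integral>y. \<bar>h u x y * f y\<bar> \<partial>\<mu>)"
    unfolding Hs_def by (rule integral_abs_bound)
  also have "\<dots> \<le> (\<integral>y. h u x y * C \<partial>\<mu>)"
    by (rule integral_mono[OF integrable_abs[OF h_mult_integrable[OF u f]] integrable_mult_left[OF h_integrable[OF u]]])
      (use f(2) h_nonneg u in \<open>auto simp: abs_mult intro!: mult_left_mono\<close>)
  also have "\<dots> = (\<integral>y. h u x y \<partial>\<mu>) * C" by simp
  also have "\<dots> \<le> 1 * C" by (intro mult_right_mono h_integral_le u C)
  finally show ?thesis by simp
qed

lemma Hs_add:
  assumes u: "u > 0" "x \<in> X" and f: "f \<in> borel_measurable \<mu>" "\<And>y. y \<in> X \<Longrightarrow> \<bar>f y\<bar> \<le> C"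
    and g: "g \<in> borel_measurable \<mu>" "\<And>y. y \<in> X \<Longrightarrow> \<bar>g y\<bar> \<le> C'"
  shows "Hs u (\<lambda>y. f y + g y) x = Hs u f x + Hs u g x"
  unfolding Hs_def distrib_left
  by (rule Bochner_Integration.integral_add[OF h_mult_integrable[OF u f] h_mult_integrable[OF u g]])

lemma Hs_cmult: "Hs u (\<lambda>y. c * f y) x = c * Hs u f x"
proof -
  have "Hs u (\<lambda>y. c * f y) x = (\<integral>y. c * (h u x y * f y) \<partial>\<mu>)"
    unfolding Hs_def by (simp only: mult.left_commute)
  then show ?thesis unfolding Hs_def by simp
qed

definition supported :: "(('g \<Rightarrow> 'g) set \<Rightarrow> real) \<Rightarrow> real \<Rightarrow> bool" where
  "supported f R \<longleftrightarrow> continuous_on G (\<lambda>g. f (cs g)) \<and> (\<forall>x\<in>X. N x > R \<longrightarrow> f x = 0)"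

lemma supported_bounded:
  assumes "supported f R" obtains C where "C \<ge> 0" "\<And>x. x \<in> X \<Longrightarrow> \<bar>f x\<bar> \<le> C"
proof -
  obtain C where C: "C \<ge> 0" "\<And>x. x \<in> X \<Longrightarrow> N x \<le> R \<Longrightarrow> \<bar>f x\<bar> \<le> C"
    using bounded_on_sublevel[of f R] assms unfolding supported_def by blast
  have "\<bar>f x\<bar> \<le> C" if "x \<in> X" for x
    using C that assms by (cases "N x \<le> R") (auto simp: supported_def)
  then show thesis using that C(1) by blast
qed

lemma supported_measurable: "supported f R \<Longrightarrow> f \<in> borel_measurable \<mu>"
  by (auto simp: supported_def intro: measurable_continuous)

lemma supported_lap: "C2X \<theta> \<Longrightarrow> supported \<theta> R \<Longrightarrow> supported (lap \<theta>) R"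
  unfolding supported_def using continuous_lap support_lap by blast

lemma Hs_initial:
  assumes "supported f R" "x \<in> X" shows "((\<lambda>u. Hs u f x) \<longlongrightarrow> f x) (at_right 0)"
proof -
  have "continuous_compact_support br th H0 f"
    using assms(1) unfolding supported_def by (intro continuous_support) auto
  then show ?thesis using heat assms(2) by (simp add: heat_kernel_def Hs_def)
qed

text \<open>The heat equation for the kernel permits differentiation under the integral, with bounds
  uniform on the support of \<open>\<theta>\<close> and on the times in
  \<open>{s / 2..2 * s}\<close>; Green's formula then moves the Laplacian to
  \<open>\<theta>\<close>.\<close>

lemma Hs_derivative:
  assumes \<theta>: "C2X \<theta>" "supported \<theta> R" and s: "s > 0" and x: "x \<in> X"
  shows "((\<lambda>s. Hs s \<theta> x) has_real_derivative Hs s (lap \<theta>) x) (at s)"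
proof -
  have t0: "\<theta> y = 0" if "y \<in> X" "N y > R" for y using \<theta>(2) that by (simp add: supported_def)
  obtain Ct where Ct: "Ct \<ge> 0" "\<And>y. y \<in> X \<Longrightarrow> \<bar>\<theta> y\<bar> \<le> Ct" using supported_bounded[OF \<theta>(2)] by blast
  let ?S = "{s / 2..2 * s} \<times> CN R"
  have "compact ((\<lambda>(t, Y). lap (\<lambda>y. h t y x) (E Y)) ` ?S)"
    by (intro compact_continuous_image h_continuous_E(2)[OF x] compact_Times compact_CN compact_Icc) (use s in auto)
  then obtain C where C: "\<And>t Y. t \<in> {s / 2..2 * s} \<Longrightarrow> Y \<in> CN R \<Longrightarrow> \<bar>lap (\<lambda>y. h t y x) (E Y)\<bar> \<le> C"
    unfolding compact_eq_bounded_closed bounded_iff by fastforce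
  have bound: "\<bar>lap (\<lambda>y. h t y x) y\<bar> \<le> C" if "t \<in> {s / 2..2 * s}" "y \<in> X" "N y \<le> R" for t y
    using X_CN[OF that(2,3)] C[OF that(1)] by metis
  define w where "w y = C * Ct * indicator {y \<in> X. N y \<le> R} y" for y
  have "((\<lambda>s. \<integral>y. h s y x * \<theta> y \<partial>\<mu>) has_real_derivative (\<integral>y. lap (\<lambda>y. h s y x) y * \<theta> y \<partial>\<mu>)) (at s)"
  proof (rule has_derivative_integral[where a="s/2" and b="2 * s" and w=w])
    fix t assume t: "s / 2 < t" "t < 2 * s"
    then have t': "t > 0" using s by linarith
    have "integrable \<mu> (\<lambda>y. h t x y * \<theta> y)"
      by (rule h_mult_integrable[OF t' x supported_measurable[OF \<theta>(2)] Ct(2)])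
    then show "integrable \<mu> (\<lambda>y. h t y x * \<theta> y)"
      by (rule Bochner_Integration.integrable_cong[THEN iffD1, OF refl, rotated]) (simp add: h_sym[OF t' x])
    fix y assume "y \<in> space \<mu>"
    then have y: "y \<in> X" by simp
    show "((\<lambda>t. h t y x * \<theta> y) has_real_derivative lap (\<lambda>y. h t y x) y * \<theta> y) (at t)"
      by (rule DERIV_cmult_right[OF h_time[OF t' y x]])
    show "\<bar>lap (\<lambda>y. h t y x) y * \<theta> y\<bar> \<le> w y"
    proof (cases "N y \<le> R")
      case True
      have "\<bar>lap (\<lambda>y. h t y x) y\<bar> \<le> C" using t by (intro bound y True) auto
      then show ?thesis using Ct(2)[OF y] True y by (simp add: w_def abs_mult) (intro mult_mono, auto)
    qed (use t0[OF y] y in \<open>simp add: w_def\<close>)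
  next
    show "integrable \<mu> w"
      unfolding w_def using finite_sublevel[of R] by (intro integrable_mult_right integrable_real_indicator) auto
    show "(\<lambda>y. lap (\<lambda>y. h s y x) y * \<theta> y) \<in> borel_measurable \<mu>"
      using supported_measurable[OF \<theta>(2)] measurable_continuous[OF continuous_lap[OF h_C2X[OF s x]]] by simp
  qed (use s in auto)
  moreover have "(\<integral>y. lap (\<lambda>y. h s y x) y * \<theta> y \<partial>\<mu>) = (\<integral>y. lap \<theta> y * h s y x \<partial>\<mu>)"
    by (rule green[OF h_C2X[OF s x] \<theta>(1) t0])
  moreover have "(\<integral>y. lap \<theta> y * h s y x \<partial>\<mu>) = Hs s (lap \<theta>) x"
    unfolding Hs_def by (intro Bochner_Integration.integral_cong refl) (simp add: h_sym[OF s x] mult.commute)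
  ultimately have d: "((\<lambda>s. \<integral>y. h s y x * \<theta> y \<partial>\<mu>) has_real_derivative Hs s (lap \<theta>) x) (at s)" by simp
  have eq: "(\<integral>y. h t y x * \<theta> y \<partial>\<mu>) = Hs t \<theta> x" if "t > 0" for t
    unfolding Hs_def by (intro Bochner_Integration.integral_cong refl) (simp add: h_sym[OF that x])
  show ?thesis
    by (rule has_field_derivative_transform_within_open[OF d, of "{0<..}"]) (use s eq in auto)
qed

lemma Hs_mean_value:
  assumes \<theta>: "C2X \<theta>" "supported \<theta> R" and r: "r > 0" and x: "x \<in> X"
  obtains z where "0 < z" "z < r" "Hs r \<theta> x = \<theta> x + r * Hs z (lap \<theta>) x"
proof -
  \<comment> \<open>The initial condition makes the extension by \<open>\<theta> x\<close> at time 0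
    continuous, so that the mean value theorem reaches down to the endpoint.\<close>
  define m where "m s = (if s = 0 then \<theta> x else Hs s \<theta> x)" for s
  have dm: "(m has_real_derivative Hs s (lap \<theta>) x) (at s)" if "s > 0" for s
    by (rule has_field_derivative_transform_within_open[OF Hs_derivative[OF \<theta> that x], of "{0<..}"])
      (use that in \<open>auto simp: m_def\<close>)
  have "continuous_on {0..r} m"
    unfolding continuous_on_eq_continuous_within
  proof -
    show "\<forall>s\<in>{0..r}. continuous (at s within {0..r}) m"
    proof
      fix s assume s: "s \<in> {0..r}"
      show "continuous (at s within {0..r}) m"
      proof (cases "s = 0")
        case True
        have "((\<lambda>u. Hs u \<theta> x) \<longlongrightarrow> \<theta> x) (at_right 0)" by (rule Hs_initial[OF \<theta>(2) x])
        then have "(m \<longlongrightarrow> \<theta> x) (at_right 0)"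
          by (rule Lim_transform_eventually) (auto simp: m_def eventually_at_right_less eventually_at_filter)
        moreover have "at 0 within {0..r} = at_right 0" using r by (simp add: at_within_Icc_at_right)
        ultimately show ?thesis using True by (simp add: continuous_within m_def)
      next
        case False
        then show ?thesis using s dm[of s] by (auto intro!: continuous_at_imp_continuous_at_within DERIV_isCont)
      qed
    qed
  qed
  moreover have "m differentiable (at s)" if "0 < s" "s < r" for s
    using dm[OF that(1)] by (auto simp: real_differentiable_def)
  ultimately obtain l z where z: "0 < z" "z < r" "DERIV m z :> l" "m r - m 0 = (r - 0) * l"
    using MVT[OF r, of m] by auto
  have "l = Hs z (lap \<theta>) x" using z(3) dm[OF z(1)] DERIV_unique by blast
  then show thesis using z r by (intro that[of z]) (auto simp: m_def)
qed

lemma Hs_generator: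
  assumes \<theta>: "C2X \<theta>" "supported \<theta> R" and x: "x \<in> X"
  shows "((\<lambda>r. (Hs r \<theta> x - \<theta> x) / r) \<longlongrightarrow> lap \<theta> x) (at_right 0)"
proof (rule tendstoI)
  fix e :: real assume e: "e > 0"
  have "((\<lambda>u. Hs u (lap \<theta>) x) \<longlongrightarrow> lap \<theta> x) (at_right 0)"
    by (rule Hs_initial[OF supported_lap[OF \<theta>] x])
  then have "\<forall>\<^sub>F u in at_right 0. dist (Hs u (lap \<theta>) x) (lap \<theta> x) < e" using e by (rule tendstoD)
  then obtain b where b: "b > 0" "\<And>u. 0 < u \<Longrightarrow> u < b \<Longrightarrow> dist (Hs u (lap \<theta>) x) (lap \<theta> x) < e"
    unfolding eventually_at_right_field by auto
  show "\<forall>\<^sub>F r in at_right 0. dist ((Hs r \<theta> x - \<theta> x) / r) (lap \<theta> x) < e"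
    unfolding eventually_at_right_field
  proof (intro exI[of _ b] conjI allI impI b(1))
    fix r :: real assume r: "0 < r" "r < b"
    obtain z where "0 < z" "z < r" "Hs r \<theta> x = \<theta> x + r * Hs z (lap \<theta>) x" by (rule Hs_mean_value[OF \<theta> r(1) x])
    then show "dist ((Hs r \<theta> x - \<theta> x) / r) (lap \<theta> x) < e" using b(2)[of z] r by simp
  qed
qed

lemma Hs_lipschitz:
  assumes \<theta>: "C2X \<theta>" "supported \<theta> R" and x: "x \<in> X" and C: "\<And>y. y \<in> X \<Longrightarrow> \<bar>lap \<theta> y\<bar> \<le> C"
  shows "s > 0 \<Longrightarrow> \<bar>Hs s \<theta> x - \<theta> x\<bar> \<le> C * s"
    and "s > 0 \<Longrightarrow> r > 0 \<Longrightarrow> \<bar>Hs s \<theta> x - Hs r \<theta> x\<bar> \<le> C * \<bar>s - r\<bar>"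
proof -
  have b: "\<bar>Hs z (lap \<theta>) x\<bar> \<le> C" if "z > 0" for z
    by (rule Hs_bound[OF that x supported_measurable[OF supported_lap[OF \<theta>]] C])
  show "\<bar>Hs s \<theta> x - \<theta> x\<bar> \<le> C * s" if s: "s > 0"
  proof -
    obtain z where z: "0 < z" "z < s" "Hs s \<theta> x = \<theta> x + s * Hs z (lap \<theta>) x" by (rule Hs_mean_value[OF \<theta> s x])
    then show ?thesis using b[OF z(1)] s by (simp add: abs_mult mult.commute mult_right_mono)
  qed
  show "\<bar>Hs s \<theta> x - Hs r \<theta> x\<bar> \<le> C * \<bar>s - r\<bar>" if "s > 0" "r > 0"
    using field_differentiable_bound[of "{0<..}" "\<lambda>s. Hs s \<theta> x" "\<lambda>s. Hs s (lap \<theta>) x" C s r] that b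
    by (auto intro!: has_field_derivative_at_within[OF Hs_derivative[OF \<theta> _ x]] simp: convex_real_interval)
qed

text \<open>A cutoff that is 1 at \<open>x\<close> and falls to 0 over a width \<open>d\<close> has
  Laplacian at most \<open>2 * C / d\<close>. By \<open>Hs_lipschitz\<close> its image at time
  \<open>s\<close> is still at least \<open>1 - 2 * C * s / d\<close> at \<open>x\<close>, and this
  bounds the mass from below; \<open>d\<close> is taken large.\<close>

theorem stochastic_completeness:
  assumes s: "s > 0" and x: "x \<in> X" shows "(\<integral>y. h s x y \<partial>\<mu>) = 1"
proof (rule antisym[OF h_integral_le[OF s x]], rule field_le_epsilon)
  fix e :: real assume e: "e > 0"
  obtain C where C: "C \<ge> 0" "\<And>a b. a < b \<Longrightarrow> \<exists>\<eta>. C2X \<eta> \<and> (\<forall>x. 0 \<le> \<eta> x \<and> \<eta> x \<le> 1) \<and>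
    (\<forall>x. N x \<le> a \<longrightarrow> \<eta> x = 1) \<and> (\<forall>x. b \<le> N x \<longrightarrow> \<eta> x = 0) \<and>
    (\<forall>x\<in>X. \<bar>lap \<eta> x\<bar> \<le> C * (1 / (b - a) + 1 / (b - a)\<^sup>2))" using cutoff by blast
  define d where "d = max 1 (2 * C * s / e)"
  have d: "d \<ge> 1" "2 * C * s \<le> e * d"
    using e by (auto simp: d_def max_def field_simps)
  obtain \<eta> where \<eta>: "C2X \<eta>" "\<And>x. 0 \<le> \<eta> x" "\<And>x. \<eta> x \<le> 1" "\<And>y. N y \<le> N x \<Longrightarrow> \<eta> y = 1"
    "\<And>y. N x + d \<le> N y \<Longrightarrow> \<eta> y = 0" "\<And>y. y \<in> X \<Longrightarrow> \<bar>lap \<eta> y\<bar> \<le> C * (1 / d + 1 / d\<^sup>2)"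
    using C(2)[of "N x" "N x + d"] d(1) by auto
  have sup: "supported \<eta> (N x + d)" using \<eta>(1,5) by (simp add: supported_def C2X_continuous)
  have lb: "C * (1 / d + 1 / d\<^sup>2) \<le> 2 * C / d"
  proof -
    have "1 / d\<^sup>2 \<le> 1 / d" using d(1) by (intro divide_left_mono) (auto simp: power2_eq_square)
    then have "C * (1 / d + 1 / d\<^sup>2) \<le> C * (2 / d)" using C(1) by (intro mult_left_mono) auto
    then show ?thesis by simp
  qed
  have "\<bar>Hs s \<eta> x - \<eta> x\<bar> \<le> 2 * C / d * s"
    by (rule Hs_lipschitz(1)[OF \<eta>(1) sup x _ s]) (use \<eta>(6) lb in force)
  also have "\<dots> \<le> e" using d by (simp add: divide_le_eq)
  finally have "Hs s \<eta> x \<ge> 1 - e" using \<eta>(4)[of x] by simp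
  moreover have "Hs s \<eta> x \<le> Hs s (\<lambda>_. 1) x"
    by (rule Hs_mono[OF s x supported_measurable[OF sup], where C=1 and C'=1]) (use \<eta>(2,3) in auto)
  ultimately show "1 \<le> (\<integral>y. h s x y \<partial>\<mu>) + e" by (simp add: Hs_def)
qed

lemma h_nn_1: "u > 0 \<Longrightarrow> x \<in> X \<Longrightarrow> (\<integral>\<^sup>+ y. ennreal (h u x y) \<partial>\<mu>) = 1"
  by (simp add: h_nn_eq stochastic_completeness)

text \<open>Scheffe's lemma replaces local bounds on the kernel: total mass one and pointwise continuity
  give continuity in \<open>L\<^sup>1\<close>.\<close>
lemma Hs_continuous:
  assumes u: "u > 0" and f: "f \<in> borel_measurable \<mu>" "\<And>y. y \<in> X \<Longrightarrow> \<bar>f y\<bar> \<le> C"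
  shows "continuous_on S (\<lambda>Y. Hs u f (E Y))"
  unfolding continuous_on_sequentially comp_def
proof (intro allI ballI impI)
  fix Z Y assume "(\<forall>n. Z n \<in> S) \<and> Z \<longlonglongrightarrow> Y"
  then have Z: "Z \<longlonglongrightarrow> Y" by simp
  have C0: "C \<ge> 0" using f(2)[OF org_X] by linarith
  have nn: "(\<integral>\<^sup>+ y. ennreal (norm (h u (E W) y)) \<partial>\<mu>) = 1" for W
  proof -
    have "(\<integral>\<^sup>+ y. ennreal (norm (h u (E W) y)) \<partial>\<mu>) = (\<integral>\<^sup>+ y. ennreal (h u (E W) y) \<partial>\<mu>)"
      by (intro nn_integral_cong) (simp add: h_nonneg u)
    then show ?thesis by (simp add: h_nn_1 u)
  qed
  have "(\<lambda>n. \<integral>\<^sup>+ y. norm (h u (E (Z n)) y - h u (E Y) y) \<partial>\<mu>) \<longlonglongrightarrow> 0"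
  proof (rule Scheffe_lemma2)
    show "AE y in \<mu>. (\<lambda>n. h u (E (Z n)) y) \<longlonglongrightarrow> h u (E Y) y"
    proof (rule AE_I2)
      fix y assume "y \<in> space \<mu>"
      then have y: "y \<in> X" by simp
      show "(\<lambda>n. h u (E (Z n)) y) \<longlonglongrightarrow> h u (E Y) y"
        using continuous_on_tendsto_compose[OF continuous_E[where S=UNIV and f="\<lambda>x. h u x y", OF h_continuous_1[OF u y]] Z] by simp
    qed
  qed (use nn in \<open>auto simp: h_measurable h_integrable u simp del: real_norm_def\<close>)
  then have L: "(\<lambda>n. \<integral>\<^sup>+ y. ennreal \<bar>h u (E (Z n)) y - h u (E Y) y\<bar> \<partial>\<mu>) \<longlonglongrightarrow> 0" by simp
  have int: "integrable \<mu> (\<lambda>y. \<bar>h u (E (Z n)) y - h u (E Y) y\<bar>)" for n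
    by (intro integrable_abs Bochner_Integration.integrable_diff h_integrable u E_X)
  have "(\<integral>\<^sup>+ y. ennreal \<bar>h u (E (Z n)) y - h u (E Y) y\<bar> \<partial>\<mu>) = ennreal (\<integral>y. \<bar>h u (E (Z n)) y - h u (E Y) y\<bar> \<partial>\<mu>)" for n
    by (rule nn_integral_eq_integral[OF int]) auto
  then have "(\<lambda>n. ennreal (\<integral>y. \<bar>h u (E (Z n)) y - h u (E Y) y\<bar> \<partial>\<mu>)) \<longlonglongrightarrow> ennreal 0" using L by simp
  then have R: "(\<lambda>n. \<integral>y. \<bar>h u (E (Z n)) y - h u (E Y) y\<bar> \<partial>\<mu>) \<longlonglongrightarrow> 0"
    by (subst (asm) tendsto_ennreal_iff) auto
  have "(\<lambda>n. Hs u f (E (Z n)) - Hs u f (E Y)) \<longlonglongrightarrow> 0"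
  proof (rule Lim_null_comparison)
    show "\<forall>\<^sub>F n in sequentially. norm (Hs u f (E (Z n)) - Hs u f (E Y)) \<le> C * (\<integral>y. \<bar>h u (E (Z n)) y - h u (E Y) y\<bar> \<partial>\<mu>)"
    proof (intro always_eventually allI)
      fix n
      have "Hs u f (E (Z n)) - Hs u f (E Y) = (\<integral>y. (h u (E (Z n)) y - h u (E Y) y) * f y \<partial>\<mu>)"
        unfolding Hs_def left_diff_distrib
        by (rule Bochner_Integration.integral_diff[symmetric]; rule h_mult_integrable[OF u E_X f])
      also have "\<bar>\<dots>\<bar> \<le> (\<integral>y. \<bar>(h u (E (Z n)) y - h u (E Y) y) * f y\<bar> \<partial>\<mu>)" by (rule integral_abs_bound)
      also have "\<dots> \<le> (\<integral>y. C * \<bar>h u (E (Z n)) y - h u (E Y) y\<bar> \<partial>\<mu>)"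
      proof (rule integral_mono)
        show "integrable \<mu> (\<lambda>y. \<bar>(h u (E (Z n)) y - h u (E Y) y) * f y\<bar>)"
          unfolding left_diff_distrib
          by (intro integrable_abs Bochner_Integration.integrable_diff h_mult_integrable[OF u E_X f])
        show "integrable \<mu> (\<lambda>y. C * \<bar>h u (E (Z n)) y - h u (E Y) y\<bar>)" by (intro integrable_mult_right int)
        fix y assume "y \<in> space \<mu>"
        then have "\<bar>f y\<bar> \<le> C" using f(2) by simp
        then show "\<bar>(h u (E (Z n)) y - h u (E Y) y) * f y\<bar> \<le> C * \<bar>h u (E (Z n)) y - h u (E Y) y\<bar>"
          by (simp add: abs_mult mult.commute[of C] mult_left_mono)
      qed
      finally show "norm (Hs u f (E (Z n)) - Hs u f (E Y)) \<le> C * (\<integral>y. \<bar>h u (E (Z n)) y - h u (E Y) y\<bar> \<partial>\<mu>)" by simp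
    qed
    show "(\<lambda>n. C * (\<integral>y. \<bar>h u (E (Z n)) y - h u (E Y) y\<bar> \<partial>\<mu>)) \<longlonglongrightarrow> 0"
      using tendsto_mult_right_zero[OF R] .
  qed
  then show "(\<lambda>n. Hs u f (E (Z n))) \<longlonglongrightarrow> Hs u f (E Y)" by (rule LIM_zero_cancel)
qed

text \<open>Extension by 0 to times \<open>u \<le> 0\<close>, about which \<open>heat_kernel\<close>
  says nothing; joint measurability on the whole time axis can then be stated.\<close>

definition h0 :: "real \<Rightarrow> ('g \<Rightarrow> 'g) set \<Rightarrow> ('g \<Rightarrow> 'g) set \<Rightarrow> real" where
  "h0 u x y = indicator {0<..} u * h u x y"

lemma h0_measurable_ux: assumes y: "y \<in> X"
  shows "(\<lambda>(u, x). h0 u x y) \<in> borel_measurable (lborel \<Otimes>\<^sub>M \<mu>)"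
proof (rule measurable_Caratheodory)
  fix x assume x: "x \<in> X"
  have "continuous_on {0<..} (\<lambda>u. h u x y)"
    using h_time[OF _ x y] by (intro continuous_at_imp_continuous_on) (auto intro: DERIV_isCont)
  then have "(\<lambda>u. indicator {0<..} u *\<^sub>R h u x y) \<in> borel_measurable borel"
    by (rule borel_measurable_continuous_on_indicator[rotated]) simp
  then show "(\<lambda>u. h0 u x y) \<in> borel_measurable lborel" by (simp add: h0_def)
next
  fix u :: real
  show "continuous_on G (\<lambda>g. h0 u (cs g) y)"
    unfolding h0_def using h_continuous_1[OF _ y, of u] by (cases "u > 0") auto
qed

text \<open>\<open>measurable_Caratheodory\<close> is used twice: first for time and one space
  variable, then with this pair as the parameter and the other space variable as the continuous
  one.\<close>

lemma h0_measurable: "(\<lambda>(ux, y). h0 (fst ux) (snd ux) y) \<in> borel_measurable ((lborel \<Otimes>\<^sub>M \<mu>) \<Otimes>\<^sub>M \<mu>)"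
proof (rule measurable_Caratheodory)
  show "(\<lambda>ux. h0 (fst ux) (snd ux) y) \<in> borel_measurable (lborel \<Otimes>\<^sub>M \<mu>)" if "y \<in> X" for y
    using h0_measurable_ux[OF that] by (simp add: case_prod_beta)
  show "continuous_on G (\<lambda>g. h0 (fst ux) (snd ux) (cs g))" if "ux \<in> space (lborel \<Otimes>\<^sub>M \<mu>)" for ux
    unfolding h0_def using h_continuous_2[of "fst ux" "snd ux"] that
    by (cases "fst ux > 0") (auto simp: space_pair_measure)
qed

lemma h_measurable_xy: assumes u: "u > 0"
  shows "(\<lambda>(x, y). h u x y) \<in> borel_measurable (\<mu> \<Otimes>\<^sub>M \<mu>)"
  by (rule measurable_Caratheodory)
    (use measurable_continuous[OF h_continuous_1[OF u]] h_continuous_2[OF u] in auto)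

sublocale PP: pair_sigma_finite \<mu> \<mu> ..

lemma Hs_measurable: assumes u: "u > 0" and f: "f \<in> borel_measurable \<mu>"
  shows "Hs u f \<in> borel_measurable \<mu>"
  unfolding Hs_def[abs_def]
proof (rule borel_measurable_lebesgue_integral)
  have "(\<lambda>z. f (snd z)) \<in> borel_measurable (\<mu> \<Otimes>\<^sub>M \<mu>)" using measurable_compose[OF measurable_snd f] .
  then show "(\<lambda>(x, y). h u x y * f y) \<in> borel_measurable (\<mu> \<Otimes>\<^sub>M \<mu>)"
    using h_measurable_xy[OF u] by (simp add: case_prod_beta)
qed

lemma Hs_semigroup:
  assumes u: "u > 0" and v: "v > 0" and x: "x \<in> X"
    and f: "f \<in> borel_measurable \<mu>" "\<And>y. y \<in> X \<Longrightarrow> \<bar>f y\<bar> \<le> C"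
  shows "Hs (u + v) f x = Hs u (Hs v f) x"
proof -
  have C0: "C \<ge> 0" using f(2)[OF org_X] by linarith
  have mf: "(\<lambda>z. f (snd z)) \<in> borel_measurable (\<mu> \<Otimes>\<^sub>M \<mu>)" using measurable_compose[OF measurable_snd f(1)] .
  have mh: "(\<lambda>z. h u x (fst z)) \<in> borel_measurable (\<mu> \<Otimes>\<^sub>M \<mu>)"
    using measurable_compose[OF measurable_fst h_measurable[OF u x]] .
  have m: "(\<lambda>(z, y). h u x z * h v z y * f y) \<in> borel_measurable (\<mu> \<Otimes>\<^sub>M \<mu>)"
    using mf mh h_measurable_xy[OF v] by (simp add: case_prod_beta)
  have int: "integrable (\<mu> \<Otimes>\<^sub>M \<mu>) (\<lambda>(z, y). h u x z * h v z y * f y)"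
  proof (rule PP.Fubini_integrable[OF m])
    have i: "integrable \<mu> (\<lambda>y. h u x z * h v z y * f y)" if "z \<in> X" for z
      using integrable_mult_right[OF h_mult_integrable[OF v that f], of "h u x z"] by (simp add: mult.assoc)
    show "AE z in \<mu>. integrable \<mu> (\<lambda>y. case (z, y) of (z, y) \<Rightarrow> h u x z * h v z y * f y)"
      using i by (intro AE_I2) simp
    have mm: "(\<lambda>(z, y). norm (h u x z * h v z y * f y)) \<in> borel_measurable (\<mu> \<Otimes>\<^sub>M \<mu>)"
      using m by (simp add: case_prod_beta)
    show "integrable \<mu> (\<lambda>z. \<integral>y. norm (case (z, y) of (z, y) \<Rightarrow> h u x z * h v z y * f y) \<partial>\<mu>)"
    proof (rule Bochner_Integration.integrable_bound[OF integrable_mult_left[OF h_integrable[OF u x], of C]])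
      show "(\<lambda>z. \<integral>y. norm (case (z, y) of (z, y) \<Rightarrow> h u x z * h v z y * f y) \<partial>\<mu>) \<in> borel_measurable \<mu>"
        using borel_measurable_lebesgue_integral[OF mm] by simp
      show "AE z in \<mu>. norm (\<integral>y. norm (case (z, y) of (z, y) \<Rightarrow> h u x z * h v z y * f y) \<partial>\<mu>) \<le> norm (h u x z * C)"
      proof (rule AE_I2)
        fix z assume "z \<in> space \<mu>"
        then have z: "z \<in> X" by simp
        have hz: "0 \<le> h u x z" by (rule h_nonneg[OF u x z])
        have "(\<integral>y. norm (h u x z * h v z y * f y) \<partial>\<mu>) = (\<integral>y. h u x z * (h v z y * \<bar>f y\<bar>) \<partial>\<mu>)"
          by (intro Bochner_Integration.integral_cong refl) (simp add: abs_mult h_nonneg u v x z mult.assoc)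
        also have "\<dots> = h u x z * Hs v (\<lambda>y. \<bar>f y\<bar>) z" by (simp add: Hs_def)
        also have "\<dots> \<le> h u x z * C"
          using Hs_bound[OF v z, of "\<lambda>y. \<bar>f y\<bar>" C] f hz by (intro mult_left_mono) auto
        finally show "norm (\<integral>y. norm (case (z, y) of (z, y) \<Rightarrow> h u x z * h v z y * f y) \<partial>\<mu>) \<le> norm (h u x z * C)"
          using hz C0 by simp
      qed
    qed
  qed
  have "Hs (u + v) f x = (\<integral>y. (\<integral>z. h u x z * h v z y * f y \<partial>\<mu>) \<partial>\<mu>)"
    unfolding Hs_def by (intro Bochner_Integration.integral_cong refl) (simp add: h_semigroup[OF u v x])
  also have "\<dots> = (\<integral>z. (\<integral>y. h u x z * h v z y * f y \<partial>\<mu>) \<partial>\<mu>)"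
    by (rule PP.Fubini_integral[OF int])
  also have "\<dots> = Hs u (Hs v f) x"
    unfolding Hs_def by (simp add: mult.assoc)
  finally show ?thesis .
qed

end

section \<open>Invariance of the heat kernel\<close>

lemma continuous_on_Lipschitz_Times:
  fixes F :: "real \<Rightarrow> 'a::metric_space \<Rightarrow> real"
  assumes L: "\<And>s r y. s \<in> S \<Longrightarrow> r \<in> S \<Longrightarrow> y \<in> T \<Longrightarrow> \<bar>F s y - F r y\<bar> \<le> L * \<bar>s - r\<bar>"
    and c: "\<And>s. s \<in> S \<Longrightarrow> continuous_on T (F s)"
  shows "continuous_on (S \<times> T) (\<lambda>(s, y). F s y)"
  unfolding continuous_on_sequentially comp_def
proof (intro allI ballI impI)
  fix z a assume a: "a \<in> S \<times> T" and z: "(\<forall>n. z n \<in> S \<times> T) \<and> z \<longlonglongrightarrow> a"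
  obtain s y where sy: "a = (s, y)" "s \<in> S" "y \<in> T" using a by auto
  have zn: "fst (z n) \<in> S" "snd (z n) \<in> T" for n using z by (auto simp: mem_Times_iff)
  have l1: "(\<lambda>n. fst (z n)) \<longlonglongrightarrow> s" and l2: "(\<lambda>n. snd (z n)) \<longlonglongrightarrow> y"
    using z tendsto_fst[of z a sequentially] tendsto_snd[of z a sequentially] sy(1) by auto
  have c2: "(\<lambda>n. F s (snd (z n))) \<longlonglongrightarrow> F s y"
    using continuous_on_tendsto_compose[OF c[OF sy(2)] l2 sy(3)] zn by simp
  have "(\<lambda>n. F (fst (z n)) (snd (z n)) - F s (snd (z n))) \<longlonglongrightarrow> 0"
  proof (rule Lim_null_comparison)
    show "\<forall>\<^sub>F n in sequentially. norm (F (fst (z n)) (snd (z n)) - F s (snd (z n))) \<le> L * \<bar>fst (z n) - s\<bar>"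
      using L[OF zn(1) sy(2) zn(2)] by simp
    have "(\<lambda>n. L * \<bar>fst (z n) - s\<bar>) \<longlonglongrightarrow> L * \<bar>s - s\<bar>" by (intro tendsto_intros l1)
    then show "(\<lambda>n. L * \<bar>fst (z n) - s\<bar>) \<longlonglongrightarrow> 0" by simp
  qed
  from tendsto_add[OF this c2] show "(\<lambda>n. case z n of (s, y) \<Rightarrow> F s y) \<longlonglongrightarrow> (case a of (s, y) \<Rightarrow> F s y)"
    by (simp add: case_prod_beta sy(1))
qed

context rank_one_heat
begin

lemma lap_eq_below:
  assumes "C2X u" "C2X v" "\<And>x. x \<in> X \<Longrightarrow> N x < R \<Longrightarrow> u x = v x" "x \<in> X" "N x < R"
  shows "lap u x = lap v x"
proof -
  have c: "C2X (\<lambda>x. - 1 * v x)" by (rule C2X_mult[OF C2X_const assms(2)])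
  have "lap (\<lambda>x. u x + - 1 * v x) x = 0"
    by (rule lap_zero_below[where R=R]) (use assms C2X_add[OF assms(1) c] in auto)
  moreover have "lap (\<lambda>x. u x + - 1 * v x) x = lap u x + - 1 * lap v x"
    unfolding lap_add[OF assms(1) c assms(4)] lap_cmult[OF assms(2,4)] ..
  ultimately show ?thesis by simp
qed

lemma Hs_const: "u > 0 \<Longrightarrow> x \<in> X \<Longrightarrow> Hs u (\<lambda>_. c) x = c"
  by (simp add: Hs_def stochastic_completeness)

lemma Hs_add_const:
  assumes "u > 0" "x \<in> X" "f \<in> borel_measurable \<mu>" "\<And>y. y \<in> X \<Longrightarrow> \<bar>f y\<bar> \<le> C"
  shows "Hs u (\<lambda>y. f y + c) x = Hs u f x + c"
  using Hs_add[OF assms, of "\<lambda>_. c" "\<bar>c\<bar>"] Hs_const[OF assms(1,2)] by simp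

text \<open>Both maximum principles below reduce to this test: a smooth function that touches the data
  from above is controlled by its Laplacian at the point of contact.\<close>
lemma touching_from_above:
  assumes P: "C2X P" and ch: "continuous_on G (\<lambda>g. ch (cs g))" and x: "x \<in> X" "N x < b" and rmax: "rmax > 0"
    and m: "\<And>r. 0 < r \<Longrightarrow> r < rmax \<Longrightarrow> u r \<in> borel_measurable \<mu>"
    and bd: "\<And>r y. 0 < r \<Longrightarrow> r < rmax \<Longrightarrow> y \<in> X \<Longrightarrow> \<bar>u r y\<bar> \<le> C"
    and le: "\<And>r y. 0 < r \<Longrightarrow> r < rmax \<Longrightarrow> y \<in> X \<Longrightarrow> N y \<le> b \<Longrightarrow> u r y \<le> P y - r * ch y"
    and init: "\<And>r. 0 < r \<Longrightarrow> r < rmax \<Longrightarrow> P x \<le> Hs r (u r) x"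
  shows "ch x \<le> lap P x"
proof -
  define a where "a = (N x + b) / 2"
  have ab: "N x < a" "a < b" using x(2) by (auto simp: a_def field_simps)
  obtain \<eta> where \<eta>: "C2X \<eta>" "\<And>x. 0 \<le> \<eta> x" "\<And>x. \<eta> x \<le> 1" "\<And>y. N y \<le> a \<Longrightarrow> \<eta> y = 1" "\<And>y. b \<le> N y \<Longrightarrow> \<eta> y = 0"
    using cutoff ab(2) by metis
  have C0: "C \<ge> 0" using bd[of "rmax / 2" org] rmax by fastforce
  \<comment> \<open>\<open>\<Phi> + C\<close> equals \<open>\<eta> * P + (1 - \<eta>) * C\<close>:
    the touching function where \<open>N y \<le> a\<close>, the trivial bound far out. The constant
    is split off because \<open>Hs_generator\<close> demands bounded support, while
    \<open>Hs\<close> preserves constants.\<close>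
  define \<Phi> where "\<Phi> y = \<eta> y * P y + (- C) * \<eta> y" for y
  define X' where "X' y = - 1 * (\<eta> y * ch y)" for y
  have \<eta>1: "\<eta> x = 1" using \<eta>(4) ab by simp
  have cX: "continuous_on G (\<lambda>g. X' (cs g))"
    unfolding X'_def by (intro continuous_on_mult continuous_on_const C2X_continuous[OF \<eta>(1)] ch)
  have c\<Phi>: "C2X \<Phi>" unfolding \<Phi>_def by (intro C2X_add C2X_mult C2X_const \<eta>(1) P)
  have s\<Phi>: "supported \<Phi> b" using \<eta>(5) C2X_continuous[OF c\<Phi>] by (simp add: supported_def \<Phi>_def)
  have sX: "supported X' b" using \<eta>(5) cX by (simp add: supported_def X'_def)
  obtain C\<Phi> where C\<Phi>: "\<And>y. y \<in> X \<Longrightarrow> \<bar>\<Phi> y\<bar> \<le> C\<Phi>" using supported_bounded[OF s\<Phi>] by blast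
  obtain CX where CX: "\<And>y. y \<in> X \<Longrightarrow> \<bar>X' y\<bar> \<le> CX" using supported_bounded[OF sX] by blast
  have m\<Phi>: "\<Phi> \<in> borel_measurable \<mu>" and mX: "X' \<in> borel_measurable \<mu>"
    by (rule supported_measurable[OF s\<Phi>], rule supported_measurable[OF sX])
  have key: "0 \<le> (Hs r \<Phi> x - \<Phi> x) / r + Hs r X' x" if r: "0 < r" "r < rmax" for r
  proof -
    have CrX: "\<bar>r * X' y\<bar> \<le> r * CX" if "y \<in> X" for y
      using CX[OF that] r by (simp add: abs_mult)
    have mrX: "(\<lambda>y. r * X' y) \<in> borel_measurable \<mu>" using mX by simp
    have b2: "\<bar>\<Phi> y + r * X' y\<bar> \<le> C\<Phi> + r * CX" if "y \<in> X" for y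
      using C\<Phi>[OF that] CrX[OF that] by linarith
    have b3: "\<bar>\<Phi> y + r * X' y + C\<bar> \<le> C\<Phi> + r * CX + C" if "y \<in> X" for y
      using b2[OF that] C0 by linarith
    have m2: "(\<lambda>y. \<Phi> y + r * X' y) \<in> borel_measurable \<mu>" using m\<Phi> mrX by simp
    have "P x \<le> Hs r (u r) x" by (rule init[OF r])
    also have "\<dots> \<le> Hs r (\<lambda>y. \<Phi> y + r * X' y + C) x"
    proof (rule Hs_mono[OF r(1) x(1) m[OF r] bd[OF r] _ b3])
      show "(\<lambda>y. \<Phi> y + r * X' y + C) \<in> borel_measurable \<mu>" using m2 by simp
      fix y assume y: "y \<in> X"
      show "u r y \<le> \<Phi> y + r * X' y + C"
      proof (cases "N y \<le> b")
        case True
        have "u r y = \<eta> y * u r y + (1 - \<eta> y) * u r y" by (simp add: algebra_simps)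
        also have "\<dots> \<le> \<eta> y * (P y - r * ch y) + (1 - \<eta> y) * C"
          using le[OF r y True] bd[OF r y] \<eta>(2,3)[of y] by (intro add_mono mult_left_mono) auto
        also have "\<dots> = \<Phi> y + r * X' y + C" by (simp add: \<Phi>_def X'_def algebra_simps)
        finally show ?thesis .
      next
        case False
        then have "\<eta> y = 0" using \<eta>(5) by simp
        then show ?thesis using bd[OF r y] by (simp add: \<Phi>_def X'_def)
      qed
    qed
    also have "\<dots> = Hs r (\<lambda>y. \<Phi> y + r * X' y) x + C" by (rule Hs_add_const[OF r(1) x(1) m2 b2])
    also have "Hs r (\<lambda>y. \<Phi> y + r * X' y) x = Hs r \<Phi> x + Hs r (\<lambda>y. r * X' y) x"
      by (rule Hs_add[OF r(1) x(1) m\<Phi> C\<Phi> mrX CrX])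
    also have "Hs r (\<lambda>y. r * X' y) x = r * Hs r X' x" by (rule Hs_cmult)
    finally have "P x \<le> Hs r \<Phi> x + r * Hs r X' x + C" .
    moreover have "\<Phi> x = P x - C" by (simp add: \<Phi>_def \<eta>1)
    ultimately have "0 \<le> Hs r \<Phi> x - \<Phi> x + r * Hs r X' x" by linarith
    then have "0 \<le> (Hs r \<Phi> x - \<Phi> x + r * Hs r X' x) / r" using r by simp
    then show ?thesis using r by (simp add: add_divide_distrib)
  qed
  have "((\<lambda>r. (Hs r \<Phi> x - \<Phi> x) / r + Hs r X' x) \<longlongrightarrow> lap \<Phi> x + X' x) (at_right 0)"
    by (intro tendsto_add Hs_generator[OF c\<Phi> s\<Phi> x(1)] Hs_initial[OF sX x(1)])
  moreover have "\<forall>\<^sub>F r in at_right 0. 0 \<le> (Hs r \<Phi> x - \<Phi> x) / r + Hs r X' x"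
    unfolding eventually_at_right_field using key rmax by (intro exI[of _ rmax]) simp
  ultimately have "0 \<le> lap \<Phi> x + X' x" by (rule tendsto_lowerbound) simp
  moreover have "lap \<Phi> x = lap (\<lambda>y. P y + - C) x"
    by (rule lap_eq_below[where R=a, OF c\<Phi> C2X_add[OF P C2X_const] _ x(1) ab(1)]) (simp add: \<Phi>_def \<eta>(4))
  moreover have "\<dots> = lap P x" by (simp only: lap_add[OF P C2X_const x(1)] lap_const add_0_right)
  ultimately show ?thesis by (simp add: X'_def \<eta>1)
qed

text \<open>The semigroup gives the smallest nonnegative solution. The difference of
  \<open>Hs s f\<close> and \<open>V s\<close> is lowered by \<open>d * (N - N org)\<close>, which
  confines a positive maximum to a compact set, and by \<open>d * (C + 1) * s\<close>, which exceeds
  anything that \<open>d * lap N\<close> can contribute. At the maximum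
  \<open>touching_from_above\<close> then gives a contradiction.\<close>

lemma parabolic_comparison:
  assumes V: "\<And>s. 0 \<le> s \<Longrightarrow> C2X (V s)" and V0: "\<And>s x. 0 \<le> s \<Longrightarrow> x \<in> X \<Longrightarrow> 0 \<le> V s x"
    and dV: "\<And>s x. 0 \<le> s \<Longrightarrow> x \<in> X \<Longrightarrow> ((\<lambda>s. V s x) has_real_derivative lap (V s) x) (at s)"
    and cV: "continuous_on ({0..} \<times> UNIV) (\<lambda>(s, Y). V s (E Y))"
    and cL: "continuous_on ({0..} \<times> UNIV) (\<lambda>(s, Y). lap (V s) (E Y))"
    and f: "C2X f" "supported f R" and fV: "\<And>x. x \<in> X \<Longrightarrow> f x \<le> V 0 x"
    and s1: "0 < s1" and x1: "x1 \<in> X"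
  shows "Hs s1 f x1 \<le> V s1 x1"
proof (rule ccontr)
  assume neg: "\<not> ?thesis"
  define gap where "gap = Hs s1 f x1 - V s1 x1"
  have gap: "gap > 0" using neg by (simp add: gap_def)
  obtain C where C: "C > 0" "\<And>x. x \<in> X \<Longrightarrow> \<bar>lap N x\<bar> \<le> C" using lap_N_le by metis
  obtain Cf where Cf: "Cf \<ge> 0" "\<And>x. x \<in> X \<Longrightarrow> \<bar>f x\<bar> \<le> Cf" using supported_bounded[OF f(2)] by blast
  obtain L where L: "L \<ge> 0" "\<And>x. x \<in> X \<Longrightarrow> \<bar>lap f x\<bar> \<le> L"
    using supported_bounded[OF supported_lap[OF f]] by blast
  have mf: "f \<in> borel_measurable \<mu>" by (rule supported_measurable[OF f(2)])
  have n0: "0 \<le> N x - N org" if "x \<in> X" for x using N_org_le[OF that] by simp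
  define q where "q = (N x1 - N org) + (C + 1) * s1"
  have q: "q > 0" using n0[OF x1] C(1) s1 by (simp add: q_def add_nonneg_pos)
  \<comment> \<open>Small enough for the corrections to cost only half of the assumed gap at
    \<open>(s1, x1)\<close>, so that the maximum of \<open>w\<close> is positive.\<close>
  define d where "d = gap / (2 * q)"
  have d: "d > 0" "d * q = gap / 2" using gap q by (simp_all add: d_def)
  define v where "v s x = (if s = 0 then f x else Hs s f x)" for s x
  have vb: "\<bar>v s x\<bar> \<le> Cf" if "0 \<le> s" "x \<in> X" for s x
    using that Cf(2) Hs_bound[OF _ that(2) mf Cf(2), of s] by (auto simp: v_def)
  have vL: "\<bar>v s x - v r x\<bar> \<le> L * \<bar>s - r\<bar>" if "0 \<le> s" "0 \<le> r" "x \<in> X" for s r x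
    using Hs_lipschitz[OF f that(3) L(2), of s] Hs_lipschitz[OF f that(3) L(2), of r] that
    by (cases "s = 0"; cases "r = 0") (auto simp: v_def abs_minus_commute)
  define w where "w s x = v s x - V s x - d * (N x - N org) - d * (C + 1) * s" for s x
  \<comment> \<open>Beyond \<open>R1\<close> the correction in \<open>N\<close> exceeds the bound
    \<open>Cf\<close> of \<open>v\<close>, and \<open>V\<close> is nonnegative, so \<open>w\<close>
    is negative there; \<open>x1\<close> stays inside.\<close>
  define R1 where "R1 = max (N x1) (N org + Cf / d)"
  have "continuous_on ({0..s1} \<times> CN R1) (\<lambda>(s, Y). w s (E Y))"
  proof -
    have c1: "continuous_on ({0..s1} \<times> CN R1) (\<lambda>(s, Y). v s (E Y))"
    proof (rule continuous_on_Lipschitz_Times[where L=L])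
      show "continuous_on (CN R1) (\<lambda>Y. v s (E Y))" if "s \<in> {0..s1}" for s
        using that continuous_E[OF C2X_continuous[OF f(1)]] Hs_continuous[OF _ mf Cf(2), of s]
        by (cases "s = 0") (simp_all add: v_def)
    qed (use vL in auto)
    have c2: "continuous_on ({0..s1} \<times> CN R1) (\<lambda>(s, Y). V s (E Y))"
      by (rule continuous_on_subset[OF cV]) auto
    have c3: "continuous_on ({0..s1} \<times> CN R1) (\<lambda>z. N (E (snd z)))"
      by (rule continuous_on_compose2[OF continuous_E[OF C2X_continuous[OF C2X_N], of UNIV]
            continuous_on_snd[OF continuous_on_id] subset_UNIV])
    show ?thesis
      using c1 c2 c3 unfolding w_def case_prod_beta
      by (intro continuous_on_diff continuous_on_mult continuous_on_const continuous_on_fst continuous_on_id)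
  qed
  moreover have "compact ({0..s1} \<times> CN R1)" by (intro compact_Times compact_Icc compact_CN)
  moreover obtain Y1 where Y1: "Y1 \<in> CN R1" "x1 = E Y1" using X_CN[OF x1, of R1] by (auto simp: R1_def)
  ultimately obtain z where z: "z \<in> {0..s1} \<times> CN R1"
    "\<forall>z'\<in>{0..s1} \<times> CN R1. (case z' of (s, Y) \<Rightarrow> w s (E Y)) \<le> (case z of (s, Y) \<Rightarrow> w s (E Y))"
    using continuous_attains_sup[of "{0..s1} \<times> CN R1" "\<lambda>(s, Y). w s (E Y)"] s1 by fastforce
  obtain s0 Y0 where zz: "z = (s0, Y0)" by (cases z)
  define x0 where "x0 = E Y0"
  define w0 where "w0 = w s0 x0"
  have x0: "x0 \<in> X" by (simp add: x0_def)
  have s0: "0 \<le> s0" "s0 \<le> s1" using z(1) by (auto simp: zz)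
  have max1: "w s (E Y) \<le> w0" if "0 \<le> s" "s \<le> s1" "Y \<in> CN R1" for s Y
    using z(2) that by (fastforce simp: zz w0_def x0_def)
  have "w s1 x1 = gap - d * q" using s1 by (simp add: w_def v_def gap_def q_def algebra_simps)
  then have "w s1 x1 = gap / 2" using d(2) by simp
  then have w0: "w0 > 0" using max1[of s1 Y1] Y1 s1 gap by simp
  have max2: "w s x \<le> w0" if s: "0 \<le> s" "s \<le> s1" and x: "x \<in> X" for s x
  proof (cases "N x \<le> R1")
    case True
    then obtain Y where "Y \<in> CN R1" "x = E Y" using X_CN[OF x] by blast
    then show ?thesis using max1 s by simp
  next
    case False
    then have "Cf / d < N x - N org" by (simp add: R1_def)
    then have "Cf < d * (N x - N org)" using d(1) by (simp add: divide_less_eq mult.commute)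
    moreover have "v s x \<le> Cf" using vb[OF s(1) x] by simp
    moreover have "0 \<le> V s x" by (rule V0[OF s(1) x])
    moreover have "0 \<le> d * (C + 1) * s" using d(1) C(1) s by simp
    ultimately show ?thesis using w0 by (simp add: w_def)
  qed
  have "s0 \<noteq> 0"
  proof
    assume "s0 = 0"
    then have "w0 = f x0 - V 0 x0 - d * (N x0 - N org)" by (simp add: w0_def w_def v_def)
    moreover have "0 \<le> d * (N x0 - N org)" using d(1) n0[OF x0] by simp
    ultimately show False using w0 fV[OF x0] by simp
  qed
  then have s0': "0 < s0" using s0 by simp
  \<comment> \<open>Time now runs backwards from \<open>s0\<close>. Uniform continuity of the
    Laplacian on this compact set bounds \<open>V (s0 - r) y\<close> by
    \<open>V s0 y - r * (lap (V s0) y - d / 2)\<close>, for all \<open>y\<close> with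
    \<open>N y \<le> b\<close> at once.\<close>
  define b where "b = N x0 + 1"
  have "compact ({0..s0} \<times> CN b)" by (intro compact_Times compact_Icc compact_CN)
  moreover have "continuous_on ({0..s0} \<times> CN b) (\<lambda>(s, Y). lap (V s) (E Y))"
    by (rule continuous_on_subset[OF cL]) auto
  ultimately have "uniformly_continuous_on ({0..s0} \<times> CN b) (\<lambda>(s, Y). lap (V s) (E Y))"
    by (rule compact_uniformly_continuous[rotated])
  then obtain e where e: "e > 0" "\<And>a c. a \<in> {0..s0} \<times> CN b \<Longrightarrow> c \<in> {0..s0} \<times> CN b \<Longrightarrow> dist c a < e \<Longrightarrow>
      dist (case c of (s, Y) \<Rightarrow> lap (V s) (E Y)) (case a of (s, Y) \<Rightarrow> lap (V s) (E Y)) < d / 2"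
    using d(1) unfolding uniformly_continuous_on_def by (meson half_gt_zero)
  have uc: "lap (V s0) y - d / 2 \<le> lap (V s) y" if "0 \<le> s" "s \<le> s0" "s0 - s < e" and y: "y \<in> X" "N y \<le> b" for s y
  proof -
    obtain Y where Y: "Y \<in> CN b" "y = E Y" using X_CN[OF y] by metis
    have "dist (s, Y) (s0, Y) < e" using that by (simp add: dist_Pair_Pair dist_real_def)
    then have "dist (lap (V s) y) (lap (V s0) y) < d / 2" using e(2)[of "(s0, Y)" "(s, Y)"] Y that s0' by simp
    then show ?thesis unfolding dist_real_def by linarith
  qed
  define c1 where "c1 = - d * N org + d * (C + 1) * s0 + w0"
  define P where "P y = V s0 y + (d * N y + c1)" for y
  \<comment> \<open>The added constant is the rate \<open>d * (C + 1)\<close> of the correction in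
    time minus the error \<open>d / 2\<close>. Contact would require it to be at most
    \<open>d * lap N x0\<close>, which is at most \<open>d * C\<close>.\<close>
  define ch where "ch y = lap (V s0) y + (d * (C + 1) - d / 2)" for y
  have cN: "C2X (\<lambda>y. d * N y)" by (rule C2X_mult[OF C2X_const C2X_N])
  have cN1: "C2X (\<lambda>y. d * N y + c1)" by (rule C2X_add[OF cN C2X_const])
  have "ch x0 \<le> lap P x0"
  proof (rule touching_from_above[where u="\<lambda>r. Hs (s0 - r) f" and b=b and C=Cf and rmax="min s0 e"])
    show "C2X P" unfolding P_def by (rule C2X_add[OF V[OF s0(1)] cN1])
    show "continuous_on G (\<lambda>g. ch (cs g))"
      unfolding ch_def by (intro continuous_on_add continuous_on_const continuous_lap V s0)
    show "N x0 < b" by (simp add: b_def)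
    show "0 < min s0 e" using s0' e by simp
    fix r assume r: "0 < r" "r < min s0 e"
    show "Hs (s0 - r) f \<in> borel_measurable \<mu>" by (rule Hs_measurable[OF _ mf]) (use r in simp)
    show "P x0 \<le> Hs r (Hs (s0 - r) f) x0"
    proof -
      have "Hs r (Hs (s0 - r) f) x0 = Hs s0 f x0" using Hs_semigroup[OF r(1) _ x0 mf Cf(2), of "s0 - r"] r by simp
      moreover have "P x0 = Hs s0 f x0" using \<open>s0 \<noteq> 0\<close> by (simp add: P_def c1_def w0_def w_def v_def algebra_simps)
      ultimately show ?thesis by simp
    qed
    fix y assume y: "y \<in> X"
    show "\<bar>Hs (s0 - r) f y\<bar> \<le> Cf" by (rule Hs_bound[OF _ y mf Cf(2)]) (use r in simp)
    assume Ny: "N y \<le> b"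
    obtain z where z: "s0 - r < z" "z < s0" "V s0 y - V (s0 - r) y = (s0 - (s0 - r)) * lap (V z) y"
      using MVT2[of "s0 - r" s0 "\<lambda>s. V s y" "\<lambda>s. lap (V s) y"] dV[OF _ y] r by auto
    have "lap (V s0) y - d / 2 \<le> lap (V z) y" using z r by (intro uc y Ny) auto
    then have "r * (lap (V s0) y - d / 2) \<le> r * lap (V z) y" using r by (intro mult_left_mono) auto
    then have 1: "V (s0 - r) y \<le> V s0 y - r * (lap (V s0) y - d / 2)" using z(3) by simp
    have "w (s0 - r) y \<le> w0" by (rule max2) (use r s0 y in auto)
    then have "Hs (s0 - r) f y \<le> V (s0 - r) y + d * (N y - N org) + d * (C + 1) * (s0 - r) + w0"
      using r by (simp add: w_def v_def)
    also have "\<dots> \<le> (V s0 y - r * (lap (V s0) y - d / 2)) + d * (N y - N org) + d * (C + 1) * (s0 - r) + w0"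
      using 1 by simp
    also have "\<dots> = P y - r * ch y" by (simp add: P_def ch_def c1_def algebra_simps)
    finally show "Hs (s0 - r) f y \<le> P y - r * ch y" .
  qed (rule x0)
  moreover have "lap P x0 = lap (V s0) x0 + d * lap N x0"
    unfolding P_def lap_add[OF V[OF s0(1)] cN1 x0] lap_add[OF cN C2X_const x0] lap_cmult[OF C2X_N x0] lap_const by simp
  ultimately have "d * (C + 1) - d / 2 \<le> d * lap N x0" by (simp add: ch_def)
  moreover have "d * lap N x0 \<le> d * C" using C(2)[OF x0] d(1) by (intro mult_left_mono) auto
  moreover have "d * (C + 1) = d * C + d" by (simp add: algebra_simps)
  ultimately show False using d(1) by linarith
qed

text \<open>The function \<open>V r z = h (t + r) (translate a z) ay\<close> solves the heat
  equation and is smooth down to \<open>r = 0\<close>, because \<open>t > 0\<close>. By comparison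
  it dominates the semigroup applied to \<open>\<theta> * V 0\<close>, and symmetry with a change of
  variables rewrites the latter at \<open>(s, x)\<close> as \<open>Hs t g ay\<close>. As
  \<open>t\<close> tends to 0 this converges to \<open>g ay\<close>, which is
  \<open>h s x y\<close>.\<close>

lemma heat_kernel_le_translate:
  assumes a: "a \<in> G" and s: "s > 0" and x: "x \<in> X" and y: "y \<in> X"
  shows "h s x y \<le> h s (translate a x) (translate a y)"
proof -
  define ay where "ay = translate a y"
  have ay: "ay \<in> X" and ax: "translate a x \<in> X" using a x y by (auto simp: ay_def translate_X)
  have ia: "inv a \<in> G" by (rule G_inv[OF a])
  obtain \<theta> where \<theta>: "C2X \<theta>" "\<And>x. 0 \<le> \<theta> x" "\<And>x. \<theta> x \<le> 1" "\<And>z. N z \<le> N y \<Longrightarrow> \<theta> z = 1" "\<And>z. N y + 1 \<le> N z \<Longrightarrow> \<theta> z = 0"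
    using cutoff[of thesis] less_add_one[of "N y"] by metis
  define g where "g z = h s x (translate (inv a) z) * \<theta> (translate (inv a) z)" for z
  have cg: "continuous_on G (\<lambda>l. g (cs l))"
  proof -
    have "continuous_on G (\<lambda>l. h s x (cs (inv a \<circ> l)))"
      by (rule continuous_on_compose2[OF h_continuous_2[OF s x] continuous_left_mult[OF ia]]) (auto intro: G_comp ia)
    moreover have "continuous_on G (\<lambda>l. \<theta> (translate (inv a) (cs l)))"
      by (rule C2X_continuous[OF C2X_translate[OF \<theta>(1) ia]])
    ultimately show ?thesis unfolding g_def translate_cs by (rule continuous_on_mult)
  qed
  obtain Rg where Rg: "\<And>z. z \<in> X \<Longrightarrow> N z \<le> N y + 1 \<Longrightarrow> \<bar>N (translate a z)\<bar> \<le> Rg"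
    using bounded_on_sublevel[OF C2X_continuous[OF C2X_translate[OF C2X_N a]]] by blast
  have sg: "supported g Rg"
    unfolding supported_def
  proof (intro conjI ballI impI cg)
    fix z assume z: "z \<in> X" "Rg < N z"
    have "\<not> N (translate (inv a) z) \<le> N y + 1"
      using Rg[of "translate (inv a) z"] z translate_X[OF ia z(1)] translate_inv(2)[OF a, of z] by auto
    then show "g z = 0" using \<theta>(5) by (simp add: g_def)
  qed
  have mg: "g \<in> borel_measurable \<mu>" by (rule supported_measurable[OF sg])
  have gy: "g ay = h s x y" using \<theta>(4)[of y] by (simp add: g_def ay_def translate_inv(1)[OF a])
  have le: "Hs t g ay \<le> h (t + s) (translate a x) ay" if t: "t > 0" for t
  proof -
    define V where "V r z = h (t + r) (translate a z) ay" for r z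
    have V: "C2X (V r)" if "r \<ge> 0" for r
      unfolding V_def by (rule C2X_translate[OF h_C2X[OF _ ay] a]) (use t that in simp)
    have lV: "lap (V r) z = lap (\<lambda>z. h (t + r) z ay) (translate a z)" if "r \<ge> 0" "z \<in> X" for r z
      unfolding V_def by (rule lap_translate[OF h_C2X[OF _ ay] a that(2)]) (use t that in simp)
    have cc: "continuous_on ({0..} \<times> UNIV) (\<lambda>(r, Y). (t + r, a \<circ> ex Y))"
      unfolding case_prod_beta
      by (intro continuous_on_Pair continuous_on_add continuous_on_const continuous_on_fst continuous_on_id
          continuous_on_compose2[OF continuous_left_mult[OF a] continuous_on_compose2[OF continuous_ex[of UNIV]
            continuous_on_snd[OF continuous_on_id] subset_UNIV] subset_UNIV])
    have ci: "(\<lambda>(r, Y). (t + r, a \<circ> ex Y)) ` ({0..} \<times> UNIV) \<subseteq> {0<..} \<times> G"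
      using t a by (auto intro: G_comp)
    have tE: "translate a (E Y) = cs (a \<circ> ex Y)" for Y by (simp add: E_def)
    obtain Rf where sf: "supported (\<lambda>z. \<theta> z * V 0 z) Rf" "C2X (\<lambda>z. \<theta> z * V 0 z)"
    proof
      show "C2X (\<lambda>z. \<theta> z * V 0 z)" by (rule C2X_mult[OF \<theta>(1) V]) simp
      from C2X_continuous[OF this] show "supported (\<lambda>z. \<theta> z * V 0 z) (N y + 1)"
        using \<theta>(5) by (simp add: supported_def)
    qed
    have "Hs s (\<lambda>z. \<theta> z * V 0 z) x \<le> V s x"
    proof (rule parabolic_comparison[OF V _ _ _ _ sf(2,1) _ s x])
      show "0 \<le> V r z" if "0 \<le> r" "z \<in> X" for r z
        unfolding V_def using that t a ay by (intro h_nonneg translate_X) auto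
      show "((\<lambda>r. V r z) has_real_derivative lap (V r) z) (at r)" if "0 \<le> r" "z \<in> X" for r z
      proof -
        have "((\<lambda>q. h q (translate a z) ay) has_real_derivative lap (V r) z) (at (t + r))"
          unfolding lV[OF that] by (rule h_time) (use that t a ay in \<open>auto intro: translate_X\<close>)
        then show ?thesis unfolding V_def by (simp add: DERIV_shift add.commute)
      qed
      show "continuous_on ({0..} \<times> UNIV) (\<lambda>(r, Y). V r (E Y))"
        using continuous_on_compose2[OF h_continuous(1)[OF ay] cc ci] by (simp add: case_prod_beta V_def tE)
      have "continuous_on ({0..} \<times> UNIV) (\<lambda>(r, Y). lap (\<lambda>z. h (t + r) z ay) (translate a (E Y)))"
        using continuous_on_compose2[OF h_continuous(2)[OF ay] cc ci] by (simp add: case_prod_beta tE)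
      then show "continuous_on ({0..} \<times> UNIV) (\<lambda>(r, Y). lap (V r) (E Y))"
        by (rule continuous_on_cong[THEN iffD1, OF refl, rotated]) (auto simp: lV)
      show "\<theta> z * V 0 z \<le> V 0 z" if "z \<in> X" for z
      proof (rule mult_left_le_one_le[OF _ \<theta>(2,3)])
        show "0 \<le> V 0 z" unfolding V_def using that t a ay by (intro h_nonneg translate_X) auto
      qed
    qed
    moreover have "Hs s (\<lambda>z. \<theta> z * V 0 z) x = Hs t g ay"
    proof -
      have "Hs t g ay = (\<integral>z. h t ay (translate a z) * g (translate a z) \<partial>\<mu>)"
        unfolding Hs_def by (rule integral_translate[OF a, symmetric]) (use h_measurable[OF t ay] mg in simp)
      also have "\<dots> = (\<integral>z. h s x z * (\<theta> z * V 0 z) \<partial>\<mu>)"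
      proof (rule Bochner_Integration.integral_cong[OF refl])
        fix z assume "z \<in> space \<mu>"
        then have "translate a z \<in> X" using a by (simp add: translate_X)
        then show "h t ay (translate a z) * g (translate a z) = h s x z * (\<theta> z * V 0 z)"
          using h_sym[OF t ay] by (simp add: g_def V_def translate_inv(1)[OF a])
      qed
      finally show ?thesis by (simp add: Hs_def)
    qed
    ultimately show ?thesis by (simp add: V_def)
  qed
  have l1: "((\<lambda>t. Hs t g ay) \<longlongrightarrow> h s x y) (at_right 0)" using Hs_initial[OF sg ay] by (simp add: gy)
  have l2: "((\<lambda>t. h (t + s) (translate a x) ay) \<longlongrightarrow> h s (translate a x) ay) (at_right 0)"
  proof -
    have "isCont (\<lambda>q. h q (translate a x) ay) s" by (rule DERIV_isCont[OF h_time[OF s ax ay]])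
    then have "((\<lambda>t. h (0 + t + s) (translate a x) ay) \<longlongrightarrow> h s (translate a x) ay) (at 0)"
      by (simp add: isCont_iff add.commute)
    then show ?thesis by (simp add: filterlim_at_split)
  qed
  have l3: "\<forall>\<^sub>F t in at_right 0. Hs t g ay \<le> h (t + s) (translate a x) ay"
    unfolding eventually_at_right_field using le by (intro exI[of _ 1]) simp
  show ?thesis unfolding ay_def[symmetric] by (rule tendsto_le[OF _ l2 l1 l3]) simp
qed

text \<open>The preceding inequality for \<open>inv a\<close>, at the translated points, is the
  reverse one.\<close>

theorem heat_kernel_translate:
  assumes a: "a \<in> G" and s: "s > 0" and x: "x \<in> X" and y: "y \<in> X"
  shows "h s (translate a x) (translate a y) = h s x y"
  using heat_kernel_le_translate[OF assms] heat_kernel_le_translate[OF G_inv[OF a] s translate_X[OF a x] translate_X[OF a y]]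
  by (simp add: translate_inv(1)[OF a])

text \<open>The hypothesis \<open>sub\<close> is a weak form of \<open>lap u \<ge> - c\<close>. For
  \<open>d > c / c0\<close> the maximum of \<open>u + d * N\<close> over the points with
  \<open>N\<close> at most \<open>N z\<close> cannot lie where \<open>N < N z\<close>, by
  \<open>touching_from_above\<close>. So it lies on the sphere through \<open>z\<close>, where
  \<open>u\<close> is constant by \<open>K_invariant_radial\<close>; finally \<open>d\<close>
  decreases to \<open>c / c0\<close>.\<close>

lemma elliptic_maximum_principle:
  fixes u :: "('g \<Rightarrow> 'g) set \<Rightarrow> real"
  assumes m: "u \<in> borel_measurable \<mu>" and bd: "\<And>x. x \<in> X \<Longrightarrow> \<bar>u x\<bar> \<le> C"
    and cont: "continuous_on UNIV (\<lambda>Y. u (E Y))"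
    and inv: "\<And>k x. k \<in> K \<Longrightarrow> x \<in> X \<Longrightarrow> u (translate k x) = u x"
    and sub: "\<And>r x. 0 < r \<Longrightarrow> r < r0 \<Longrightarrow> x \<in> X \<Longrightarrow> u x - c * r \<le> Hs r u x" and r0: "r0 > 0"
    and c: "c \<ge> 0" and c0: "c0 > 0" "\<And>x. x \<in> X \<Longrightarrow> c0 \<le> lap N x" and z: "z \<in> X"
  shows "u org \<le> u z + c / c0 * (N z - N org)"
proof -
  have *: "u org \<le> u z + d * (N z - N org)" if d: "c / c0 < d" for d
  proof -
    have d0: "d > 0" using d c c0(1) by (meson divide_nonneg_pos le_less_trans)
    have dc: "c < d * c0" using d c0(1) by (simp add: divide_less_eq)
    define \<rho> where "\<rho> = N z"
    have org\<rho>: "N org \<le> \<rho>" using N_org_le[OF z] by (simp add: \<rho>_def)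
    have "continuous_on (CN \<rho>) (\<lambda>Y. u (E Y) + d * N (E Y))"
      by (intro continuous_on_add continuous_on_mult continuous_on_const continuous_on_subset[OF cont] subset_UNIV
          continuous_E C2X_continuous C2X_N)
    moreover obtain Y1 where Y1: "Y1 \<in> CN \<rho>" "org = E Y1" using X_CN[OF org_X org\<rho>] .
    ultimately obtain Y0 where Y0: "Y0 \<in> CN \<rho>" "\<And>Y. Y \<in> CN \<rho> \<Longrightarrow> u (E Y) + d * N (E Y) \<le> u (E Y0) + d * N (E Y0)"
      using continuous_attains_sup[OF compact_CN, of \<rho> "\<lambda>Y. u (E Y) + d * N (E Y)"] by blast
    define m0 where "m0 = u (E Y0) + d * N (E Y0)"
    have max: "u y + d * N y \<le> m0" if y: "y \<in> X" "N y \<le> \<rho>" for y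
    proof -
      obtain Y where "Y \<in> CN \<rho>" "y = E Y" using X_CN[OF y] .
      then show ?thesis using Y0(2) by (simp add: m0_def)
    qed
    have Y0p: "Y0 \<in> p" "N (E Y0) \<le> \<rho>" using Y0(1) by (auto simp: CN_def)
    have "N (E Y0) = \<rho>"
    proof (rule ccontr)
      assume "N (E Y0) \<noteq> \<rho>"
      then have lt: "N (E Y0) < \<rho>" using Y0p by simp
      define P where "P y = m0 + (- d) * N y" for y
      have cN: "C2X (\<lambda>y. (- d) * N y)" by (rule C2X_mult[OF C2X_const C2X_N])
      have "- c \<le> lap P (E Y0)"
      proof (rule touching_from_above[where u="\<lambda>r y. u y + c * r" and b=\<rho> and rmax=r0 and C="C + c * r0" and ch="\<lambda>_. - c"])
        show "C2X P" unfolding P_def by (rule C2X_add[OF C2X_const cN])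
        fix r assume r: "0 < r" "r < r0"
        show "(\<lambda>y. u y + c * r) \<in> borel_measurable \<mu>" using m by simp
        show "P (E Y0) \<le> Hs r (\<lambda>y. u y + c * r) (E Y0)"
          using sub[OF r E_X, of Y0] Hs_add_const[OF r(1) E_X m bd, of "c * r" Y0] by (simp add: P_def m0_def)
        fix y assume y: "y \<in> X"
        have "c * r \<le> c * r0" using r c by (intro mult_left_mono) auto
        moreover have "0 \<le> c * r" using c r by simp
        ultimately show "\<bar>u y + c * r\<bar> \<le> C + c * r0" using bd[OF y] unfolding abs_le_iff by linarith
        show "u y + c * r \<le> P y - r * - c" if "N y \<le> \<rho>"
          using max[OF y that] by (simp add: P_def mult.commute)
      qed (use lt r0 in auto)
      also have "lap P (E Y0) = - d * lap N (E Y0)"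
        unfolding P_def lap_add[OF C2X_const cN E_X] lap_cmult[OF C2X_N E_X] lap_const by simp
      also have "\<dots> \<le> - (d * c0)" using c0(2)[OF E_X, of Y0] d0 by simp
      finally show False using dc by simp
    qed
    obtain Z where Z: "Z \<in> p" "z = E Z" using X_E[OF z] by blast
    have "Q Y0 Y0 = Q Z Z" by (rule N_inject[OF Y0p(1) Z(1)]) (use \<open>N (E Y0) = \<rho>\<close> Z in \<open>simp add: \<rho>_def\<close>)
    then have "u (E Y0) = u z"
      using K_invariant_radial[OF inv cont Y0p(1)] K_invariant_radial[OF inv cont Z(1)] Z(2) by simp
    then have "u org + d * N org \<le> u z + d * N z"
      using max[OF org_X org\<rho>] \<open>N (E Y0) = \<rho>\<close> by (simp add: m0_def \<rho>_def)
    then show ?thesis by (simp add: algebra_simps)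
  qed
  have "((\<lambda>d. u z + d * (N z - N org)) \<longlongrightarrow> u z + c / c0 * (N z - N org)) (at_right (c / c0))"
    by (intro tendsto_intros)
  then show ?thesis
    by (rule tendsto_lowerbound) (use * in \<open>auto simp: eventually_at_right_field intro!: exI[of _ "c / c0 + 1"]\<close>)
qed

end

section \<open>The subordination density\<close>

text \<open>The density of the one-sided stable law of index 1/2, set to 0 for
  \<open>u \<le> 0\<close> so that it can be shifted on the whole line.\<close>

definition eta :: "real \<Rightarrow> real \<Rightarrow> real" where
  "eta t u = (if u > 0 then t / (2 * sqrt pi) * (exp (- t\<^sup>2 / (4 * u)) * u powr (- 3 / 2)) else 0)"

lemma eta_nonneg: "t > 0 \<Longrightarrow> 0 \<le> eta t u"
  by (simp add: eta_def)

lemma eta_measurable [measurable]: "eta t \<in> borel_measurable borel"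
  unfolding eta_def[abs_def] by measurable

text \<open>Time scales like \<open>t\<^sup>2\<close>, so the estimates reduce to
  \<open>t = 1\<close>.\<close>

lemma eta_scale: assumes t: "t > 0" shows "eta t u = eta 1 (u / t\<^sup>2) / t\<^sup>2"
proof (cases "u > 0")
  case True
  have "(t\<^sup>2) powr (- 3 / 2) = (t powr 2) powr (- 3 / 2)" using t by (simp add: powr_numeral)
  also have "\<dots> = t powr (- 3)" by (simp add: powr_powr)
  also have "\<dots> = 1 / t ^ 3" using t by (simp add: powr_minus_divide powr_numeral)
  finally have "(u / t\<^sup>2) powr (- 3 / 2) = u powr (- 3 / 2) * t ^ 3"
    using True t by (simp add: powr_divide)
  then show ?thesis using True t by (simp add: eta_def field_simps power2_eq_square power3_eq_cube)
qed (use t in \<open>simp add: eta_def zero_less_divide_iff\<close>)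

lemma two_sqrt_pi: "1 \<le> 2 * sqrt pi"
  using pi_gt3 real_sqrt_ge_1_iff[of pi] by linarith

text \<open>The constant is \<open>16 ^ 4\<close>, from the fourth power of
  \<open>1 / (16 * u) \<le> exp (1 / (16 * u))\<close>. Order 4 absorbs both
  \<open>u powr (- 3 / 2)\<close> and the factor \<open>1 / u\<^sup>2\<close> that differentiation
  of \<open>eta 1\<close> produces near 0.\<close>

lemma exp_minus_inverse_le:
  fixes u :: real assumes "u > 0" shows "exp (- 1 / (4 * u)) \<le> 65536 * u ^ 4"
proof -
  have "1 / (16 * u) \<le> exp (1 / (16 * u))" using exp_ge_add_one_self[of "1 / (16 * u)"] by linarith
  then have "(1 / (16 * u)) ^ 4 \<le> exp (1 / (16 * u)) ^ 4" using assms by (intro power_mono) auto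
  also have "exp (1 / (16 * u)) ^ 4 = exp (1 / (4 * u))"
    using exp_of_nat_mult[of 4 "1 / (16 * u)"] assms by (simp add: field_simps)
  finally have "1 \<le> exp (1 / (4 * u)) * (65536 * u ^ 4)"
    using assms by (simp add: power_divide power_mult_distrib divide_le_eq mult_ac)
  then have "exp (- 1 / (4 * u)) * 1 \<le> exp (- 1 / (4 * u)) * (exp (1 / (4 * u)) * (65536 * u ^ 4))"
    by (intro mult_left_mono) auto
  also have "\<dots> = 65536 * u ^ 4" by (simp flip: mult.assoc exp_add)
  finally show ?thesis by simp
qed

lemma powr_bounds:
  fixes u :: real assumes "u > 0"
  shows "u \<ge> 1 \<Longrightarrow> u powr (- 3 / 2) \<le> 1 / u" "u \<le> 1 \<Longrightarrow> u powr (- 3 / 2) \<le> 1 / u\<^sup>2"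
proof -
  assume "u \<ge> 1"
  then have "u powr (- 3 / 2) \<le> u powr (- 1)" by (intro powr_mono) auto
  then show "u powr (- 3 / 2) \<le> 1 / u" using assms by (simp add: powr_minus_divide)
next
  assume "u \<le> 1"
  then have "u powr (- 3 / 2) \<le> u powr (- 2)" using assms by (intro powr_mono') auto
  then show "u powr (- 3 / 2) \<le> 1 / u\<^sup>2" using assms by (simp add: powr_minus_divide powr_numeral)
qed

lemma eta_1_le:
  assumes "0 < u" "u \<le> 1" shows "eta 1 u \<le> 65536 * u"
proof -
  note p = two_sqrt_pi
  have "eta 1 u \<le> 1 * (exp (- 1 / (4 * u)) * u powr (- 3 / 2))"
    unfolding eta_def using assms p by (simp add: divide_le_eq mult_left_le)
  also have "\<dots> \<le> 1 * ((65536 * u ^ 4) * (1 / u\<^sup>2))"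
    using assms by (intro mult_left_mono mult_mono exp_minus_inverse_le powr_bounds) auto
  also have "\<dots> = 65536 * (u * u)" using assms by (simp add: power4_eq_xxxx power2_eq_square)
  also have "\<dots> \<le> 65536 * (u * 1)" using assms by (intro mult_left_mono) auto
  finally show ?thesis by simp
qed

text \<open>For \<open>u \<ge> 1\<close> the derivative is at most \<open>2 / u\<^sup>2\<close>. For
  smaller \<open>u\<close> the exponential bounds it by \<open>2 * 65536\<close>, and
  \<open>1 + u\<^sup>2 \<le> 2\<close> costs another factor 2, whence \<open>262144\<close>.\<close>

lemma eta_1_derivative:
  assumes u: "u > 0"
  obtains l where "(eta 1 has_real_derivative l) (at u)" "\<bar>l\<bar> \<le> 262144 / (1 + u\<^sup>2)"
proof -
  define l where "l = 1 / (2 * sqrt pi) * (exp (- 1 / (4 * u)) * u powr (- 3 / 2) * (1 / (4 * u\<^sup>2) - 3 / (2 * u)))"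
  have "((\<lambda>u. 1 / (2 * sqrt pi) * (exp (- 1 / (4 * u)) * u powr (- 3 / 2))) has_real_derivative l) (at u)"
  proof -
    have "((\<lambda>u. u powr (- 3 / 2)) has_real_derivative (- 3 / 2) * u powr (- 3 / 2 - 1)) (at u)"
      using u by (rule has_real_derivative_powr)
    then have 1: "((\<lambda>u. u powr (- 3 / 2)) has_real_derivative (- 3 / 2) * (u powr (- 3 / 2) / u)) (at u)"
      by (rule DERIV_cong) (use u powr_diff[of u "- 3 / 2" 1] in simp)
    have 3: "((\<lambda>u. exp (- 1 / (4 * u))) has_real_derivative exp (- 1 / (4 * u)) * (1 / (4 * u\<^sup>2))) (at u)"
      using u by (auto intro!: derivative_eq_intros simp: power2_eq_square)
    show ?thesis
      unfolding l_def
      by (rule DERIV_cong[OF DERIV_cmult[OF DERIV_mult[OF 3 1]]]) (simp add: algebra_simps)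
  qed
  then have d: "(eta 1 has_real_derivative l) (at u)"
    by (rule has_field_derivative_transform_within_open[where S="{0<..}"]) (use u in \<open>auto simp: eta_def\<close>)
  have p: "1 / (2 * sqrt pi) \<le> 1" using two_sqrt_pi by simp
  have "\<bar>l\<bar> = 1 / (2 * sqrt pi) * (exp (- 1 / (4 * u)) * u powr (- 3 / 2) * \<bar>1 / (4 * u\<^sup>2) - 3 / (2 * u)\<bar>)"
    by (simp add: l_def abs_mult)
  also have "\<dots> \<le> 1 * (exp (- 1 / (4 * u)) * u powr (- 3 / 2) * \<bar>1 / (4 * u\<^sup>2) - 3 / (2 * u)\<bar>)"
    using p by (intro mult_right_mono) auto
  also have "\<dots> \<le> 262144 / (1 + u\<^sup>2)"
  proof (cases "u \<ge> 1")
    case True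
    have "1 / (4 * u\<^sup>2) \<le> 1 / (4 * u)" using True by (intro divide_left_mono) (auto simp: power2_eq_square)
    moreover have "0 \<le> 1 / (4 * u\<^sup>2)" "1 / (4 * u) = (1/4) * (1 / u)" "3 / (2 * u) = (3/2) * (1/u)" "0 \<le> 1 / u"
      using u by auto
    ultimately have "\<bar>1 / (4 * u\<^sup>2) - 3 / (2 * u)\<bar> \<le> 2 * (1 / u)" by linarith
    then have "1 * (exp (- 1 / (4 * u)) * u powr (- 3 / 2) * \<bar>1 / (4 * u\<^sup>2) - 3 / (2 * u)\<bar>) \<le> 1 * (1 * (1 / u) * (2 * (1 / u)))"
      using True u by (intro mult_left_mono mult_mono powr_bounds) auto
    also have "\<dots> = 2 / u\<^sup>2" by (simp add: power2_eq_square)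
    also have "\<dots> = 4 / (2 * u\<^sup>2)" by simp
    also have "\<dots> \<le> 4 / (1 + u\<^sup>2)"
      using True one_le_power[of u 2] by (intro divide_left_mono) (auto intro!: mult_pos_pos add_pos_nonneg)
    also have "\<dots> \<le> 262144 / (1 + u\<^sup>2)" by (intro divide_right_mono) auto
    finally show ?thesis .
  next
    case False
    have "1 / (2 * u) \<le> 1 / (2 * u\<^sup>2)" using False u by (intro divide_left_mono) (auto simp: power2_eq_square mult_left_le)
    moreover have "0 \<le> 1 / (2 * u)" "1 / (4 * u\<^sup>2) = (1/4) * (1 / u\<^sup>2)" "1 / (2 * u\<^sup>2) = (1/2) * (1 / u\<^sup>2)"
      "3 / (2 * u) = 3 * (1 / (2 * u))" "0 \<le> 1 / u\<^sup>2"
      using u by auto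
    ultimately have "\<bar>1 / (4 * u\<^sup>2) - 3 / (2 * u)\<bar> \<le> 2 * (1 / u\<^sup>2)" by linarith
    then have "1 * (exp (- 1 / (4 * u)) * u powr (- 3 / 2) * \<bar>1 / (4 * u\<^sup>2) - 3 / (2 * u)\<bar>) \<le> 1 * ((65536 * u ^ 4) * (1 / u\<^sup>2) * (2 * (1 / u\<^sup>2)))"
      using False u by (intro mult_left_mono mult_mono powr_bounds exp_minus_inverse_le) auto
    also have "\<dots> = 131072" using u by (simp add: power4_eq_xxxx power2_eq_square)
    also have "\<dots> \<le> 262144 / (1 + u\<^sup>2)"
      using False u power_le_one[of u 2] by (simp add: pos_le_divide_eq add_pos_nonneg)
    finally show ?thesis .
  qed
  finally show thesis using d that by blast
qed

text \<open>For \<open>u > r\<close> this is the mean value theorem: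
  \<open>1 + u\<^sup>2 \<le> 3 * (1 + v\<^sup>2)\<close> if \<open>v\<close> lies at most 1 below
  \<open>u\<close>, so \<open>786432\<close> is \<open>3 * 262144\<close>. For
  \<open>u \<le> r\<close> the shifted term is 0 and \<open>eta_1_le\<close> bounds the other one by
  a multiple of \<open>r\<close>.\<close>

lemma eta_1_shift:
  assumes u: "u > 0" and r: "0 < r" "r \<le> 1"
  shows "\<bar>eta 1 (u - r) - eta 1 u\<bar> \<le> 786432 * r / (1 + u\<^sup>2)"
proof (cases "u \<le> r")
  case True
  have "eta 1 (u - r) = 0" using True by (simp add: eta_def)
  then have "\<bar>eta 1 (u - r) - eta 1 u\<bar> = eta 1 u" by (simp add: eta_nonneg)
  also have "\<dots> \<le> 65536 * r" using eta_1_le[OF u] True r by simp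
  also have "\<dots> \<le> 786432 * r / (1 + u\<^sup>2)"
  proof -
    have "u\<^sup>2 \<le> 1" using True r u by (intro power_le_one) auto
    then have "r * (1 + u\<^sup>2) \<le> r * 12" using r by (intro mult_left_mono) auto
    then show ?thesis by (simp add: pos_le_divide_eq add_pos_nonneg)
  qed
  finally show ?thesis .
next
  case False
  have ex: "\<exists>l. (eta 1 has_real_derivative l) (at v) \<and> \<bar>l\<bar> \<le> 786432 / (1 + u\<^sup>2)" if v: "u - r \<le> v" "v \<le> u" for v
  proof -
    have v0: "v > 0" using v False by simp
    obtain l where l: "(eta 1 has_real_derivative l) (at v)" "\<bar>l\<bar> \<le> 262144 / (1 + v\<^sup>2)" by (rule eta_1_derivative[OF v0])
    have "u\<^sup>2 \<le> (v + 1)\<^sup>2" using v r u by (intro power_mono) auto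
    also have "\<dots> \<le> 2 * v\<^sup>2 + 2" using sum_squares_bound[of v 1] by (simp add: power2_sum)
    finally have "1 + u\<^sup>2 \<le> 3 * (1 + v\<^sup>2)" using zero_le_power2[of v] by (simp only: distrib_left)
    then have "262144 / (1 + v\<^sup>2) \<le> 786432 / (1 + u\<^sup>2)"
      by (simp add: pos_le_divide_eq pos_divide_le_eq add_pos_nonneg)
    then show ?thesis using l by auto
  qed
  then obtain d where d: "\<And>v. u - r \<le> v \<Longrightarrow> v \<le> u \<Longrightarrow> (eta 1 has_real_derivative d v) (at v) \<and> \<bar>d v\<bar> \<le> 786432 / (1 + u\<^sup>2)"
    by metis
  obtain z where z: "u - r < z" "z < u" "eta 1 u - eta 1 (u - r) = (u - (u - r)) * d z"
    using MVT2[of "u - r" u "eta 1" d] d r by auto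
  have "\<bar>eta 1 (u - r) - eta 1 u\<bar> = r * \<bar>d z\<bar>" using z(3) r by (simp add: abs_mult abs_minus_commute)
  also have "\<dots> \<le> r * (786432 / (1 + u\<^sup>2))" using d[of z] z r by (intro mult_left_mono) auto
  finally show ?thesis by (simp add: mult.commute)
qed

lemma eta_1_integrable: "integrable lborel (eta 1)"
proof (rule integrableI_bounded)
  let ?g = "\<lambda>u::real. (1 + u) powr (- 3 / 2)"
  have le: "ennreal (norm (eta 1 u)) \<le> 262144 * (ennreal (?g u) * indicator {0..} u)" for u
  proof (cases "u > 0")
    case True
    have "eta 1 u \<le> 262144 * ?g u"
    proof (cases "u \<ge> 1")
      case True
      have p: "1 / (2 * sqrt pi) \<le> 1" using two_sqrt_pi by simp
      have "eta 1 u \<le> 1 * (1 * u powr (- 3 / 2))"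
      proof -
        have "1 / (2 * sqrt pi) * (exp (- 1 / (4 * u)) * u powr (- 3 / 2)) \<le> 1 * (1 * u powr (- 3 / 2))"
          using True by (intro mult_mono p) auto
        then show ?thesis using True by (simp add: eta_def)
      qed
      also have "\<dots> = 2 powr (3 / 2) * (2 * u) powr (- 3 / 2)"
        using True by (simp add: powr_mult powr_minus)
      also have "\<dots> \<le> 2 powr 2 * (1 + u) powr (- 3 / 2)"
        using True by (intro mult_mono powr_mono powr_mono2') auto
      also have "\<dots> \<le> 262144 * ?g u" by (intro mult_right_mono) (auto simp: powr_numeral)
      finally show ?thesis .
    next
      case False
      have "1 / 4 = (2::real) powr (- 2)" by (simp add: powr_minus powr_numeral)
      also have "\<dots> \<le> 2 powr (- 3 / 2)" by (intro powr_mono) auto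
      also have "\<dots> \<le> ?g u" using False \<open>u > 0\<close> by (intro powr_mono2') auto
      finally have "1 / 4 \<le> ?g u" .
      then show ?thesis using eta_1_le[of u] False \<open>u > 0\<close> by simp
    qed
    then have "ennreal (eta 1 u) \<le> ennreal (262144 * ?g u)" by (rule ennreal_leI)
    then show ?thesis using True by (simp add: eta_nonneg ennreal_mult)
  qed (simp add: eta_def)
  have "(\<integral>\<^sup>+u. ennreal (?g u) * indicator {0..} u \<partial>lborel) = ennreal (0 - (- 2 * (1 + 0) powr (- 1 / 2)))"
  proof (rule nn_integral_FTC_atLeast)
    show "((\<lambda>u. - 2 * (1 + u) powr (- 1 / 2)) has_real_derivative ?g u) (at u)" if "0 \<le> u" for u :: real
      using that by (auto intro!: derivative_eq_intros)
    have "((\<lambda>u::real. (1 + u) powr (- 1 / 2)) \<longlongrightarrow> 0) at_top"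
      by (rule tendsto_neg_powr) (auto intro: filterlim_tendsto_add_at_top[OF tendsto_const filterlim_ident])
    then have "((\<lambda>u::real. - 2 * (1 + u) powr (- 1 / 2)) \<longlongrightarrow> - 2 * 0) at_top" by (rule tendsto_mult_left)
    then show "((\<lambda>u::real. - 2 * (1 + u) powr (- 1 / 2)) \<longlongrightarrow> 0) at_top" by simp
  qed auto
  then have "(\<integral>\<^sup>+u. 262144 * (ennreal (?g u) * indicator {0..} u) \<partial>lborel) < \<infinity>"
    by (simp add: nn_integral_cmult ennreal_mult_less_top)
  moreover have "(\<integral>\<^sup>+u. ennreal (norm (eta 1 u)) \<partial>lborel) \<le> (\<integral>\<^sup>+u. 262144 * (ennreal (?g u) * indicator {0..} u) \<partial>lborel)"
    by (rule nn_integral_mono) (rule le)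
  ultimately show "(\<integral>\<^sup>+u. ennreal (norm (eta 1 u)) \<partial>lborel) < \<infinity>" by (rule le_less_trans[rotated])
qed simp

lemma eta_integrable: assumes "t > 0" shows "integrable lborel (eta t)"
proof -
  have "integrable lborel (\<lambda>u. eta 1 (0 + 1 / t\<^sup>2 * u) / t\<^sup>2)"
    by (intro integrable_divide lborel_integrable_real_affine eta_1_integrable) (use assms in simp)
  then show ?thesis by (subst eta_scale[OF assms, abs_def]) (simp add: mult.commute)
qed

text \<open>The total mass of the Poisson kernel, the same for all times and all base
  points.\<close>

definition eta_mass :: real where "eta_mass = (\<integral>u. eta 1 u \<partial>lborel)"

lemma eta_integral: assumes "t > 0" shows "(\<integral>u. eta t u \<partial>lborel) = eta_mass"
proof -
  have "eta_mass = \<bar>1 / t\<^sup>2\<bar> *\<^sub>R (\<integral>u. eta 1 (0 + 1 / t\<^sup>2 * u) \<partial>lborel)"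
    unfolding eta_mass_def by (rule lborel_integral_real_affine) (use assms in simp)
  also have "\<dots> = (\<integral>u. eta 1 (u / t\<^sup>2) / t\<^sup>2 \<partial>lborel)" by simp
  finally show ?thesis by (simp add: eta_scale[OF assms])
qed

lemma eta_mass_pos: "eta_mass > 0"
proof (rule ccontr)
  assume "\<not> ?thesis"
  moreover have "eta_mass \<ge> 0" unfolding eta_mass_def by (intro integral_nonneg_AE) (simp add: eta_nonneg)
  ultimately have "(\<integral>u. eta 1 u \<partial>lborel) = 0" by (simp add: eta_mass_def)
  then have "AE u in lborel. eta 1 u = 0"
    using integral_nonneg_eq_0_iff_AE[OF eta_1_integrable] by (simp add: eta_nonneg)
  then have "AE u in lborel. u \<notin> {1..2::real}"
    by (rule eventually_mono) (auto simp: eta_def split: if_splits)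
  then have "emeasure lborel {1..2::real} = 0"
    by (subst (asm) AE_iff_measurable[where N="{1..2::real}"]) auto
  then show False by simp
qed

text \<open>After scaling to \<open>t = 1\<close> the shift is \<open>r / t\<^sup>2\<close>, at most
  1, and \<open>eta_1_shift\<close> is integrated over the half line, where
  \<open>1 / (1 + u\<^sup>2)\<close> has integral \<open>pi / 2\<close>.\<close>

lemma eta_shift_integral:
  assumes t: "t > 0" and r: "0 < r" "r \<le> t\<^sup>2"
  shows "(\<integral>u. \<bar>eta t (u - r) - eta t u\<bar> \<partial>lborel) \<le> 786432 * pi / 2 / t\<^sup>2 * r"
proof -
  let ?g = "\<lambda>u. 1 / (1 + (u / t\<^sup>2)\<^sup>2)"
  define c where "c = 786432 * r / t ^ 4"
  have c0: "c \<ge> 0" using r by (simp add: c_def)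
  have le: "\<bar>eta t (u - r) - eta t u\<bar> \<le> c * (?g u * indicator {0..} u)" for u
  proof (cases "u > 0")
    case True
    have "\<bar>eta t (u - r) - eta t u\<bar> = \<bar>eta 1 (u / t\<^sup>2 - r / t\<^sup>2) - eta 1 (u / t\<^sup>2)\<bar> / t\<^sup>2"
      unfolding eta_scale[OF t, of "u - r"] eta_scale[OF t, of u] by (simp add: diff_divide_distrib abs_divide flip: diff_divide_distrib)
    also have "\<dots> \<le> (786432 * (r / t\<^sup>2) / (1 + (u / t\<^sup>2)\<^sup>2)) / t\<^sup>2"
      using True t r by (intro divide_right_mono eta_1_shift) auto
    also have "\<dots> = c * ?g u" by (simp add: c_def power4_eq_xxxx power2_eq_square)
    finally show ?thesis using True by simp
  next
    case False
    then have "eta t (u - r) = 0" "eta t u = 0" using r by (auto simp: eta_def)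
    then show ?thesis using c0 by (simp add: indicator_def)
  qed
  have nn: "(\<integral>\<^sup>+u. ennreal (?g u) * indicator {0..} u \<partial>lborel) = ennreal (t\<^sup>2 * (pi / 2) - t\<^sup>2 * arctan (0 / t\<^sup>2))"
  proof (rule nn_integral_FTC_atLeast)
    show "((\<lambda>u. t\<^sup>2 * arctan (u / t\<^sup>2)) has_real_derivative ?g u) (at u)" if "0 \<le> u" for u
      using t by (auto intro!: derivative_eq_intros simp: divide_simps)
    have "filterlim (\<lambda>u. u / t\<^sup>2) at_top at_top"
      using filterlim_tendsto_pos_mult_at_top[OF tendsto_const[of "1 / t\<^sup>2"] _ filterlim_ident] t by simp
    from filterlim_compose[OF tendsto_arctan_at_top this]
    show "((\<lambda>u. t\<^sup>2 * arctan (u / t\<^sup>2)) \<longlongrightarrow> t\<^sup>2 * (pi / 2)) at_top" by (rule tendsto_mult_left)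
  qed auto
  have gi: "integrable lborel (\<lambda>u. ?g u * indicator {0..} u)"
    and gv: "(\<integral>u. ?g u * indicator {0..} u \<partial>lborel) = t\<^sup>2 * (pi / 2)"
  proof -
    have "(\<integral>\<^sup>+u. ennreal (?g u * indicator {0..} u) \<partial>lborel) = ennreal (t\<^sup>2 * (pi / 2))"
    proof -
      have "ennreal (?g u * indicator {0..} u) = ennreal (?g u) * indicator {0..} u" for u
        by (simp add: indicator_def)
      then show ?thesis using nn by (simp only: arctan_zero_zero div_0 mult_zero_right diff_zero)
    qed
    then have "has_bochner_integral lborel (\<lambda>u. ?g u * indicator {0..} u) (t\<^sup>2 * (pi / 2))"
      by (intro has_bochner_integral_nn_integral) (auto intro!: AE_I2)
    then show "integrable lborel (\<lambda>u. ?g u * indicator {0..} u)" "(\<integral>u. ?g u * indicator {0..} u \<partial>lborel) = t\<^sup>2 * (pi / 2)"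
      by (auto simp: has_bochner_integral_iff)
  qed
  have "(\<integral>u. \<bar>eta t (u - r) - eta t u\<bar> \<partial>lborel) \<le> (\<integral>u. c * (?g u * indicator {0..} u) \<partial>lborel)"
  proof (rule integral_mono[OF _ integrable_mult_right[OF gi] le])
    have "integrable lborel (\<lambda>u. eta t (- r + 1 * u))"
      by (rule lborel_integrable_real_affine[OF eta_integrable[OF t]]) simp
    then show "integrable lborel (\<lambda>u. \<bar>eta t (u - r) - eta t u\<bar>)"
      using eta_integrable[OF t] by simp
  qed
  also have "\<dots> = c * (t\<^sup>2 * (pi / 2))" by (simp only: integral_mult_right_zero gv)
  also have "\<dots> = 786432 * pi / 2 / t\<^sup>2 * r" using t by (simp add: c_def power4_eq_xxxx power2_eq_square)
  finally show ?thesis .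
qed

section \<open>The Poisson semigroup\<close>

context rank_one_heat
begin

abbreviation pk :: "real \<Rightarrow> ('g \<Rightarrow> 'g) set \<Rightarrow> ('g \<Rightarrow> 'g) set \<Rightarrow> real" where "pk \<equiv> poisson_kernel h"

lemma eta_h0: "eta t u * h u x y = eta t u * h0 u x y"
  by (simp add: eta_def h0_def)

lemma pk_eq: "pk t x y = (\<integral>u. eta t u * h u x y \<partial>lborel)"
proof -
  have "pk t x y = (\<integral>u. t / (2 * sqrt pi) * (indicator {0<..} u *\<^sub>R (h u x y * exp (- t\<^sup>2 / (4 * u)) * u powr (- 3 / 2))) \<partial>lborel)"
    unfolding poisson_kernel_def set_lebesgue_integral_def by (rule integral_mult_right_zero[symmetric])
  also have "\<dots> = (\<integral>u. eta t u * h u x y \<partial>lborel)"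
    by (rule Bochner_Integration.integral_cong[OF refl]) (simp add: eta_def indicator_def)
  finally show ?thesis .
qed

lemma pk_nonneg: "t > 0 \<Longrightarrow> x \<in> X \<Longrightarrow> y \<in> X \<Longrightarrow> 0 \<le> pk t x y"
  unfolding pk_eq by (intro integral_nonneg_AE AE_I2) (simp add: eta_def h_nonneg)

lemma pk_sym: "x \<in> X \<Longrightarrow> y \<in> X \<Longrightarrow> pk t x y = pk t y x"
  unfolding pk_eq by (intro Bochner_Integration.integral_cong refl) (simp add: eta_def h_sym)

lemma pk_translate: "a \<in> G \<Longrightarrow> x \<in> X \<Longrightarrow> y \<in> X \<Longrightarrow> pk t (translate a x) (translate a y) = pk t x y"
  unfolding pk_eq by (intro Bochner_Integration.integral_cong refl) (simp add: eta_def heat_kernel_translate)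

lemma pk_measurable: "(\<lambda>(x, y). pk t x y) \<in> borel_measurable (\<mu> \<Otimes>\<^sub>M \<mu>)"
proof -
  have "(\<lambda>z. ((snd z, fst (fst z)), snd (fst z))) \<in> measurable ((\<mu> \<Otimes>\<^sub>M \<mu>) \<Otimes>\<^sub>M lborel) ((lborel \<Otimes>\<^sub>M \<mu>) \<Otimes>\<^sub>M \<mu>)"
    by measurable
  from measurable_compose[OF this h0_measurable]
  have "(\<lambda>z. h0 (snd z) (fst (fst z)) (snd (fst z))) \<in> borel_measurable ((\<mu> \<Otimes>\<^sub>M \<mu>) \<Otimes>\<^sub>M lborel)"
    by (simp add: case_prod_beta)
  then have "(\<lambda>(xy, u). eta t u * h0 u (fst xy) (snd xy)) \<in> borel_measurable ((\<mu> \<Otimes>\<^sub>M \<mu>) \<Otimes>\<^sub>M lborel)"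
    unfolding case_prod_beta by measurable
  from lborel.borel_measurable_lebesgue_integral[OF this] show ?thesis
    by (simp add: pk_eq eta_h0 case_prod_beta)
qed

lemma pk_measurable': "(\<lambda>(y, x). pk t x y) \<in> borel_measurable (\<mu> \<Otimes>\<^sub>M \<mu>)"
  using measurable_compose[OF measurable_pair_swap' pk_measurable] by (simp add: case_prod_beta)

lemma pk_measurable_2: "x \<in> X \<Longrightarrow> (\<lambda>y. pk t x y) \<in> borel_measurable \<mu>"
  using measurable_compose[OF measurable_Pair1' pk_measurable, of x] by simp

sublocale LP: pair_sigma_finite lborel \<mu> ..

text \<open>Absolute integrability for Fubini, with a time weight, a family of sub-probability
  densities and a bounded function. In \<open>pk_integral\<close> the density varies with
  \<open>u\<close>, in \<open>Hs_Pw\<close> the function does.\<close>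

lemma weighted_integrable:
  fixes \<psi> :: "real \<Rightarrow> real"
  assumes \<psi>: "integrable lborel \<psi>" and km: "(\<lambda>(u, y). k u y) \<in> borel_measurable (lborel \<Otimes>\<^sub>M \<mu>)"
    and k: "\<And>u. integrable \<mu> (k u)" "\<And>u y. y \<in> X \<Longrightarrow> 0 \<le> k u y" "\<And>u. (\<integral>y. k u y \<partial>\<mu>) \<le> 1"
    and F: "(\<lambda>(u, y). F u y) \<in> borel_measurable (lborel \<Otimes>\<^sub>M \<mu>)" "\<And>u y. y \<in> X \<Longrightarrow> \<bar>F u y\<bar> \<le> C"
  shows "integrable (lborel \<Otimes>\<^sub>M \<mu>) (\<lambda>(u, y). \<psi> u * (k u y * F u y))"
proof (rule LP.Fubini_integrable)
  have C0: "C \<ge> 0" using F(2)[OF org_X, of 0] by linarith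
  have [measurable]: "(\<lambda>z. \<psi> (fst z)) \<in> borel_measurable (lborel \<Otimes>\<^sub>M \<mu>)"
    using measurable_compose[OF measurable_fst borel_measurable_integrable[OF \<psi>]] .
  show m: "(\<lambda>(u, y). \<psi> u * (k u y * F u y)) \<in> borel_measurable (lborel \<Otimes>\<^sub>M \<mu>)"
    using km F(1) unfolding case_prod_beta by measurable
  have Fu: "F u \<in> borel_measurable \<mu>" for u
    using measurable_compose[OF measurable_Pair1' F(1), of u] by simp
  have ik: "integrable \<mu> (\<lambda>y. k u y * F u y)" for u
  proof (rule Bochner_Integration.integrable_bound)
    show "integrable \<mu> (\<lambda>y. k u y * C)" by (rule integrable_mult_left[OF k(1)])
    show "(\<lambda>y. k u y * F u y) \<in> borel_measurable \<mu>" using borel_measurable_integrable[OF k(1)] Fu by simp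
    show "AE y in \<mu>. norm (k u y * F u y) \<le> norm (k u y * C)"
      using F(2)[of _ u] C0 by (intro AE_I2) (simp add: abs_mult mult_left_mono)
  qed
  show "AE u in lborel. integrable \<mu> (\<lambda>y. case (u, y) of (u, y) \<Rightarrow> \<psi> u * (k u y * F u y))"
    using ik by simp
  show "integrable lborel (\<lambda>u. \<integral>y. norm (case (u, y) of (u, y) \<Rightarrow> \<psi> u * (k u y * F u y)) \<partial>\<mu>)"
  proof (rule Bochner_Integration.integrable_bound[OF integrable_mult_left[OF \<psi>, of C]])
    have "(\<lambda>(u, y). norm (\<psi> u * (k u y * F u y))) \<in> borel_measurable (lborel \<Otimes>\<^sub>M \<mu>)"
      using m by (simp add: case_prod_beta)
    from borel_measurable_lebesgue_integral[OF this]
    show "(\<lambda>u. \<integral>y. norm (case (u, y) of (u, y) \<Rightarrow> \<psi> u * (k u y * F u y)) \<partial>\<mu>) \<in> borel_measurable lborel"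
      by simp
    have "(\<integral>y. norm (\<psi> u * (k u y * F u y)) \<partial>\<mu>) \<le> \<bar>\<psi> u\<bar> * C" for u
    proof -
      have "(\<integral>y. norm (\<psi> u * (k u y * F u y)) \<partial>\<mu>) = \<bar>\<psi> u\<bar> * (\<integral>y. \<bar>k u y * F u y\<bar> \<partial>\<mu>)"
        by (simp add: abs_mult[of "\<psi> u"])
      also have "(\<integral>y. \<bar>k u y * F u y\<bar> \<partial>\<mu>) \<le> (\<integral>y. k u y * C \<partial>\<mu>)"
        by (rule integral_mono[OF integrable_abs[OF ik] integrable_mult_left[OF k(1)]])
          (use F(2)[of _ u] k(2)[of _ u] in \<open>simp add: abs_mult mult_left_mono\<close>)
      also have "(\<integral>y. k u y * C \<partial>\<mu>) = (\<integral>y. k u y \<partial>\<mu>) * C" by simp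
      also have "\<dots> \<le> 1 * C" using k(3) C0 by (rule mult_right_mono)
      finally show ?thesis by (simp add: mult_left_mono)
    qed
    then show "AE u in lborel. norm (\<integral>y. norm (case (u, y) of (u, y) \<Rightarrow> \<psi> u * (k u y * F u y)) \<partial>\<mu>) \<le> norm (\<psi> u * C)"
      using C0 by (intro AE_I2) (simp add: abs_mult)
  qed
qed

lemma h0_measurable_2: assumes x: "x \<in> X"
  shows "(\<lambda>(u, y). h0 u x y) \<in> borel_measurable (lborel \<Otimes>\<^sub>M \<mu>)"
proof -
  have "(\<lambda>z. ((fst z, x), snd z)) \<in> measurable (lborel \<Otimes>\<^sub>M \<mu>) ((lborel \<Otimes>\<^sub>M \<mu>) \<Otimes>\<^sub>M \<mu>)"
    using x by (intro measurable_Pair measurable_fst measurable_snd measurable_const) auto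
  from measurable_compose[OF this h0_measurable] show ?thesis by (simp add: case_prod_beta)
qed

lemma h0_integrable: assumes "x \<in> X" shows "integrable \<mu> (h0 u x)" "(\<integral>y. h0 u x y \<partial>\<mu>) \<le> 1"
  using h_integrable[OF _ assms] h_integral_le[OF _ assms] by (cases "u > 0"; simp add: h0_def[abs_def])+

text \<open>The Poisson semigroup on bounded functions as an average of \<open>Hs\<close>;
  \<open>pk_integral\<close> identifies it with integration against \<open>pk t x\<close>.\<close>

definition Pw :: "real \<Rightarrow> (('g \<Rightarrow> 'g) set \<Rightarrow> real) \<Rightarrow> ('g \<Rightarrow> 'g) set \<Rightarrow> real" where
  "Pw t w x = (\<integral>u. eta t u * Hs u w x \<partial>lborel)"

lemma pk_integral:
  assumes t: "t > 0" and x: "x \<in> X" and w: "w \<in> borel_measurable \<mu>" "\<And>y. y \<in> X \<Longrightarrow> \<bar>w y\<bar> \<le> C"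
  shows "integrable \<mu> (\<lambda>y. pk t x y * w y)" "(\<integral>y. pk t x y * w y \<partial>\<mu>) = Pw t w x"
    "integrable lborel (\<lambda>u. eta t u * Hs u w x)"
proof -
  have "(\<lambda>(u::real, y). w y) \<in> borel_measurable (lborel \<Otimes>\<^sub>M \<mu>)"
    unfolding case_prod_beta by (rule measurable_compose[OF measurable_snd w(1)])
  then have i: "integrable (lborel \<Otimes>\<^sub>M \<mu>) (\<lambda>(u, y). eta t u * (h0 u x y * w y))"
    by (intro weighted_integrable[where F="\<lambda>u. w", OF eta_integrable[OF t] h0_measurable_2[OF x] h0_integrable(1)[OF x] _ h0_integrable(2)[OF x] _ w(2)])
      (auto simp: case_prod_beta h0_def h_nonneg x indicator_def)
  have 1: "(\<integral>u. eta t u * (h0 u x y * w y) \<partial>lborel) = pk t x y * w y" for y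
    by (simp add: pk_eq eta_h0 flip: mult.assoc)
  have 2: "eta t u * (\<integral>y. h0 u x y * w y \<partial>\<mu>) = eta t u * Hs u w x" for u
    by (cases "u > 0") (simp_all add: Hs_def eta_def h0_def)
  show "integrable \<mu> (\<lambda>y. pk t x y * w y)" using LP.integrable_snd[OF i] by (simp add: 1)
  show "(\<integral>y. pk t x y * w y \<partial>\<mu>) = Pw t w x" using LP.Fubini_integral[OF i] by (simp add: 1 2 Pw_def)
  show "integrable lborel (\<lambda>u. eta t u * Hs u w x)" using LP.integrable_fst[OF i] by (simp add: 2)
qed

lemma Pw_const: "t > 0 \<Longrightarrow> x \<in> X \<Longrightarrow> Pw t (\<lambda>_. c) x = c * eta_mass"
proof -
  assume t: "t > 0" and x: "x \<in> X"
  have "Pw t (\<lambda>_. c) x = (\<integral>u. c * eta t u \<partial>lborel)"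
    unfolding Pw_def by (rule Bochner_Integration.integral_cong[OF refl]) (simp add: eta_def Hs_const x)
  then show ?thesis by (simp add: eta_integral[OF t])
qed

lemma eta_mult_le:
  assumes "t > 0" "u > 0 \<Longrightarrow> \<bar>v\<bar> \<le> C" shows "\<bar>eta t u * v\<bar> \<le> eta t u * C"
proof (cases "u > 0")
  case True
  then show ?thesis
    using assms(2)[OF True] eta_nonneg[OF assms(1), of u] by (simp add: abs_mult mult_left_mono)
qed (simp add: eta_def)

lemma Pw_bound:
  assumes t: "t > 0" and x: "x \<in> X" and w: "w \<in> borel_measurable \<mu>" "\<And>y. y \<in> X \<Longrightarrow> \<bar>w y\<bar> \<le> C"
  shows "\<bar>Pw t w x\<bar> \<le> C * eta_mass"
proof -
  have "\<bar>Pw t w x\<bar> \<le> (\<integral>u. \<bar>eta t u * Hs u w x\<bar> \<partial>lborel)" unfolding Pw_def by (rule integral_abs_bound)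
  also have "\<dots> \<le> (\<integral>u. C * eta t u \<partial>lborel)"
  proof (rule integral_mono[OF integrable_abs[OF pk_integral(3)[OF assms]] integrable_mult_right[OF eta_integrable[OF t]]])
    fix u show "\<bar>eta t u * Hs u w x\<bar> \<le> C * eta t u"
      unfolding mult.commute[of C] by (rule eta_mult_le[OF t Hs_bound[OF _ x w]])
  qed
  finally show ?thesis by (simp add: eta_integral[OF t])
qed

lemma Pw_measurable:
  assumes t: "t > 0" and w: "w \<in> borel_measurable \<mu>" "\<And>y. y \<in> X \<Longrightarrow> \<bar>w y\<bar> \<le> C"
  shows "Pw t w \<in> borel_measurable \<mu>"
proof -
  have "(\<lambda>z. w (snd z)) \<in> borel_measurable (\<mu> \<Otimes>\<^sub>M \<mu>)" using measurable_compose[OF measurable_snd w(1)] .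
  then have "(\<lambda>(x, y). pk t x y * w y) \<in> borel_measurable (\<mu> \<Otimes>\<^sub>M \<mu>)"
    using pk_measurable[of t] by (simp add: case_prod_beta)
  from borel_measurable_lebesgue_integral[OF this] show ?thesis
    by (rule measurable_cong[THEN iffD1, rotated]) (simp add: pk_integral(2)[OF t _ w])
qed

lemma Pw_continuous:
  assumes t: "t > 0" and w: "w \<in> borel_measurable \<mu>" "\<And>y. y \<in> X \<Longrightarrow> \<bar>w y\<bar> \<le> C"
  shows "continuous_on UNIV (\<lambda>Y. Pw t w (E Y))"
  unfolding continuous_on_sequentially comp_def
proof (intro allI ballI impI)
  fix Z :: "nat \<Rightarrow> 'g" and Y assume "(\<forall>n. Z n \<in> UNIV) \<and> Z \<longlonglongrightarrow> Y"
  then have Z: "Z \<longlonglongrightarrow> Y" by simp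
  have m: "(\<lambda>u. eta t u * Hs u w (E W)) \<in> borel_measurable lborel" for W
    by (rule borel_measurable_integrable[OF pk_integral(3)[OF t E_X w]])
  show "(\<lambda>n. Pw t w (E (Z n))) \<longlonglongrightarrow> Pw t w (E Y)"
    unfolding Pw_def
  proof (rule integral_dominated_convergence[OF m m integrable_mult_left[OF eta_integrable[OF t], of C]])
    have "(\<lambda>n. eta t u * Hs u w (E (Z n))) \<longlonglongrightarrow> eta t u * Hs u w (E Y)" for u
    proof (cases "u > 0")
      case True
      have "(\<lambda>n. Hs u w (E (Z n))) \<longlonglongrightarrow> Hs u w (E Y)"
        using continuous_on_tendsto_compose[OF Hs_continuous[OF True w, of UNIV] Z] by simp
      then show ?thesis by (rule tendsto_mult_left)
    qed (simp add: eta_def)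
    then show "AE u in lborel. (\<lambda>n. eta t u * Hs u w (E (Z n))) \<longlonglongrightarrow> eta t u * Hs u w (E Y)" by simp
    have "\<bar>eta t u * Hs u w (E (Z n))\<bar> \<le> eta t u * C" for u n
      by (rule eta_mult_le[OF t Hs_bound[OF _ E_X w]])
    then show "AE u in lborel. norm (eta t u * Hs u w (E (Z n))) \<le> eta t u * C" for n by simp
  qed
qed

lemma pk_integral_translate:
  fixes f :: "('g \<Rightarrow> 'g) set \<Rightarrow> 'b::{real_normed_algebra_1, banach, second_countable_topology}"
  assumes a: "a \<in> G" and x: "x \<in> X" and f: "f \<in> borel_measurable \<mu>"
  shows "(\<integral>y. of_real (pk t (translate a x) y) * f y \<partial>\<mu>) = (\<integral>y. of_real (pk t x y) * f (translate a y) \<partial>\<mu>)"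
proof -
  have "(\<lambda>y. of_real (pk t (translate a x) y) * f y) \<in> borel_measurable \<mu>"
    using pk_measurable_2[OF translate_X[OF a x]] f by measurable
  from integral_translate[OF a this]
  have "(\<integral>y. of_real (pk t (translate a x) y) * f y \<partial>\<mu>) =
      (\<integral>y. of_real (pk t (translate a x) (translate a y)) * f (translate a y) \<partial>\<mu>)" by simp
  also have "\<dots> = (\<integral>y. of_real (pk t x y) * f (translate a y) \<partial>\<mu>)"
    by (rule Bochner_Integration.integral_cong[OF refl]) (simp add: pk_translate a x)
  finally show ?thesis .
qed

lemma Pw_translate:
  assumes t: "t > 0" and a: "a \<in> G" and x: "x \<in> X"
    and w: "w \<in> borel_measurable \<mu>" "\<And>y. y \<in> X \<Longrightarrow> \<bar>w y\<bar> \<le> C"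
    and inv: "\<And>y. y \<in> X \<Longrightarrow> w (translate a y) = w y"
  shows "Pw t w (translate a x) = Pw t w x"
proof -
  have "(\<integral>y. pk t x y * w (translate a y) \<partial>\<mu>) = (\<integral>y. pk t x y * w y \<partial>\<mu>)"
    by (rule Bochner_Integration.integral_cong[OF refl]) (simp add: inv)
  then show ?thesis
    using pk_integral_translate[OF a x w(1), of t] pk_integral(2)[OF t x w] pk_integral(2)[OF t translate_X[OF a x] w]
    by simp
qed

text \<open>By the semigroup law \<open>Hs r (Pw t w)\<close> averages \<open>Hs (u + r) w\<close>
  with the weight \<open>eta t u\<close>, that is \<open>Hs u w\<close> with the weight
  \<open>eta t (u - r)\<close>. The difference from \<open>Pw t w\<close> is then controlled by
  \<open>eta_shift_integral\<close>.\<close>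

lemma Hs_Pw:
  assumes t: "t > 0" and x: "x \<in> X" and w: "w \<in> borel_measurable \<mu>" "\<And>y. y \<in> X \<Longrightarrow> \<bar>w y\<bar> \<le> C"
    and r: "0 < r" "r \<le> t\<^sup>2"
  shows "\<bar>Hs r (Pw t w) x - Pw t w x\<bar> \<le> C * (786432 * pi / 2 / t\<^sup>2) * r"
proof -
  have C0: "C \<ge> 0" using w(2)[OF org_X] by linarith
  define F where "F u z = (\<integral>y. h0 u z y * w y \<partial>\<mu>)" for u z
  have F: "F u z = (if u > 0 then Hs u w z else 0)" for u z
    by (simp add: F_def Hs_def h0_def)
  have Fb: "\<bar>F u z\<bar> \<le> C" if "z \<in> X" for u z
    using Hs_bound[OF _ that w] C0 by (simp add: F)
  have mw: "(\<lambda>z. w (snd z)) \<in> borel_measurable ((lborel \<Otimes>\<^sub>M \<mu>) \<Otimes>\<^sub>M \<mu>)" using measurable_compose[OF measurable_snd w(1)] .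
  have "(\<lambda>z. h0 (fst (fst z)) (snd (fst z)) (snd z)) \<in> borel_measurable ((lborel \<Otimes>\<^sub>M \<mu>) \<Otimes>\<^sub>M \<mu>)"
    using h0_measurable by (simp add: case_prod_beta)
  from borel_measurable_times[OF this mw]
  have "(\<lambda>(uz, y). h0 (fst uz) (snd uz) y * w y) \<in> borel_measurable ((lborel \<Otimes>\<^sub>M \<mu>) \<Otimes>\<^sub>M \<mu>)"
    by (simp add: case_prod_beta)
  from borel_measurable_lebesgue_integral[OF this]
  have Fm: "(\<lambda>(u, z). F u z) \<in> borel_measurable (lborel \<Otimes>\<^sub>M \<mu>)" by (simp add: F_def case_prod_beta)
  have Fx: "(\<lambda>u. F u x) \<in> borel_measurable lborel"
    using measurable_compose[OF measurable_Pair2'[of x \<mu> lborel] Fm] x by simp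
  have "(\<lambda>(u::real, z). h r x z) \<in> borel_measurable (lborel \<Otimes>\<^sub>M \<mu>)"
    unfolding case_prod_beta by (rule measurable_compose[OF measurable_snd h_measurable[OF r(1) x]])
  then have i: "integrable (lborel \<Otimes>\<^sub>M \<mu>) (\<lambda>(u, z). eta t u * (h r x z * F u z))"
    by (intro weighted_integrable[where k="\<lambda>u. h r x", OF eta_integrable[OF t] _ h_integrable[OF r(1) x] _ h_integral_le[OF r(1) x] Fm Fb])
      (auto simp: case_prod_beta h_nonneg r(1) x)
  have PF: "Pw t w z = (\<integral>u. eta t u * F u z \<partial>lborel)" for z
    unfolding Pw_def by (rule Bochner_Integration.integral_cong[OF refl]) (simp add: F eta_def)
  have "Hs r (Pw t w) x = (\<integral>z. (\<integral>u. eta t u * (h r x z * F u z) \<partial>lborel) \<partial>\<mu>)"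
    unfolding Hs_def PF by (simp add: mult.left_commute[of "eta t _"])
  also have "\<dots> = (\<integral>u. (\<integral>z. eta t u * (h r x z * F u z) \<partial>\<mu>) \<partial>lborel)"
    by (rule LP.Fubini_integral[OF i])
  also have "\<dots> = (\<integral>u. eta t ((r + 1 * u) - r) * F (r + 1 * u) x \<partial>lborel)"
  proof (rule Bochner_Integration.integral_cong[OF refl])
    fix u
    have "(\<integral>z. h r x z * F u z \<partial>\<mu>) = F (r + u) x" if "u > 0"
      using Hs_semigroup[OF r(1) that x w] that r(1) by (simp add: F Hs_def)
    then show "(\<integral>z. eta t u * (h r x z * F u z) \<partial>\<mu>) = eta t ((r + 1 * u) - r) * F (r + 1 * u) x"
      by (cases "u > 0") (simp_all add: eta_def)
  qed
  also have "\<dots> = (\<integral>u. eta t (u - r) * F u x \<partial>lborel)"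
    using lborel_integral_real_affine[of 1 "\<lambda>u. eta t (u - r) * F u x" r] by simp
  finally have 1: "Hs r (Pw t w) x = (\<integral>u. eta t (u - r) * F u x \<partial>lborel)" .
  have e1: "integrable lborel (\<lambda>u. eta t (u - r))"
    using lborel_integrable_real_affine[OF eta_integrable[OF t], of 1 "- r"] by simp
  have e2: "integrable lborel (\<lambda>u. \<bar>eta t (u - r) - eta t u\<bar>)"
    by (intro integrable_abs Bochner_Integration.integrable_diff e1 eta_integrable t)
  have b: "integrable lborel (\<lambda>u. g u * F u x)" if "integrable lborel g" for g :: "real \<Rightarrow> real"
    by (rule Bochner_Integration.integrable_bound[OF integrable_mult_left[OF that, of C]])
      (use Fx borel_measurable_integrable[OF that] Fb[OF x] C0 in \<open>auto simp: abs_mult intro!: mult_left_mono\<close>)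
  have "Hs r (Pw t w) x - Pw t w x = (\<integral>u. (eta t (u - r) - eta t u) * F u x \<partial>lborel)"
    unfolding 1 PF left_diff_distrib by (rule Bochner_Integration.integral_diff[symmetric]; rule b) (intro e1 eta_integrable t)+
  also have "\<bar>\<dots>\<bar> \<le> (\<integral>u. \<bar>(eta t (u - r) - eta t u) * F u x\<bar> \<partial>lborel)" by (rule integral_abs_bound)
  also have "\<dots> \<le> (\<integral>u. C * \<bar>eta t (u - r) - eta t u\<bar> \<partial>lborel)"
    by (rule integral_mono[OF integrable_abs[OF b] integrable_mult_right[OF e2]])
      (use Fb[OF x] e1 eta_integrable[OF t] in \<open>auto simp: abs_mult mult.commute[of C] intro!: mult_left_mono\<close>)
  also have "\<dots> = C * (\<integral>u. \<bar>eta t (u - r) - eta t u\<bar> \<partial>lborel)" by simp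
  also have "\<dots> \<le> C * (786432 * pi / 2 / t\<^sup>2 * r)" by (intro mult_left_mono eta_shift_integral t r C0)
  finally show ?thesis by (simp add: mult.assoc)
qed


text \<open>Fubini and the symmetry of \<open>pk\<close>. The third claim with
  \<open>\<phi> = 1\<close> gives integrability of \<open>pk t x y * f y\<close> in \<open>y\<close>
  for almost every \<open>x\<close>, which the passage to complex functions relies on.\<close>

lemma pk_dual:
  fixes f :: "('g \<Rightarrow> 'g) set \<Rightarrow> real"
  assumes t: "t > 0" and f: "integrable \<mu> f"
    and \<phi>: "\<phi> \<in> borel_measurable \<mu>" "\<And>y. y \<in> X \<Longrightarrow> \<bar>\<phi> y\<bar> \<le> C"
  shows "integrable \<mu> (\<lambda>x. \<phi> x * (\<integral>y. pk t x y * f y \<partial>\<mu>))"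
    "(\<integral>x. \<phi> x * (\<integral>y. pk t x y * f y \<partial>\<mu>) \<partial>\<mu>) = (\<integral>y. f y * Pw t \<phi> y \<partial>\<mu>)"
    "AE x in \<mu>. integrable \<mu> (\<lambda>y. \<phi> x * (pk t x y * f y))"
proof -
  have \<phi>a: "(\<lambda>x. \<bar>\<phi> x\<bar>) \<in> borel_measurable \<mu>" "\<And>y. y \<in> X \<Longrightarrow> \<bar>\<bar>\<phi> y\<bar>\<bar> \<le> C" using \<phi> by auto
  have m: "(\<lambda>(y, x). \<phi> x * (pk t x y * f y)) \<in> borel_measurable (\<mu> \<Otimes>\<^sub>M \<mu>)"
    unfolding case_prod_beta
    by (intro borel_measurable_times measurable_compose[OF measurable_snd \<phi>(1)]
        measurable_compose[OF measurable_fst borel_measurable_integrable[OF f]] pk_measurable'[unfolded case_prod_beta])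
  have i1: "integrable \<mu> (\<lambda>x. \<phi> x * (pk t x y * f y))" if y: "y \<in> X" for y
  proof -
    have a: "integrable \<mu> (\<lambda>x. pk t y x * \<phi> x * f y)" by (rule integrable_mult_left[OF pk_integral(1)[OF t y \<phi>]])
    have b: "pk t y x * \<phi> x * f y = \<phi> x * (pk t x y * f y)" if "x \<in> space \<mu>" for x
      using pk_sym[OF y, of x t] that by simp
    show ?thesis by (rule iffD1[OF Bochner_Integration.integrable_cong[OF refl b] a])
  qed
  have v: "(\<integral>x. \<phi> x * (pk t x y * f y) \<partial>\<mu>) = f y * Pw t \<phi> y" if y: "y \<in> X" for y
  proof -
    have "(\<integral>x. \<phi> x * (pk t x y * f y) \<partial>\<mu>) = (\<integral>x. f y * (pk t y x * \<phi> x) \<partial>\<mu>)"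
      by (rule Bochner_Integration.integral_cong[OF refl]) (simp add: pk_sym[OF y])
    then show ?thesis by (simp add: pk_integral(2)[OF t y \<phi>])
  qed
  have i: "integrable (\<mu> \<Otimes>\<^sub>M \<mu>) (\<lambda>(y, x). \<phi> x * (pk t x y * f y))"
  proof (rule PP.Fubini_integrable[OF m])
    show "AE y in \<mu>. integrable \<mu> (\<lambda>x. case (y, x) of (y, x) \<Rightarrow> \<phi> x * (pk t x y * f y))"
      using i1 by (intro AE_I2) simp
    show "integrable \<mu> (\<lambda>y. \<integral>x. norm (case (y, x) of (y, x) \<Rightarrow> \<phi> x * (pk t x y * f y)) \<partial>\<mu>)"
    proof (rule Bochner_Integration.integrable_bound)
      show "integrable \<mu> (\<lambda>y. f y * (C * eta_mass))" by (rule integrable_mult_left[OF f])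
      have "(\<lambda>(y, x). norm (\<phi> x * (pk t x y * f y))) \<in> borel_measurable (\<mu> \<Otimes>\<^sub>M \<mu>)"
        using measurable_compose[OF m borel_measurable_norm] by (simp add: case_prod_beta)
      from borel_measurable_lebesgue_integral[OF this]
      show "(\<lambda>y. \<integral>x. norm (case (y, x) of (y, x) \<Rightarrow> \<phi> x * (pk t x y * f y)) \<partial>\<mu>) \<in> borel_measurable \<mu>" by simp
      show "AE y in \<mu>. norm (\<integral>x. norm (case (y, x) of (y, x) \<Rightarrow> \<phi> x * (pk t x y * f y)) \<partial>\<mu>) \<le> norm (f y * (C * eta_mass))"
      proof (rule AE_I2)
        fix y assume "y \<in> space \<mu>"
        then have y: "y \<in> X" by simp
        have "(\<integral>x. norm (\<phi> x * (pk t x y * f y)) \<partial>\<mu>) = (\<integral>x. \<bar>f y\<bar> * (pk t y x * \<bar>\<phi> x\<bar>) \<partial>\<mu>)"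
          by (rule Bochner_Integration.integral_cong[OF refl]) (simp add: abs_mult pk_sym[OF y] pk_nonneg t y)
        also have "\<dots> = \<bar>f y\<bar> * Pw t (\<lambda>x. \<bar>\<phi> x\<bar>) y" by (simp add: pk_integral(2)[OF t y \<phi>a])
        finally have "(\<integral>x. norm (\<phi> x * (pk t x y * f y)) \<partial>\<mu>) = \<bar>f y\<bar> * Pw t (\<lambda>x. \<bar>\<phi> x\<bar>) y" .
        moreover have "\<bar>Pw t (\<lambda>x. \<bar>\<phi> x\<bar>) y\<bar> \<le> \<bar>C * eta_mass\<bar>" using Pw_bound[OF t y \<phi>a] by linarith
        ultimately show "norm (\<integral>x. norm (case (y, x) of (y, x) \<Rightarrow> \<phi> x * (pk t x y * f y)) \<partial>\<mu>) \<le> norm (f y * (C * eta_mass))"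
          by (simp add: abs_mult mult_left_mono)
      qed
    qed
  qed
  show "AE x in \<mu>. integrable \<mu> (\<lambda>y. \<phi> x * (pk t x y * f y))"
    using PP.AE_integrable_snd[OF i] by simp
  show "integrable \<mu> (\<lambda>x. \<phi> x * (\<integral>y. pk t x y * f y \<partial>\<mu>))"
    using PP.integrable_snd[OF i] by simp
  have "(\<integral>x. (\<integral>y. \<phi> x * (pk t x y * f y) \<partial>\<mu>) \<partial>\<mu>) = (\<integral>y. (\<integral>x. \<phi> x * (pk t x y * f y) \<partial>\<mu>) \<partial>\<mu>)"
    by (rule PP.Fubini_integral[OF i])
  also have "\<dots> = (\<integral>y. f y * Pw t \<phi> y \<partial>\<mu>)"
    by (rule Bochner_Integration.integral_cong[OF refl]) (simp add: v)
  finally show "(\<integral>x. \<phi> x * (\<integral>y. pk t x y * f y \<partial>\<mu>) \<partial>\<mu>) = (\<integral>y. f y * Pw t \<phi> y \<partial>\<mu>)"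
    by simp
qed

lemma pk_L1_integrable:
  fixes f :: "('g \<Rightarrow> 'g) set \<Rightarrow> real"
  assumes "t > 0" "integrable \<mu> f" shows "integrable \<mu> (\<lambda>x. \<integral>y. pk t x y * f y \<partial>\<mu>)"
  using pk_dual(1)[OF assms, of "\<lambda>_. 1" 1] by simp

lemma pk_integrable: assumes "t > 0" "y \<in> X" shows "integrable \<mu> (\<lambda>x. pk t x y)"
proof -
  have "integrable \<mu> (\<lambda>x. pk t y x)" using pk_integral(1)[OF assms, of "\<lambda>_. 1" 1] by simp
  then show ?thesis
    by (rule Bochner_Integration.integrable_cong[THEN iffD1, OF refl, rotated]) (simp add: pk_sym assms)
qed

end

context rank_one_heat
begin

lemma pk_AE_integrable:
  fixes f :: "('g \<Rightarrow> 'g) set \<Rightarrow> real"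
  assumes t: "t > 0" and f: "integrable \<mu> f"
  shows "AE x in \<mu>. integrable \<mu> (\<lambda>y. pk t x y * f y)"
  using pk_dual(3)[OF assms, of "\<lambda>_. 1" 1] by simp

section \<open>Failure of the convergence for general integrable functions\<close>

lemma L1_measurable: assumes u: "C2X u" shows "L1 V u \<in> borel_measurable \<mu>"
proof (rule borel_measurable_LIMSEQ_real)
  let ?u = "\<lambda>n x. (u (translate (ex ((1 / real (Suc n)) *\<^sub>R V)) x) - u x) * real (Suc n)"
  have m: "u \<in> borel_measurable \<mu>" by (rule measurable_continuous[OF C2X_continuous[OF u]])
  show "?u n \<in> borel_measurable \<mu>" for n
    using measurable_compose[OF measurable_translate[OF G_ex] m] m by simp
  fix x assume "x \<in> space \<mu>"
  then have x: "x \<in> X" by simp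
  have "((\<lambda>s. (u (translate (ex ((0 + s) *\<^sub>R V)) x) - u (translate (ex (0 *\<^sub>R V)) x)) / s) \<longlongrightarrow> L1 V u (translate (ex (0 *\<^sub>R V)) x)) (at 0)"
    by (rule DERIV_D[OF L1_has_derivative(1)[OF u x]])
  moreover have "filterlim (\<lambda>n. 1 / real (Suc n)) (at 0) sequentially"
    by (rule filterlim_atI) (use LIMSEQ_Suc[OF lim_1_over_n] in auto)
  ultimately have "(\<lambda>n. (u (translate (ex ((0 + 1 / real (Suc n)) *\<^sub>R V)) x) - u (translate (ex (0 *\<^sub>R V)) x)) / (1 / real (Suc n)))
      \<longlonglongrightarrow> L1 V u (translate (ex (0 *\<^sub>R V)) x)"
    by (rule filterlim_compose)
  then show "(\<lambda>n. ?u n x) \<longlonglongrightarrow> L1 V u x" by (simp del: of_nat_Suc)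
qed

lemma finite_open_sublevel: "emeasure \<mu> {x \<in> X. N x < b} < \<infinity>"
proof -
  have "emeasure \<mu> {x \<in> X. N x < b} \<le> emeasure \<mu> {x \<in> X. N x \<le> b}"
    by (rule emeasure_mono[OF _ sets_sublevel(1)]) auto
  then show ?thesis using finite_sublevel[of b] by (rule le_less_trans)
qed

text \<open>If the set were null, the semigroup would annihilate a bump function that is 1 at
  \<open>org\<close> and supported in it, against the initial condition.\<close>

lemma sublevel_mass_pos:
  assumes b: "N org < b" shows "measure \<mu> {x \<in> X. N x < b} > 0"
proof (rule ccontr)
  let ?U = "{x \<in> X. N x < b}"
  assume "\<not> ?thesis"
  then have "measure \<mu> ?U = 0" using measure_nonneg[of \<mu> ?U] by linarith
  moreover note finite_open_sublevel[of b]
  ultimately have "emeasure \<mu> ?U = 0" by (simp add: emeasure_eq_ennreal_measure top.not_eq_extremum)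
  then have ae: "AE x in \<mu>. x \<notin> ?U" by (intro AE_not_in null_setsI sets_sublevel)
  obtain \<theta> where \<theta>: "C2X \<theta>" "\<And>x. N x \<le> N org \<Longrightarrow> \<theta> x = 1" "\<And>x. b \<le> N x \<Longrightarrow> \<theta> x = 0"
    using cutoff b by metis
  have s: "supported \<theta> b" using C2X_continuous[OF \<theta>(1)] \<theta>(3) by (simp add: supported_def)
  have "Hs u \<theta> org = 0" for u
    unfolding Hs_def
  proof (rule integral_eq_zero_AE)
    show "AE y in \<mu>. h u org y * \<theta> y = 0"
      using ae AE_space by eventually_elim (use \<theta>(3) in auto)
  qed
  then have "((\<lambda>u::real. 0) \<longlongrightarrow> \<theta> org) (at_right 0)" using Hs_initial[OF s org_X] by simp
  then have "\<theta> org = 0" by (simp add: tendsto_const_iff)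
  then show False using \<theta>(2)[of org] by simp
qed

abbreviation PS :: "real \<Rightarrow> (('g \<Rightarrow> 'g) set \<Rightarrow> complex) \<Rightarrow> ('g \<Rightarrow> 'g) set \<Rightarrow> complex" where
  "PS \<equiv> poisson_semigroup \<mu> h"

lemma PS_measurable: assumes f: "f \<in> borel_measurable \<mu>" shows "PS t f \<in> borel_measurable \<mu>"
proof -
  have "(\<lambda>(x, y). complex_of_real (pk t x y) * f y) \<in> borel_measurable (\<mu> \<Otimes>\<^sub>M \<mu>)"
    unfolding case_prod_beta
    by (intro borel_measurable_times measurable_compose[OF measurable_snd f]
        measurable_compose[OF pk_measurable[unfolded case_prod_beta] borel_measurable_of_real])
  from borel_measurable_lebesgue_integral[OF this] show ?thesis
    unfolding poisson_semigroup_def[abs_def] .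
qed

text \<open>The multiples of \<open>pk t x org\<close> cancel because the masses agree.\<close>

lemma asymptotics_difference:
  assumes f: "integrable \<mu> f" "integrable \<mu> g" and eq: "(\<integral>x. f x \<partial>\<mu>) = (\<integral>x. g x \<partial>\<mu>)"
    and a: "poisson_asymptotics \<mu> h org f" "poisson_asymptotics \<mu> h org g"
  shows "((\<lambda>t. \<integral>\<^sup>+x. ennreal (norm (PS t f x - PS t g x)) \<partial>\<mu>) \<longlongrightarrow> 0) at_top"
proof (rule tendsto_sandwich[OF _ _ tendsto_const])
  let ?r = "\<lambda>f t x. PS t f x - (\<integral>y. f y \<partial>\<mu>) * complex_of_real (pk t x org)"
  have m: "?r f t \<in> borel_measurable \<mu>" if "integrable \<mu> f" for f t
  proof -
    have "(\<lambda>x. pk t x org) \<in> borel_measurable \<mu>"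
      using measurable_compose[OF measurable_Pair2'[of org \<mu> \<mu>] pk_measurable[of t]] by simp
    then show ?thesis using PS_measurable[OF borel_measurable_integrable[OF that]] by measurable
  qed
  show "\<forall>\<^sub>F t in at_top. (\<integral>\<^sup>+x. ennreal (norm (PS t f x - PS t g x)) \<partial>\<mu>) \<le> L1_norm \<mu> (?r f t) + L1_norm \<mu> (?r g t)"
  proof (intro always_eventually allI)
    fix t
    have "(\<integral>\<^sup>+x. ennreal (norm (PS t f x - PS t g x)) \<partial>\<mu>) \<le> (\<integral>\<^sup>+x. ennreal (norm (?r f t x)) + ennreal (norm (?r g t x)) \<partial>\<mu>)"
    proof (rule nn_integral_mono)
      fix x
      have "norm (PS t f x - PS t g x) = norm (?r f t x - ?r g t x)" by (simp add: eq)
      also have "\<dots> \<le> norm (?r f t x) + norm (?r g t x)" by (rule norm_triangle_ineq4)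
      finally show "ennreal (norm (PS t f x - PS t g x)) \<le> ennreal (norm (?r f t x)) + ennreal (norm (?r g t x))"
        by (simp flip: ennreal_plus)
    qed
    also have "\<dots> = L1_norm \<mu> (?r f t) + L1_norm \<mu> (?r g t)"
      unfolding L1_norm_def using m[OF f(1), of t] m[OF f(2), of t] by (intro nn_integral_add) auto
    finally show "(\<integral>\<^sup>+x. ennreal (norm (PS t f x - PS t g x)) \<partial>\<mu>) \<le> L1_norm \<mu> (?r f t) + L1_norm \<mu> (?r g t)" .
  qed
  have "((\<lambda>t. L1_norm \<mu> (?r f t) + L1_norm \<mu> (?r g t)) \<longlongrightarrow> 0 + 0) at_top"
    by (intro tendsto_add) (use a in \<open>simp_all add: poisson_asymptotics_def\<close>)
  then show "((\<lambda>t. L1_norm \<mu> (?r f t) + L1_norm \<mu> (?r g t)) \<longlongrightarrow> 0) at_top" by simp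
qed simp

text \<open>If the asymptotics held for the indicator of a ball and for its translates, then \<open>P\<^sub>t\<close> of
  the indicator would become asymptotically invariant under translation in \<open>L\<^sup>1\<close>. Pairing with the
  bounded functions \<open>L1 V N\<close> contradicts their uniform drift.\<close>
theorem asymptotics_fails: "\<exists>f. integrable \<mu> f \<and> \<not> poisson_asymptotics \<mu> h org f"
proof (rule ccontr)
  assume "\<not> ?thesis"
  then have all: "poisson_asymptotics \<mu> h org f" if "integrable \<mu> f" for f using that by blast
  define b where "b = N org + 1"
  define U where "U = {x \<in> X. N x < b}"
  define g where "g = (\<lambda>x. indicator U x :: real)"
  define q where "q t x = (\<integral>y. pk t x y * g y \<partial>\<mu>)" for t x
  have Ufin: "emeasure \<mu> U < \<infinity>" unfolding U_def by (rule finite_open_sublevel)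
  have Us: "U \<in> sets \<mu>" unfolding U_def by (rule sets_sublevel)
  have gi: "integrable \<mu> g" unfolding g_def using Us Ufin by (rule integrable_real_indicator)
  have gm: "g \<in> borel_measurable \<mu>" by (rule borel_measurable_integrable[OF gi])
  have gv: "(\<integral>x. g x \<partial>\<mu>) = measure \<mu> U" unfolding g_def using Us sets.sets_into_space[OF Us] by (simp add: Int_absorb2)
  have mU: "measure \<mu> U > 0" unfolding U_def by (rule sublevel_mass_pos) (simp add: b_def)
  have qi: "integrable \<mu> (q t)" if "t > 0" for t
    unfolding q_def[abs_def] by (rule pk_L1_integrable[OF that gi])
  have q0: "0 \<le> q t x" if "t > 0" "x \<in> X" for t x
    unfolding q_def using that by (intro integral_nonneg_AE AE_I2) (simp add: g_def pk_nonneg)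
  have qv: "(\<integral>x. q t x \<partial>\<mu>) = measure \<mu> U * eta_mass" if t: "t > 0" for t
  proof -
    have "(\<integral>x. q t x \<partial>\<mu>) = (\<integral>y. g y * Pw t (\<lambda>_. 1) y \<partial>\<mu>)"
      using pk_dual(2)[OF t gi, of "\<lambda>_. 1" 1] by (simp add: q_def)
    also have "\<dots> = (\<integral>y. g y * eta_mass \<partial>\<mu>)"
      by (rule Bochner_Integration.integral_cong[OF refl]) (simp add: Pw_const[OF t])
    finally show ?thesis by (simp add: gv)
  qed
  \<comment> \<open>The indicator \<open>g\<close> and its translate have equal mass, and
    translation commutes with the Poisson semigroup since the kernel is invariant; so the assumed
    convergence makes this quantity tend to 0.\<close>
  define I where "I V t = (\<integral>x. \<bar>q t (translate (inv (ex V)) x) - q t x\<bar> \<partial>\<mu>)" for V t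
  have qa: "integrable \<mu> (\<lambda>x. q t (translate (inv (ex V)) x))" if "t > 0" for t V
    by (rule integrable_translate[OF G_inv[OF G_ex] qi[OF that]])
  have I0: "((\<lambda>t. I V t) \<longlongrightarrow> 0) at_top" for V
  proof -
    let ?a = "inv (ex V)"
    have a: "?a \<in> G" by (rule G_inv[OF G_ex])
    let ?f1 = "\<lambda>x. complex_of_real (g (translate ?a x))" and ?f2 = "\<lambda>x. complex_of_real (g x)"
    have i: "integrable \<mu> ?f1" "integrable \<mu> ?f2"
      using integrable_translate[OF a gi] gi by (auto intro: integrable_of_real)
    have e: "(\<integral>x. ?f1 x \<partial>\<mu>) = (\<integral>x. ?f2 x \<partial>\<mu>)" using integral_translate[OF a gm] by simp
    have 2: "PS t ?f2 x = complex_of_real (q t x)" for t x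
      unfolding poisson_semigroup_def q_def by (simp flip: of_real_mult)
    have 1: "PS t ?f1 x = complex_of_real (q t (translate ?a x))" if "x \<in> X" for t x
      using pk_integral_translate[OF a that gm, of t] unfolding poisson_semigroup_def q_def
      by (simp flip: of_real_mult)
    have "((\<lambda>t. \<integral>\<^sup>+x. ennreal (norm (PS t ?f1 x - PS t ?f2 x)) \<partial>\<mu>) \<longlongrightarrow> 0) at_top"
      by (rule asymptotics_difference[OF i e all[OF i(1)] all[OF i(2)]])
    moreover have "(\<integral>\<^sup>+x. ennreal (norm (PS t ?f1 x - PS t ?f2 x)) \<partial>\<mu>) = ennreal (I V t)" if "t > 0" for t
    proof -
      have "(\<integral>\<^sup>+x. ennreal (norm (PS t ?f1 x - PS t ?f2 x)) \<partial>\<mu>) = (\<integral>\<^sup>+x. ennreal \<bar>q t (translate ?a x) - q t x\<bar> \<partial>\<mu>)"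
        by (rule nn_integral_cong) (simp add: 1 2 flip: of_real_diff)
      also have "\<dots> = ennreal (I V t)" unfolding I_def
        by (rule nn_integral_eq_integral) (use qa[OF that] qi[OF that] in auto)
      finally show ?thesis .
    qed
    ultimately have "((\<lambda>t. ennreal (I V t)) \<longlongrightarrow> ennreal 0) at_top"
      by (simp, elim Lim_transform_eventually) (auto intro!: eventually_mono[OF eventually_gt_at_top[of 0]])
    moreover have "0 \<le> I V t" for t unfolding I_def by (rule integral_nonneg_AE) simp
    ultimately show ?thesis by (subst (asm) tendsto_ennreal_iff) auto
  qed
  obtain C where C: "C > 0" "\<And>V x. V \<in> P0 \<Longrightarrow> x \<in> X \<Longrightarrow> \<bar>L1 V N x\<bar> \<le> C" using N_derivative_bounds by metis
  obtain \<kappa> where \<kappa>: "\<kappa> > 0" "\<And>x. x \<in> X \<Longrightarrow> \<kappa> \<le> (\<Sum>V\<in>P0. L1 V N (translate (ex V) x) - L1 V N x)" by (rule escape) auto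
  have mL: "L1 V N \<in> borel_measurable \<mu>" for V by (rule L1_measurable[OF C2X_N])
  have ip: "integrable \<mu> (\<lambda>x. u x * L1 V N x)" if "integrable \<mu> u" "V \<in> P0" for u V
    by (rule Bochner_Integration.integrable_bound[OF integrable_mult_left[OF that(1), of C]])
      (use mL borel_measurable_integrable[OF that(1)] C(1) C(2)[OF that(2)] in \<open>auto simp: abs_mult intro!: mult_left_mono\<close>)
  \<comment> \<open>\<open>escape\<close> bounds the paired increments from below by the mass of
    \<open>q t\<close>. A change of variables moves the translation by \<open>ex V\<close> from
    \<open>L1 V N\<close> to \<open>q t\<close>, where it costs at most
    \<open>C * I V t\<close>.\<close>
  have key: "\<kappa> * (measure \<mu> U * eta_mass) \<le> (\<Sum>V\<in>P0. C * I V t)" if t: "t > 0" for t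
  proof -
    have ia: "integrable \<mu> (\<lambda>x. q t x * L1 V N (translate (ex V) x))" if "V \<in> P0" for V
      using integrable_translate[OF G_ex ip[OF qa[OF t] that], of V V] by (simp add: translate_inv(1))
    have "\<kappa> * (measure \<mu> U * eta_mass) = (\<integral>x. q t x * \<kappa> \<partial>\<mu>)" by (simp add: qv[OF t])
    also have "\<dots> \<le> (\<integral>x. (\<Sum>V\<in>P0. q t x * L1 V N (translate (ex V) x) - q t x * L1 V N x) \<partial>\<mu>)"
    proof (rule integral_mono)
      show "integrable \<mu> (\<lambda>x. q t x * \<kappa>)" by (rule integrable_mult_left[OF qi[OF t]])
      show "integrable \<mu> (\<lambda>x. \<Sum>V\<in>P0. q t x * L1 V N (translate (ex V) x) - q t x * L1 V N x)"
        by (intro Bochner_Integration.integrable_sum Bochner_Integration.integrable_diff ia ip qi t)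
      fix x assume "x \<in> space \<mu>"
      then have x: "x \<in> X" by simp
      have "q t x * \<kappa> \<le> q t x * (\<Sum>V\<in>P0. L1 V N (translate (ex V) x) - L1 V N x)"
        by (rule mult_left_mono[OF \<kappa>(2)[OF x] q0[OF t x]])
      then show "q t x * \<kappa> \<le> (\<Sum>V\<in>P0. q t x * L1 V N (translate (ex V) x) - q t x * L1 V N x)"
        by (simp add: sum_distrib_left right_diff_distrib)
    qed
    also have "\<dots> = (\<Sum>V\<in>P0. (\<integral>x. q t x * L1 V N (translate (ex V) x) - q t x * L1 V N x \<partial>\<mu>))"
      by (rule Bochner_Integration.integral_sum) (intro Bochner_Integration.integrable_diff ia ip qi t)
    also have "\<dots> \<le> (\<Sum>V\<in>P0. C * I V t)"
    proof (rule sum_mono)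
      fix V assume V: "V \<in> P0"
      have "(\<integral>x. q t x * L1 V N (translate (ex V) x) - q t x * L1 V N x \<partial>\<mu>)
          = (\<integral>x. q t x * L1 V N (translate (ex V) x) \<partial>\<mu>) - (\<integral>x. q t x * L1 V N x \<partial>\<mu>)"
        by (rule Bochner_Integration.integral_diff[OF ia[OF V] ip[OF qi[OF t] V]])
      also have "(\<integral>x. q t x * L1 V N (translate (ex V) x) \<partial>\<mu>) = (\<integral>x. q t (translate (inv (ex V)) x) * L1 V N x \<partial>\<mu>)"
        using integral_translate[OF G_ex borel_measurable_integrable[OF ip[OF qa[OF t] V]], of V V]
        by (simp add: translate_inv(1))
      also have "\<dots> - (\<integral>x. q t x * L1 V N x \<partial>\<mu>) = (\<integral>x. (q t (translate (inv (ex V)) x) - q t x) * L1 V N x \<partial>\<mu>)"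
        unfolding left_diff_distrib
        by (rule Bochner_Integration.integral_diff[OF ip[OF qa[OF t] V] ip[OF qi[OF t] V], symmetric])
      also have "\<dots> \<le> (\<integral>x. \<bar>q t (translate (inv (ex V)) x) - q t x\<bar> * C \<partial>\<mu>)"
      proof (rule integral_mono)
        show "integrable \<mu> (\<lambda>x. (q t (translate (inv (ex V)) x) - q t x) * L1 V N x)"
          by (intro ip Bochner_Integration.integrable_diff qa qi t V)
        show "integrable \<mu> (\<lambda>x. \<bar>q t (translate (inv (ex V)) x) - q t x\<bar> * C)"
          by (intro integrable_mult_left integrable_abs Bochner_Integration.integrable_diff qa qi t)
        fix x assume "x \<in> space \<mu>"
        then have "\<bar>L1 V N x\<bar> \<le> C" using C(2)[OF V] by simp
        then have 1: "\<bar>q t (translate (inv (ex V)) x) - q t x\<bar> * \<bar>L1 V N x\<bar> \<le> \<bar>q t (translate (inv (ex V)) x) - q t x\<bar> * C"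
          by (intro mult_left_mono) auto
        show "(q t (translate (inv (ex V)) x) - q t x) * L1 V N x \<le> \<bar>q t (translate (inv (ex V)) x) - q t x\<bar> * C"
          by (rule order_trans[OF abs_ge_self]) (use 1 in \<open>simp only: abs_mult\<close>)
      qed
      also have "\<dots> = C * I V t" by (simp add: I_def mult.commute)
      finally show "(\<integral>x. q t x * L1 V N (translate (ex V) x) - q t x * L1 V N x \<partial>\<mu>) \<le> C * I V t" .
    qed
    finally show ?thesis .
  qed
  have "((\<lambda>t. \<Sum>V\<in>P0. C * I V t) \<longlongrightarrow> (\<Sum>V\<in>P0. C * 0)) at_top"
    by (intro tendsto_sum tendsto_mult_left I0)
  moreover have "\<forall>\<^sub>F t in at_top. \<kappa> * (measure \<mu> U * eta_mass) \<le> (\<Sum>V\<in>P0. C * I V t)"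
    using eventually_gt_at_top[of 0] by eventually_elim (rule key)
  ultimately have "\<kappa> * (measure \<mu> U * eta_mass) \<le> (\<Sum>V\<in>P0. C * 0)"
    by (rule tendsto_lowerbound) simp
  moreover have "\<kappa> * (measure \<mu> U * eta_mass) > 0" using \<kappa>(1) mU eta_mass_pos by simp
  ultimately show False by simp
qed

section \<open>Convergence for radial functions\<close>

lemma Pw_oscillation:
  assumes t: "t > 0" and w: "w \<in> borel_measurable \<mu>" "\<And>y. y \<in> X \<Longrightarrow> \<bar>w y\<bar> \<le> 1"
    and inv: "\<And>k y. k \<in> K \<Longrightarrow> y \<in> X \<Longrightarrow> w (translate k y) = w y"
    and c0: "c0 > 0" "\<And>x. x \<in> X \<Longrightarrow> c0 \<le> lap N x" and z: "z \<in> X"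
  shows "\<bar>Pw t w z - Pw t w org\<bar> \<le> 786432 * pi / 2 / t\<^sup>2 / c0 * (N z - N org)"
proof -
  define c where "c = 786432 * pi / 2 / t\<^sup>2"
  have c: "c \<ge> 0" by (simp add: c_def)
  have m: "Pw t w \<in> borel_measurable \<mu>" by (rule Pw_measurable[OF t w])
  have b: "\<bar>Pw t w x\<bar> \<le> eta_mass" if "x \<in> X" for x using Pw_bound[OF t that w] by simp
  have ct: "continuous_on UNIV (\<lambda>Y. Pw t w (E Y))" by (rule Pw_continuous[OF t w])
  have K: "Pw t w (translate k x) = Pw t w x" if "k \<in> K" "x \<in> X" for k x
    by (rule Pw_translate[OF t K_G[OF that(1)] that(2) w inv[OF that(1)]])
  have H: "\<bar>Hs r (Pw t w) x - Pw t w x\<bar> \<le> c * r" if "0 < r" "r < t\<^sup>2" "x \<in> X" for r x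
    using Hs_Pw[OF t that(3) w that(1)] that(2) by (simp add: c_def)
  have t2: "0 < t\<^sup>2" using t by simp
  have "Pw t w org \<le> Pw t w z + c / c0 * (N z - N org)"
  proof (rule elliptic_maximum_principle[OF m b ct K _ t2 c c0 z])
    show "Pw t w x - c * r \<le> Hs r (Pw t w) x" if "0 < r" "r < t\<^sup>2" "x \<in> X" for r x
      using H[OF that] by linarith
  qed
  moreover have "- Pw t w org \<le> - Pw t w z + c / c0 * (N z - N org)"
  proof (rule elliptic_maximum_principle[where u="\<lambda>x. - Pw t w x", OF _ _ _ _ _ t2 c c0 z])
    show "(\<lambda>x. - Pw t w x) \<in> borel_measurable \<mu>" using m by simp
    show "\<bar>- Pw t w x\<bar> \<le> eta_mass" if "x \<in> X" for x using b[OF that] by simp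
    show "continuous_on UNIV (\<lambda>Y. - Pw t w (E Y))" by (rule continuous_on_minus[OF ct])
    show "- Pw t w (translate k x) = - Pw t w x" if "k \<in> K" "x \<in> X" for k x using K[OF that] by simp
    show "- Pw t w x - c * r \<le> Hs r (\<lambda>x. - Pw t w x) x" if "0 < r" "r < t\<^sup>2" "x \<in> X" for r x
      using H[OF that] Hs_cmult[of r "-1" "Pw t w" x] by simp
  qed
  ultimately show ?thesis unfolding c_def[symmetric] abs_le_iff by linarith
qed

text \<open>By duality the \<open>L\<^sup>1\<close> norm equals the integral of \<open>f\<close> against \<open>w - w org\<close>, where \<open>w\<close> is \<open>P\<^sub>t\<close> of
  the sign. The latter is radial and nearly harmonic, hence nearly constant on bounded sets.\<close>
lemma radial_convergence:
  fixes f :: "('g \<Rightarrow> 'g) set \<Rightarrow> real"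
  assumes f: "integrable \<mu> f" and inv: "\<And>k y. k \<in> K \<Longrightarrow> y \<in> X \<Longrightarrow> f (translate k y) = f y"
  shows "((\<lambda>t. \<integral>\<^sup>+x. ennreal \<bar>(\<integral>y. pk t x y * f y \<partial>\<mu>) - (\<integral>y. f y \<partial>\<mu>) * pk t x org\<bar> \<partial>\<mu>) \<longlongrightarrow> 0) at_top"
proof -
  define m where "m = (\<integral>y. f y \<partial>\<mu>)"
  define F where "F t x = (\<integral>y. pk t x y * f y \<partial>\<mu>) - m * pk t x org" for t x
  \<comment> \<open>The sign varies with \<open>t\<close> without control, but the oscillation
    estimate sees only its bound by 1 and its invariance under \<open>K\<close>, and is therefore
    uniform.\<close>
  define \<phi> where "\<phi> t x = sgn (F t x)" for t x
  define w where "w t = Pw t (\<phi> t)" for t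
  have fm: "f \<in> borel_measurable \<mu>" by (rule borel_measurable_integrable[OF f])
  have Fi: "integrable \<mu> (F t)" if t: "t > 0" for t
    unfolding F_def[abs_def]
    by (intro Bochner_Integration.integrable_diff integrable_mult_right pk_L1_integrable[OF t f] pk_integrable[OF t org_X])
  have \<phi>m: "\<phi> t \<in> borel_measurable \<mu>" if "t > 0" for t
    using borel_measurable_integrable[OF Fi[OF that]] unfolding \<phi>_def[abs_def] by measurable
  have \<phi>b: "\<bar>\<phi> t x\<bar> \<le> 1" for t x by (simp add: \<phi>_def sgn_if)
  have \<phi>K: "\<phi> t (translate k x) = \<phi> t x" if k: "k \<in> K" and x: "x \<in> X" for t k x
  proof -
    have "(\<integral>y. pk t (translate k x) y * f y \<partial>\<mu>) = (\<integral>y. pk t x y * f (translate k y) \<partial>\<mu>)"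
      using pk_integral_translate[OF K_G[OF k] x fm, of t] by simp
    also have "\<dots> = (\<integral>y. pk t x y * f y \<partial>\<mu>)"
      by (rule Bochner_Integration.integral_cong[OF refl]) (simp add: inv k)
    finally have "F t (translate k x) = F t x"
      using pk_translate[OF K_G[OF k] x org_X, of t] by (simp add: F_def translate_K_org k)
    then show ?thesis by (simp add: \<phi>_def)
  qed
  have wm: "w t \<in> borel_measurable \<mu>" if "t > 0" for t
    unfolding w_def by (rule Pw_measurable[OF that \<phi>m[OF that] \<phi>b])
  have wb: "\<bar>w t x\<bar> \<le> eta_mass" if "t > 0" "x \<in> X" for t x
    using Pw_bound[OF that \<phi>m[OF that(1)] \<phi>b] by (simp add: w_def)
  have wi: "integrable \<mu> (\<lambda>y. f y * w t y)" if t: "t > 0" for t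
    by (rule Bochner_Integration.integrable_bound[OF integrable_mult_left[OF f, of eta_mass]])
      (use fm wm[OF t] wb[OF t] eta_mass_pos in \<open>auto simp: abs_mult intro!: mult_left_mono\<close>)
  have norm_eq: "(\<integral>x. \<bar>F t x\<bar> \<partial>\<mu>) = (\<integral>y. f y * (w t y - w t org) \<partial>\<mu>)" if t: "t > 0" for t
  proof -
    have 1: "(\<integral>x. \<phi> t x * pk t x org \<partial>\<mu>) = w t org"
    proof -
      have "(\<integral>x. \<phi> t x * pk t x org \<partial>\<mu>) = (\<integral>x. pk t org x * \<phi> t x \<partial>\<mu>)"
        by (rule Bochner_Integration.integral_cong[OF refl]) (simp add: pk_sym[OF org_X])
      then show ?thesis using pk_integral(2)[OF t org_X \<phi>m[OF t] \<phi>b] by (simp add: w_def)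
    qed
    have i2: "integrable \<mu> (\<lambda>x. \<phi> t x * (m * pk t x org))"
      by (rule Bochner_Integration.integrable_bound[OF integrable_mult_right[OF pk_integrable[OF t org_X], of m]])
        (use \<phi>m[OF t] \<phi>b borel_measurable_integrable[OF pk_integrable[OF t org_X]] in \<open>auto simp: abs_mult intro!: mult_left_le_one_le\<close>)
    have "(\<integral>x. \<bar>F t x\<bar> \<partial>\<mu>) = (\<integral>x. \<phi> t x * (\<integral>y. pk t x y * f y \<partial>\<mu>) - \<phi> t x * (m * pk t x org) \<partial>\<mu>)"
      by (rule Bochner_Integration.integral_cong[OF refl])
        (simp add: \<phi>_def F_def abs_sgn mult.commute flip: right_diff_distrib left_diff_distrib)
    also have "\<dots> = (\<integral>x. \<phi> t x * (\<integral>y. pk t x y * f y \<partial>\<mu>) \<partial>\<mu>) - (\<integral>x. \<phi> t x * (m * pk t x org) \<partial>\<mu>)"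
      by (rule Bochner_Integration.integral_diff[OF pk_dual(1)[OF t f \<phi>m[OF t] \<phi>b] i2])
    also have "(\<integral>x. \<phi> t x * (m * pk t x org) \<partial>\<mu>) = m * w t org"
      by (simp add: mult.left_commute[of _ m] 1)
    also have "(\<integral>x. \<phi> t x * (\<integral>y. pk t x y * f y \<partial>\<mu>) \<partial>\<mu>) = (\<integral>y. f y * w t y \<partial>\<mu>)"
      unfolding w_def by (rule pk_dual(2)[OF t f \<phi>m[OF t] \<phi>b])
    also have "(\<integral>y. f y * w t y \<partial>\<mu>) - m * w t org = (\<integral>y. f y * (w t y - w t org) \<partial>\<mu>)"
      unfolding right_diff_distrib using wi[OF t] f by (simp add: m_def)
    finally show ?thesis .
  qed
  obtain c0 where c0: "c0 > 0" "\<And>x. x \<in> X \<Longrightarrow> c0 \<le> lap N x" using lap_N_pos by metis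
  \<comment> \<open>Set to 0 for \<open>t \<le> 0\<close>, because dominated convergence asks for
    measurability at every \<open>t\<close>.\<close>
  define s where "s t y = (if t > 0 then f y * (w t y - w t org) else 0)" for t y
  have "((\<lambda>t. \<integral>y. s t y \<partial>\<mu>) \<longlongrightarrow> (\<integral>y. 0 \<partial>\<mu>)) at_top"
  proof (rule integral_dominated_convergence_at_top[where w="\<lambda>y. \<bar>f y\<bar> * (2 * eta_mass)"])
    show "s t \<in> borel_measurable \<mu>" for t
      unfolding s_def[abs_def] using fm wm[of t] by (cases "t > 0") auto
    show "integrable \<mu> (\<lambda>y. \<bar>f y\<bar> * (2 * eta_mass))" by (intro integrable_mult_left integrable_abs f)
    show "AE y in \<mu>. ((\<lambda>t. s t y) \<longlongrightarrow> 0) at_top"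
    proof (rule AE_I2)
      fix y assume "y \<in> space \<mu>"
      then have y: "y \<in> X" by simp
      define d where "d = \<bar>f y\<bar> * (786432 * pi / 2 / c0 * (N y - N org))"
      show "((\<lambda>t. s t y) \<longlongrightarrow> 0) at_top"
      proof (rule Lim_null_comparison)
        show "\<forall>\<^sub>F t in at_top. norm (s t y) \<le> d / t\<^sup>2"
          using eventually_gt_at_top[of 0]
        proof eventually_elim
          fix t :: real assume t: "0 < t"
          have "\<bar>w t y - w t org\<bar> \<le> 786432 * pi / 2 / t\<^sup>2 / c0 * (N y - N org)"
            unfolding w_def by (rule Pw_oscillation[OF t \<phi>m[OF t] \<phi>b \<phi>K c0 y])
          then have "\<bar>f y\<bar> * \<bar>w t y - w t org\<bar> \<le> \<bar>f y\<bar> * (786432 * pi / 2 / t\<^sup>2 / c0 * (N y - N org))"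
            by (intro mult_left_mono) auto
          then show "norm (s t y) \<le> d / t\<^sup>2" using t by (simp add: s_def d_def abs_mult mult_ac)
        qed
        have "filterlim (\<lambda>t::real. t\<^sup>2) at_top at_top" by (rule filterlim_pow_at_top) (auto intro: filterlim_ident)
        then show "((\<lambda>t. d / t\<^sup>2) \<longlongrightarrow> 0) at_top"
          by (intro tendsto_divide_0[OF tendsto_const]) (rule filterlim_at_top_imp_at_infinity)
      qed
    qed
    show "\<forall>\<^sub>F t in at_top. AE y in \<mu>. norm (s t y) \<le> \<bar>f y\<bar> * (2 * eta_mass)"
      using eventually_gt_at_top[of 0]
    proof eventually_elim
      fix t :: real assume t: "0 < t"
      have "\<bar>w t y - w t org\<bar> \<le> 2 * eta_mass" if "y \<in> X" for y
        using wb[OF t that] wb[OF t org_X] by linarith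
      then show "AE y in \<mu>. norm (s t y) \<le> \<bar>f y\<bar> * (2 * eta_mass)"
        using t by (intro AE_I2) (simp add: s_def abs_mult mult_left_mono)
    qed
  qed simp
  then have "((\<lambda>t. ennreal (\<integral>y. s t y \<partial>\<mu>)) \<longlongrightarrow> 0) at_top" using tendsto_ennrealI by fastforce
  moreover have "\<forall>\<^sub>F t in at_top. ennreal (\<integral>y. s t y \<partial>\<mu>) = (\<integral>\<^sup>+x. ennreal \<bar>F t x\<bar> \<partial>\<mu>)"
    using eventually_gt_at_top[of 0]
  proof eventually_elim
    fix t :: real assume t: "0 < t"
    have "(\<integral>\<^sup>+x. ennreal \<bar>F t x\<bar> \<partial>\<mu>) = ennreal (\<integral>x. \<bar>F t x\<bar> \<partial>\<mu>)"
      by (rule nn_integral_eq_integral) (use Fi[OF t] in auto)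
    then show "ennreal (\<integral>y. s t y \<partial>\<mu>) = (\<integral>\<^sup>+x. ennreal \<bar>F t x\<bar> \<partial>\<mu>)"
      using norm_eq[OF t] t by (simp add: s_def)
  qed
  ultimately have "((\<lambda>t. \<integral>\<^sup>+x. ennreal \<bar>F t x\<bar> \<partial>\<mu>) \<longlongrightarrow> 0) at_top" by (rule Lim_transform_eventually)
  then show ?thesis by (simp add: F_def m_def)
qed

text \<open>\<open>radial_convergence\<close> applies to the real and the imaginary part, both
  invariant under \<open>K\<close> by \<open>radial_K\<close>, and the norm of a complex number is
  at most the sum of the absolute values of its parts.\<close>

theorem asymptotics_radial:
  assumes f: "integrable \<mu> f" and rad: "radial br th H0 f"
  shows "poisson_asymptotics \<mu> h org f"
  unfolding poisson_asymptotics_def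
proof (rule tendsto_sandwich[OF _ _ tendsto_const])
  define R where "R g t x = (\<integral>y. pk t x y * g y \<partial>\<mu>) - (\<integral>y. g y \<partial>\<mu>) * pk t x org" for g t x
  let ?f1 = "\<lambda>x. Re (f x)" and ?f2 = "\<lambda>x. Im (f x)"
  have i: "integrable \<mu> ?f1" "integrable \<mu> ?f2" using f by auto
  have m: "R g t \<in> borel_measurable \<mu>" if "integrable \<mu> g" "t > 0" for g t
    unfolding R_def[abs_def] using pk_L1_integrable[OF that(2,1)] pk_integrable[OF that(2) org_X]
    by (intro borel_measurable_integrable Bochner_Integration.integrable_diff integrable_mult_right)
  show "\<forall>\<^sub>F t in at_top. L1_norm \<mu> (\<lambda>x. PS t f x - (\<integral>y. f y \<partial>\<mu>) * complex_of_real (pk t x org))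
      \<le> (\<integral>\<^sup>+x. ennreal \<bar>R ?f1 t x\<bar> \<partial>\<mu>) + (\<integral>\<^sup>+x. ennreal \<bar>R ?f2 t x\<bar> \<partial>\<mu>)"
    using eventually_gt_at_top[of 0]
  proof eventually_elim
    fix t :: real assume t: "0 < t"
    have "L1_norm \<mu> (\<lambda>x. PS t f x - (\<integral>y. f y \<partial>\<mu>) * complex_of_real (pk t x org))
        \<le> (\<integral>\<^sup>+x. ennreal \<bar>R ?f1 t x\<bar> + ennreal \<bar>R ?f2 t x\<bar> \<partial>\<mu>)"
      unfolding L1_norm_def
    \<comment> \<open>The semigroup integral is split into real and imaginary parts at points where
      both integrands are integrable; these are almost all points.\<close>
    proof (rule nn_integral_mono_AE)
      show "AE x in \<mu>. ennreal (norm (PS t f x - (\<integral>y. f y \<partial>\<mu>) * complex_of_real (pk t x org)))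
          \<le> ennreal \<bar>R ?f1 t x\<bar> + ennreal \<bar>R ?f2 t x\<bar>"
        using pk_AE_integrable[OF t i(1)] pk_AE_integrable[OF t i(2)]
      proof eventually_elim
        fix x assume 1: "integrable \<mu> (\<lambda>y. pk t x y * Re (f y))" and 2: "integrable \<mu> (\<lambda>y. pk t x y * Im (f y))"
        have eq: "complex_of_real (pk t x y) * f y = complex_of_real (pk t x y * Re (f y)) + \<i> * complex_of_real (pk t x y * Im (f y))" for y
          by (simp add: complex_eq_iff)
        have "PS t f x = complex_of_real (\<integral>y. pk t x y * Re (f y) \<partial>\<mu>) + \<i> * complex_of_real (\<integral>y. pk t x y * Im (f y) \<partial>\<mu>)"
          unfolding poisson_semigroup_def eq
          using 1 2 by (subst Bochner_Integration.integral_add) (auto simp del: of_real_mult intro!: integrable_mult_right integrable_of_real)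
        then have "Re (PS t f x - (\<integral>y. f y \<partial>\<mu>) * complex_of_real (pk t x org)) = R ?f1 t x"
          "Im (PS t f x - (\<integral>y. f y \<partial>\<mu>) * complex_of_real (pk t x org)) = R ?f2 t x"
          using f by (auto simp: R_def)
        then show "ennreal (norm (PS t f x - (\<integral>y. f y \<partial>\<mu>) * complex_of_real (pk t x org)))
            \<le> ennreal \<bar>R ?f1 t x\<bar> + ennreal \<bar>R ?f2 t x\<bar>"
          using cmod_le[of "PS t f x - (\<integral>y. f y \<partial>\<mu>) * complex_of_real (pk t x org)"]
          by (simp flip: ennreal_plus)
      qed
    qed
    also have "\<dots> = (\<integral>\<^sup>+x. ennreal \<bar>R ?f1 t x\<bar> \<partial>\<mu>) + (\<integral>\<^sup>+x. ennreal \<bar>R ?f2 t x\<bar> \<partial>\<mu>)"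
      using m[OF i(1) t] m[OF i(2) t] by (intro nn_integral_add) auto
    finally show "L1_norm \<mu> (\<lambda>x. PS t f x - (\<integral>y. f y \<partial>\<mu>) * complex_of_real (pk t x org))
      \<le> (\<integral>\<^sup>+x. ennreal \<bar>R ?f1 t x\<bar> \<partial>\<mu>) + (\<integral>\<^sup>+x. ennreal \<bar>R ?f2 t x\<bar> \<partial>\<mu>)" .
  qed
  have K: "f (translate k x) = f x" if "k \<in> K" "x \<in> X" for k x by (rule radial_K[OF rad that])
  have "((\<lambda>t. (\<integral>\<^sup>+x. ennreal \<bar>R ?f1 t x\<bar> \<partial>\<mu>) + (\<integral>\<^sup>+x. ennreal \<bar>R ?f2 t x\<bar> \<partial>\<mu>)) \<longlongrightarrow> 0 + 0) at_top"
    unfolding R_def by (intro tendsto_add radial_convergence i) (simp_all add: K)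
  then show "((\<lambda>t. (\<integral>\<^sup>+x. ennreal \<bar>R ?f1 t x\<bar> \<partial>\<mu>) + (\<integral>\<^sup>+x. ennreal \<bar>R ?f2 t x\<bar> \<partial>\<mu>)) \<longlongrightarrow> 0) at_top" by simp
qed simp

end

theorem theorem2:
  fixes br :: "'g::euclidean_space \<Rightarrow> 'g \<Rightarrow> 'g"
    and th :: "'g \<Rightarrow> 'g"
    and A :: "'g set"
    and alpha :: "'g \<Rightarrow> real"
    and H0 :: 'g
    and M :: "('g \<Rightarrow> 'g) set measure"
    and h :: "real \<Rightarrow> ('g \<Rightarrow> 'g) set \<Rightarrow> ('g \<Rightarrow> 'g) set \<Rightarrow> real"
  assumes "rank_one_data br th A alpha H0"
    and "riemannian_measure br th H0 M"
    and "heat_kernel br th H0 M h"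
  shows "(\<exists>f. integrable M f \<and> \<not> poisson_asymptotics M h (origin br th) f) \<and>
         (\<forall>f. integrable M f \<and> radial br th H0 f \<longrightarrow> poisson_asymptotics M h (origin br th) f)"
proof -
  interpret rank_one_heat br th A alpha H0 M h
    by unfold_locales (rule assms)+
  show ?thesis
    unfolding org_def[symmetric] using asymptotics_fails asymptotics_radial by simp
qed

end
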